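(* Let $\mathfrak{A},\mathfrak{B}$ be small 2-categories, $\mathfrak{H}$ a 2-category, and $\mathcal{A}:\mathfrak{A}\to\mathfrak{H}$, $\mathrm{t}:\mathfrak{A}\to\mathfrak{B}$ pseudofunctors. The pseudofunctor $\mathcal{A}$ has a pointwise pseudo-Kan extension $\mathrm{PsRan}_{\mathrm{t}}\mathcal{A}$ if and only if $\mathfrak{H}$ has the weighted bilimit $\mathrm{bilim}(\mathfrak{B}(b,\mathrm{t}-),\mathcal{A})$ for every object $b$ of $\mathfrak{B}$. In this case, there is an equivalence $$\mathrm{PsRan}_{\mathrm{t}}\mathcal{A}(b)\simeq\mathrm{bilim}(\mathfrak{B}(b,\mathrm{t}-),\mathcal{A})$$ pseudonatural in $b$.
   Context: $[\mathfrak{A},\mathfrak{H}]_{PS}$ denotes the 2-category of pseudofunctors, pseudonatural transformations and modifications; $\mathsf{CAT}$ is the 2-category of categories. Weighted bilimit: for pseudofunctors $\mathcal{W}:\mathfrak{A}\to\mathsf{CAT}$ and $\mathcal{A}:\mathfrak{A}\to\mathfrak{H}$, $\mathrm{bilim}(\mathcal{W},\mathcal{A})$ is (if it exists) an object of $\mathfrak{H}$ endowed with an equivalence $\mathfrak{H}(X,\mathrm{bilim}(\mathcal{W},\mathcal{A}))\simeq[\mathfrak{A},\mathsf{CAT}]_{PS}(\mathcal{W},\mathfrak{H}(X,\mathcal{A}-))$ pseudonatural in $X$. Right pseudo-Kan extension: $\mathrm{PsRan}_{\mathrm{t}}\mathcal{A}:\mathfrak{B}\to\mathfrak{H}$ is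 (if it exists) a pseudofunctor with a pseudonatural transformation (the universal arrow) $\varepsilon_{\mathcal{A}}:(\mathrm{PsRan}_{\mathrm{t}}\mathcal{A})\circ\mathrm{t}\to\mathcal{A}$ such that $$[\mathfrak{B},\mathfrak{H}]_{PS}(-,\mathrm{PsRan}_{\mathrm{t}}\mathcal{A})\to[\mathfrak{A},\mathfrak{H}]_{PS}(-\circ\mathrm{t},\mathcal{A}),\quad\alpha\mapsto\varepsilon_{\mathcal{A}}\,(\alpha\mathrm{t})$$ is a pseudonatural equivalence. A pseudofunctor $U:\mathfrak{H}\to\mathfrak{H}'$ preserves $\mathrm{PsRan}_{\mathrm{t}}\mathcal{A}$ if $\mathrm{PsRan}_{\mathrm{t}}(U\circ\mathcal{A})\simeq U\circ\mathrm{PsRan}_{\mathrm{t}}\mathcal{A}$ with universal arrow $U\varepsilon_{\mathcal{A}}$. $\mathrm{PsRan}_{\mathrm{t}}\mathcal{A}$ is pointwise if it exists and is preserved by all representable pseudofunctors $\mathfrak{H}(X,-):\mathfrak{H}\to\mathsf{CAT}$. *)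

theory Defs
  imports "HOL-Library.FuncSet"
begin

(* Conventions.  Cells carry their source and target; composition is written in the order of
   functions (g after f) and is only meaningful on composable cells.  Since HOL functions are
   total, the values of functors, transformations, ... off the relevant carrier are fixed to be
   undefined (extensional), so that equality of records is equality of cells. *)

section \<open>Categories, functors, natural transformations\<close>

record ('o, 'm) cat =
  Ob :: "'o set"
  Ar :: "'m set"
  Dom :: "'m \<Rightarrow> 'o"
  Cod :: "'m \<Rightarrow> 'o"
  Idt :: "'o \<Rightarrow> 'm"
  Cmp :: "'m \<Rightarrow> 'm \<Rightarrow> 'm"

locale category =
  fixes C :: "('o, 'm) cat"
  assumes dom_cod: "u \<in> Ar C \<Longrightarrow> Dom C u \<in> Ob C \<and> Cod C u \<in> Ob C"
    and idt: "x \<in> Ob C \<Longrightarrow> Idt C x \<in> Ar C \<and> Dom C (Idt C x) = x \<and> Cod C (Idt C x) = x"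
    and cmp: "\<lbrakk>u \<in> Ar C; v \<in> Ar C; Cod C u = Dom C v\<rbrakk> \<Longrightarrow>
      Cmp C v u \<in> Ar C \<and> Dom C (Cmp C v u) = Dom C u \<and> Cod C (Cmp C v u) = Cod C v"
    and cmp_assoc: "\<lbrakk>u \<in> Ar C; v \<in> Ar C; w \<in> Ar C; Cod C u = Dom C v; Cod C v = Dom C w\<rbrakk> \<Longrightarrow>
      Cmp C (Cmp C w v) u = Cmp C w (Cmp C v u)"
    and cmp_idt: "u \<in> Ar C \<Longrightarrow> Cmp C u (Idt C (Dom C u)) = u"
    and idt_cmp: "u \<in> Ar C \<Longrightarrow> Cmp C (Idt C (Cod C u)) u = u"

record ('o, 'm, 'p, 'n) ftor =
  F_src :: "('o, 'm) cat"
  F_trg :: "('p, 'n) cat"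
  F_ob :: "'o \<Rightarrow> 'p"
  F_ar :: "'m \<Rightarrow> 'n"

locale cat_functor =
  fixes F :: "('o, 'm, 'p, 'n) ftor"
  assumes src_category: "category (F_src F)"
    and trg_category: "category (F_trg F)"
    and ob_ext: "F_ob F \<in> extensional (Ob (F_src F))"
    and ar_ext: "F_ar F \<in> extensional (Ar (F_src F))"
    and ob: "x \<in> Ob (F_src F) \<Longrightarrow> F_ob F x \<in> Ob (F_trg F)"
    and ar: "u \<in> Ar (F_src F) \<Longrightarrow> F_ar F u \<in> Ar (F_trg F)
      \<and> Dom (F_trg F) (F_ar F u) = F_ob F (Dom (F_src F) u)
      \<and> Cod (F_trg F) (F_ar F u) = F_ob F (Cod (F_src F) u)"
    and pres_idt: "x \<in> Ob (F_src F) \<Longrightarrow>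
      F_ar F (Idt (F_src F) x) = Idt (F_trg F) (F_ob F x)"
    and pres_cmp: "\<lbrakk>u \<in> Ar (F_src F); v \<in> Ar (F_src F); Cod (F_src F) u = Dom (F_src F) v\<rbrakk> \<Longrightarrow>
      F_ar F (Cmp (F_src F) v u) = Cmp (F_trg F) (F_ar F v) (F_ar F u)"

definition ftor_id :: "('o, 'm) cat \<Rightarrow> ('o, 'm, 'o, 'm) ftor" where
  "ftor_id C = \<lparr>F_src = C, F_trg = C, F_ob = (\<lambda>x\<in>Ob C. x), F_ar = (\<lambda>u\<in>Ar C. u)\<rparr>"

definition ftor_comp ::
  "('p, 'n, 'q, 'r) ftor \<Rightarrow> ('o, 'm, 'p, 'n) ftor \<Rightarrow> ('o, 'm, 'q, 'r) ftor" where
  "ftor_comp G F = \<lparr>F_src = F_src F, F_trg = F_trg G,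
     F_ob = (\<lambda>x\<in>Ob (F_src F). F_ob G (F_ob F x)),
     F_ar = (\<lambda>u\<in>Ar (F_src F). F_ar G (F_ar F u))\<rparr>"

record ('o, 'm, 'p, 'n) ntrans =
  T_src :: "('o, 'm, 'p, 'n) ftor"
  T_trg :: "('o, 'm, 'p, 'n) ftor"
  T_at :: "'o \<Rightarrow> 'n"

locale nat_transformation =
  fixes \<tau> :: "('o, 'm, 'p, 'n) ntrans"
  assumes src_functor: "cat_functor (T_src \<tau>)"
    and trg_functor: "cat_functor (T_trg \<tau>)"
    and parallel: "F_src (T_trg \<tau>) = F_src (T_src \<tau>)" "F_trg (T_trg \<tau>) = F_trg (T_src \<tau>)"
    and at_ext: "T_at \<tau> \<in> extensional (Ob (F_src (T_src \<tau>)))"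
    and at: "x \<in> Ob (F_src (T_src \<tau>)) \<Longrightarrow> T_at \<tau> x \<in> Ar (F_trg (T_src \<tau>))
      \<and> Dom (F_trg (T_src \<tau>)) (T_at \<tau> x) = F_ob (T_src \<tau>) x
      \<and> Cod (F_trg (T_src \<tau>)) (T_at \<tau> x) = F_ob (T_trg \<tau>) x"
    and natural: "u \<in> Ar (F_src (T_src \<tau>)) \<Longrightarrow>
      Cmp (F_trg (T_src \<tau>)) (F_ar (T_trg \<tau>) u) (T_at \<tau> (Dom (F_src (T_src \<tau>)) u))
      = Cmp (F_trg (T_src \<tau>)) (T_at \<tau> (Cod (F_src (T_src \<tau>)) u)) (F_ar (T_src \<tau>) u)"

definition nt_id :: "('o, 'm, 'p, 'n) ftor \<Rightarrow> ('o, 'm, 'p, 'n) ntrans" where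
  "nt_id F = \<lparr>T_src = F, T_trg = F, T_at = (\<lambda>x\<in>Ob (F_src F). Idt (F_trg F) (F_ob F x))\<rparr>"

definition nt_vcomp ::
  "('o, 'm, 'p, 'n) ntrans \<Rightarrow> ('o, 'm, 'p, 'n) ntrans \<Rightarrow> ('o, 'm, 'p, 'n) ntrans" where
  "nt_vcomp \<tau> \<sigma> = \<lparr>T_src = T_src \<sigma>, T_trg = T_trg \<tau>,
     T_at = (\<lambda>x\<in>Ob (F_src (T_src \<sigma>)). Cmp (F_trg (T_src \<sigma>)) (T_at \<tau> x) (T_at \<sigma> x))\<rparr>"

definition nt_hcomp ::
  "('p, 'n, 'q, 'r) ntrans \<Rightarrow> ('o, 'm, 'p, 'n) ntrans \<Rightarrow> ('o, 'm, 'q, 'r) ntrans" where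
  "nt_hcomp \<tau> \<sigma> = \<lparr>T_src = ftor_comp (T_src \<tau>) (T_src \<sigma>),
     T_trg = ftor_comp (T_trg \<tau>) (T_trg \<sigma>),
     T_at = (\<lambda>x\<in>Ob (F_src (T_src \<sigma>)). Cmp (F_trg (T_src \<tau>))
       (T_at \<tau> (F_ob (T_trg \<sigma>) x)) (F_ar (T_src \<tau>) (T_at \<sigma> x)))\<rparr>"

definition nat_iso :: "('o, 'm, 'p, 'n) ntrans \<Rightarrow> bool" where
  "nat_iso \<tau> \<longleftrightarrow> nat_transformation \<tau> \<and> (\<exists>\<sigma>. nat_transformation \<sigma>
     \<and> T_src \<sigma> = T_trg \<tau> \<and> T_trg \<sigma> = T_src \<tau>
     \<and> nt_vcomp \<sigma> \<tau> = nt_id (T_src \<tau>) \<and> nt_vcomp \<tau> \<sigma> = nt_id (T_trg \<tau>))"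

definition equivalence_of_categories :: "('o, 'm, 'p, 'n) ftor \<Rightarrow> bool" where
  "equivalence_of_categories F \<longleftrightarrow> cat_functor F \<and> (\<exists>G. cat_functor G
     \<and> F_src G = F_trg F \<and> F_trg G = F_src F
     \<and> (\<exists>\<eta>. nat_iso \<eta> \<and> T_src \<eta> = ftor_id (F_src F) \<and> T_trg \<eta> = ftor_comp G F)
     \<and> (\<exists>\<epsilon>. nat_iso \<epsilon> \<and> T_src \<epsilon> = ftor_comp F G \<and> T_trg \<epsilon> = ftor_id (F_trg F)))"


section \<open>2-categories\<close>

record ('c, 'f, 't) two_cat =
  ob :: "'c set"
  one :: "'f set"
  two :: "'t set"
  src :: "'f \<Rightarrow> 'c"
  trg :: "'f \<Rightarrow> 'c"
  dm :: "'t \<Rightarrow> 'f"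
  cd :: "'t \<Rightarrow> 'f"
  id1 :: "'c \<Rightarrow> 'f"
  comp1 :: "'f \<Rightarrow> 'f \<Rightarrow> 'f"  (infixl \<open>\<odot>\<index>\<close> 75)
  id2 :: "'f \<Rightarrow> 't"
  vcomp :: "'t \<Rightarrow> 't \<Rightarrow> 't"  (infixl \<open>\<cdot>\<index>\<close> 70)
  hcomp :: "'t \<Rightarrow> 't \<Rightarrow> 't"  (infixl \<open>\<star>\<index>\<close> 75)

locale two_category =
  fixes K :: "('c, 'f, 't) two_cat" (structure)
  assumes src_trg: "f \<in> one K \<Longrightarrow> src K f \<in> ob K \<and> trg K f \<in> ob K"
    and dm_cd: "\<alpha> \<in> two K \<Longrightarrow> dm K \<alpha> \<in> one K \<and> cd K \<alpha> \<in> one K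
      \<and> src K (cd K \<alpha>) = src K (dm K \<alpha>) \<and> trg K (cd K \<alpha>) = trg K (dm K \<alpha>)"
    and id1: "x \<in> ob K \<Longrightarrow> id1 K x \<in> one K \<and> src K (id1 K x) = x \<and> trg K (id1 K x) = x"
    and comp1: "\<lbrakk>f \<in> one K; g \<in> one K; trg K f = src K g\<rbrakk> \<Longrightarrow>
      g \<odot> f \<in> one K \<and> src K (g \<odot> f) = src K f \<and> trg K (g \<odot> f) = trg K g"
    and comp1_assoc: "\<lbrakk>f \<in> one K; g \<in> one K; h \<in> one K; trg K f = src K g; trg K g = src K h\<rbrakk> \<Longrightarrow>
      (h \<odot> g) \<odot> f = h \<odot> (g \<odot> f)"
    and comp1_id1: "f \<in> one K \<Longrightarrow> f \<odot> id1 K (src K f) = f"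
    and id1_comp1: "f \<in> one K \<Longrightarrow> id1 K (trg K f) \<odot> f = f"
    and id2: "f \<in> one K \<Longrightarrow> id2 K f \<in> two K \<and> dm K (id2 K f) = f \<and> cd K (id2 K f) = f"
    and vcomp: "\<lbrakk>\<alpha> \<in> two K; \<beta> \<in> two K; cd K \<alpha> = dm K \<beta>\<rbrakk> \<Longrightarrow>
      \<beta> \<cdot> \<alpha> \<in> two K \<and> dm K (\<beta> \<cdot> \<alpha>) = dm K \<alpha> \<and> cd K (\<beta> \<cdot> \<alpha>) = cd K \<beta>"
    and vcomp_assoc: "\<lbrakk>\<alpha> \<in> two K; \<beta> \<in> two K; \<gamma> \<in> two K; cd K \<alpha> = dm K \<beta>; cd K \<beta> = dm K \<gamma>\<rbrakk> \<Longrightarrow>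
      (\<gamma> \<cdot> \<beta>) \<cdot> \<alpha> = \<gamma> \<cdot> (\<beta> \<cdot> \<alpha>)"
    and vcomp_id2: "\<alpha> \<in> two K \<Longrightarrow> \<alpha> \<cdot> id2 K (dm K \<alpha>) = \<alpha>"
    and id2_vcomp: "\<alpha> \<in> two K \<Longrightarrow> id2 K (cd K \<alpha>) \<cdot> \<alpha> = \<alpha>"
    and hcomp: "\<lbrakk>\<alpha> \<in> two K; \<beta> \<in> two K; trg K (dm K \<alpha>) = src K (dm K \<beta>)\<rbrakk> \<Longrightarrow>
      \<beta> \<star> \<alpha> \<in> two K \<and> dm K (\<beta> \<star> \<alpha>) = dm K \<beta> \<odot> dm K \<alpha> \<and> cd K (\<beta> \<star> \<alpha>) = cd K \<beta> \<odot> cd K \<alpha>"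
    and hcomp_assoc: "\<lbrakk>\<alpha> \<in> two K; \<beta> \<in> two K; \<gamma> \<in> two K;
        trg K (dm K \<alpha>) = src K (dm K \<beta>); trg K (dm K \<beta>) = src K (dm K \<gamma>)\<rbrakk> \<Longrightarrow>
      (\<gamma> \<star> \<beta>) \<star> \<alpha> = \<gamma> \<star> (\<beta> \<star> \<alpha>)"
    and hcomp_id: "\<alpha> \<in> two K \<Longrightarrow> \<alpha> \<star> id2 K (id1 K (src K (dm K \<alpha>))) = \<alpha>"
    and id_hcomp: "\<alpha> \<in> two K \<Longrightarrow> id2 K (id1 K (trg K (dm K \<alpha>))) \<star> \<alpha> = \<alpha>"
    and hcomp_id2: "\<lbrakk>f \<in> one K; g \<in> one K; trg K f = src K g\<rbrakk> \<Longrightarrow>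
      id2 K g \<star> id2 K f = id2 K (g \<odot> f)"
    and interchange: "\<lbrakk>\<alpha> \<in> two K; \<alpha>' \<in> two K; \<beta> \<in> two K; \<beta>' \<in> two K;
        cd K \<alpha> = dm K \<alpha>'; cd K \<beta> = dm K \<beta>'; trg K (dm K \<alpha>) = src K (dm K \<beta>)\<rbrakk> \<Longrightarrow>
      (\<beta>' \<cdot> \<beta>) \<star> (\<alpha>' \<cdot> \<alpha>) = (\<beta>' \<star> \<alpha>') \<cdot> (\<beta> \<star> \<alpha>)"

definition hom :: "('c, 'f, 't) two_cat \<Rightarrow> 'c \<Rightarrow> 'c \<Rightarrow> ('f, 't) cat" where
  "hom K x y = \<lparr>Ob = {f \<in> one K. src K f = x \<and> trg K f = y},
     Ar = {\<alpha> \<in> two K. src K (dm K \<alpha>) = x \<and> trg K (dm K \<alpha>) = y},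
     Dom = dm K, Cod = cd K, Idt = id2 K, Cmp = vcomp K\<rparr>"

definition iso2 :: "('c, 'f, 't) two_cat \<Rightarrow> 't \<Rightarrow> bool" where
  "iso2 K \<alpha> \<longleftrightarrow> \<alpha> \<in> two K \<and> (\<exists>\<beta>\<in>two K. dm K \<beta> = cd K \<alpha> \<and> cd K \<beta> = dm K \<alpha>
     \<and> \<beta> \<cdot>\<^bsub>K\<^esub> \<alpha> = id2 K (dm K \<alpha>) \<and> \<alpha> \<cdot>\<^bsub>K\<^esub> \<beta> = id2 K (cd K \<alpha>))"

definition inv2 :: "('c, 'f, 't) two_cat \<Rightarrow> 't \<Rightarrow> 't" where
  "inv2 K \<alpha> = (THE \<beta>. \<beta> \<in> two K \<and> dm K \<beta> = cd K \<alpha> \<and> cd K \<beta> = dm K \<alpha>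
     \<and> \<beta> \<cdot>\<^bsub>K\<^esub> \<alpha> = id2 K (dm K \<alpha>) \<and> \<alpha> \<cdot>\<^bsub>K\<^esub> \<beta> = id2 K (cd K \<alpha>))"

definition equivalence1 :: "('c, 'f, 't) two_cat \<Rightarrow> 'f \<Rightarrow> bool" where
  "equivalence1 K f \<longleftrightarrow> f \<in> one K \<and> (\<exists>g\<in>one K. src K g = trg K f \<and> trg K g = src K f
     \<and> (\<exists>\<eta>. iso2 K \<eta> \<and> dm K \<eta> = id1 K (src K f) \<and> cd K \<eta> = g \<odot>\<^bsub>K\<^esub> f)
     \<and> (\<exists>\<epsilon>. iso2 K \<epsilon> \<and> dm K \<epsilon> = f \<odot>\<^bsub>K\<^esub> g \<and> cd K \<epsilon> = id1 K (trg K f)))"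

text \<open>The dual reverses 1-cells but not 2-cells.\<close>

definition op2 :: "('c, 'f, 't) two_cat \<Rightarrow> ('c, 'f, 't) two_cat" where
  "op2 K = \<lparr>ob = ob K, one = one K, two = two K, src = trg K, trg = src K, dm = dm K, cd = cd K,
     id1 = id1 K, comp1 = (\<lambda>g f. f \<odot>\<^bsub>K\<^esub> g), id2 = id2 K, vcomp = vcomp K,
     hcomp = (\<lambda>\<beta> \<alpha>. \<alpha> \<star>\<^bsub>K\<^esub> \<beta>)\<rparr>"

definition prod2 :: "('c, 'f, 't) two_cat \<Rightarrow> ('d, 'g, 'u) two_cat \<Rightarrow>
    ('c \<times> 'd, 'f \<times> 'g, 't \<times> 'u) two_cat" where
  "prod2 K L = \<lparr>ob = ob K \<times> ob L, one = one K \<times> one L, two = two K \<times> two L,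
     src = map_prod (src K) (src L), trg = map_prod (trg K) (trg L),
     dm = map_prod (dm K) (dm L), cd = map_prod (cd K) (cd L),
     id1 = map_prod (id1 K) (id1 L),
     comp1 = (\<lambda>(g, g') (f, f'). (g \<odot>\<^bsub>K\<^esub> f, g' \<odot>\<^bsub>L\<^esub> f')),
     id2 = map_prod (id2 K) (id2 L),
     vcomp = (\<lambda>(\<beta>, \<beta>') (\<alpha>, \<alpha>'). (\<beta> \<cdot>\<^bsub>K\<^esub> \<alpha>, \<beta>' \<cdot>\<^bsub>L\<^esub> \<alpha>')),
     hcomp = (\<lambda>(\<beta>, \<beta>') (\<alpha>, \<alpha>'). (\<beta> \<star>\<^bsub>K\<^esub> \<alpha>, \<beta>' \<star>\<^bsub>L\<^esub> \<alpha>'))\<rparr>"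

text \<open>All categories whose objects are drawn from \<open>'o\<close> and whose arrows are drawn from \<open>'m\<close>;
  these types play the role of the universe. The hom-categories of any
  \<open>('c, 'o, 'm) two_cat\<close> are objects of this 2-category, so 2-categories that are enriched in
  the same \<open>CAT\<close> have the same types of 1-cells and 2-cells; the type of objects is arbitrary.\<close>

definition CAT :: "(('o, 'm) cat, ('o, 'm, 'o, 'm) ftor, ('o, 'm, 'o, 'm) ntrans) two_cat" where
  "CAT = \<lparr>ob = {C. category C}, one = {F. cat_functor F}, two = {\<tau>. nat_transformation \<tau>},
     src = F_src, trg = F_trg, dm = T_src, cd = T_trg, id1 = ftor_id, comp1 = ftor_comp,
     id2 = nt_id, vcomp = nt_vcomp, hcomp = nt_hcomp\<rparr>"


section \<open>Pseudofunctors, pseudonatural transformations, modifications\<close>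

text \<open>\<open>Pc F g f : F g \<odot> F f \<Rightarrow> F (g \<odot> f)\<close> and \<open>Pu F x : id (F x) \<Rightarrow> F (id x)\<close>
  are the constraint 2-cells.\<close>

record ('a, 'p, 'q, 'c, 'f, 't) psfun =
  P0 :: "'a \<Rightarrow> 'c"
  P1 :: "'p \<Rightarrow> 'f"
  P2 :: "'q \<Rightarrow> 't"
  Pc :: "'p \<Rightarrow> 'p \<Rightarrow> 't"
  Pu :: "'a \<Rightarrow> 't"

definition restrict_comp :: "('a, 'p, 'q) two_cat \<Rightarrow> ('p \<Rightarrow> 'p \<Rightarrow> 't) \<Rightarrow> 'p \<Rightarrow> 'p \<Rightarrow> 't" where
  "restrict_comp A c g f =
     (if f \<in> one A \<and> g \<in> one A \<and> trg A f = src A g then c g f else undefined)"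

locale pseudofunctor =
  fixes A :: "('a, 'p, 'q) two_cat"
    and H :: "('c, 'f, 't) two_cat"
    and F :: "('a, 'p, 'q, 'c, 'f, 't) psfun"
  assumes P_ext: "P0 F \<in> extensional (ob A)" "P1 F \<in> extensional (one A)"
      "P2 F \<in> extensional (two A)" "restrict_comp A (Pc F) = Pc F" "Pu F \<in> extensional (ob A)"
    and P0: "x \<in> ob A \<Longrightarrow> P0 F x \<in> ob H"
    and P1: "f \<in> one A \<Longrightarrow> P1 F f \<in> one H
      \<and> src H (P1 F f) = P0 F (src A f) \<and> trg H (P1 F f) = P0 F (trg A f)"
    and P2: "\<alpha> \<in> two A \<Longrightarrow> P2 F \<alpha> \<in> two H
      \<and> dm H (P2 F \<alpha>) = P1 F (dm A \<alpha>) \<and> cd H (P2 F \<alpha>) = P1 F (cd A \<alpha>)"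
    and P2_id2: "f \<in> one A \<Longrightarrow> P2 F (id2 A f) = id2 H (P1 F f)"
    and P2_vcomp: "\<lbrakk>\<alpha> \<in> two A; \<beta> \<in> two A; cd A \<alpha> = dm A \<beta>\<rbrakk> \<Longrightarrow>
      P2 F (\<beta> \<cdot>\<^bsub>A\<^esub> \<alpha>) = P2 F \<beta> \<cdot>\<^bsub>H\<^esub> P2 F \<alpha>"
    and Pc: "\<lbrakk>f \<in> one A; g \<in> one A; trg A f = src A g\<rbrakk> \<Longrightarrow> iso2 H (Pc F g f)
      \<and> dm H (Pc F g f) = P1 F g \<odot>\<^bsub>H\<^esub> P1 F f \<and> cd H (Pc F g f) = P1 F (g \<odot>\<^bsub>A\<^esub> f)"
    and Pu: "x \<in> ob A \<Longrightarrow> iso2 H (Pu F x)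
      \<and> dm H (Pu F x) = id1 H (P0 F x) \<and> cd H (Pu F x) = P1 F (id1 A x)"
    and Pc_natural: "\<lbrakk>\<alpha> \<in> two A; \<beta> \<in> two A; trg A (dm A \<alpha>) = src A (dm A \<beta>)\<rbrakk> \<Longrightarrow>
      P2 F (\<beta> \<star>\<^bsub>A\<^esub> \<alpha>) \<cdot>\<^bsub>H\<^esub> Pc F (dm A \<beta>) (dm A \<alpha>)
      = Pc F (cd A \<beta>) (cd A \<alpha>) \<cdot>\<^bsub>H\<^esub> (P2 F \<beta> \<star>\<^bsub>H\<^esub> P2 F \<alpha>)"
    and Pc_assoc: "\<lbrakk>f \<in> one A; g \<in> one A; h \<in> one A; trg A f = src A g; trg A g = src A h\<rbrakk> \<Longrightarrow>
      Pc F (h \<odot>\<^bsub>A\<^esub> g) f \<cdot>\<^bsub>H\<^esub> (Pc F h g \<star>\<^bsub>H\<^esub> id2 H (P1 F f))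
      = Pc F h (g \<odot>\<^bsub>A\<^esub> f) \<cdot>\<^bsub>H\<^esub> (id2 H (P1 F h) \<star>\<^bsub>H\<^esub> Pc F g f)"
    and Pu_right: "f \<in> one A \<Longrightarrow>
      Pc F f (id1 A (src A f)) \<cdot>\<^bsub>H\<^esub> (id2 H (P1 F f) \<star>\<^bsub>H\<^esub> Pu F (src A f)) = id2 H (P1 F f)"
    and Pu_left: "f \<in> one A \<Longrightarrow>
      Pc F (id1 A (trg A f)) f \<cdot>\<^bsub>H\<^esub> (Pu F (trg A f) \<star>\<^bsub>H\<^esub> id2 H (P1 F f)) = id2 H (P1 F f)"

text \<open>\<open>N2 \<alpha> f : G f \<odot> \<alpha>\<^sub>x \<Rightarrow> \<alpha>\<^sub>y \<odot> F f\<close> for \<open>\<alpha> : F \<rightarrow> G\<close> and \<open>f : x \<rightarrow> y\<close>.\<close>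

record ('a, 'p, 'q, 'c, 'f, 't) pstrans =
  N_src :: "('a, 'p, 'q, 'c, 'f, 't) psfun"
  N_trg :: "('a, 'p, 'q, 'c, 'f, 't) psfun"
  N1 :: "'a \<Rightarrow> 'f"
  N2 :: "'p \<Rightarrow> 't"

locale pseudonatural =
  fixes A :: "('a, 'p, 'q) two_cat"
    and H :: "('c, 'f, 't) two_cat"
    and \<alpha> :: "('a, 'p, 'q, 'c, 'f, 't) pstrans"
  assumes N_src: "pseudofunctor A H (N_src \<alpha>)"
    and N_trg: "pseudofunctor A H (N_trg \<alpha>)"
    and N_ext: "N1 \<alpha> \<in> extensional (ob A)" "N2 \<alpha> \<in> extensional (one A)"
    and N1: "x \<in> ob A \<Longrightarrow> N1 \<alpha> x \<in> one H
      \<and> src H (N1 \<alpha> x) = P0 (N_src \<alpha>) x \<and> trg H (N1 \<alpha> x) = P0 (N_trg \<alpha>) x"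
    and N2: "f \<in> one A \<Longrightarrow> iso2 H (N2 \<alpha> f)
      \<and> dm H (N2 \<alpha> f) = P1 (N_trg \<alpha>) f \<odot>\<^bsub>H\<^esub> N1 \<alpha> (src A f)
      \<and> cd H (N2 \<alpha> f) = N1 \<alpha> (trg A f) \<odot>\<^bsub>H\<^esub> P1 (N_src \<alpha>) f"
    and N2_natural: "\<chi> \<in> two A \<Longrightarrow>
      N2 \<alpha> (cd A \<chi>) \<cdot>\<^bsub>H\<^esub> (P2 (N_trg \<alpha>) \<chi> \<star>\<^bsub>H\<^esub> id2 H (N1 \<alpha> (src A (dm A \<chi>))))
      = (id2 H (N1 \<alpha> (trg A (dm A \<chi>))) \<star>\<^bsub>H\<^esub> P2 (N_src \<alpha>) \<chi>) \<cdot>\<^bsub>H\<^esub> N2 \<alpha> (dm A \<chi>)"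
    and N2_comp: "\<lbrakk>f \<in> one A; g \<in> one A; trg A f = src A g\<rbrakk> \<Longrightarrow>
      N2 \<alpha> (g \<odot>\<^bsub>A\<^esub> f) \<cdot>\<^bsub>H\<^esub> (Pc (N_trg \<alpha>) g f \<star>\<^bsub>H\<^esub> id2 H (N1 \<alpha> (src A f)))
      = (id2 H (N1 \<alpha> (trg A g)) \<star>\<^bsub>H\<^esub> Pc (N_src \<alpha>) g f)
        \<cdot>\<^bsub>H\<^esub> ((N2 \<alpha> g \<star>\<^bsub>H\<^esub> id2 H (P1 (N_src \<alpha>) f))
        \<cdot>\<^bsub>H\<^esub> (id2 H (P1 (N_trg \<alpha>) g) \<star>\<^bsub>H\<^esub> N2 \<alpha> f))"
    and N2_id: "x \<in> ob A \<Longrightarrow>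
      N2 \<alpha> (id1 A x) \<cdot>\<^bsub>H\<^esub> (Pu (N_trg \<alpha>) x \<star>\<^bsub>H\<^esub> id2 H (N1 \<alpha> x))
      = id2 H (N1 \<alpha> x) \<star>\<^bsub>H\<^esub> Pu (N_src \<alpha>) x"

record ('a, 'p, 'q, 'c, 'f, 't) modif =
  M_src :: "('a, 'p, 'q, 'c, 'f, 't) pstrans"
  M_trg :: "('a, 'p, 'q, 'c, 'f, 't) pstrans"
  M_at :: "'a \<Rightarrow> 't"

locale modification =
  fixes A :: "('a, 'p, 'q) two_cat"
    and H :: "('c, 'f, 't) two_cat"
    and m :: "('a, 'p, 'q, 'c, 'f, 't) modif"
  assumes M_src: "pseudonatural A H (M_src m)"
    and M_trg: "pseudonatural A H (M_trg m)"
    and M_parallel: "N_src (M_trg m) = N_src (M_src m)" "N_trg (M_trg m) = N_trg (M_src m)"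
    and M_ext: "M_at m \<in> extensional (ob A)"
    and M_at: "x \<in> ob A \<Longrightarrow> M_at m x \<in> two H
      \<and> dm H (M_at m x) = N1 (M_src m) x \<and> cd H (M_at m x) = N1 (M_trg m) x"
    and M_natural: "f \<in> one A \<Longrightarrow>
      N2 (M_trg m) f \<cdot>\<^bsub>H\<^esub> (id2 H (P1 (N_trg (M_src m)) f) \<star>\<^bsub>H\<^esub> M_at m (src A f))
      = (M_at m (trg A f) \<star>\<^bsub>H\<^esub> id2 H (P1 (N_src (M_src m)) f)) \<cdot>\<^bsub>H\<^esub> N2 (M_src m) f"

definition ps_id :: "('a, 'p, 'q) two_cat \<Rightarrow> ('c, 'f, 't) two_cat \<Rightarrow>
    ('a, 'p, 'q, 'c, 'f, 't) psfun \<Rightarrow> ('a, 'p, 'q, 'c, 'f, 't) pstrans" where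
  "ps_id A H F = \<lparr>N_src = F, N_trg = F,
     N1 = (\<lambda>x\<in>ob A. id1 H (P0 F x)), N2 = (\<lambda>f\<in>one A. id2 H (P1 F f))\<rparr>"

definition ps_comp :: "('a, 'p, 'q) two_cat \<Rightarrow> ('c, 'f, 't) two_cat \<Rightarrow>
    ('a, 'p, 'q, 'c, 'f, 't) pstrans \<Rightarrow> ('a, 'p, 'q, 'c, 'f, 't) pstrans \<Rightarrow>
    ('a, 'p, 'q, 'c, 'f, 't) pstrans" where
  "ps_comp A H \<beta> \<alpha> = \<lparr>N_src = N_src \<alpha>, N_trg = N_trg \<beta>,
     N1 = (\<lambda>x\<in>ob A. N1 \<beta> x \<odot>\<^bsub>H\<^esub> N1 \<alpha> x),
     N2 = (\<lambda>f\<in>one A. (id2 H (N1 \<beta> (trg A f)) \<star>\<^bsub>H\<^esub> N2 \<alpha> f)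
       \<cdot>\<^bsub>H\<^esub> (N2 \<beta> f \<star>\<^bsub>H\<^esub> id2 H (N1 \<alpha> (src A f))))\<rparr>"

text \<open>\<open>PS A H\<close> is the 2-category of pseudofunctors from \<open>A\<close> to \<open>H\<close>.\<close>

definition PS :: "('a, 'p, 'q) two_cat \<Rightarrow> ('c, 'f, 't) two_cat \<Rightarrow>
    (('a, 'p, 'q, 'c, 'f, 't) psfun, ('a, 'p, 'q, 'c, 'f, 't) pstrans,
     ('a, 'p, 'q, 'c, 'f, 't) modif) two_cat" where
  "PS A H = \<lparr>
     ob = {F. pseudofunctor A H F},
     one = {\<alpha>. pseudonatural A H \<alpha>},
     two = {m. modification A H m},
     src = N_src, trg = N_trg, dm = M_src, cd = M_trg,
     id1 = ps_id A H,
     comp1 = ps_comp A H,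
     id2 = (\<lambda>\<alpha>. \<lparr>M_src = \<alpha>, M_trg = \<alpha>, M_at = (\<lambda>x\<in>ob A. id2 H (N1 \<alpha> x))\<rparr>),
     vcomp = (\<lambda>n m. \<lparr>M_src = M_src m, M_trg = M_trg n,
       M_at = (\<lambda>x\<in>ob A. M_at n x \<cdot>\<^bsub>H\<^esub> M_at m x)\<rparr>),
     hcomp = (\<lambda>n m. \<lparr>M_src = ps_comp A H (M_src n) (M_src m),
       M_trg = ps_comp A H (M_trg n) (M_trg m),
       M_at = (\<lambda>x\<in>ob A. M_at n x \<star>\<^bsub>H\<^esub> M_at m x)\<rparr>)\<rparr>"

text \<open>A pseudonatural transformation is an equivalence if its components are.\<close>

definition pseudonatural_equivalence :: "('a, 'p, 'q) two_cat \<Rightarrow> ('c, 'f, 't) two_cat \<Rightarrow>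
    ('a, 'p, 'q, 'c, 'f, 't) pstrans \<Rightarrow> bool" where
  "pseudonatural_equivalence A H \<alpha> \<longleftrightarrow>
     pseudonatural A H \<alpha> \<and> (\<forall>x\<in>ob A. equivalence1 H (N1 \<alpha> x))"

text \<open>The data of a 2-functor, with identity constraint cells.\<close>

definition strict :: "('a, 'p, 'q) two_cat \<Rightarrow> ('c, 'f, 't) two_cat \<Rightarrow>
    ('a \<Rightarrow> 'c) \<Rightarrow> ('p \<Rightarrow> 'f) \<Rightarrow> ('q \<Rightarrow> 't) \<Rightarrow> ('a, 'p, 'q, 'c, 'f, 't) psfun" where
  "strict A H p0 p1 p2 = \<lparr>P0 = restrict p0 (ob A), P1 = restrict p1 (one A),
     P2 = restrict p2 (two A),
     Pc = restrict_comp A (\<lambda>g f. id2 H (p1 (g \<odot>\<^bsub>A\<^esub> f))),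
     Pu = (\<lambda>x\<in>ob A. id2 H (id1 H (p0 x)))\<rparr>"

text \<open>Composite of \<open>F : A \<rightarrow> H\<close> and \<open>U : H \<rightarrow> K\<close>.\<close>

definition psf_comp :: "('a, 'p, 'q) two_cat \<Rightarrow> ('d, 'g, 'u) two_cat \<Rightarrow>
    ('c, 'f, 't, 'd, 'g, 'u) psfun \<Rightarrow> ('a, 'p, 'q, 'c, 'f, 't) psfun \<Rightarrow>
    ('a, 'p, 'q, 'd, 'g, 'u) psfun" where
  "psf_comp A K U F = \<lparr>P0 = (\<lambda>x\<in>ob A. P0 U (P0 F x)),
     P1 = (\<lambda>f\<in>one A. P1 U (P1 F f)), P2 = (\<lambda>\<alpha>\<in>two A. P2 U (P2 F \<alpha>)),
     Pc = restrict_comp A (\<lambda>g f. P2 U (Pc F g f) \<cdot>\<^bsub>K\<^esub> Pc U (P1 F g) (P1 F f)),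
     Pu = (\<lambda>x\<in>ob A. P2 U (Pu F x) \<cdot>\<^bsub>K\<^esub> Pu U (P0 F x))\<rparr>"

text \<open>\<open>psf_op F : op2 A \<rightarrow> op2 H\<close> for \<open>F : A \<rightarrow> H\<close>.\<close>

definition psf_op :: "('a, 'p, 'q, 'c, 'f, 't) psfun \<Rightarrow> ('a, 'p, 'q, 'c, 'f, 't) psfun" where
  "psf_op F = F\<lparr>Pc := \<lambda>g f. Pc F f g\<rparr>"

text \<open>\<open>\<alpha>t\<close> for \<open>\<alpha>\<close> in \<open>[B,H]\<close> and \<open>t : A \<rightarrow> B\<close>.\<close>

definition ps_whisker_right :: "('a, 'p, 'q) two_cat \<Rightarrow> ('d, 'g, 'u) two_cat \<Rightarrow>
    ('c, 'f, 't, 'd, 'g, 'u) pstrans \<Rightarrow> ('a, 'p, 'q, 'c, 'f, 't) psfun \<Rightarrow>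
    ('a, 'p, 'q, 'd, 'g, 'u) pstrans" where
  "ps_whisker_right A H \<alpha> t = \<lparr>N_src = psf_comp A H (N_src \<alpha>) t,
     N_trg = psf_comp A H (N_trg \<alpha>) t,
     N1 = (\<lambda>x\<in>ob A. N1 \<alpha> (P0 t x)), N2 = (\<lambda>f\<in>one A. N2 \<alpha> (P1 t f))\<rparr>"

definition modif_whisker_right :: "('a, 'p, 'q) two_cat \<Rightarrow> ('d, 'g, 'u) two_cat \<Rightarrow>
    ('c, 'f, 't, 'd, 'g, 'u) modif \<Rightarrow> ('a, 'p, 'q, 'c, 'f, 't) psfun \<Rightarrow>
    ('a, 'p, 'q, 'd, 'g, 'u) modif" where
  "modif_whisker_right A H m t = \<lparr>M_src = ps_whisker_right A H (M_src m) t,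
     M_trg = ps_whisker_right A H (M_trg m) t, M_at = (\<lambda>x\<in>ob A. M_at m (P0 t x))\<rparr>"

text \<open>\<open>U\<alpha>\<close> for \<open>\<alpha>\<close> in \<open>[A,H]\<close> and \<open>U : H \<rightarrow> K\<close>.\<close>

definition ps_whisker_left :: "('a, 'p, 'q) two_cat \<Rightarrow> ('d, 'g, 'u) two_cat \<Rightarrow>
    ('c, 'f, 't, 'd, 'g, 'u) psfun \<Rightarrow> ('a, 'p, 'q, 'c, 'f, 't) pstrans \<Rightarrow>
    ('a, 'p, 'q, 'd, 'g, 'u) pstrans" where
  "ps_whisker_left A K U \<alpha> = \<lparr>N_src = psf_comp A K U (N_src \<alpha>),
     N_trg = psf_comp A K U (N_trg \<alpha>),
     N1 = (\<lambda>x\<in>ob A. P1 U (N1 \<alpha> x)),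
     N2 = (\<lambda>f\<in>one A. inv2 K (Pc U (N1 \<alpha> (trg A f)) (P1 (N_src \<alpha>) f))
       \<cdot>\<^bsub>K\<^esub> (P2 U (N2 \<alpha> f) \<cdot>\<^bsub>K\<^esub> Pc U (P1 (N_trg \<alpha>) f) (N1 \<alpha> (src A f))))\<rparr>"

text \<open>The 2-functor \<open>[B,H] \<rightarrow> [A,H]\<close> of precomposition with \<open>t : A \<rightarrow> B\<close>.\<close>

definition precomp :: "('a, 'p, 'q) two_cat \<Rightarrow> ('c, 'f, 't) two_cat \<Rightarrow> ('d, 'g, 'u) two_cat \<Rightarrow>
    ('a, 'p, 'q, 'c, 'f, 't) psfun \<Rightarrow>
    (('c, 'f, 't, 'd, 'g, 'u) psfun, ('c, 'f, 't, 'd, 'g, 'u) pstrans,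
     ('c, 'f, 't, 'd, 'g, 'u) modif, ('a, 'p, 'q, 'd, 'g, 'u) psfun,
     ('a, 'p, 'q, 'd, 'g, 'u) pstrans, ('a, 'p, 'q, 'd, 'g, 'u) modif) psfun" where
  "precomp A B H t = strict (PS B H) (PS A H) (\<lambda>F. psf_comp A H F t)
     (\<lambda>\<alpha>. ps_whisker_right A H \<alpha> t) (\<lambda>m. modif_whisker_right A H m t)"


section \<open>Representable pseudofunctors\<close>

text \<open>\<open>hom_map K f g : K(x,y) \<rightarrow> K(x',y')\<close> sends \<open>u\<close> to \<open>g \<odot> u \<odot> f\<close>, for \<open>f : x' \<rightarrow> x\<close> and
  \<open>g : y \<rightarrow> y'\<close>; \<open>hom_map2\<close> is its action on 2-cells.\<close>

definition hom_map :: "('c, 'f, 't) two_cat \<Rightarrow> 'f \<Rightarrow> 'f \<Rightarrow> ('f, 't, 'f, 't) ftor" where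
  "hom_map K f g = \<lparr>F_src = hom K (trg K f) (src K g), F_trg = hom K (src K f) (trg K g),
     F_ob = (\<lambda>u\<in>Ob (hom K (trg K f) (src K g)). (g \<odot>\<^bsub>K\<^esub> u) \<odot>\<^bsub>K\<^esub> f),
     F_ar = (\<lambda>\<alpha>\<in>Ar (hom K (trg K f) (src K g)). (id2 K g \<star>\<^bsub>K\<^esub> \<alpha>) \<star>\<^bsub>K\<^esub> id2 K f)\<rparr>"

definition hom_map2 :: "('c, 'f, 't) two_cat \<Rightarrow> 't \<Rightarrow> 't \<Rightarrow> ('f, 't, 'f, 't) ntrans" where
  "hom_map2 K \<phi> \<gamma> = \<lparr>T_src = hom_map K (dm K \<phi>) (dm K \<gamma>), T_trg = hom_map K (cd K \<phi>) (cd K \<gamma>),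
     T_at = (\<lambda>u\<in>Ob (hom K (trg K (dm K \<phi>)) (src K (dm K \<gamma>))). (\<gamma> \<star>\<^bsub>K\<^esub> id2 K u) \<star>\<^bsub>K\<^esub> \<phi>)\<rparr>"

text \<open>\<open>K(X,-) : K \<rightarrow> CAT\<close> and \<open>K(-,Y) : op2 K \<rightarrow> CAT\<close>.\<close>

definition rep :: "('c, 'f, 't) two_cat \<Rightarrow> 'c \<Rightarrow>
    ('c, 'f, 't, ('f, 't) cat, ('f, 't, 'f, 't) ftor, ('f, 't, 'f, 't) ntrans) psfun" where
  "rep K X = strict K CAT (\<lambda>Y. hom K X Y) (\<lambda>g. hom_map K (id1 K X) g)
     (\<lambda>\<gamma>. hom_map2 K (id2 K (id1 K X)) \<gamma>)"

definition corep :: "('c, 'f, 't) two_cat \<Rightarrow> 'c \<Rightarrow>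
    ('c, 'f, 't, ('f, 't) cat, ('f, 't, 'f, 't) ftor, ('f, 't, 'f, 't) ntrans) psfun" where
  "corep K Y = strict (op2 K) CAT (\<lambda>X. hom K X Y) (\<lambda>f. hom_map K f (id1 K Y))
     (\<lambda>\<phi>. hom_map2 K \<phi> (id2 K (id1 K Y)))"

text \<open>The Yoneda 2-functor \<open>op2 K \<rightarrow> [K,CAT]\<close>, \<open>X \<mapsto> K(X,-)\<close>.\<close>

definition yoneda :: "('c, 'f, 't) two_cat \<Rightarrow>
    ('c, 'f, 't,
     ('c, 'f, 't, ('f, 't) cat, ('f, 't, 'f, 't) ftor, ('f, 't, 'f, 't) ntrans) psfun,
     ('c, 'f, 't, ('f, 't) cat, ('f, 't, 'f, 't) ftor, ('f, 't, 'f, 't) ntrans) pstrans,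
     ('c, 'f, 't, ('f, 't) cat, ('f, 't, 'f, 't) ftor, ('f, 't, 'f, 't) ntrans) modif) psfun" where
  "yoneda K = (let
      y1 = (\<lambda>f. \<lparr>N_src = rep K (trg K f), N_trg = rep K (src K f),
        N1 = (\<lambda>Y\<in>ob K. hom_map K f (id1 K Y)),
        N2 = (\<lambda>h\<in>one K. nt_id (hom_map K f h))\<rparr>)
    in strict (op2 K) (PS K CAT) (rep K) y1
      (\<lambda>\<phi>. \<lparr>M_src = y1 (dm K \<phi>), M_trg = y1 (cd K \<phi>),
        M_at = (\<lambda>Y\<in>ob K. hom_map2 K \<phi> (id2 K (id1 K Y)))\<rparr>))"

text \<open>For \<open>F : A \<rightarrow> H\<close>, the pseudofunctor \<open>op2 H \<rightarrow> [A,CAT]\<close>, \<open>X \<mapsto> H(X,F-)\<close>.\<close>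

definition nerve :: "('a, 'p, 'q) two_cat \<Rightarrow> ('c, 'f, 't) two_cat \<Rightarrow>
    ('a, 'p, 'q, 'c, 'f, 't) psfun \<Rightarrow>
    ('c, 'f, 't,
     ('a, 'p, 'q, ('f, 't) cat, ('f, 't, 'f, 't) ftor, ('f, 't, 'f, 't) ntrans) psfun,
     ('a, 'p, 'q, ('f, 't) cat, ('f, 't, 'f, 't) ftor, ('f, 't, 'f, 't) ntrans) pstrans,
     ('a, 'p, 'q, ('f, 't) cat, ('f, 't, 'f, 't) ftor, ('f, 't, 'f, 't) ntrans) modif) psfun" where
  "nerve A H F = psf_comp (op2 H) (PS A CAT) (precomp A H CAT F) (yoneda H)"


section \<open>Pseudonatural transformations between category-valued pseudofunctors\<close>

text \<open>Pseudofunctors such as \<open>H(-,L)\<close> and \<open>[A,CAT](W,H(-,F-))\<close> have values in \<open>CAT\<close> over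
  different types, hence are not objects of one \<open>PS S CAT\<close>.  The following repeats the
  definition of pseudonatural transformation for target \<open>CAT\<close>, with components
  that are functors between categories over possibly different types.\<close>

record ('s, 'p, 'o, 'm, 'o2, 'm2) cat_pstrans =
  C1 :: "'s \<Rightarrow> ('o, 'm, 'o2, 'm2) ftor"
  C2 :: "'p \<Rightarrow> ('o, 'm, 'o2, 'm2) ntrans"

locale cat_pseudonatural =
  fixes S :: "('s, 'p, 'q) two_cat"
    and F :: "('s, 'p, 'q, ('o, 'm) cat, ('o, 'm, 'o, 'm) ftor, ('o, 'm, 'o, 'm) ntrans) psfun"
    and G :: "('s, 'p, 'q, ('o2, 'm2) cat, ('o2, 'm2, 'o2, 'm2) ftor, ('o2, 'm2, 'o2, 'm2) ntrans) psfun"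
    and \<theta> :: "('s, 'p, 'o, 'm, 'o2, 'm2) cat_pstrans"
  assumes C_src: "pseudofunctor S CAT F"
    and C_trg: "pseudofunctor S CAT G"
    and C1: "x \<in> ob S \<Longrightarrow> cat_functor (C1 \<theta> x)
      \<and> F_src (C1 \<theta> x) = P0 F x \<and> F_trg (C1 \<theta> x) = P0 G x"
    and C2: "f \<in> one S \<Longrightarrow> nat_iso (C2 \<theta> f)
      \<and> T_src (C2 \<theta> f) = ftor_comp (P1 G f) (C1 \<theta> (src S f))
      \<and> T_trg (C2 \<theta> f) = ftor_comp (C1 \<theta> (trg S f)) (P1 F f)"
    and C2_natural: "\<chi> \<in> two S \<Longrightarrow>
      nt_vcomp (C2 \<theta> (cd S \<chi>)) (nt_hcomp (P2 G \<chi>) (nt_id (C1 \<theta> (src S (dm S \<chi>)))))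
      = nt_vcomp (nt_hcomp (nt_id (C1 \<theta> (trg S (dm S \<chi>)))) (P2 F \<chi>)) (C2 \<theta> (dm S \<chi>))"
    and C2_comp: "\<lbrakk>f \<in> one S; g \<in> one S; trg S f = src S g\<rbrakk> \<Longrightarrow>
      nt_vcomp (C2 \<theta> (g \<odot>\<^bsub>S\<^esub> f)) (nt_hcomp (Pc G g f) (nt_id (C1 \<theta> (src S f))))
      = nt_vcomp (nt_hcomp (nt_id (C1 \<theta> (trg S g))) (Pc F g f))
          (nt_vcomp (nt_hcomp (C2 \<theta> g) (nt_id (P1 F f)))
            (nt_hcomp (nt_id (P1 G g)) (C2 \<theta> f)))"
    and C2_id: "x \<in> ob S \<Longrightarrow>
      nt_vcomp (C2 \<theta> (id1 S x)) (nt_hcomp (Pu G x) (nt_id (C1 \<theta> x)))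
      = nt_hcomp (nt_id (C1 \<theta> x)) (Pu F x)"

definition cat_pseudonatural_equivalence ::
    "('s, 'p, 'q) two_cat \<Rightarrow>
     ('s, 'p, 'q, ('o, 'm) cat, ('o, 'm, 'o, 'm) ftor, ('o, 'm, 'o, 'm) ntrans) psfun \<Rightarrow>
     ('s, 'p, 'q, ('o2, 'm2) cat, ('o2, 'm2, 'o2, 'm2) ftor, ('o2, 'm2, 'o2, 'm2) ntrans) psfun \<Rightarrow>
     ('s, 'p, 'o, 'm, 'o2, 'm2) cat_pstrans \<Rightarrow> bool" where
  "cat_pseudonatural_equivalence S F G \<theta> \<longleftrightarrow> cat_pseudonatural S F G \<theta>
     \<and> (\<forall>x\<in>ob S. equivalence_of_categories (C1 \<theta> x))"


section \<open>Weighted bilimits\<close>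

text \<open>\<open>(L, \<theta>)\<close> is a bilimit of \<open>D\<close> weighted by \<open>W\<close>; \<open>\<theta>\<close> is the equivalence
  \<open>H(X,L) \<simeq> [A,CAT](W,H(X,D-))\<close>, pseudonatural in \<open>X\<close>.\<close>

definition is_bilimit where
  "is_bilimit A H W D L \<theta> \<longleftrightarrow> L \<in> ob H \<and>
     cat_pseudonatural_equivalence (op2 H) (corep H L)
       (psf_comp (op2 H) CAT (rep (PS A CAT) W) (nerve A H D)) \<theta>"

definition has_bilimit where
  "has_bilimit A H W D \<longleftrightarrow> (\<exists>L \<theta>. is_bilimit A H W D L \<theta>)"

text \<open>The weight \<open>B(b,t-)\<close>.\<close>

definition hom_weight where
  "hom_weight A B t b = psf_comp A CAT (rep B b) t"

text \<open>For \<open>L : B \<rightarrow> H\<close>, the pseudofunctor \<open>(X,b) \<mapsto> H(X,L b)\<close>, and, for \<open>t : A \<rightarrow> B\<close> and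
  \<open>D : A \<rightarrow> H\<close>, the pseudofunctor \<open>(X,b) \<mapsto> [A,CAT](B(b,t-),H(X,D-))\<close>, both from
  \<open>op2 H \<times> B\<close> to \<open>CAT\<close>.\<close>

definition hom_family where
  "hom_family B H L = \<lparr>
     P0 = (\<lambda>(X, b)\<in>ob (prod2 (op2 H) B). hom H X (P0 L b)),
     P1 = (\<lambda>(f, g)\<in>one (prod2 (op2 H) B). hom_map H f (P1 L g)),
     P2 = (\<lambda>(\<phi>, \<gamma>)\<in>two (prod2 (op2 H) B). hom_map2 H \<phi> (P2 L \<gamma>)),
     Pc = restrict_comp (prod2 (op2 H) B)
       (\<lambda>(f, g) (f', g'). hom_map2 H (id2 H (f' \<odot>\<^bsub>H\<^esub> f)) (Pc L g g')),
     Pu = (\<lambda>(X, b)\<in>ob (prod2 (op2 H) B). hom_map2 H (id2 H (id1 H X)) (Pu L b))\<rparr>"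

definition bilimit_family where
  "bilimit_family A B H t D = strict (prod2 (op2 H) B) CAT
     (\<lambda>(X, b). hom (PS A CAT) (P0 (nerve A B t) b) (P0 (nerve A H D) X))
     (\<lambda>(f, g). hom_map (PS A CAT) (P1 (nerve A B t) g) (P1 (nerve A H D) f))
     (\<lambda>(\<phi>, \<gamma>). hom_map2 (PS A CAT) (P2 (nerve A B t) \<gamma>) (P2 (nerve A H D) \<phi>))"

text \<open>The pseudofunctor structure of \<open>b \<mapsto> bilim(B(b,t-),D)\<close>: it is a pseudofunctor \<open>L\<close> with an
  equivalence \<open>H(X,L b) \<simeq> [A,CAT](B(b,t-),H(X,D-))\<close> pseudonatural in \<open>X\<close> and \<open>b\<close> jointly.\<close>

definition is_bilimit_pseudofunctor where
  "is_bilimit_pseudofunctor A B H t D L \<Theta> \<longleftrightarrow> pseudofunctor B H L \<and>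
     cat_pseudonatural_equivalence (prod2 (op2 H) B)
       (hom_family B H L) (bilimit_family A B H t D) \<Theta>"

text \<open>\<open>\<Theta>\<close> restricts to a chosen family of bilimits \<open>(l b, \<theta> b)\<close>. As \<open>L (id b)\<close> need not be an
  identity, the constraint cell of \<open>\<Theta>\<close> at \<open>(f, id b)\<close> agrees with that of \<open>\<theta> b\<close> at \<open>f\<close> only up
  to the unit constraint of \<open>L\<close>.\<close>

definition extends_bilimits where
  "extends_bilimits B H L \<Theta> l \<theta> \<longleftrightarrow> (\<forall>b\<in>ob B. P0 L b = l b
     \<and> (\<forall>X\<in>ob H. C1 \<Theta> (X, b) = C1 (\<theta> b) X)
     \<and> (\<forall>f\<in>one H. C2 \<Theta> (f, id1 B b)
         = nt_vcomp (nt_hcomp (nt_id (C1 (\<theta> b) (src H f))) (hom_map2 H (id2 H f) (Pu L b)))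
             (C2 (\<theta> b) f)))"


section \<open>Pseudo-Kan extensions\<close>

text \<open>The transformation \<open>[B,H](-,R) \<rightarrow> [A,H](- \<circ> t, D)\<close>, \<open>\<alpha> \<mapsto> \<epsilon>(\<alpha>t)\<close>; it is strictly natural,
  so its constraint cells are identities.\<close>

definition psran_functor where
  "psran_functor A B H t D R \<epsilon> K = \<lparr>
     F_src = hom (PS B H) K R, F_trg = hom (PS A H) (psf_comp A H K t) D,
     F_ob = (\<lambda>\<alpha>\<in>Ob (hom (PS B H) K R). \<epsilon> \<odot>\<^bsub>PS A H\<^esub> ps_whisker_right A H \<alpha> t),
     F_ar = (\<lambda>m\<in>Ar (hom (PS B H) K R).
       id2 (PS A H) \<epsilon> \<star>\<^bsub>PS A H\<^esub> modif_whisker_right A H m t)\<rparr>"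

definition psran_map where
  "psran_map A B H t D R \<epsilon> = \<lparr>
     C1 = psran_functor A B H t D R \<epsilon>,
     C2 = (\<lambda>\<beta>. nt_id (ftor_comp (psran_functor A B H t D R \<epsilon> (N_src \<beta>))
       (P1 (corep (PS B H) R) \<beta>)))\<rparr>"

text \<open>\<open>(R, \<epsilon>)\<close> is a right pseudo-Kan extension of \<open>D\<close> along \<open>t\<close>.\<close>

definition is_psran where
  "is_psran A B H t D R \<epsilon> \<longleftrightarrow> pseudofunctor B H R
     \<and> pseudonatural A H \<epsilon> \<and> N_src \<epsilon> = psf_comp A H R t \<and> N_trg \<epsilon> = D
     \<and> cat_pseudonatural_equivalence (op2 (PS B H))
         (corep (PS B H) R)
         (psf_comp (op2 (PS B H)) CAT (corep (PS A H) D) (psf_op (precomp A B H t)))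
         (psran_map A B H t D R \<epsilon>)"

text \<open>\<open>U : H \<rightarrow> K\<close> preserves the right pseudo-Kan extension \<open>(R, \<epsilon>)\<close>.\<close>

definition preserves_psran where
  "preserves_psran A B K t D R \<epsilon> U \<longleftrightarrow>
     is_psran A B K t (psf_comp A K U D) (psf_comp B K U R) (ps_whisker_left A K U \<epsilon>)"

definition is_pointwise_psran where
  "is_pointwise_psran A B H t D R \<epsilon> \<longleftrightarrow> is_psran A B H t D R \<epsilon>
     \<and> (\<forall>X\<in>ob H. preserves_psran A B CAT t D R \<epsilon> (rep H X))"

end

theory Submission
 imports Defs
begin

text \<open>The theorem compares, for \<open>\<epsilon> : R t \<rightarrow> D\<close>, the functors
 \<open>H(X, R b) \<rightarrow> [A,CAT](B(b,t-), H(X,D-))\<close> that send \<open>x\<close> to the transformation with components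
 \<open>u \<mapsto> \<epsilon> a \<odot> R u \<odot> x\<close>.  Call \<open>(R, \<epsilon>)\<close> universal if all of them are equivalences; this says that
 \<open>R b\<close> is the bilimit of \<open>D\<close> weighted by \<open>B(b,t-)\<close>.  The proof shows that pointwise
 pseudo-Kan extensions, universal pairs and bilimits in all weights \<open>B(b,t-)\<close> are the same thing.

 A transformation \<open>B(b,t-) \<rightarrow> H(X,D-)\<close> is handled as a cone, that is, as a family of cells of \<open>H\<close>.
 Every family of cones that is pseudonatural in \<open>b\<close> factors through a universal one
 (\<open>ex_factorisation\<close>), and this gives the universal property of \<open>R\<close>
 (\<open>psran_if_universal\<close>).  Representables preserve universality, because a cone in \<open>CAT\<close> with
 vertex \<open>Y\<close> over \<open>H(X,D-)\<close> is a diagram of cones over \<open>D\<close> with vertex \<open>X\<close>, indexed by \<open>Y\<close>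
 (\<open>hom_universal\<close>).  So universal pairs are pointwise extensions.  Conversely, the
 Yoneda lemma identifies \<open>H(X, R b)\<close> with the transformations \<open>B(b,-) \<rightarrow> H(X,R-)\<close>; if
 \<open>H(X,R-)\<close> is an extension of \<open>H(X,D-)\<close>, then these correspond to the transformations
 \<open>B(b,t-) \<rightarrow> H(X,D-)\<close> (\<open>universal_if_preserved\<close>).

 For bilimits the presheaf \<open>X \<mapsto> M(S b, N X)\<close> is considered, with \<open>M = [A,CAT]\<close>, \<open>S b = B(b,t-)\<close> and
 \<open>N X = H(X,D-)\<close>.  A bilimit is determined by its universal element
 \<open>S b \<rightarrow> N (l b)\<close>.  Restricting the universal elements along the 1-cells of \<open>B\<close> and representing the result
 makes \<open>l\<close> a pseudofunctor (\<open>ex_universal_psf\<close>); conjugating with the given equivalences yields a jointly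
 pseudonatural equivalence that extends them (\<open>ex_extension\<close>).  Conversely the universal elements
 of any jointly pseudonatural equivalence \<open>(L, \<Theta>)\<close> are pseudonatural in \<open>b\<close>, and their values at
 the identities of \<open>t a\<close> form a transformation \<open>L t \<rightarrow> D\<close> that makes \<open>L\<close> universal
 (\<open>ex_universal_trans\<close>).  Thus \<open>L\<close> is an extension, hence equivalent to \<open>R\<close> (\<open>psran_unique\<close>).\<close>

text \<open>In \<open>g *[K] f\<close>, \<open>b **[K] a\<close> and \<open>b .[K] a\<close> the 2-category is written as an index on the composition
 of 1-cells and on the horizontal and vertical composition of 2-cells; \<open>f |> b\<close> and \<open>b <| f\<close> are whiskerings.
 \<open>r1\<close> and \<open>r2\<close> restrict the data of a cone along \<open>x\<close>.\<close>

abbreviation vcomp_at ("(_/ .[_]/ _)" [70,0,71] 70) where "b .[K] a \<equiv> vcomp K b a"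
abbreviation hcomp_at ("(_/ **[_]/ _)" [75,0,76] 75) where "b **[K] a \<equiv> hcomp K b a"
abbreviation comp_at ("(_/ *[_]/ _)" [75,0,76] 75) where "g *[K] f \<equiv> comp1 K g f"
abbreviation whisker_left (infixr "|>\<index>" 75) where "f |>\<^bsub>K\<^esub> b \<equiv> hcomp K (id2 K f) b"
abbreviation whisker_right (infixl "<|\<index>" 75) where "b <|\<^bsub>K\<^esub> f \<equiv> hcomp K b (id2 K f)"
abbreviation whisker_left_at ("(_/ |>[_]/ _)" [76,0,75] 75) where "f |>[K] b \<equiv> hcomp K (id2 K f) b"
abbreviation whisker_right_at ("(_/ <|[_]/ _)" [75,0,76] 75) where "b <|[K] f \<equiv> hcomp K b (id2 K f)"
abbreviation r1 where "r1 H c x \<equiv> %a u. c a u *[H] x"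
abbreviation r2 where "r2 H c x \<equiv> %f u. c f u **[H] id2 H x"
lemmas (in two_category) tcat = two_category_axioms
section \<open>Functors and natural transformations\<close>

context category
begin

lemma Dom_in [simp]: "u : Ar C ==> Dom C u : Ob C"
 and Cod_in [simp]: "u : Ar C ==> Cod C u : Ob C"
 using dom_cod by auto

lemma Idt_simps [simp]:
 assumes "x : Ob C"
 shows "Idt C x : Ar C" "Dom C (Idt C x) = x" "Cod C (Idt C x) = x"
 using idt assms by auto

lemma Cmp_simps [simp]:
 assumes "u : Ar C" "v : Ar C" "Cod C u = Dom C v"
 shows "Cmp C v u : Ar C" "Dom C (Cmp C v u) = Dom C u" "Cod C (Cmp C v u) = Cod C v"
 using cmp assms by auto

lemma Cmp_Idt [simp]: "u : Ar C ==> Dom C u = x ==> Cmp C u (Idt C x) = u"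
 and Idt_Cmp [simp]: "u : Ar C ==> Cod C u = x ==> Cmp C (Idt C x) u = u"
 using cmp_idt idt_cmp by auto

end

lemma ftor_eqI:
 fixes F G :: "('o, 'm, 'p, 'n) ftor"
 assumes "cat_functor F" "cat_functor G" "F_src F = F_src G" "F_trg F = F_trg G"
  and "!!x. x : Ob (F_src G) ==> F_ob F x = F_ob G x"
  and "!!u. u : Ar (F_src G) ==> F_ar F u = F_ar G u"
 shows "F = G"
proof -
 have "F_ob F = F_ob G" "F_ar F = F_ar G"
  using assms cat_functor.ob_ext[OF assms(1)] cat_functor.ob_ext[OF assms(2)]
   cat_functor.ar_ext[OF assms(1)] cat_functor.ar_ext[OF assms(2)]
  by (metis extensionalityI)+
 then show ?thesis using assms(3,4) by simp
qed

lemma ntrans_eqI: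
 fixes sg ta :: "('o, 'm, 'p, 'n) ntrans"
 assumes "nat_transformation sg" "nat_transformation ta" "T_src sg = T_src ta" "T_trg sg = T_trg ta"
  and "!!x. x : Ob (F_src (T_src ta)) ==> T_at sg x = T_at ta x"
 shows "sg = ta"
proof -
 have "T_at sg = T_at ta"
  using assms nat_transformation.at_ext[OF assms(1)] nat_transformation.at_ext[OF assms(2)]
  by (metis extensionalityI)
 then show ?thesis using assms(3,4) by simp
qed

text \<open>Typing judgements for functors and transformations; with the categories as parameters
  they can be used as rewrite rules also when source and target are given by other terms.\<close>

definition ftor_in where
 "ftor_in F C D \<longleftrightarrow> cat_functor F & F_src F = C & F_trg F = D"

definition nt_in where
 "nt_in ta F G \<longleftrightarrow> nat_transformation ta & T_src ta = F & T_trg ta = G"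

lemma ftor_inD:
 assumes "ftor_in F C D"
 shows "cat_functor F" "F_src F = C" "F_trg F = D" "category C" "category D"
  "x : Ob C ==> F_ob F x : Ob D"
  "u : Ar C ==> F_ar F u : Ar D"
  "u : Ar C ==> Dom D (F_ar F u) = F_ob F (Dom C u)"
  "u : Ar C ==> Cod D (F_ar F u) = F_ob F (Cod C u)"
  "x : Ob C ==> F_ar F (Idt C x) = Idt D (F_ob F x)"
  "[|u : Ar C; v : Ar C; Cod C u = Dom C v|] ==>
    F_ar F (Cmp C v u) = Cmp D (F_ar F v) (F_ar F u)"
 using assms unfolding ftor_in_def cat_functor_def by auto

lemma ftor_inI:
 assumes "category C" "category D" "F_src F = C" "F_trg F = D"
  "F_ob F : extensional (Ob C)" "F_ar F : extensional (Ar C)"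
  "!!x. x : Ob C ==> F_ob F x : Ob D"
  "!!u. u : Ar C ==> F_ar F u : Ar D"
  "!!u. u : Ar C ==> Dom D (F_ar F u) = F_ob F (Dom C u)"
  "!!u. u : Ar C ==> Cod D (F_ar F u) = F_ob F (Cod C u)"
  "!!x. x : Ob C ==> F_ar F (Idt C x) = Idt D (F_ob F x)"
  "!!u v. [|u : Ar C; v : Ar C; Cod C u = Dom C v|] ==>
    F_ar F (Cmp C v u) = Cmp D (F_ar F v) (F_ar F u)"
 shows "ftor_in F C D"
 using assms unfolding ftor_in_def cat_functor_def by auto

lemma nt_inD:
 assumes "nt_in ta F G"
 shows "nat_transformation ta" "T_src ta = F" "T_trg ta = G" "cat_functor F" "cat_functor G"
  "F_src G = F_src F" "F_trg G = F_trg F"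
  "x : Ob (F_src F) ==> T_at ta x : Ar (F_trg F)"
  "x : Ob (F_src F) ==> Dom (F_trg F) (T_at ta x) = F_ob F x"
  "x : Ob (F_src F) ==> Cod (F_trg F) (T_at ta x) = F_ob G x"
  "u : Ar (F_src F) ==> Cmp (F_trg F) (F_ar G u) (T_at ta (Dom (F_src F) u))
    = Cmp (F_trg F) (T_at ta (Cod (F_src F) u)) (F_ar F u)"
 using assms unfolding nt_in_def nat_transformation_def by auto

lemma nt_inI:
 assumes "ftor_in F C D" "ftor_in G C D" "T_src ta = F" "T_trg ta = G"
  "T_at ta : extensional (Ob C)"
  "!!x. x : Ob C ==> T_at ta x : Ar D"
  "!!x. x : Ob C ==> Dom D (T_at ta x) = F_ob F x"
  "!!x. x : Ob C ==> Cod D (T_at ta x) = F_ob G x"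
  "!!u. u : Ar C ==> Cmp D (F_ar G u) (T_at ta (Dom C u)) = Cmp D (T_at ta (Cod C u)) (F_ar F u)"
 shows "nt_in ta F G"
 using assms unfolding nt_in_def nat_transformation_def ftor_in_def by auto

lemma nt_in_eqI:
 assumes "nt_in sg F G" "nt_in ta F G" "!!x. x : Ob (F_src F) ==> T_at sg x = T_at ta x"
 shows "sg = ta"
 using assms unfolding nt_in_def by (auto intro: ntrans_eqI)

lemma ftor_in_eqI:
 assumes "ftor_in F C D" "ftor_in G C D" "!!x. x : Ob C ==> F_ob F x = F_ob G x"
  "!!u. u : Ar C ==> F_ar F u = F_ar G u"
 shows "F = G"
 using assms unfolding ftor_in_def by (auto intro: ftor_eqI)

lemma ftor_comp_simps [simp]:
 "F_src (ftor_comp G F) = F_src F" "F_trg (ftor_comp G F) = F_trg G"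
 "x : Ob (F_src F) ==> F_ob (ftor_comp G F) x = F_ob G (F_ob F x)"
 "u : Ar (F_src F) ==> F_ar (ftor_comp G F) u = F_ar G (F_ar F u)"
 by (auto simp: ftor_comp_def)

lemma ftor_id_simps [simp]:
 "F_src (ftor_id C) = C" "F_trg (ftor_id C) = C"
 "x : Ob C ==> F_ob (ftor_id C) x = x"
 "u : Ar C ==> F_ar (ftor_id C) u = u"
 by (auto simp: ftor_id_def)

lemma nt_id_simps [simp]:
 "T_src (nt_id F) = F" "T_trg (nt_id F) = F"
 "x : Ob (F_src F) ==> T_at (nt_id F) x = Idt (F_trg F) (F_ob F x)"
 by (auto simp: nt_id_def)

lemma nt_vcomp_simps [simp]:
 "T_src (nt_vcomp ta sg) = T_src sg" "T_trg (nt_vcomp ta sg) = T_trg ta"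
 "x : Ob (F_src (T_src sg)) ==>
   T_at (nt_vcomp ta sg) x = Cmp (F_trg (T_src sg)) (T_at ta x) (T_at sg x)"
 by (auto simp: nt_vcomp_def)

lemma nt_hcomp_simps [simp]:
 "T_src (nt_hcomp ta sg) = ftor_comp (T_src ta) (T_src sg)"
 "T_trg (nt_hcomp ta sg) = ftor_comp (T_trg ta) (T_trg sg)"
 "x : Ob (F_src (T_src sg)) ==> T_at (nt_hcomp ta sg) x =
   Cmp (F_trg (T_src ta)) (T_at ta (F_ob (T_trg sg) x)) (F_ar (T_src ta) (T_at sg x))"
 by (auto simp: nt_hcomp_def)

lemma ftor_in_id: assumes "category C" shows "ftor_in (ftor_id C) C C"
proof -
 interpret category C by fact
 show ?thesis by (rule ftor_inI) (auto simp: ftor_id_def assms)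
qed

lemma ftor_in_comp:
 assumes "ftor_in F C D" "ftor_in G D E" shows "ftor_in (ftor_comp G F) C E"
 using ftor_inD[OF assms(1)] ftor_inD[OF assms(2)]
 by (intro ftor_inI) (auto simp: ftor_comp_def category.idt category.cmp category.dom_cod)

lemma nt_in_id: assumes "ftor_in F C D" shows "nt_in (nt_id F) F F"
proof -
 note * = ftor_inD[OF assms]
 interpret C: category C by (rule *)
 interpret D: category D by (rule *)
 show ?thesis by (rule nt_inI[OF assms assms]) (auto simp: nt_id_def *)
qed

lemma nt_in_vcomp:
 assumes "nt_in sg F G" "nt_in ta G H" shows "nt_in (nt_vcomp ta sg) F H"
proof -
 note s = nt_inD[OF assms(1)] and t = nt_inD[OF assms(2)]
 have F: "ftor_in F (F_src F) (F_trg F)" and H: "ftor_in H (F_src F) (F_trg F)"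
  and G: "ftor_in G (F_src F) (F_trg F)"
  using s(4-7) t(4-7) by (auto simp: ftor_in_def)
 interpret C: category "F_src F" using F by (rule ftor_inD)
 interpret D: category "F_trg F" using F by (rule ftor_inD)
 note ss = s[unfolded s(6,7)] and tt = t[unfolded s(6,7)]
 show ?thesis
 proof (rule nt_inI[OF F H], goal_cases)
  case (7 u)
  then show ?case
   using ss tt ftor_inD[OF F] ftor_inD[OF G] ftor_inD[OF H]
   apply (simp add: nt_vcomp_def)
   apply (subst D.cmp_assoc[symmetric]; simp)
   apply (subst D.cmp_assoc; simp)
   apply (subst D.cmp_assoc; simp)
   done
 qed (use ss tt in "auto simp: nt_vcomp_def")
qed

lemma nt_in_hcomp:
 assumes "nt_in sg F G" "ftor_in F C D" "nt_in ta H K" "ftor_in H D E"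
 shows "nt_in (nt_hcomp ta sg) (ftor_comp H F) (ftor_comp K G)"
proof -
 note s = nt_inD[OF assms(1)] and t = nt_inD[OF assms(3)]
 note F = assms(2) and H = assms(4)
 have G: "ftor_in G C D" and K: "ftor_in K D E"
  using s t ftor_inD[OF F] ftor_inD[OF H] by (auto simp: ftor_in_def)
 note FD = ftor_inD[OF F] and HD = ftor_inD[OF H] and GD = ftor_inD[OF G] and KD = ftor_inD[OF K]
 interpret C: category C by (rule FD)
 interpret D: category D by (rule FD)
 interpret E: category E by (rule HD)
 note ss = s[unfolded FD(2,3)] and tt = t[unfolded HD(2,3)]
 show ?thesis
 proof (rule nt_inI[OF ftor_in_comp[OF F H] ftor_in_comp[OF G K]], goal_cases)
  case (7 u)
  have n: "Cmp E (F_ar K (F_ar G u)) (T_at ta (F_ob G (Dom C u)))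
    = Cmp E (T_at ta (F_ob G (Cod C u))) (F_ar H (F_ar G u))"
   using tt(11)[of "F_ar G u"] GD 7 by simp
  have "F_ar H (Cmp D (F_ar G u) (T_at sg (Dom C u))) = F_ar H (Cmp D (T_at sg (Cod C u)) (F_ar F u))"
   using ss(11)[of u] 7 by simp
  moreover have "F_ar H (Cmp D (F_ar G u) (T_at sg (Dom C u)))
    = Cmp E (F_ar H (F_ar G u)) (F_ar H (T_at sg (Dom C u)))"
   by (rule HD(11)) (use ss FD GD 7 in auto)
  moreover have "F_ar H (Cmp D (T_at sg (Cod C u)) (F_ar F u))
    = Cmp E (F_ar H (T_at sg (Cod C u))) (F_ar H (F_ar F u))"
   by (rule HD(11)) (use ss FD GD 7 in auto)
  ultimately have m: "Cmp E (F_ar H (F_ar G u)) (F_ar H (T_at sg (Dom C u)))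
    = Cmp E (F_ar H (T_at sg (Cod C u))) (F_ar H (F_ar F u))"
   by simp
  let ?p = "F_ar K (F_ar G u)" and ?q = "T_at ta (F_ob G (Dom C u))" and ?r = "F_ar H (T_at sg (Dom C u))"
   and ?s = "T_at ta (F_ob G (Cod C u))" and ?t = "F_ar H (F_ar G u)" and ?w = "F_ar H (T_at sg (Cod C u))"
   and ?z = "F_ar H (F_ar F u)"
  have ty: "?p : Ar E" "?q : Ar E" "?r : Ar E" "?s : Ar E" "?t : Ar E" "?w : Ar E" "?z : Ar E"
   "Cod E ?q = Dom E ?p" "Cod E ?r = Dom E ?q" "Cod E ?t = Dom E ?s" "Cod E ?r = Dom E ?t"
   "Cod E ?z = Dom E ?w" "Cod E ?w = Dom E ?s"
   using ss tt FD GD HD KD 7 by auto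
  have "Cmp E ?p (Cmp E ?q ?r) = Cmp E (Cmp E ?p ?q) ?r" using ty by (simp add: E.cmp_assoc)
  also have "\<dots> = Cmp E ?s (Cmp E ?t ?r)" unfolding n using ty by (simp add: E.cmp_assoc)
  also have "\<dots> = Cmp E (Cmp E ?s ?w) ?z" unfolding m using ty by (simp add: E.cmp_assoc)
  finally show ?case using ss tt FD GD HD KD 7 by (simp add: nt_hcomp_def)
 qed (use ss tt FD GD HD KD in "auto simp: nt_hcomp_def")
qed

lemma category_hom:
 assumes "two_category K" shows "category (hom K x y)"
proof -
 interpret two_category K by fact
 show ?thesis
  by unfold_locales (auto simp: hom_def vcomp id2 dm_cd vcomp_assoc vcomp_id2 id2_vcomp)
qed

lemma hom_simps [simp]:
 "f : Ob (hom K x y) \<longleftrightarrow> f : one K & src K f = x & trg K f = y"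
 "al : Ar (hom K x y) \<longleftrightarrow> al : two K & src K (dm K al) = x & trg K (dm K al) = y"
 "Dom (hom K x y) = dm K" "Cod (hom K x y) = cd K"
 "Idt (hom K x y) = id2 K" "Cmp (hom K x y) = vcomp K"
 by (auto simp: hom_def)

lemma CAT_simps [simp]:
 "C : ob CAT \<longleftrightarrow> category C" "F : one CAT \<longleftrightarrow> cat_functor F"
 "ta : two CAT \<longleftrightarrow> nat_transformation ta"
 "src CAT = F_src" "trg CAT = F_trg" "dm CAT = T_src" "cd CAT = T_trg"
 "id1 CAT = ftor_id" "comp1 CAT = ftor_comp" "id2 CAT = nt_id" "vcomp CAT = nt_vcomp"
 "hcomp CAT = nt_hcomp"
 by (auto simp: CAT_def)

lemma ftor_comp_assoc:
 assumes "ftor_in F C D" "ftor_in G D E" "ftor_in H E E'"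
 shows "ftor_comp (ftor_comp H G) F = ftor_comp H (ftor_comp G F)"
 by (rule ftor_in_eqI[OF ftor_in_comp[OF assms(1) ftor_in_comp[OF assms(2,3)]]
    ftor_in_comp[OF ftor_in_comp[OF assms(1,2)] assms(3)]])
   (use ftor_inD[OF assms(1)] ftor_inD[OF assms(2)] in auto)

lemma ftor_comp_id:
 assumes "ftor_in F C D"
 shows "ftor_comp F (ftor_id C) = F" "ftor_comp (ftor_id D) F = F"
proof -
 note D = ftor_inD[OF assms]
 show "ftor_comp F (ftor_id C) = F"
  by (rule ftor_in_eqI[OF ftor_in_comp[OF ftor_in_id assms] assms]) (use D in auto)
 show "ftor_comp (ftor_id D) F = F"
  by (rule ftor_in_eqI[OF ftor_in_comp[OF assms ftor_in_id] assms]) (use D in auto)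
qed

lemma nt_vcomp_assoc:
 assumes "nt_in al F G" "nt_in bt G H" "nt_in gm H K"
 shows "nt_vcomp (nt_vcomp gm bt) al = nt_vcomp gm (nt_vcomp bt al)"
proof -
 note D = nt_inD[OF assms(1)] nt_inD[OF assms(2)] nt_inD[OF assms(3)]
 interpret D: category "F_trg F" using D(4) by (rule cat_functor.trg_category)
 show ?thesis
  by (rule nt_in_eqI[OF nt_in_vcomp[OF assms(1) nt_in_vcomp[OF assms(2,3)]]
  nt_in_vcomp[OF nt_in_vcomp[OF assms(1,2)] assms(3)]])
   (use D in "simp add: D.cmp_assoc")
qed

lemma nt_vcomp_id:
 assumes "nt_in al F G"
 shows "nt_vcomp al (nt_id F) = al" "nt_vcomp (nt_id G) al = al"
proof -
 note D = nt_inD[OF assms]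
 interpret D: category "F_trg F" using D(4) by (rule cat_functor.trg_category)
 have f: "ftor_in F (F_src F) (F_trg F)" "ftor_in G (F_src F) (F_trg F)"
  using D by (auto simp: ftor_in_def)
 show "nt_vcomp al (nt_id F) = al"
  by (rule nt_in_eqI[OF nt_in_vcomp[OF nt_in_id[OF f(1)] assms] assms]) (use D in auto)
 show "nt_vcomp (nt_id G) al = al"
  by (rule nt_in_eqI[OF nt_in_vcomp[OF assms nt_in_id[OF f(2)]] assms]) (use D in auto)
qed

lemma nt_hcomp_id2:
 assumes f: "ftor_in F C D" "ftor_in G D E"
 shows "nt_hcomp (nt_id G) (nt_id F) = nt_id (ftor_comp G F)"
proof -
 note D = ftor_inD[OF f(1)] ftor_inD[OF f(2)]
 interpret E: category E by (rule D)
 show ?thesis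
  by (rule nt_in_eqI[OF nt_in_hcomp[OF nt_in_id[OF f(1)] f(1) nt_in_id[OF f(2)] f(2)]
   nt_in_id[OF ftor_in_comp[OF f]]]) (use D in auto)
qed

lemma nt_hcomp_id:
 assumes a: "nt_in al F G" and f: "ftor_in F C D"
 shows "nt_hcomp al (nt_id (ftor_id C)) = al" "nt_hcomp (nt_id (ftor_id D)) al = al"
proof -
 note D = nt_inD[OF a] and DF = ftor_inD[OF f]
 have g: "ftor_in G C D" using D DF by (auto simp: ftor_in_def)
 note DG = ftor_inD[OF g]
 interpret C: category C by (rule DF)
 interpret D: category D by (rule DF)
 note i = ftor_in_id[OF C.category_axioms] and j = ftor_in_id[OF D.category_axioms]
 have "nt_in (nt_hcomp al (nt_id (ftor_id C))) F G"
  using nt_in_hcomp[OF nt_in_id[OF i] i a f] by (simp add: ftor_comp_id[OF f] ftor_comp_id[OF g])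
 then show "nt_hcomp al (nt_id (ftor_id C)) = al"
  by (rule nt_in_eqI[OF _ a]) (use D DF in auto)
 have "nt_in (nt_hcomp (nt_id (ftor_id D)) al) F G"
  using nt_in_hcomp[OF a f nt_in_id[OF j] j] by (simp add: ftor_comp_id[OF f] ftor_comp_id[OF g])
 then show "nt_hcomp (nt_id (ftor_id D)) al = al"
  by (rule nt_in_eqI[OF _ a]) (use D DF DG in auto)
qed

lemma nt_hcomp_assoc:
 assumes a: "nt_in al F F'" "nt_in bt G G'" "nt_in gm H H'"
  and f: "ftor_in F C D" "ftor_in G D E" "ftor_in H E E'"
 shows "nt_hcomp (nt_hcomp gm bt) al = nt_hcomp gm (nt_hcomp bt al)"
proof -
 note D = nt_inD[OF a(1)] nt_inD[OF a(2)] nt_inD[OF a(3)]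
 have g: "ftor_in F' C D" "ftor_in G' D E" "ftor_in H' E E'"
  using D f by (auto simp: ftor_in_def)
 interpret E: category E' using f by (auto dest: ftor_inD)
 note e = ftor_comp_assoc[OF f] ftor_comp_assoc[OF g]
 have "nt_in (nt_hcomp (nt_hcomp gm bt) al) (ftor_comp (ftor_comp H G) F) (ftor_comp (ftor_comp H' G') F')"
  by (rule nt_in_hcomp[OF a(1) f(1) nt_in_hcomp[OF a(2) f(2) a(3) f(3)] ftor_in_comp[OF f(2,3)]])
 moreover have "nt_in (nt_hcomp gm (nt_hcomp bt al)) (ftor_comp (ftor_comp H G) F) (ftor_comp (ftor_comp H' G') F')"
  unfolding e by (rule nt_in_hcomp[OF nt_in_hcomp[OF a(1) f(1) a(2) f(2)] ftor_in_comp[OF f(1,2)] a(3) f(3)])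
 ultimately show ?thesis
 proof (rule nt_in_eqI, goal_cases)
  case (1 x)
  note DF = ftor_inD[OF f(1)] ftor_inD[OF f(2)] ftor_inD[OF f(3)] ftor_inD[OF g(1)] ftor_inD[OF g(2)] ftor_inD[OF g(3)]
  have "F_ar H (Cmp E (T_at bt (F_ob F' x)) (F_ar G (T_at al x)))
   = Cmp E' (F_ar H (T_at bt (F_ob F' x))) (F_ar H (F_ar G (T_at al x)))"
   by (rule ftor_inD(11)[OF f(3)]) (use 1 D DF in auto)
  then show ?case using 1 D DF by (simp add: E.cmp_assoc)
 qed
qed

lemma nt_interchange:
 assumes a: "nt_in al F F'" "nt_in al' F' F''" "nt_in bt G G'" "nt_in bt' G' G''"
  and f: "ftor_in F C D" "ftor_in G D E"
 shows "nt_hcomp (nt_vcomp bt' bt) (nt_vcomp al' al) = nt_vcomp (nt_hcomp bt' al') (nt_hcomp bt al)"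
proof -
 note D = nt_inD[OF a(1)] nt_inD[OF a(2)] nt_inD[OF a(3)] nt_inD[OF a(4)]
 have g: "ftor_in F' C D" "ftor_in F'' C D" "ftor_in G' D E" "ftor_in G'' D E"
  using D f by (auto simp: ftor_in_def)
 interpret E: category E using f by (auto dest: ftor_inD)
 show ?thesis
 proof (rule nt_in_eqI[OF nt_in_hcomp[OF nt_in_vcomp[OF a(1,2)] f(1) nt_in_vcomp[OF a(3,4)] f(2)]
   nt_in_vcomp[OF nt_in_hcomp[OF a(1) f(1) a(3) f(2)] nt_in_hcomp[OF a(2) g(1) a(4) g(3)]]], goal_cases)
  case (1 x)
  then have x: "x : Ob C" using ftor_inD[OF f(1)] by simp
  note DF' = ftor_inD(2,3,6-9)[OF f(1)] ftor_inD(2,3,6-9)[OF f(2)] ftor_inD(2,3,6-9)[OF g(1)]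
   ftor_inD(2,3,6-9)[OF g(2)] ftor_inD(2,3,6-9)[OF g(3)] ftor_inD(2,3,6-9)[OF g(4)]
  note D' = nt_inD(8-10)[OF a(1), unfolded DF'] nt_inD(8-10)[OF a(2), unfolded DF']
   nt_inD(8-10)[OF a(3), unfolded DF'] nt_inD(8-10)[OF a(4), unfolded DF'] nt_inD(2,3)[OF a(1)]
   nt_inD(2,3)[OF a(2)] nt_inD(2,3)[OF a(3)] nt_inD(2,3)[OF a(4)]
  have m: "F_ar G (Cmp D (T_at al' x) (T_at al x)) = Cmp E (F_ar G (T_at al' x)) (F_ar G (T_at al x))"
   by (rule ftor_inD(11)[OF f(2)]) (use x in "simp_all add: D' DF'")
  have n: "Cmp E (F_ar G' (T_at al' x)) (T_at bt (F_ob F' x)) =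
    Cmp E (T_at bt (F_ob F'' x)) (F_ar G (T_at al' x))"
   using nt_inD(11)[OF a(3), of "T_at al' x"] x by (simp add: D' DF')
  let ?p = "T_at bt' (F_ob F'' x)" and ?q = "T_at bt (F_ob F'' x)" and ?r = "F_ar G (T_at al' x)"
   and ?s = "F_ar G (T_at al x)" and ?t = "F_ar G' (T_at al' x)" and ?w = "T_at bt (F_ob F' x)"
  have t: "?p : Ar E" "?q : Ar E" "?r : Ar E" "?s : Ar E" "?t : Ar E" "?w : Ar E"
   "Dom E ?p = F_ob G' (F_ob F'' x)" "Cod E ?q = F_ob G' (F_ob F'' x)" "Dom E ?q = F_ob G (F_ob F'' x)"
   "Cod E ?r = F_ob G (F_ob F'' x)" "Dom E ?r = F_ob G (F_ob F' x)" "Cod E ?s = F_ob G (F_ob F' x)"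
   "Cod E ?t = F_ob G' (F_ob F'' x)" "Dom E ?t = F_ob G' (F_ob F' x)" "Cod E ?w = F_ob G' (F_ob F' x)"
   "Dom E ?w = F_ob G (F_ob F' x)"
   using x by (simp_all add: DF' D')
  have "Cmp E (Cmp E ?p ?q) (Cmp E ?r ?s) = Cmp E ?p (Cmp E (Cmp E ?q ?r) ?s)"
   using t by (simp add: E.cmp_assoc)
  also have "\<dots> = Cmp E (Cmp E ?p ?t) (Cmp E ?w ?s)"
   unfolding n[symmetric] using t by (simp add: E.cmp_assoc)
  finally show ?case using x by (simp add: m D' DF')
 qed
qed

lemma nt_dest:
 assumes "nat_transformation ta"
 shows "nt_in ta (T_src ta) (T_trg ta)" "ftor_in (T_src ta) (F_src (T_src ta)) (F_trg (T_src ta))"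
  "cat_functor (T_src ta)" "cat_functor (T_trg ta)"
  "F_src (T_trg ta) = F_src (T_src ta)" "F_trg (T_trg ta) = F_trg (T_src ta)"
 using assms by (auto simp: nat_transformation_def nt_in_def ftor_in_def)

lemma two_category_CAT: "two_category (CAT :: (('o, 'm) cat, _, _) two_cat)"
proof (unfold_locales, goal_cases)
 case (1 f)
 then show ?case by (simp add: cat_functor_def)
next
 case (2 al)
 then show ?case by (simp add: nt_dest)
next
 case (3 x)
 then show ?case using ftor_in_id[of x] by (simp add: ftor_in_def)
next
 case (4 f g)
 then show ?case using ftor_in_comp[of f "F_src f" "F_src g" g "F_trg g"] by (simp add: ftor_in_def)
next
 case (5 f g h)
 then show ?case using ftor_comp_assoc[of f "F_src f" "F_src g" g "F_src h" h "F_trg h"] by (simp add: ftor_in_def)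
next
 case (6 f)
 then show ?case using ftor_comp_id(1)[of f "F_src f" "F_trg f"] by (simp add: ftor_in_def)
next
 case (7 f)
 then show ?case using ftor_comp_id(2)[of f "F_src f" "F_trg f"] by (simp add: ftor_in_def)
next
 case (8 f)
 then show ?case using nt_in_id[of f] by (simp add: ftor_in_def nt_in_def)
next
 case (9 al bt)
 then have "nt_in (nt_vcomp bt al) (T_src al) (T_trg bt)"
  by (intro nt_in_vcomp[where G = "T_trg al"]) (simp_all add: nt_in_def)
 then show ?case by (simp add: nt_in_def)
next
 case (10 al bt gm)
 then show ?case using nt_vcomp_assoc[of al "T_src al" "T_trg al" bt "T_trg bt" gm "T_trg gm"] by (simp add: nt_in_def)
next
 case (11 al)
 then show ?case using nt_vcomp_id(1)[of al "T_src al" "T_trg al"] by (simp add: nt_in_def)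
next
 case (12 al)
 then show ?case using nt_vcomp_id(2)[of al "T_src al" "T_trg al"] by (simp add: nt_in_def)
next
 case (13 al bt)
 note d = 13(1,2)[simplified, THEN nt_dest(1)] 13(1,2)[simplified, THEN nt_dest(2)]
 show ?case using nt_in_hcomp[OF d(1) d(3) d(2)] d(4) 13(3) by (simp add: nt_in_def)
next
 case (14 al bt gm)
 note d = 14(1-3)[simplified, THEN nt_dest(1)] 14(1-3)[simplified, THEN nt_dest(2)]
 show ?case using nt_hcomp_assoc[OF d(1-4)] d(5,6) 14(4,5) by simp
next
 case (15 al)
 note d = 15(1)[simplified, THEN nt_dest(1)] 15(1)[simplified, THEN nt_dest(2)]
 show ?case using nt_hcomp_id(1)[OF d] by simp
next
 case (16 al)
 note d = 16(1)[simplified, THEN nt_dest(1)] 16(1)[simplified, THEN nt_dest(2)]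
 show ?case using nt_hcomp_id(2)[OF d] by simp
next
 case (17 f g)
 then show ?case using nt_hcomp_id2[of f "F_src f" "F_src g" g "F_trg g"] by (simp add: ftor_in_def)
next
 case (18 al al' bt bt')
 note d = 18(1-4)[simplified, THEN nt_dest(1)] 18(1-4)[simplified, THEN nt_dest(2)]
 show ?case
  using nt_interchange[OF d(1) _ d(3) _ d(5), of al' _ bt'] d(2,4,7) 18(5-7) by simp
qed

section \<open>Calculus in a 2-category\<close>

context two_category
begin

lemma one_simps [simp]:
 "f : one K ==> src K f : ob K" "f : one K ==> trg K f : ob K"
 using src_trg by auto

lemma two_simps [simp]:
 assumes "al : two K"
 shows "dm K al : one K" "cd K al : one K" "src K (cd K al) = src K (dm K al)"
  "trg K (cd K al) = trg K (dm K al)"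
 using dm_cd assms by auto

lemma id1_simps [simp]:
 assumes "x : ob K" shows "id1 K x : one K" "src K (id1 K x) = x" "trg K (id1 K x) = x"
 using id1 assms by auto

lemma comp1_simps [simp]:
 assumes "f : one K" "g : one K" "trg K f = src K g"
 shows "g \<odot> f : one K" "src K (g \<odot> f) = src K f" "trg K (g \<odot> f) = trg K g"
 using comp1 assms by auto

declare comp1_assoc [simp]

lemma comp1_id [simp]:
 "f : one K ==> src K f = x ==> f \<odot> id1 K x = f" "f : one K ==> trg K f = x ==> id1 K x \<odot> f = f"
 using comp1_id1 id1_comp1 by auto

lemma id2_simps [simp]:
 assumes "f : one K" shows "id2 K f : two K" "dm K (id2 K f) = f" "cd K (id2 K f) = f"
 using id2 assms by auto

lemma vcomp_simps [simp]:
 assumes "al : two K" "bt : two K" "cd K al = dm K bt"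
 shows "bt \<cdot> al : two K" "dm K (bt \<cdot> al) = dm K al" "cd K (bt \<cdot> al) = cd K bt"
 using vcomp assms by auto

declare vcomp_assoc [simp]

lemma vcomp_id [simp]:
 "al : two K ==> dm K al = f ==> al \<cdot> id2 K f = al" "al : two K ==> cd K al = f ==> id2 K f \<cdot> al = al"
 using vcomp_id2 id2_vcomp by auto

lemma hcomp_simps [simp]:
 assumes "al : two K" "bt : two K" "trg K (dm K al) = src K (dm K bt)"
 shows "bt \<star> al : two K" "dm K (bt \<star> al) = dm K bt \<odot> dm K al" "cd K (bt \<star> al) = cd K bt \<odot> cd K al"
 using hcomp assms by auto

declare hcomp_assoc [simp]

lemma hcomp_id1 [simp]:
 "al : two K ==> src K (dm K al) = x ==> al <| id1 K x = al"
 "al : two K ==> trg K (dm K al) = x ==> id1 K x |> al = al"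
 using hcomp_id id_hcomp by auto

declare hcomp_id2 [simp]

lemma whisker_whisker [simp]:
 assumes "al : two K" "f : one K" "g : one K" "trg K (dm K al) = src K f" "trg K f = src K g"
 shows "g |> (f |> al) = (g \<odot> f) |> al"
 by (subst hcomp_assoc[symmetric]) (use assms in "simp_all del: hcomp_assoc")

lemma whisker_vcomp [simp]:
 "[|al : two K; bt : two K; g : one K; cd K al = dm K bt; trg K (dm K al) = src K g|] ==>
   g |> (bt \<cdot> al) = (g |> bt) \<cdot> (g |> al)"
 "[|al : two K; bt : two K; f : one K; cd K al = dm K bt; trg K f = src K (dm K al)|] ==>
   (bt \<cdot> al) <| f = (bt <| f) \<cdot> (al <| f)"
 using interchange[of al bt "id2 K g" "id2 K g"] interchange[of "id2 K f" "id2 K f" al bt] by auto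

text \<open>The two ways of splitting a horizontal composite into whiskered cells.\<close>

lemma hcomp_split:
 assumes "al : two K" "bt : two K" "trg K (dm K al) = src K (dm K bt)"
 shows "bt \<star> al = (bt <| cd K al) \<cdot> (dm K bt |> al)"
  "bt \<star> al = (cd K bt |> al) \<cdot> (bt <| dm K al)"
 using assms interchange[of al "id2 K (cd K al)" "id2 K (dm K bt)" bt]
  interchange[of "id2 K (dm K al)" al bt "id2 K (cd K bt)"] by auto

text \<open>The two ways of composing cells at different places agree; most calculations below move a cell past
 another one in this way.\<close>

lemma exchange:
 assumes "al : two K" "bt : two K" "trg K (dm K al) = src K (dm K bt)"
  "dm K al = f" "cd K al = f'" "dm K bt = g" "cd K bt = g'"
 shows "(bt <| f') \<cdot> (g |> al) = (g' |> al) \<cdot> (bt <| f)"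
 using hcomp_split[OF assms(1-3)] assms(4-7) by simp

lemma iso2_in [simp]: "iso2 K al ==> al : two K"
 by (simp add: iso2_def)

lemma iso2_inv:
 assumes "iso2 K al"
 shows "inv2 K al : two K & dm K (inv2 K al) = cd K al & cd K (inv2 K al) = dm K al
  & inv2 K al \<cdot> al = id2 K (dm K al) & al \<cdot> inv2 K al = id2 K (cd K al)"
proof -
 obtain bt where b: "al : two K" "bt : two K" "dm K bt = cd K al" "cd K bt = dm K al"
   "bt \<cdot> al = id2 K (dm K al)" "al \<cdot> bt = id2 K (cd K al)"
  using assms unfolding iso2_def by blast
 show ?thesis unfolding inv2_def
 proof (rule theI)
  show "bt : two K & dm K bt = cd K al & cd K bt = dm K al & bt \<cdot> al = id2 K (dm K al) & al \<cdot> bt = id2 K (cd K al)"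
   using b by simp
  fix gm assume g: "gm : two K & dm K gm = cd K al & cd K gm = dm K al & gm \<cdot> al = id2 K (dm K al) & al \<cdot> gm = id2 K (cd K al)"
  have "gm = gm \<cdot> (al \<cdot> bt)" using b g by (simp del: vcomp_assoc)
  also have "\<dots> = (gm \<cdot> al) \<cdot> bt" by (rule vcomp_assoc[symmetric]) (use b g in auto)
  also have "\<dots> = bt" using b g by (simp del: vcomp_assoc)
  finally show "gm = bt" .
 qed
qed

lemma inv2_simps [simp]:
 assumes "iso2 K al"
 shows "inv2 K al : two K" "dm K (inv2 K al) = cd K al" "cd K (inv2 K al) = dm K al"
  "inv2 K al \<cdot> al = id2 K (dm K al)" "al \<cdot> inv2 K al = id2 K (cd K al)"
 using iso2_inv[OF assms] by auto

lemma inv2_cancel [simp]: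
 assumes "iso2 K al" "bt : two K"
 shows "cd K bt = dm K al ==> inv2 K al \<cdot> (al \<cdot> bt) = bt" "cd K bt = cd K al ==> al \<cdot> (inv2 K al \<cdot> bt) = bt"
proof -
 show "inv2 K al \<cdot> (al \<cdot> bt) = bt" if "cd K bt = dm K al"
  by (subst vcomp_assoc[symmetric]) (use assms that in "simp_all del: vcomp_assoc")
 show "al \<cdot> (inv2 K al \<cdot> bt) = bt" if "cd K bt = cd K al"
  by (subst vcomp_assoc[symmetric]) (use assms that in "simp_all del: vcomp_assoc")
qed

lemma iso2I:
 assumes "al : two K" "bt : two K" "dm K bt = cd K al" "cd K bt = dm K al"
  "bt \<cdot> al = id2 K (dm K al)" "al \<cdot> bt = id2 K (cd K al)"
 shows "iso2 K al"
 using assms unfolding iso2_def by blast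

lemma inv2_eqI:
 assumes "iso2 K al" "bt : two K" "cd K bt = dm K al" "dm K bt = cd K al" "al \<cdot> bt = id2 K (cd K al)"
 shows "inv2 K al = bt"
 using inv2_cancel(1)[OF assms(1,2,3)] assms by simp

lemma iso2_id2 [simp]: "f : one K ==> iso2 K (id2 K f)"
 by (rule iso2I[of _ "id2 K f"]) auto

lemma inv2_id2 [simp]: "f : one K ==> inv2 K (id2 K f) = id2 K f"
 by (rule inv2_eqI) auto

lemma iso2_inv2 [simp]: "iso2 K al ==> iso2 K (inv2 K al)"
 by (rule iso2I[of _ al]) auto

lemma inv2_inv2 [simp]: "iso2 K al ==> inv2 K (inv2 K al) = al"
 by (rule inv2_eqI) auto

lemma iso2_vcomp [simp]:
 "[|iso2 K al; iso2 K bt; cd K al = dm K bt|] ==> iso2 K (bt \<cdot> al)"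
 by (rule iso2I[of _ "inv2 K al \<cdot> inv2 K bt"]) auto

lemma inv2_vcomp [simp]:
 "[|iso2 K al; iso2 K bt; cd K al = dm K bt|] ==> inv2 K (bt \<cdot> al) = inv2 K al \<cdot> inv2 K bt"
 by (rule inv2_eqI) auto

lemma iso2_hcomp [simp]:
 "[|iso2 K al; iso2 K bt; trg K (dm K al) = src K (dm K bt)|] ==> iso2 K (bt \<star> al)"
 by (rule iso2I[of _ "inv2 K bt \<star> inv2 K al"]) (auto simp: interchange[symmetric])

lemma inv2_hcomp [simp]:
 "[|iso2 K al; iso2 K bt; trg K (dm K al) = src K (dm K bt)|] ==> inv2 K (bt \<star> al) = inv2 K bt \<star> inv2 K al"
 by (rule inv2_eqI) (auto simp: interchange[symmetric])

lemma iso2_cancel_left: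
 assumes "bt \<cdot> al = bt \<cdot> al'" "iso2 K bt" "al : two K" "al' : two K" "cd K al = dm K bt" "cd K al' = dm K bt"
 shows "al = al'"
 using arg_cong[OF assms(1), of "%z. inv2 K bt \<cdot> z"] assms(2-) by simp

lemma iso2_cancel_right:
 assumes "bt \<cdot> al = bt' \<cdot> al" "iso2 K al" "bt : two K" "bt' : two K" "cd K al = dm K bt" "cd K al = dm K bt'"
 shows "bt = bt'"
proof -
 have r: "gm = (gm \<cdot> al) \<cdot> inv2 K al" if "gm : two K" "cd K al = dm K gm" for gm
  using assms(2) that by simp
 show ?thesis
  by (subst r[OF assms(3,5)], subst assms(1), rule r[symmetric]) (fact assms)+
qed

lemma vreassoc:
 assumes "bt \<cdot> al = bt' \<cdot> al'" "al : two K" "bt : two K" "cd K al = dm K bt"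
  "al' : two K" "bt' : two K" "cd K al' = dm K bt'" "z : two K" "cd K z = dm K al" "cd K z = dm K al'"
 shows "bt \<cdot> (al \<cdot> z) = bt' \<cdot> (al' \<cdot> z)"
 using vcomp_assoc[of z al bt] vcomp_assoc[of z al' bt'] assms by metis

lemma vreassoc1:
 assumes "bt \<cdot> al = gm" "al : two K" "bt : two K" "cd K al = dm K bt" "z : two K" "cd K z = dm K al"
 shows "bt \<cdot> (al \<cdot> z) = gm \<cdot> z"
 using vcomp_assoc[of z al bt] assms by metis

end

section \<open>Pseudofunctors, transformations and modifications\<close>

text \<open>The following locales restate the definitions with named source and target and with both
  2-categories at hand.\<close>

locale psf = A: two_category A + H: two_category H + pseudofunctor A H F
 for A :: "('a, 'p, 'q) two_cat" and H :: "('c, 'f, 't) two_cat" and F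
begin

lemma P_simps [simp]:
 "x : ob A ==> P0 F x : ob H"
 "f : one A ==> P1 F f : one H"
 "f : one A ==> src H (P1 F f) = P0 F (src A f)"
 "f : one A ==> trg H (P1 F f) = P0 F (trg A f)"
 "al : two A ==> P2 F al : two H"
 "al : two A ==> dm H (P2 F al) = P1 F (dm A al)"
 "al : two A ==> cd H (P2 F al) = P1 F (cd A al)"
 "f : one A ==> P2 F (id2 A f) = id2 H (P1 F f)"
 "[|al : two A; bt : two A; cd A al = dm A bt|] ==> P2 F (bt .[A] al) = P2 F bt .[H] P2 F al"
 using P0 P1 P2 P2_id2 P2_vcomp by auto

lemma Pc_simps [simp]:
 assumes "f : one A" "g : one A" "trg A f = src A g"
 shows "iso2 H (Pc F g f)" "Pc F g f : two H" "dm H (Pc F g f) = P1 F g *[H] P1 F f"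
  "cd H (Pc F g f) = P1 F (g *[A] f)"
 using Pc[OF assms] by simp_all

lemma Pu_simps [simp]:
 assumes "x : ob A"
 shows "iso2 H (Pu F x)" "Pu F x : two H" "dm H (Pu F x) = id1 H (P0 F x)"
  "cd H (Pu F x) = P1 F (id1 A x)"
 using Pu[OF assms] by simp_all

lemma P2_iso2 [simp]: "iso2 A al ==> iso2 H (P2 F al)"
 by (rule H.iso2I[of _ "P2 F (inv2 A al)"]) (auto simp flip: P_simps(9))

lemma psf_axioms': "psf A H F" ..

end

lemma psfun_eqI:
 fixes F G :: "('a, 'p, 'q, 'c, 'f, 't) psfun"
 assumes "pseudofunctor A H F" "pseudofunctor A H G"
  "!!x. x : ob A ==> P0 F x = P0 G x" "!!f. f : one A ==> P1 F f = P1 G f"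
  "!!al. al : two A ==> P2 F al = P2 G al"
  "!!f g. [|f : one A; g : one A; trg A f = src A g|] ==> Pc F g f = Pc G g f"
  "!!x. x : ob A ==> Pu F x = Pu G x"
 shows "F = G"
proof -
 interpret F: pseudofunctor A H F by fact
 interpret G: pseudofunctor A H G by fact
 have "restrict_comp A (Pc F) = restrict_comp A (Pc G)"
  unfolding restrict_comp_def using assms(6) by (intro ext) auto
 then have "Pc F = Pc G" using F.P_ext(4) G.P_ext(4) by simp
 moreover have "P0 F = P0 G" "P1 F = P1 G" "P2 F = P2 G" "Pu F = Pu G"
  using assms F.P_ext G.P_ext by (metis extensionalityI)+
 ultimately show ?thesis by simp
qed

locale pst = A: two_category A + H: two_category H + F: psf A H F + G: psf A H G
 for A :: "('a, 'p, 'q) two_cat" and H :: "('c, 'f, 't) two_cat" and F G +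
 fixes al :: "('a, 'p, 'q, 'c, 'f, 't) pstrans"
 assumes pseudonatural: "pseudonatural A H al"
  and N_st [simp]: "N_src al = F" "N_trg al = G"
begin

lemma N1_simps [simp]:
 assumes "x : ob A" shows "N1 al x : one H" "src H (N1 al x) = P0 F x" "trg H (N1 al x) = P0 G x"
 using pseudonatural.N1[OF pseudonatural assms] by auto

lemma N2_simps [simp]:
 assumes "f : one A"
 shows "iso2 H (N2 al f)" "N2 al f : two H" "dm H (N2 al f) = P1 G f *[H] N1 al (src A f)"
  "cd H (N2 al f) = N1 al (trg A f) *[H] P1 F f"
 using pseudonatural.N2[OF pseudonatural assms] by simp_all

lemma N2_nat:
 assumes "ch : two A" "dm A ch = f" "cd A ch = g" "src A f = x" "trg A f = y"
 shows "N2 al g .[H] (P2 G ch <|[H] N1 al x) = (N1 al y |>[H] P2 F ch) .[H] N2 al f"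
 using pseudonatural.N2_natural[OF pseudonatural assms(1)] assms by simp

lemma N2_cmp:
 assumes "f : one A" "g : one A" "trg A f = src A g" "src A f = x" "trg A g = z"
 shows "N2 al (g *[A] f) .[H] (Pc G g f <|[H] N1 al x)
  = (N1 al z |>[H] Pc F g f) .[H] ((N2 al g <|[H] P1 F f) .[H] (P1 G g |>[H] N2 al f))"
 using pseudonatural.N2_comp[OF pseudonatural assms(1-3)] assms by simp

lemma N2_unit:
 assumes "x : ob A"
 shows "N2 al (id1 A x) .[H] (Pu G x <|[H] N1 al x) = N1 al x |>[H] Pu F x"
 using pseudonatural.N2_id[OF pseudonatural assms] by simp

lemma N_ext: "N1 al : extensional (ob A)" "N2 al : extensional (one A)"
 using pseudonatural.N_ext[OF pseudonatural] by auto

end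

lemma pstI:
 assumes "two_category A" "two_category H" "pseudofunctor A H F" "pseudofunctor A H G"
  "N_src al = F" "N_trg al = G" "N1 al : extensional (ob A)" "N2 al : extensional (one A)"
  "!!x. x : ob A ==> N1 al x : one H & src H (N1 al x) = P0 F x & trg H (N1 al x) = P0 G x"
  "!!f. f : one A ==> iso2 H (N2 al f) & dm H (N2 al f) = P1 G f *[H] N1 al (src A f)
   & cd H (N2 al f) = N1 al (trg A f) *[H] P1 F f"
  "!!ch. ch : two A ==> N2 al (cd A ch) .[H] (P2 G ch <|[H] N1 al (src A (dm A ch)))
   = (N1 al (trg A (dm A ch)) |>[H] P2 F ch) .[H] N2 al (dm A ch)"
  "!!f g. [|f : one A; g : one A; trg A f = src A g|] ==>
   N2 al (g *[A] f) .[H] (Pc G g f <|[H] N1 al (src A f))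
   = (N1 al (trg A g) |>[H] Pc F g f)
    .[H] ((N2 al g <|[H] P1 F f) .[H] (P1 G g |>[H] N2 al f))"
  "!!x. x : ob A ==> N2 al (id1 A x) .[H] (Pu G x <|[H] N1 al x) = N1 al x |>[H] Pu F x"
 shows "pst A H F G al"
 using assms unfolding pst_def pst_axioms_def psf_def pseudonatural_def by simp

lemma pst_iff:
 assumes "two_category A" "two_category H"
 shows "pst A H F G al \<longleftrightarrow> pseudonatural A H al & N_src al = F & N_trg al = G"
 using assms unfolding pst_def pst_axioms_def psf_def pseudonatural_def by auto

lemma pst_eqI:
 assumes "pst A H F G al" "pst A H F G bt" "!!x. x : ob A ==> N1 al x = N1 bt x"
  "!!f. f : one A ==> N2 al f = N2 bt f"
 shows "al = bt"
proof -
 interpret a: pst A H F G al by fact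
 interpret b: pst A H F G bt by fact
 have "N1 al = N1 bt" "N2 al = N2 bt"
  using assms a.N_ext b.N_ext by (metis extensionalityI)+
 then show ?thesis by simp
qed

locale mdf = al: pst A H F G al + bt: pst A H F G bt
 for A :: "('a, 'p, 'q) two_cat" and H :: "('c, 'f, 't) two_cat" and F G al bt +
 fixes m :: "('a, 'p, 'q, 'c, 'f, 't) modif"
 assumes modification: "modification A H m"
  and M_st [simp]: "M_src m = al" "M_trg m = bt"
begin

lemma M_simps [simp]:
 assumes "x : ob A" shows "M_at m x : two H" "dm H (M_at m x) = N1 al x" "cd H (M_at m x) = N1 bt x"
 using modification.M_at[OF modification assms] by auto

lemma M_nat:
 assumes "f : one A" "src A f = x" "trg A f = y"
 shows "N2 bt f .[H] (P1 G f |>[H] M_at m x) = (M_at m y <|[H] P1 F f) .[H] N2 al f"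
 using modification.M_natural[OF modification assms(1)] assms by simp

lemma M_ext: "M_at m : extensional (ob A)"
 using modification.M_ext[OF modification] .

end

lemma mdfI:
 assumes "pst A H F G al" "pst A H F G bt" "M_src m = al" "M_trg m = bt" "M_at m : extensional (ob A)"
  "!!x. x : ob A ==> M_at m x : two H & dm H (M_at m x) = N1 al x & cd H (M_at m x) = N1 bt x"
  "!!f. f : one A ==> N2 bt f .[H] (P1 G f |>[H] M_at m (src A f))
   = (M_at m (trg A f) <|[H] P1 F f) .[H] N2 al f"
 shows "mdf A H F G al bt m"
 using assms unfolding mdf_def mdf_axioms_def modification_def pst_def pst_axioms_def by simp

lemma mdf_iff:
 assumes "two_category A" "two_category H"
 shows "mdf A H F G al bt m \<longleftrightarrow> modification A H m & M_src m = al & M_trg m = bt & N_src al = F & N_trg al = G"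
 using assms unfolding mdf_def mdf_axioms_def modification_def by (auto simp: pst_iff)

lemma mdf_eqI:
 assumes "mdf A H F G al bt m" "mdf A H F G al bt n" "!!x. x : ob A ==> M_at m x = M_at n x"
 shows "m = n"
proof -
 interpret m: mdf A H F G al bt m by fact
 interpret n: mdf A H F G al bt n by fact
 have "M_at m = M_at n"
  using assms m.M_ext n.M_ext by (metis extensionalityI)
 then show ?thesis by simp
qed

lemma PS_simps [simp]:
 "F : ob (PS A H) \<longleftrightarrow> pseudofunctor A H F" "al : one (PS A H) \<longleftrightarrow> pseudonatural A H al"
 "m : two (PS A H) \<longleftrightarrow> modification A H m"
 "src (PS A H) = N_src" "trg (PS A H) = N_trg" "dm (PS A H) = M_src" "cd (PS A H) = M_trg"
 "id1 (PS A H) = ps_id A H" "comp1 (PS A H) = ps_comp A H"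
 "M_src (id2 (PS A H) al) = al" "M_trg (id2 (PS A H) al) = al"
 "x : ob A ==> M_at (id2 (PS A H) al) x = id2 H (N1 al x)"
 "M_src (n .[PS A H] m) = M_src m" "M_trg (n .[PS A H] m) = M_trg n"
 "x : ob A ==> M_at (n .[PS A H] m) x = M_at n x .[H] M_at m x"
 "M_src (n **[PS A H] m) = ps_comp A H (M_src n) (M_src m)"
 "M_trg (n **[PS A H] m) = ps_comp A H (M_trg n) (M_trg m)"
 "x : ob A ==> M_at (n **[PS A H] m) x = M_at n x **[H] M_at m x"
 by (auto simp: PS_def)

lemma PS_ext:
 "M_at (id2 (PS A H) al) : extensional (ob A)" "M_at (n .[PS A H] m) : extensional (ob A)"
 "M_at (n **[PS A H] m) : extensional (ob A)"
 by (auto simp: PS_def)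

lemma ps_id_simps [simp]:
 "N_src (ps_id A H F) = F" "N_trg (ps_id A H F) = F"
 "x : ob A ==> N1 (ps_id A H F) x = id1 H (P0 F x)"
 "f : one A ==> N2 (ps_id A H F) f = id2 H (P1 F f)"
 by (auto simp: ps_id_def)

lemma ps_comp_simps [simp]:
 "N_src (ps_comp A H bt al) = N_src al" "N_trg (ps_comp A H bt al) = N_trg bt"
 "x : ob A ==> N1 (ps_comp A H bt al) x = N1 bt x *[H] N1 al x"
 "f : one A ==> N2 (ps_comp A H bt al) f = (N1 bt (trg A f) |>[H] N2 al f)
   .[H] (N2 bt f <|[H] N1 al (src A f))"
 by (auto simp: ps_comp_def)

lemma pst_ps_id: assumes "psf A H F" shows "pst A H F F (ps_id A H F)"
proof -
 interpret psf A H F by fact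
 show ?thesis
  by (rule pstI) (auto simp: ps_id_def A.tcat H.tcat pseudofunctor_axioms)
qed

lemma pst_ps_comp:
 assumes "pst A H F G al" "pst A H G K bt" shows "pst A H F K (ps_comp A H bt al)"
proof -
 interpret al: pst A H F G al by fact
 interpret bt: pst A H G K bt by fact
 let ?c = "ps_comp A H bt al"
 show ?thesis
 proof (rule pstI, goal_cases)
  case (11 ch)
  let ?f = "dm A ch" and ?g = "cd A ch" let ?x = "src A ?f" and ?y = "trg A ?f"
  have b: "(N2 bt ?g <|[H] N1 al ?x) .[H] (P2 K ch <|[H] (N1 bt ?x *[H] N1 al ?x))
   = (N1 bt ?y |>[H] (P2 G ch <|[H] N1 al ?x)) .[H] (N2 bt ?f <|[H] N1 al ?x)"
   using arg_cong[OF bt.N2_nat[OF 11 refl refl refl refl], of "%z. z <|[H] N1 al ?x"] 11 by simp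
  have a: "(N1 bt ?y |>[H] N2 al ?g) .[H] (N1 bt ?y |>[H] (P2 G ch <|[H] N1 al ?x))
   = ((N1 bt ?y *[H] N1 al ?y) |>[H] P2 F ch) .[H] (N1 bt ?y |>[H] N2 al ?f)"
   using arg_cong[OF al.N2_nat[OF 11 refl refl refl refl], of "%z. N1 bt ?y |>[H] z"] 11 by simp
  show ?case using 11 by (simp add: b al.H.vreassoc[OF a])
 next
  case (12 f g)
  let ?x = "src A f" and ?y = "src A g" and ?z = "trg A g"
  have b: "(N2 bt (g *[A] f) <|[H] N1 al ?x) .[H] (Pc K g f <|[H] (N1 bt ?x *[H] N1 al ?x))
   = (N1 bt ?z |>[H] (Pc G g f <|[H] N1 al ?x))
    .[H] ((N2 bt g <|[H] (P1 G f *[H] N1 al ?x)) .[H] (P1 K g |>[H] (N2 bt f <|[H] N1 al ?x)))"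
   using arg_cong[OF bt.N2_cmp[OF 12 refl refl], of "%z. z <|[H] N1 al ?x"] 12 by simp
  have a: "(N1 bt ?z |>[H] N2 al (g *[A] f)) .[H] (N1 bt ?z |>[H] (Pc G g f <|[H] N1 al ?x))
   = ((N1 bt ?z *[H] N1 al ?z) |>[H] Pc F g f) .[H]
    ((N1 bt ?z |>[H] (N2 al g <|[H] P1 F f)) .[H] ((N1 bt ?z *[H] P1 G g) |>[H] N2 al f))"
   using arg_cong[OF al.N2_cmp[OF 12 refl refl], of "%z. N1 bt ?z |>[H] z"] 12 by simp
  have e: "((N1 bt ?z *[H] P1 G g) |>[H] N2 al f) .[H] (N2 bt g <|[H] (P1 G f *[H] N1 al ?x))
   = (N2 bt g <|[H] (N1 al ?y *[H] P1 F f)) .[H] ((P1 K g *[H] N1 bt ?y) |>[H] N2 al f)"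
   by (rule al.H.exchange[symmetric]) (use 12 in auto)
  show ?case using 12 by (simp add: b al.H.vreassoc[OF a] al.H.vreassoc[OF e])
 next
  case (13 x)
  have b: "(N2 bt (id1 A x) <|[H] N1 al x) .[H] (Pu K x <|[H] (N1 bt x *[H] N1 al x))
   = N1 bt x |>[H] (Pu G x <|[H] N1 al x)"
   using arg_cong[OF bt.N2_unit[OF 13], of "%z. z <|[H] N1 al x"] 13 by simp
  have a: "(N1 bt x |>[H] N2 al (id1 A x)) .[H] (N1 bt x |>[H] (Pu G x <|[H] N1 al x))
   = (N1 bt x *[H] N1 al x) |>[H] Pu F x"
   using arg_cong[OF al.N2_unit[OF 13], of "%z. N1 bt x |>[H] z"] 13 by simp
  show ?case using 13 by (simp add: a b)
 qed (auto simp: ps_comp_def al.F.pseudofunctor_axioms bt.G.pseudofunctor_axioms al.A.tcat al.H.tcat)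
qed

lemma mdf_id2: assumes "pst A H F G al" shows "mdf A H F G al al (id2 (PS A H) al)"
proof -
 interpret pst A H F G al by fact
 show ?thesis by (rule mdfI[OF assms assms]) (auto simp: PS_ext)
qed

lemma mdf_vcomp:
 assumes "mdf A H F G al bt m" "mdf A H F G bt gm n" shows "mdf A H F G al gm (n .[PS A H] m)"
proof -
 interpret m: mdf A H F G al bt m by fact
 interpret n: mdf A H F G bt gm n by fact
 show ?thesis
 proof (rule mdfI, goal_cases)
  case (7 f)
  then show ?case
   by (simp add: m.M_nat[OF _ refl refl] m.al.H.vreassoc[OF n.M_nat[OF 7 refl refl]])
 qed (auto simp: m.al.pst_axioms n.bt.pst_axioms PS_ext)
qed

lemma mdf_hcomp:
 assumes "mdf A H F G al al' m" "mdf A H G K bt bt' n"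
 shows "mdf A H F K (ps_comp A H bt al) (ps_comp A H bt' al') (n **[PS A H] m)"
proof -
 interpret m: mdf A H F G al al' m by fact
 interpret n: mdf A H G K bt bt' n by fact
 show ?thesis
 proof (rule mdfI, goal_cases)
  case (7 f)
  let ?x = "src A f" and ?y = "trg A f"
  have s: "M_at n ?x **[H] M_at m ?x = (M_at n ?x <|[H] N1 al' ?x) .[H] (N1 bt ?x |>[H] M_at m ?x)"
   "M_at n ?y **[H] M_at m ?y = (M_at n ?y <|[H] N1 al' ?y) .[H] (N1 bt ?y |>[H] M_at m ?y)"
   using 7 m.al.H.hcomp_split(1)[of "M_at m ?x" "M_at n ?x"] m.al.H.hcomp_split(1)[of "M_at m ?y" "M_at n ?y"] by auto
  have b: "(N2 bt' f <|[H] N1 al' ?x) .[H] (P1 K f |>[H] (M_at n ?x <|[H] N1 al' ?x))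
   = (M_at n ?y <|[H] (P1 G f *[H] N1 al' ?x)) .[H] (N2 bt f <|[H] N1 al' ?x)"
   using arg_cong[OF n.M_nat[OF 7 refl refl], of "%z. z <|[H] N1 al' ?x"] 7 by simp
  have a: "(N1 bt ?y |>[H] N2 al' f) .[H] ((N1 bt ?y *[H] P1 G f) |>[H] M_at m ?x)
   = (N1 bt ?y |>[H] (M_at m ?y <|[H] P1 F f)) .[H] (N1 bt ?y |>[H] N2 al f)"
   using arg_cong[OF m.M_nat[OF 7 refl refl], of "%z. N1 bt ?y |>[H] z"] 7 by simp
  have e1: "(N1 bt' ?y |>[H] N2 al' f) .[H] (M_at n ?y <|[H] (P1 G f *[H] N1 al' ?x))
   = (M_at n ?y <|[H] (N1 al' ?y *[H] P1 F f)) .[H] (N1 bt ?y |>[H] N2 al' f)"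
   by (rule m.al.H.exchange[symmetric]) (use 7 in auto)
  have e2: "(N2 bt f <|[H] N1 al' ?x) .[H] ((P1 K f *[H] N1 bt ?x) |>[H] M_at m ?x)
   = ((N1 bt ?y *[H] P1 G f) |>[H] M_at m ?x) .[H] (N2 bt f <|[H] N1 al ?x)"
   by (rule m.al.H.exchange) (use 7 in auto)
  show ?case using 7
   by (simp add: s m.al.H.vreassoc[OF b] e2 m.al.H.vreassoc[OF e1] m.al.H.vreassoc[OF a])
 qed (auto simp: m.al.pst_axioms n.bt.pst_axioms m.bt.pst_axioms n.al.pst_axioms PS_ext
   pst_ps_comp[OF m.al.pst_axioms n.al.pst_axioms] pst_ps_comp[OF m.bt.pst_axioms n.bt.pst_axioms])
qed

lemma ps_comp_assoc:
 assumes "pst A H F G f" "pst A H G K g" "pst A H K L h"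
 shows "ps_comp A H (ps_comp A H h g) f = ps_comp A H h (ps_comp A H g f)"
proof -
 interpret f: pst A H F G f by fact
 interpret g: pst A H G K g by fact
 interpret h: pst A H K L h by fact
 show ?thesis
  by (rule pst_eqI[OF pst_ps_comp[OF assms(1) pst_ps_comp[OF assms(2,3)]]
    pst_ps_comp[OF pst_ps_comp[OF assms(1,2)] assms(3)]]) auto
qed

lemma ps_comp_id:
 assumes "pst A H F G f"
 shows "ps_comp A H f (ps_id A H F) = f" "ps_comp A H (ps_id A H G) f = f"
proof -
 interpret f: pst A H F G f by fact
 note i = pst_ps_id[OF f.F.psf_axioms'] and j = pst_ps_id[OF f.G.psf_axioms']
 show "ps_comp A H f (ps_id A H F) = f"
  by (rule pst_eqI[OF pst_ps_comp[OF i assms] assms]) auto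
 show "ps_comp A H (ps_id A H G) f = f"
  by (rule pst_eqI[OF pst_ps_comp[OF assms j] assms]) auto
qed

lemma mdf_vcomp_assoc:
 assumes r: "mdf A H F G f g al" "mdf A H F G g h bt" "mdf A H F G h k gm"
 shows "(gm .[PS A H] bt) .[PS A H] al = gm .[PS A H] (bt .[PS A H] al)"
proof -
 interpret a: mdf A H F G f g al by (rule r)
 interpret b: mdf A H F G g h bt by (rule r)
 interpret c: mdf A H F G h k gm by (rule r)
 show ?thesis
  by (rule mdf_eqI[OF mdf_vcomp[OF r(1) mdf_vcomp[OF r(2,3)]] mdf_vcomp[OF mdf_vcomp[OF r(1,2)] r(3)]])
   simp
qed

lemma mdf_vcomp_id:
 assumes r: "mdf A H F G f g al"
 shows "al .[PS A H] id2 (PS A H) f = al" "id2 (PS A H) g .[PS A H] al = al"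
proof -
 interpret a: mdf A H F G f g al by (rule r)
 show "al .[PS A H] id2 (PS A H) f = al"
  by (rule mdf_eqI[OF mdf_vcomp[OF mdf_id2[OF a.al.pst_axioms] r] r]) simp
 show "id2 (PS A H) g .[PS A H] al = al"
  by (rule mdf_eqI[OF mdf_vcomp[OF r mdf_id2[OF a.bt.pst_axioms]] r]) simp
qed

lemma mdf_hcomp_assoc:
 assumes r: "mdf A H F G f f' al" "mdf A H G K g g' bt" "mdf A H K L h h' gm"
 shows "(gm **[PS A H] bt) **[PS A H] al = gm **[PS A H] (bt **[PS A H] al)"
proof -
 interpret a: mdf A H F G f f' al by (rule r)
 interpret b: mdf A H G K g g' bt by (rule r)
 interpret c: mdf A H K L h h' gm by (rule r)
 note e = ps_comp_assoc[OF a.al.pst_axioms b.al.pst_axioms c.al.pst_axioms]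
  ps_comp_assoc[OF a.bt.pst_axioms b.bt.pst_axioms c.bt.pst_axioms]
 show ?thesis
  by (rule mdf_eqI[OF mdf_hcomp[OF r(1) mdf_hcomp[OF r(2,3)], unfolded e]
    mdf_hcomp[OF mdf_hcomp[OF r(1,2)] r(3)]]) simp
qed

lemma mdf_hcomp_id:
 assumes r: "mdf A H F G f g al"
 shows "al **[PS A H] id2 (PS A H) (ps_id A H F) = al" "id2 (PS A H) (ps_id A H G) **[PS A H] al = al"
proof -
 interpret a: mdf A H F G f g al by (rule r)
 note e = ps_comp_id[OF a.al.pst_axioms] ps_comp_id[OF a.bt.pst_axioms]
 note i = mdf_id2[OF pst_ps_id[OF a.al.F.psf_axioms']] and j = mdf_id2[OF pst_ps_id[OF a.al.G.psf_axioms']]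
 show "al **[PS A H] id2 (PS A H) (ps_id A H F) = al"
  by (rule mdf_eqI[OF mdf_hcomp[OF i r, unfolded e] r]) simp
 show "id2 (PS A H) (ps_id A H G) **[PS A H] al = al"
  by (rule mdf_eqI[OF mdf_hcomp[OF r j, unfolded e] r]) simp
qed

lemma mdf_hcomp_id2:
 assumes "pst A H F G f" "pst A H G K g"
 shows "id2 (PS A H) g **[PS A H] id2 (PS A H) f = id2 (PS A H) (ps_comp A H g f)"
proof -
 interpret f: pst A H F G f by fact
 interpret g: pst A H G K g by fact
 show ?thesis
  by (rule mdf_eqI[OF mdf_hcomp[OF mdf_id2[OF assms(1)] mdf_id2[OF assms(2)]]
      mdf_id2[OF pst_ps_comp[OF assms]]]) simp
qed

lemma mdf_interchange:
 assumes r: "mdf A H F G f f' al" "mdf A H F G f' f'' al'" "mdf A H G K g g' bt" "mdf A H G K g' g'' bt'"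
 shows "(bt' .[PS A H] bt) **[PS A H] (al' .[PS A H] al) = (bt' **[PS A H] al') .[PS A H] (bt **[PS A H] al)"
proof -
 interpret a: mdf A H F G f f' al by (rule r)
 interpret a': mdf A H F G f' f'' al' by (rule r)
 interpret b: mdf A H G K g g' bt by (rule r)
 interpret b': mdf A H G K g' g'' bt' by (rule r)
 show ?thesis
  by (rule mdf_eqI[OF mdf_hcomp[OF mdf_vcomp[OF r(1,2)] mdf_vcomp[OF r(3,4)]]
     mdf_vcomp[OF mdf_hcomp[OF r(1,3)] mdf_hcomp[OF r(2,4)]]])
    (simp add: a.al.H.interchange)
qed

lemma two_category_PS:
 assumes A: "two_category A" and H: "two_category H" shows "two_category (PS A H)"
proof -
 note pi = pst_iff[OF A H] and mi = mdf_iff[OF A H]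
 have pd: "pst A H (N_src al) (N_trg al) al" if "pseudonatural A H al" for al
  using that by (simp add: pi)
 have sp: "psf A H F" if "pseudofunctor A H F" for F
  using that A H by (simp add: psf_def)
 have mp: "mdf A H (N_src (M_src m)) (N_trg (M_src m)) (M_src m) (M_trg m) m"
  "pst A H (N_src (M_src m)) (N_trg (M_src m)) (M_src m)"
  "pst A H (N_src (M_src m)) (N_trg (M_src m)) (M_trg m)"
  "N_src (M_trg m) = N_src (M_src m)" "N_trg (M_trg m) = N_trg (M_src m)" if "modification A H m" for m
  using that A H unfolding modification_def by (simp_all add: mi pi modification_def)
 show ?thesis
 proof (unfold_locales, goal_cases)
  case (1 f)
  then show ?case by (simp add: pseudonatural_def)
 next
  case (2 al)
  then show ?case by (simp add: modification_def)
 next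
  case (3 x)
  then show ?case using pst_ps_id[OF sp] by (simp add: pi)
 next
  case (4 f g)
  then show ?case using pst_ps_comp[of A H "N_src f" "N_trg f" f "N_trg g" g] by (simp add: pi)
 next
  case (5 f g h)
  then show ?case using ps_comp_assoc[OF pd[of f], of "N_trg g" g "N_trg h" h] pd[of g] pd[of h] by simp
 next
  case (6 f)
  then show ?case using ps_comp_id(1)[OF pd[of f]] by simp
 next
  case (7 f)
  then show ?case using ps_comp_id(2)[OF pd[of f]] by simp
 next
  case (8 f)
  then show ?case using mdf_id2[OF pd] by (simp add: mi)
 next
  case (9 al bt)
  then show ?case using mdf_vcomp[OF mp(1)[of al], of "M_trg bt" bt] mp(1)[of bt] mp(4,5)[of al] by (simp add: mi)
 next
  case (10 al bt gm)
  then show ?case using mdf_vcomp_assoc[OF mp(1)[of al], of "M_trg bt" bt "M_trg gm" gm]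
   mp(1)[of bt] mp(1)[of gm] mp(4,5)[of al] mp(4,5)[of bt] by simp
 next
  case (11 al)
  then show ?case using mdf_vcomp_id(1)[OF mp(1)] by simp
 next
  case (12 al)
  then show ?case using mdf_vcomp_id(2)[OF mp(1)] by simp
 next
  case (13 al bt)
  then show ?case using mdf_hcomp[OF mp(1)[of al], of "N_trg (M_src bt)" "M_src bt" "M_trg bt" bt] mp(1)[of bt]
   by (simp add: mi)
 next
  case (14 al bt gm)
  then show ?case using mdf_hcomp_assoc[OF mp(1)[of al], of "N_trg (M_src bt)" "M_src bt" "M_trg bt" bt
   "N_trg (M_src gm)" "M_src gm" "M_trg gm" gm] mp(1)[of bt] mp(1)[of gm] by simp
 next
  case (15 al)
  then show ?case using mdf_hcomp_id(1)[OF mp(1)] by simp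
 next
  case (16 al)
  then show ?case using mdf_hcomp_id(2)[OF mp(1)] by simp
 next
  case (17 f g)
  then show ?case using mdf_hcomp_id2[OF pd[of f], of "N_trg g" g] pd[of g] by simp
 next
  case (18 al al' bt bt')
  then show ?case using mdf_interchange[OF mp(1)[of al], of "M_trg al'" al' "N_trg (M_src bt)" "M_src bt" "M_trg bt" bt
   "M_trg bt'" bt'] mp(1)[of al'] mp(1)[of bt] mp(1)[of bt'] mp(4,5)[of al] mp(4,5)[of bt] by simp
 qed
qed

section \<open>Duals, products, strict functors and composites\<close>

lemma op2_simps [simp]:
 "ob (op2 K) = ob K" "one (op2 K) = one K" "two (op2 K) = two K" "src (op2 K) = trg K"
 "trg (op2 K) = src K" "dm (op2 K) = dm K" "cd (op2 K) = cd K" "id1 (op2 K) = id1 K"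
 "g \<odot>\<^bsub>op2 K\<^esub> f = f *[K] g" "id2 (op2 K) = id2 K" "vcomp (op2 K) = vcomp K" "bt \<star>\<^bsub>op2 K\<^esub> al = al **[K] bt"
 by (auto simp: op2_def)

lemma two_category_op2:
 assumes "two_category K" shows "two_category (op2 K)"
proof -
 interpret two_category K by fact
 show ?thesis by unfold_locales (simp_all add: interchange)
qed

lemma prod2_simps [simp]:
 "ob (prod2 K L) = ob K \<times> ob L" "one (prod2 K L) = one K \<times> one L" "two (prod2 K L) = two K \<times> two L"
 "src (prod2 K L) (f, f') = (src K f, src L f')" "trg (prod2 K L) (f, f') = (trg K f, trg L f')"
 "dm (prod2 K L) (al, al') = (dm K al, dm L al')" "cd (prod2 K L) (al, al') = (cd K al, cd L al')"
 "id1 (prod2 K L) (x, x') = (id1 K x, id1 L x')" "id2 (prod2 K L) (f, f') = (id2 K f, id2 L f')"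
 "(g, g') \<odot>\<^bsub>prod2 K L\<^esub> (f, f') = (g *[K] f, g' *[L] f')"
 "(bt, bt') \<cdot>\<^bsub>prod2 K L\<^esub> (al, al') = (bt .[K] al, bt' .[L] al')"
 "(bt, bt') \<star>\<^bsub>prod2 K L\<^esub> (al, al') = (bt **[K] al, bt' **[L] al')"
 by (auto simp: prod2_def)

lemma two_category_prod2:
 assumes "two_category K" "two_category L" shows "two_category (prod2 K L)"
proof -
 interpret K: two_category K by fact
 interpret L: two_category L by fact
 show ?thesis
  by unfold_locales (auto simp: K.interchange L.interchange)
qed

lemma strict_simps [simp]:
 "x : ob A ==> P0 (strict A H p0 p1 p2) x = p0 x"
 "f : one A ==> P1 (strict A H p0 p1 p2) f = p1 f"
 "al : two A ==> P2 (strict A H p0 p1 p2) al = p2 al"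
 "[|f : one A; g : one A; trg A f = src A g|] ==> Pc (strict A H p0 p1 p2) g f = id2 H (p1 (g *[A] f))"
 "x : ob A ==> Pu (strict A H p0 p1 p2) x = id2 H (id1 H (p0 x))"
 by (auto simp: strict_def restrict_comp_def)

lemma restrict_comp_simps [simp]:
 "[|f : one A; g : one A; trg A f = src A g|] ==> restrict_comp A c g f = c g f"
 "restrict_comp A (restrict_comp A c) = restrict_comp A c"
 by (auto simp: restrict_comp_def fun_eq_iff)

lemma strict_pseudofunctor:
 assumes "two_category A" "two_category H"
  and p0: "!!x. x : ob A ==> p0 x : ob H"
  and p1: "!!f. f : one A ==> p1 f : one H & src H (p1 f) = p0 (src A f) & trg H (p1 f) = p0 (trg A f)"
  and p2: "!!al. al : two A ==> p2 al : two H & dm H (p2 al) = p1 (dm A al) & cd H (p2 al) = p1 (cd A al)"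
  and i1: "!!x. x : ob A ==> p1 (id1 A x) = id1 H (p0 x)"
  and c1: "!!f g. [|f : one A; g : one A; trg A f = src A g|] ==> p1 (g *[A] f) = p1 g *[H] p1 f"
  and i2: "!!f. f : one A ==> p2 (id2 A f) = id2 H (p1 f)"
  and v2: "!!al bt. [|al : two A; bt : two A; cd A al = dm A bt|] ==> p2 (bt .[A] al) = p2 bt .[H] p2 al"
  and h2: "!!al bt. [|al : two A; bt : two A; trg A (dm A al) = src A (dm A bt)|] ==> p2 (bt **[A] al) = p2 bt **[H] p2 al"
 shows "pseudofunctor A H (strict A H p0 p1 p2)"
proof -
 interpret A: two_category A by fact
 interpret H: two_category H by fact
 have q: "f : one A ==> p1 f : one H" "f : one A ==> src H (p1 f) = p0 (src A f)"
  "f : one A ==> trg H (p1 f) = p0 (trg A f)" "al : two A ==> p2 al : two H"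
  "al : two A ==> dm H (p2 al) = p1 (dm A al)" "al : two A ==> cd H (p2 al) = p1 (cd A al)" for f al
  using p1 p2 by auto
 show ?thesis
  by unfold_locales (auto simp: strict_def p0 q i1 c1 i2 v2 h2)
qed

text \<open>Pseudofunctors with identity constraints are exactly the 2-functors.\<close>

locale sfun = psf +
 assumes Pc_id: "[|f : one A; g : one A; trg A f = src A g|] ==> Pc F g f = id2 H (P1 F (g *[A] f))"
  and Pu_id: "x : ob A ==> Pu F x = id2 H (id1 H (P0 F x))"
begin

lemma P1_comp [simp]:
 "[|f : one A; g : one A; trg A f = src A g|] ==> P1 F (g *[A] f) = P1 F g *[H] P1 F f"
 using Pc_simps(3)[of f g] by (simp add: Pc_id)

lemma P1_id [simp]: "x : ob A ==> P1 F (id1 A x) = id1 H (P0 F x)"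
 using Pu_simps(4)[of x] by (simp add: Pu_id)

lemma P2_hcomp [simp]:
 "[|al : two A; bt : two A; trg A (dm A al) = src A (dm A bt)|] ==> P2 F (bt **[A] al) = P2 F bt **[H] P2 F al"
 using Pc_natural[of al bt] by (simp add: Pc_id)

end

lemma sfun_strict:
 assumes "two_category A" "two_category H" "pseudofunctor A H (strict A H p0 p1 p2)"
 shows "sfun A H (strict A H p0 p1 p2)"
proof -
 interpret A: two_category A by fact
 interpret H: two_category H by fact
 interpret pseudofunctor A H "strict A H p0 p1 p2" by fact
 show ?thesis by unfold_locales auto
qed

lemma psf_comp_simps [simp]:
 "x : ob A ==> P0 (psf_comp A K U F) x = P0 U (P0 F x)"
 "f : one A ==> P1 (psf_comp A K U F) f = P1 U (P1 F f)"
 "al : two A ==> P2 (psf_comp A K U F) al = P2 U (P2 F al)"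
 "[|f : one A; g : one A; trg A f = src A g|] ==>
   Pc (psf_comp A K U F) g f = P2 U (Pc F g f) .[K] Pc U (P1 F g) (P1 F f)"
 "x : ob A ==> Pu (psf_comp A K U F) x = P2 U (Pu F x) .[K] Pu U (P0 F x)"
 by (auto simp: psf_comp_def restrict_comp_def)

lemma psf_psf_comp:
 assumes "psf A H F" "psf H K U" shows "psf A K (psf_comp A K U F)"
proof -
 interpret F: psf A H F by fact
 interpret U: psf H K U by fact
 have un: "P2 U (bt **[H] al) .[K] Pc U g f = Pc U g' f' .[K] (P2 U bt **[K] P2 U al)"
  if "al : two H" "bt : two H" "trg H (dm H al) = src H (dm H bt)" "dm H al = f" "cd H al = f'"
   "dm H bt = g" "cd H bt = g'" for al bt f g f' g'
  using U.Pc_natural[OF that(1-3)] that(4-7) by simp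
 show ?thesis
 proof (unfold_locales, goal_cases)
  case (13 al bt)
  have a: "P2 U (P2 F (bt **[A] al)) .[K] P2 U (Pc F (dm A bt) (dm A al))
    = P2 U (Pc F (cd A bt) (cd A al)) .[K] P2 U (P2 F bt **[H] P2 F al)"
   using arg_cong[OF F.Pc_natural[OF 13], of "P2 U"] 13 by simp
  have b: "P2 U (P2 F bt **[H] P2 F al) .[K] Pc U (P1 F (dm A bt)) (P1 F (dm A al))
    = Pc U (P1 F (cd A bt)) (P1 F (cd A al)) .[K] (P2 U (P2 F bt) **[K] P2 U (P2 F al))"
   by (rule un) (use 13 in auto)
  show ?case using 13 by (simp add: U.H.vreassoc[OF a] b)
 next
  case (14 f g h)
  have a: "P2 U (Pc F (h *[A] g) f) .[K] P2 U (Pc F h g <|[H] P1 F f)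
   = P2 U (Pc F h (g *[A] f)) .[K] P2 U (P1 F h |>[H] Pc F g f)"
   using arg_cong[OF F.Pc_assoc[OF 14], of "P2 U"] 14 by simp
  have b: "Pc U (P1 F (h *[A] g)) (P1 F f) .[K] (P2 U (Pc F h g) <|[K] P1 U (P1 F f))
   = P2 U (Pc F h g <|[H] P1 F f) .[K] Pc U (P1 F h *[H] P1 F g) (P1 F f)"
   using un[of "id2 H (P1 F f)" "Pc F h g"] 14 by simp
  have c: "Pc U (P1 F h) (P1 F (g *[A] f)) .[K] (P1 U (P1 F h) |>[K] P2 U (Pc F g f))
   = P2 U (P1 F h |>[H] Pc F g f) .[K] Pc U (P1 F h) (P1 F g *[H] P1 F f)"
   using un[of "Pc F g f" "id2 H (P1 F h)"] 14 by simp
  have d: "Pc U (P1 F h *[H] P1 F g) (P1 F f) .[K] (Pc U (P1 F h) (P1 F g) <|[K] P1 U (P1 F f))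
   = Pc U (P1 F h) (P1 F g *[H] P1 F f) .[K] (P1 U (P1 F h) |>[K] Pc U (P1 F g) (P1 F f))"
   using U.Pc_assoc[of "P1 F f" "P1 F g" "P1 F h"] 14 by simp
  show ?case using 14
   by (simp add: U.H.vreassoc[OF b] U.H.vreassoc[OF c] d U.H.vreassoc[OF a])
 next
  case (15 f)
  have a: "P2 U (Pc F f (id1 A (src A f))) .[K] P2 U (P1 F f |>[H] Pu F (src A f)) = id2 K (P1 U (P1 F f))"
   using arg_cong[OF F.Pu_right[OF 15], of "P2 U"] 15 by simp
  have c: "Pc U (P1 F f) (P1 F (id1 A (src A f))) .[K] (P1 U (P1 F f) |>[K] P2 U (Pu F (src A f)))
   = P2 U (P1 F f |>[H] Pu F (src A f)) .[K] Pc U (P1 F f) (id1 H (P0 F (src A f)))"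
   using un[of "Pu F (src A f)" "id2 H (P1 F f)"] 15 by simp
  show ?case using 15 U.Pu_right[of "P1 F f"]
   by (simp add: U.H.vreassoc[OF c] U.H.vreassoc1[OF a] a)
 next
  case (16 f)
  have a: "P2 U (Pc F (id1 A (trg A f)) f) .[K] P2 U (Pu F (trg A f) <|[H] P1 F f) = id2 K (P1 U (P1 F f))"
   using arg_cong[OF F.Pu_left[OF 16], of "P2 U"] 16 by simp
  have c: "Pc U (P1 F (id1 A (trg A f))) (P1 F f) .[K] (P2 U (Pu F (trg A f)) <|[K] P1 U (P1 F f))
   = P2 U (Pu F (trg A f) <|[H] P1 F f) .[K] Pc U (id1 H (P0 F (trg A f))) (P1 F f)"
   using un[of "id2 H (P1 F f)" "Pu F (trg A f)"] 16 by simp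
  show ?case using 16 U.Pu_left[of "P1 F f"]
   by (simp add: U.H.vreassoc[OF c] U.H.vreassoc1[OF a] a)
 qed (auto simp: psf_comp_def)
qed

lemma sfun_psf_comp:
 assumes "sfun A H F" "sfun H K U" shows "sfun A K (psf_comp A K U F)"
proof -
 interpret F: sfun A H F by fact
 interpret U: sfun H K U by fact
 interpret psf A K "psf_comp A K U F" by (rule psf_psf_comp) unfold_locales
 show ?thesis by unfold_locales (auto simp: F.Pc_id F.Pu_id U.Pc_id U.Pu_id)
qed

lemma psf_psf_op:
 assumes "psf A H F" shows "psf (op2 A) (op2 H) (psf_op F)"
proof -
 interpret psf A H F by fact
 interpret A': two_category "op2 A" by (rule two_category_op2) unfold_locales
 interpret H': two_category "op2 H" by (rule two_category_op2) unfold_locales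
 have i: "iso2 (op2 H) al" if "iso2 H al" for al
  by (rule H'.iso2I[of _ "inv2 H al"]) (use that in auto)
 have r: "restrict_comp (op2 A) (%g f. Pc F f g) = (%g f. Pc F f g)"
 proof (intro ext)
  fix g f
  show "restrict_comp (op2 A) (%g f. Pc F f g) g f = Pc F f g"
   using fun_cong[OF fun_cong[OF P_ext(4)], of f g] by (auto simp: restrict_comp_def)
 qed
 show ?thesis
 proof unfold_locales
  show "restrict_comp (op2 A) (Pc (psf_op F)) = Pc (psf_op F)" using r by (simp add: psf_op_def)
 qed (simp_all add: psf_op_def i P_ext Pc_natural Pc_assoc Pu_right Pu_left)
qed

section \<open>Whiskering and precomposition\<close>

lemma whisker_right_simps [simp]:
 "N_src (ps_whisker_right A H al t) = psf_comp A H (N_src al) t"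
 "N_trg (ps_whisker_right A H al t) = psf_comp A H (N_trg al) t"
 "x : ob A ==> N1 (ps_whisker_right A H al t) x = N1 al (P0 t x)"
 "f : one A ==> N2 (ps_whisker_right A H al t) f = N2 al (P1 t f)"
 "M_src (modif_whisker_right A H m t) = ps_whisker_right A H (M_src m) t"
 "M_trg (modif_whisker_right A H m t) = ps_whisker_right A H (M_trg m) t"
 "x : ob A ==> M_at (modif_whisker_right A H m t) x = M_at m (P0 t x)"
 by (auto simp: ps_whisker_right_def modif_whisker_right_def)

lemma pst_whisker_right:
 assumes "pst B H F G al" "psf A B t"
 shows "pst A H (psf_comp A H F t) (psf_comp A H G t) (ps_whisker_right A H al t)"
proof -
 interpret al: pst B H F G al by fact
 interpret t: psf A B t by fact
 interpret Ft: psf A H "psf_comp A H F t" by (rule psf_psf_comp) unfold_locales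
 interpret Gt: psf A H "psf_comp A H G t" by (rule psf_psf_comp) unfold_locales
 show ?thesis
 proof (rule pstI, goal_cases)
  case (12 f g)
  let ?x = "P0 t (src A f)" and ?z = "P0 t (trg A g)"
  have a: "N2 al (P1 t (g *[A] f)) .[H] (P2 G (Pc t g f) <|[H] N1 al ?x)
   = (N1 al ?z |>[H] P2 F (Pc t g f)) .[H] N2 al (P1 t g *[B] P1 t f)"
   by (rule al.N2_nat) (use 12 in auto)
  have b: "N2 al (P1 t g *[B] P1 t f) .[H] (Pc G (P1 t g) (P1 t f) <|[H] N1 al ?x)
   = (N1 al ?z |>[H] Pc F (P1 t g) (P1 t f)) .[H] ((N2 al (P1 t g) <|[H] P1 F (P1 t f))
    .[H] (P1 G (P1 t g) |>[H] N2 al (P1 t f)))"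
   by (rule al.N2_cmp) (use 12 in auto)
  show ?case using 12 by (simp add: al.H.vreassoc[OF a] b)
 next
  case (13 x)
  let ?x = "P0 t x"
  have a: "N2 al (P1 t (id1 A x)) .[H] (P2 G (Pu t x) <|[H] N1 al ?x)
   = (N1 al ?x |>[H] P2 F (Pu t x)) .[H] N2 al (id1 B ?x)"
   by (rule al.N2_nat) (use 13 in auto)
  show ?case using 13 by (simp add: al.H.vreassoc[OF a] al.N2_unit)
 qed (auto simp: ps_whisker_right_def t.A.tcat al.H.tcat Ft.pseudofunctor_axioms
   Gt.pseudofunctor_axioms al.N2_nat)
qed

lemma mdf_whisker_right:
 assumes "mdf B H F G al bt m" "psf A B t"
 shows "mdf A H (psf_comp A H F t) (psf_comp A H G t) (ps_whisker_right A H al t)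
  (ps_whisker_right A H bt t) (modif_whisker_right A H m t)"
proof -
 interpret m: mdf B H F G al bt m by fact
 interpret t: psf A B t by fact
 show ?thesis
  by (rule mdfI[OF pst_whisker_right pst_whisker_right])
   (use assms in "auto simp: m.al.pst_axioms m.bt.pst_axioms modif_whisker_right_def m.M_nat")
qed

lemma whisker_right_ps_comp:
 assumes "pst B H F G al" "pst B H G K bt" "psf A B t"
 shows "ps_whisker_right A H (ps_comp B H bt al) t
  = ps_comp A H (ps_whisker_right A H bt t) (ps_whisker_right A H al t)"
proof -
 interpret al: pst B H F G al by fact
 interpret bt: pst B H G K bt by fact
 interpret t: psf A B t by fact
 show ?thesis
  by (rule pst_eqI[OF pst_whisker_right[OF pst_ps_comp[OF assms(1,2)] assms(3)]
     pst_ps_comp[OF pst_whisker_right[OF assms(1,3)] pst_whisker_right[OF assms(2,3)]]]) auto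
qed

lemma whisker_right_id:
 assumes "psf B H F" "psf A B t"
 shows "ps_whisker_right A H (ps_id B H F) t = ps_id A H (psf_comp A H F t)"
proof -
 interpret F: psf B H F by fact
 interpret t: psf A B t by fact
 show ?thesis
  by (rule pst_eqI[OF pst_whisker_right[OF pst_ps_id[OF assms(1)] assms(2)]
     pst_ps_id[OF psf_psf_comp[OF assms(2,1)]]]) auto
qed

lemma precomp_simps [simp]:
 "pseudofunctor B H F ==> P0 (precomp A B H t) F = psf_comp A H F t"
 "pseudonatural B H al ==> P1 (precomp A B H t) al = ps_whisker_right A H al t"
 "modification B H m ==> P2 (precomp A B H t) m = modif_whisker_right A H m t"
 by (auto simp: precomp_def)

lemma sfun_precomp:
 assumes A: "two_category A" and B: "two_category B" and H: "two_category H" and t: "pseudofunctor A B t"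
 shows "sfun (PS B H) (PS A H) (precomp A B H t)"
proof -
 interpret t: psf A B t using A B t by (simp add: psf_def)
 note pi = pst_iff[OF A H] and mi = mdf_iff[OF A H]
 note pj = pst_iff[OF B H] and mj = mdf_iff[OF B H]
 note t' = t.psf_axioms'
 have pd: "pst B H (N_src al) (N_trg al) al" if "pseudonatural B H al" for al
  using that by (simp add: pj)
 have sp: "psf B H F" if "pseudofunctor B H F" for F
  using that B H by (simp add: psf_def)
 have mp: "mdf B H (N_src (M_src m)) (N_trg (M_src m)) (M_src m) (M_trg m) m"
  "pst B H (N_src (M_src m)) (N_trg (M_src m)) (M_src m)"
  "pst B H (N_src (M_src m)) (N_trg (M_src m)) (M_trg m)"
  "N_src (M_trg m) = N_src (M_src m)" "N_trg (M_trg m) = N_trg (M_src m)" if "modification B H m" for m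
  using that B H unfolding modification_def by (simp_all add: mj pj modification_def)
 show ?thesis unfolding precomp_def
 proof (rule sfun_strict[OF two_category_PS[OF B H] two_category_PS[OF A H]], rule strict_pseudofunctor[OF two_category_PS[OF B H] two_category_PS[OF A H]], goal_cases)
  case (1 x)
  then show ?case using psf_psf_comp[OF t' sp[of x]] by (simp add: psf_def)
 next
  case (2 f)
  then show ?case using pst_whisker_right[OF pd[of f] t'] by (simp add: pi)
 next
  case (3 al)
  then show ?case using mdf_whisker_right[OF mp(1)[of al] t'] by (simp add: mi)
 next
  case (4 x)
  then show ?case using whisker_right_id[OF sp[of x] t'] by simp
 next
  case (5 f g)
  then show ?case using whisker_right_ps_comp[OF pd[of f] _ t', of "N_trg g" g] pd[of g] by simp
 next
  case (6 f)
  have "modif_whisker_right A H (id2 (PS B H) f) t = id2 (PS A H) (ps_whisker_right A H f t)"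
   if "pst B H F G f" for F G
  proof -
   interpret f: pst B H F G f by fact
   show ?thesis
    by (rule mdf_eqI[OF mdf_whisker_right[OF mdf_id2[OF that] t']
     mdf_id2[OF pst_whisker_right[OF that t']]]) simp
  qed
  then show ?case using pd[of f] 6 by simp
 next
  case (7 al bt)
  then have r: "mdf B H (N_src (M_src al)) (N_trg (M_src al)) (M_src bt) (M_trg bt) bt"
   using mp(1)[of bt] mp(4,5)[of al] by simp
  have r': "mdf B H (N_src (M_src al)) (N_trg (M_src al)) (M_src al) (M_src bt) al"
   using mp(1)[of al] 7 by simp
  show ?case
   by (rule mdf_eqI[OF mdf_whisker_right[OF mdf_vcomp[OF r' r] t']
     mdf_vcomp[OF mdf_whisker_right[OF r' t'] mdf_whisker_right[OF r t']]]) simp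
 next
  case (8 al bt)
  then have r: "mdf B H (N_src (M_src al)) (N_src (M_src bt)) (M_src al) (M_trg al) al"
   "mdf B H (N_src (M_src bt)) (N_trg (M_src bt)) (M_src bt) (M_trg bt) bt"
   using mp(1)[of bt] mp(1)[of al] by simp_all
  have c: "ps_whisker_right A H (ps_comp B H (M_src bt) (M_src al)) t
    = ps_comp A H (ps_whisker_right A H (M_src bt) t) (ps_whisker_right A H (M_src al) t)"
   "ps_whisker_right A H (ps_comp B H (M_trg bt) (M_trg al)) t
    = ps_comp A H (ps_whisker_right A H (M_trg bt) t) (ps_whisker_right A H (M_trg al) t)"
   using r by (auto simp: mdf_def intro!: whisker_right_ps_comp t')
  show ?case
   by (rule mdf_eqI[OF mdf_whisker_right[OF mdf_hcomp[OF r] t', unfolded c]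
     mdf_hcomp[OF mdf_whisker_right[OF r(1) t'] mdf_whisker_right[OF r(2) t']]]) simp
 qed
qed

section \<open>Hom-functors and representables\<close>

context two_category
begin

lemma hom_map_simps [simp]:
 "F_src (hom_map K f g) = hom K (trg K f) (src K g)" "F_trg (hom_map K f g) = hom K (src K f) (trg K g)"
 "[|u : one K; src K u = trg K f; trg K u = src K g|] ==> F_ob (hom_map K f g) u = (g \<odot> u) \<odot> f"
 "[|al : two K; src K (dm K al) = trg K f; trg K (dm K al) = src K g|] ==>
   F_ar (hom_map K f g) al = (g |> al) <| f"
 by (auto simp: hom_map_def)

lemma hom_map2_simps [simp]:
 "T_src (hom_map2 K ph gm) = hom_map K (dm K ph) (dm K gm)"
 "T_trg (hom_map2 K ph gm) = hom_map K (cd K ph) (cd K gm)"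
 "[|u : one K; src K u = trg K (dm K ph); trg K u = src K (dm K gm)|] ==>
   T_at (hom_map2 K ph gm) u = (gm <| u) \<star> ph"
 by (auto simp: hom_map2_def)

lemma ftor_in_hom_map [simp]:
 assumes "f : one K" "g : one K" "trg K f = x" "src K g = y" "src K f = x'" "trg K g = y'"
 shows "ftor_in (hom_map K f g) (hom K x y) (hom K x' y')"
 by (rule ftor_inI) (use assms in "auto simp: category_hom tcat hom_map_def")

lemma cat_functor_hom_map [simp]:
 assumes "f : one K" "g : one K" shows "cat_functor (hom_map K f g)"
 using ftor_in_hom_map[OF assms] by (auto simp: ftor_in_def)

lemma nt_in_hom_map2 [simp]:
 assumes "ph : two K" "gm : two K" "dm K ph = f" "dm K gm = g" "cd K ph = f'" "cd K gm = g'"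
 shows "nt_in (hom_map2 K ph gm) (hom_map K f g) (hom_map K f' g')"
proof -
 have "nt_in (hom_map2 K ph gm) (hom_map K (dm K ph) (dm K gm)) (hom_map K (cd K ph) (cd K gm))"
 proof (rule nt_inI)
  show "ftor_in (hom_map K (dm K ph) (dm K gm)) (hom K (trg K (dm K ph)) (src K (dm K gm))) (hom K (src K (dm K ph)) (trg K (dm K gm)))"
   "ftor_in (hom_map K (cd K ph) (cd K gm)) (hom K (trg K (dm K ph)) (src K (dm K gm))) (hom K (src K (dm K ph)) (trg K (dm K gm)))"
   using assms(1,2) by simp_all
 next
  fix al assume "al : Ar (hom K (trg K (dm K ph)) (src K (dm K gm)))"
  then have a: "al : two K" "src K (dm K al) = trg K (dm K ph)" "trg K (dm K al) = src K (dm K gm)" by auto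
  have "(cd K gm |> (al <| cd K ph)) \<cdot> (gm \<star> (dm K al |> ph))
    = (id2 K (cd K gm) \<cdot> gm) \<star> ((al <| cd K ph) \<cdot> (dm K al |> ph))"
   by (rule interchange[symmetric]) (simp_all add: a assms(1,2))
  moreover have "(gm \<star> (cd K al |> ph)) \<cdot> (dm K gm |> (al <| dm K ph))
    = (gm \<cdot> id2 K (dm K gm)) \<star> ((cd K al |> ph) \<cdot> (al <| dm K ph))"
   by (rule interchange[symmetric]) (simp_all add: a assms(1,2))
  moreover have "(al <| cd K ph) \<cdot> (dm K al |> ph) = (cd K al |> ph) \<cdot> (al <| dm K ph)"
   by (rule exchange) (simp_all add: a assms(1,2))
  moreover have "T_at (hom_map2 K ph gm) (dm K al) = gm \<star> (dm K al |> ph)"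
   "T_at (hom_map2 K ph gm) (cd K al) = gm \<star> (cd K al |> ph)"
   "F_ar (hom_map K (dm K ph) (dm K gm)) al = dm K gm |> (al <| dm K ph)"
   "F_ar (hom_map K (cd K ph) (cd K gm)) al = cd K gm |> (al <| cd K ph)"
   "id2 K (cd K gm) \<cdot> gm = gm" "gm \<cdot> id2 K (dm K gm) = gm"
   by (simp_all add: a assms(1,2))
  ultimately show "Cmp (hom K (src K (dm K ph)) (trg K (dm K gm))) (F_ar (hom_map K (cd K ph) (cd K gm)) al) (T_at (hom_map2 K ph gm) (Dom (hom K (trg K (dm K ph)) (src K (dm K gm))) al))
   = Cmp (hom K (src K (dm K ph)) (trg K (dm K gm))) (T_at (hom_map2 K ph gm) (Cod (hom K (trg K (dm K ph)) (src K (dm K gm))) al)) (F_ar (hom_map K (dm K ph) (dm K gm)) al)"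
   by (simp only: hom_simps)
 qed (simp_all add: assms(1,2), simp add: hom_map2_def hom_def)
 then show ?thesis using assms by simp
qed

lemma nat_transformation_hom_map2 [simp]:
 "ph : two K ==> gm : two K ==> nat_transformation (hom_map2 K ph gm)"
 using nt_in_hom_map2 by (auto simp: nt_in_def)

lemma hom_map_comp [simp]:
 assumes "f : one K" "g : one K" "f' : one K" "g' : one K" "trg K f' = src K f" "trg K g = src K g'"
 shows "ftor_comp (hom_map K f' g') (hom_map K f g) = hom_map K (f \<odot> f') (g' \<odot> g)"
 by (rule ftor_in_eqI[OF ftor_in_comp[OF ftor_in_hom_map ftor_in_hom_map] ftor_in_hom_map])
  (use assms in auto)

lemma hom_map_id [simp]:
 assumes "x : ob K" "y : ob K" shows "hom_map K (id1 K x) (id1 K y) = ftor_id (hom K x y)"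
 by (rule ftor_in_eqI[OF ftor_in_hom_map ftor_in_id[OF category_hom]])
  (use assms in "auto simp: tcat")

lemma hom_map2_vcomp [simp]:
 assumes "ph : two K" "gm : two K" "ph' : two K" "gm' : two K" "cd K ph = dm K ph'" "cd K gm = dm K gm'"
 shows "nt_vcomp (hom_map2 K ph' gm') (hom_map2 K ph gm) = hom_map2 K (ph' \<cdot> ph) (gm' \<cdot> gm)"
proof (rule nt_in_eqI)
 show "nt_in (nt_vcomp (hom_map2 K ph' gm') (hom_map2 K ph gm)) (hom_map K (dm K ph) (dm K gm)) (hom_map K (cd K ph') (cd K gm'))"
  using nt_in_vcomp[OF nt_in_hom_map2[OF assms(1,2) refl refl refl refl]
    nt_in_hom_map2[OF assms(3,4) refl refl refl refl, folded assms(5,6)]] .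
 show "T_at (nt_vcomp (hom_map2 K ph' gm') (hom_map2 K ph gm)) u = T_at (hom_map2 K (ph' \<cdot> ph) (gm' \<cdot> gm)) u"
  if "u : Ob (F_src (hom_map K (dm K ph) (dm K gm)))" for u
 proof -
  have u: "u : one K" "src K u = trg K (dm K ph)" "trg K u = src K (dm K gm)"
   "trg K (dm K ph') = trg K (dm K ph)" "src K (dm K gm') = src K (dm K gm)"
   using that assms two_simps(4)[of ph] two_simps(3)[of gm] by auto
  have "(gm' \<star> (u |> ph')) \<cdot> (gm \<star> (u |> ph)) = (gm' \<cdot> gm) \<star> ((u |> ph') \<cdot> (u |> ph))"
   by (rule interchange[symmetric]) (use u assms in auto)
  moreover have "(u |> ph') \<cdot> (u |> ph) = u |> (ph' \<cdot> ph)"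
   using u assms by simp
  ultimately show ?thesis using u assms by (simp del: whisker_vcomp)
 qed
qed (use assms in auto)

lemma hom_map2_hcomp [simp]:
 assumes "ph : two K" "gm : two K" "ph' : two K" "gm' : two K"
  "trg K (dm K ph') = src K (dm K ph)" "trg K (dm K gm) = src K (dm K gm')"
 shows "nt_hcomp (hom_map2 K ph' gm') (hom_map2 K ph gm) = hom_map2 K (ph \<star> ph') (gm' \<star> gm)"
proof (rule nt_in_eqI)
 note n = nt_in_hom_map2[OF assms(1,2) refl refl refl refl] nt_in_hom_map2[OF assms(3,4) refl refl refl refl]
 have "nt_in (nt_hcomp (hom_map2 K ph' gm') (hom_map2 K ph gm))
  (ftor_comp (hom_map K (dm K ph') (dm K gm')) (hom_map K (dm K ph) (dm K gm)))
  (ftor_comp (hom_map K (cd K ph') (cd K gm')) (hom_map K (cd K ph) (cd K gm)))"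
  by (rule nt_in_hcomp[OF n(1) ftor_in_hom_map n(2) ftor_in_hom_map]) (use assms in auto)
 then show "nt_in (nt_hcomp (hom_map2 K ph' gm') (hom_map2 K ph gm)) (hom_map K (dm K ph \<odot> dm K ph') (dm K gm' \<odot> dm K gm))
   (hom_map K (cd K ph \<odot> cd K ph') (cd K gm' \<odot> cd K gm))"
  using assms by simp
 show "T_at (nt_hcomp (hom_map2 K ph' gm') (hom_map2 K ph gm)) u = T_at (hom_map2 K (ph \<star> ph') (gm' \<star> gm)) u"
  if "u : Ob (F_src (hom_map K (dm K ph \<odot> dm K ph') (dm K gm' \<odot> dm K gm)))" for u
 proof -
  have u: "u : one K" "src K u = trg K (dm K ph)" "trg K u = src K (dm K gm)" using that assms by auto
  let ?y = "gm \<star> (u |> ph)"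
  have "(gm' \<star> (cd K ?y |> ph')) \<cdot> (dm K gm' |> (?y <| dm K ph')) = gm' \<star> (?y \<star> ph')"
   using u assms by (simp flip: interchange del: hcomp_assoc whisker_whisker)
  then show ?thesis using u assms by simp
 qed
qed (use assms in auto)

lemma hom_map2_id [simp]:
 assumes "f : one K" "g : one K"
 shows "hom_map2 K (id2 K f) (id2 K g) = nt_id (hom_map K f g)"
 by (rule nt_in_eqI[OF nt_in_hom_map2 nt_in_id[OF ftor_in_hom_map]]) (use assms in auto)

text \<open>Identity transformations are normalised to this form when composites with other
  \<open>hom_map2\<close> are computed.\<close>

lemma nt_id_hom:
 "[|f : one K; g : one K|] ==> nt_id (hom_map K f g) = hom_map2 K (id2 K f) (id2 K g)"
 "[|x : ob K; y : ob K|] ==> nt_id (ftor_id (hom K x y)) = hom_map2 K (id2 K (id1 K x)) (id2 K (id1 K y))"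
 by auto

lemma sfun_rep: assumes "X : ob K" shows "sfun K CAT (rep K X)"
 unfolding rep_def
 by (rule sfun_strict[OF tcat two_category_CAT strict_pseudofunctor[OF tcat two_category_CAT]])
  (use assms in "auto simp: category_hom tcat nt_id_hom simp del: hom_map2_id")

lemma sfun_corep: assumes "Y : ob K" shows "sfun (op2 K) CAT (corep K Y)"
 unfolding corep_def
 by (rule sfun_strict[OF two_category_op2[OF tcat] two_category_CAT
    strict_pseudofunctor[OF two_category_op2[OF tcat] two_category_CAT]])
  (use assms in "auto simp: category_hom tcat nt_id_hom simp del: hom_map2_id")

lemma rep_simps [simp]:
 "Y : ob K ==> P0 (rep K X) Y = hom K X Y"
 "g : one K ==> P1 (rep K X) g = hom_map K (id1 K X) g"
 "gm : two K ==> P2 (rep K X) gm = hom_map2 K (id2 K (id1 K X)) gm"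
 "[|f : one K; g : one K; trg K f = src K g|] ==> Pc (rep K X) g f = nt_id (hom_map K (id1 K X) (g \<odot> f))"
 "Y : ob K ==> Pu (rep K X) Y = nt_id (ftor_id (hom K X Y))"
 by (auto simp: rep_def)

lemma corep_simps [simp]:
 "X : ob K ==> P0 (corep K Y) X = hom K X Y"
 "f : one K ==> P1 (corep K Y) f = hom_map K f (id1 K Y)"
 "ph : two K ==> P2 (corep K Y) ph = hom_map2 K ph (id2 K (id1 K Y))"
 "[|f : one K; g : one K; trg K g = src K f|] ==> Pc (corep K Y) g f = nt_id (hom_map K (f \<odot> g) (id1 K Y))"
 "X : ob K ==> Pu (corep K Y) X = nt_id (ftor_id (hom K X Y))"
 by (auto simp: corep_def)

lemma psf_rep: "X : ob K ==> psf K CAT (rep K X)"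
 using sfun_rep by (simp add: sfun_def)

definition yoneda1 where
 "yoneda1 f = \<lparr>N_src = rep K (trg K f), N_trg = rep K (src K f),
    N1 = (\<lambda>Y\<in>ob K. hom_map K f (id1 K Y)), N2 = (\<lambda>h\<in>one K. nt_id (hom_map K f h))\<rparr>"

definition yoneda2 where
 "yoneda2 ph = \<lparr>M_src = yoneda1 (dm K ph), M_trg = yoneda1 (cd K ph),
    M_at = (\<lambda>Y\<in>ob K. hom_map2 K ph (id2 K (id1 K Y)))\<rparr>"

lemma yoneda_eq: "yoneda K = strict (op2 K) (PS K CAT) (rep K) yoneda1 yoneda2"
 unfolding yoneda_def yoneda1_def yoneda2_def by (simp add: Let_def)

lemma yoneda1_simps [simp]:
 "N_src (yoneda1 f) = rep K (trg K f)" "N_trg (yoneda1 f) = rep K (src K f)"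
 "Y : ob K ==> N1 (yoneda1 f) Y = hom_map K f (id1 K Y)"
 "h : one K ==> N2 (yoneda1 f) h = nt_id (hom_map K f h)"
 "M_src (yoneda2 ph) = yoneda1 (dm K ph)" "M_trg (yoneda2 ph) = yoneda1 (cd K ph)"
 "Y : ob K ==> M_at (yoneda2 ph) Y = hom_map2 K ph (id2 K (id1 K Y))"
 by (auto simp: yoneda1_def yoneda2_def)

lemma pst_yoneda1:
 assumes "f : one K" shows "pst K CAT (rep K (trg K f)) (rep K (src K f)) (yoneda1 f)"
proof -
 interpret F: sfun K CAT "rep K (trg K f)" using assms by (intro sfun_rep) auto
 interpret G: sfun K CAT "rep K (src K f)" using assms by (intro sfun_rep) auto
 have i: "iso2 CAT (hom_map2 K (id2 K f) (id2 K h))" if "h : one K" for h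
  using F.H.iso2_id2[of "hom_map K f h"] assms that by simp
 show ?thesis
  by (rule pstI, unfold_locales)
   (use assms in "auto simp: i F.pseudofunctor_axioms simp: nt_id_hom simp del: hom_map2_id, auto simp: yoneda1_def")
qed

lemma mdf_yoneda2:
 assumes "ph : two K"
 shows "mdf K CAT (rep K (trg K (dm K ph))) (rep K (src K (dm K ph))) (yoneda1 (dm K ph)) (yoneda1 (cd K ph)) (yoneda2 ph)"
 by (rule mdfI[OF pst_yoneda1])
  (use assms pst_yoneda1[of "cd K ph"] in "auto simp: nt_id_hom simp del: hom_map2_id, auto simp: yoneda2_def")

lemma sfun_yoneda: "sfun (op2 K) (PS K CAT) (yoneda K)"
proof -
 note C = two_category_CAT
 note M = two_category_PS[OF tcat C]
 note pi = pst_iff[OF tcat C] and mi = mdf_iff[OF tcat C]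
 note r = psf_rep
 show ?thesis unfolding yoneda_eq
 proof (rule sfun_strict[OF two_category_op2[OF tcat] M
    strict_pseudofunctor[OF two_category_op2[OF tcat] M]], goal_cases)
  case (1 x)
  then show ?case using r[of x] by (simp add: psf_def)
 next
  case (2 f)
  then show ?case using pst_yoneda1[of f] by (simp add: pi)
 next
  case (3 al)
  then show ?case using mdf_yoneda2[of al] by (simp add: mi)
 next
  case (4 x)
  then show ?case using pst_yoneda1[of "id1 K x"] pst_ps_id[OF r[of x]]
   by (intro pst_eqI[where F = "rep K x" and G = "rep K x"]) auto
 next
  case (5 f g)
  then show ?case using pst_yoneda1[of "f \<odot> g"] pst_ps_comp[OF pst_yoneda1[of f] , of "rep K (src K g)" "yoneda1 g"]
    pst_yoneda1[of g]
   by (intro pst_eqI[where F = "rep K (trg K f)" and G = "rep K (src K g)" and H = CAT and A = K]) (auto simp: nt_id_hom simp del: hom_map2_id)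
 next
  case (6 f)
  then show ?case using mdf_yoneda2[of "id2 K f"] mdf_id2[OF pst_yoneda1[of f]]
   by (intro mdf_eqI[where F = "rep K (trg K f)" and G = "rep K (src K f)" and H = CAT and A = K]) (auto simp: nt_id_hom simp del: hom_map2_id)
 next
  case (7 al bt)
  then show ?case using mdf_yoneda2[of "bt \<cdot> al"] mdf_vcomp[OF mdf_yoneda2[of al], of "yoneda1 (cd K bt)" "yoneda2 bt"]
    mdf_yoneda2[of bt] two_simps(3,4)[of al]
   by (intro mdf_eqI[where F = "rep K (trg K (dm K al))" and G = "rep K (src K (dm K al))" and H = CAT and A = K]) (auto)
 next
  case (8 al bt)
  have e: "yoneda1 (f \<odot> g) = ps_comp K CAT (yoneda1 g) (yoneda1 f)" if "f : one K" "g : one K" "trg K g = src K f" for f g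
   using pst_yoneda1[of "f \<odot> g"] pst_ps_comp[OF pst_yoneda1[of f] , of "rep K (src K g)" "yoneda1 g"]
    pst_yoneda1[of g] that
   by (intro pst_eqI[where F = "rep K (trg K f)" and G = "rep K (src K g)" and H = CAT and A = K]) (auto simp: nt_id_hom simp del: hom_map2_id)
  from 8 show ?case
   using mdf_yoneda2[of "al \<star> bt"] mdf_hcomp[OF mdf_yoneda2[of al], of "rep K (src K (dm K bt))" "yoneda1 (dm K bt)" "yoneda1 (cd K bt)" "yoneda2 bt"]
    mdf_yoneda2[of bt] e[of "dm K al" "dm K bt"] e[of "cd K al" "cd K bt"]
   by (intro mdf_eqI[where F = "rep K (trg K (dm K al))" and G = "rep K (src K (dm K bt))" and H = CAT and A = K]) auto
 qed
qed

end

lemma sfun_nerve: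
 assumes "two_category A" "two_category H" "pseudofunctor A H F"
 shows "sfun (op2 H) (PS A CAT) (nerve A H F)"
 unfolding nerve_def
 by (rule sfun_psf_comp[OF two_category.sfun_yoneda sfun_precomp]) (use assms in "simp_all add: two_category_CAT")

text \<open>The hom-bifunctor of a 2-category, restricted along two strict functors.\<close>

lemma sfun_hom_bifunctor:
 assumes "sfun P M N" "sfun (op2 Q) M S" "two_category Q"
 shows "sfun (prod2 P Q) CAT (strict (prod2 P Q) CAT (%(x, y). hom M (P0 S y) (P0 N x))
  (%(f, g). hom_map M (P1 S g) (P1 N f)) (%(ph, gm). hom_map2 M (P2 S gm) (P2 N ph)))"
proof -
 interpret N: sfun P M N by fact
 interpret S: sfun "op2 Q" M S by fact
 interpret Q: two_category Q by fact
 note C = two_category_CAT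
 have PQ: "two_category (prod2 P Q)" by (rule two_category_prod2) unfold_locales
 have Sc: "P1 S (g *[Q] f) = P1 S f *[M] P1 S g" if "f : one Q" "g : one Q" "trg Q f = src Q g" for f g
  using S.P1_comp[of g f] that by simp
 have Sh: "P2 S (g **[Q] f) = P2 S f **[M] P2 S g" if "f : two Q" "g : two Q" "trg Q (dm Q f) = src Q (dm Q g)" for f g
  using S.P2_hcomp[of g f] that by simp
 have Si: "P1 S (id1 Q x) = id1 M (P0 S x)" "P2 S (id2 Q f) = id2 M (P1 S f)" if "x : ob Q" "f : one Q" for x f
  using S.P1_id[of x] S.P_simps(8)[of f] that by simp_all
 show ?thesis
 proof (rule sfun_strict[OF PQ C], rule strict_pseudofunctor[OF PQ C], goal_cases)
  case (4 x) then show ?case using S.P1_id[of "snd x"] by auto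
 next
  case (6 x) then show ?case using S.P_simps(8)[of "snd x"] by (auto simp: N.H.nt_id_hom simp del: N.H.hom_map2_id)
 next
  case (7 al bt) then show ?case using S.P_simps(9)[of "snd al" "snd bt"] by auto
 qed (auto simp: Sc Sh category_hom N.H.tcat)
qed

lemma psf_hom_family:
 assumes "psf B H L" shows "psf (prod2 (op2 H) B) CAT (hom_family B H L)"
proof -
 interpret psf B H L by fact
 have PQ: "two_category (prod2 (op2 H) B)" by (rule two_category_prod2[OF two_category_op2]) unfold_locales
 interpret C: two_category "CAT :: (('f, 't) cat, ('f, 't, 'f, 't) ftor, ('f, 't, 'f, 't) ntrans) two_cat" for x :: "'f \<times> 't"
  by (rule two_category_CAT)
 have i: "iso2 CAT (hom_map2 H ph gm)" if "iso2 H ph" "iso2 H gm" for ph gm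
  by (rule two_category.iso2I[OF two_category_CAT, of _ "hom_map2 H (inv2 H ph) (inv2 H gm)"]) (use that in auto)
 show ?thesis unfolding psf_def
 proof (intro conjI PQ two_category_CAT, unfold_locales, goal_cases)
  case (13 al bt) then show ?case by (auto simp: hom_family_def Pc_natural)
 next
  case (14 f g h) then show ?case by (auto simp: hom_family_def Pc_assoc simp: H.nt_id_hom simp del: H.hom_map2_id)
 next
  case (15 f) then show ?case by (auto simp: hom_family_def Pu_right simp: H.nt_id_hom simp del: H.hom_map2_id)
 next
  case (16 f) then show ?case by (auto simp: hom_family_def Pu_left simp: H.nt_id_hom simp del: H.hom_map2_id)
 next
  case (9 f) then show ?case by (auto simp: hom_family_def simp: H.nt_id_hom simp del: H.hom_map2_id)
 qed (auto simp: hom_family_def i category_hom H.tcat)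
qed

section \<open>Equivalences between hom-categories\<close>

lemma iso2_CAT [simp]: "iso2 CAT ta \<longleftrightarrow> nat_iso ta"
 unfolding iso2_def nat_iso_def by auto

context two_category
begin

lemma iso2_conj:
 assumes "a \<cdot> s = t \<cdot> b" "iso2 K s" "iso2 K t" "a : two K" "b : two K" "cd K s = dm K a" "cd K b = dm K t"
 shows "b \<cdot> inv2 K s = inv2 K t \<cdot> a"
proof -
 have d: "dm K b = dm K s" "cd K t = cd K a"
  using arg_cong[OF assms(1), of "dm K"] arg_cong[OF assms(1), of "cd K"] assms(2-) by simp_all
 have "inv2 K t \<cdot> ((a \<cdot> s) \<cdot> inv2 K s) = inv2 K t \<cdot> ((t \<cdot> b) \<cdot> inv2 K s)" by (simp only: assms(1))
 moreover have "inv2 K t \<cdot> ((a \<cdot> s) \<cdot> inv2 K s) = inv2 K t \<cdot> a" using assms(2-) d by simp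
 moreover have "inv2 K t \<cdot> ((t \<cdot> b) \<cdot> inv2 K s) = b \<cdot> inv2 K s" using assms(2-) d by simp
 ultimately show ?thesis by simp
qed

lemma nat_iso_homI:
 assumes n: "nt_in ta F G" and t: "F_trg F = hom K x y"
  and i: "!!u. u : Ob (F_src F) ==> iso2 K (T_at ta u)"
 shows "nat_iso ta"
proof -
 note D = nt_inD[OF n]
 let ?C = "F_src F"
 have f: "ftor_in F ?C (hom K x y)" "ftor_in G ?C (hom K x y)"
  using D(4-7) t by (auto simp: ftor_in_def)
 note FD = ftor_inD(6-9)[OF f(1)] ftor_inD(6-9)[OF f(2)]
 interpret C: category ?C by (rule ftor_inD(4)[OF f(1)])
 note at = D(8-11)[unfolded t, simplified]
 define sg where "sg = \<lparr>T_src = G, T_trg = F, T_at = (\<lambda>u\<in>Ob ?C. inv2 K (T_at ta u))\<rparr>"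
 have s: "nt_in sg G F"
 proof (rule nt_inI[OF f(2,1)], goal_cases)
  case (7 u)
  have "F_ar F u \<cdot> inv2 K (T_at ta (Dom ?C u)) = inv2 K (T_at ta (Cod ?C u)) \<cdot> F_ar G u"
   by (rule iso2_conj[OF at(4)]) (use 7 in "simp_all add: i at FD[simplified]")
  then show ?case using 7 by (simp add: sg_def)
 qed (simp_all add: sg_def i at FD[simplified])
 have "nt_vcomp sg ta = nt_id F"
  by (rule nt_in_eqI[OF nt_in_vcomp[OF n s] nt_in_id[OF f(1)]]) (simp add: sg_def D t i at)
 moreover have "nt_vcomp ta sg = nt_id G"
  by (rule nt_in_eqI[OF nt_in_vcomp[OF s n] nt_in_id[OF f(2)]]) (simp add: sg_def D t i at)
 ultimately show ?thesis unfolding nat_iso_def using D(1-3) nt_inD(1-3)[OF s] by auto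
qed

lemma nat_iso_homD:
 assumes "nat_iso ta" "F_trg (T_src ta) = hom K x y" "u : Ob (F_src (T_src ta))"
 shows "iso2 K (T_at ta u)"
proof -
 obtain sg where s: "nat_transformation ta" "nat_transformation sg" "T_src sg = T_trg ta" "T_trg sg = T_src ta"
  and e: "nt_vcomp sg ta = nt_id (T_src ta)" "nt_vcomp ta sg = nt_id (T_trg ta)"
  using assms(1) unfolding nat_iso_def by blast
 have n: "nt_in ta (T_src ta) (T_trg ta)" "nt_in sg (T_trg ta) (T_src ta)" using s by (auto simp: nt_in_def)
 note D = nt_inD(6-10)[OF n(1)] nt_inD(8-10)[OF n(2)]
 have "Cmp (hom K x y) (T_at sg u) (T_at ta u) = Idt (hom K x y) (F_ob (T_src ta) u)"
  using arg_cong[OF e(1), of "%z. T_at z u"] assms(2,3) by simp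
 moreover have "Cmp (hom K x y) (T_at ta u) (T_at sg u) = Idt (hom K x y) (F_ob (T_trg ta) u)"
  using arg_cong[OF e(2), of "%z. T_at z u"] assms(2,3) s(3) D(1,2) by simp
 ultimately show ?thesis
  using D(3-8)[of u, unfolded D(1,2) assms(2), simplified] assms(3) by (intro iso2I[of _ "T_at sg u"]) simp_all
qed

end

definition hom_equiv where
 "hom_equiv K x y L z w F \<longleftrightarrow> ftor_in F (hom K x y) (hom L z w)
  & (ALL u v bt. u : Ob (hom K x y) --> v : Ob (hom K x y) --> bt : two L --> dm L bt = F_ob F u --> cd L bt = F_ob F v -->
    (EX! al. al : two K & dm K al = u & cd K al = v & F_ar F al = bt))
  & (ALL c : Ob (hom L z w). EX u bt. u : Ob (hom K x y) & iso2 L bt & dm L bt = F_ob F u & cd L bt = c)"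

lemma hom_equivD:
 assumes "hom_equiv K x y L z w F"
 shows "ftor_in F (hom K x y) (hom L z w)"
  "[|u : Ob (hom K x y); v : Ob (hom K x y); bt : two L; dm L bt = F_ob F u; cd L bt = F_ob F v|] ==>
    EX! al. al : two K & dm K al = u & cd K al = v & F_ar F al = bt"
  "c : Ob (hom L z w) ==> EX u bt. u : Ob (hom K x y) & iso2 L bt & dm L bt = F_ob F u & cd L bt = c"
 using assms unfolding hom_equiv_def by blast+

text \<open>The inverse functor is built from chosen preimages of objects; fullness and faithfulness define it on
 arrows.\<close>

lemma equivalence_if_hom_equiv:
 assumes K: "two_category K" and L: "two_category L" and e: "hom_equiv K x y L z w F"
 shows "equivalence_of_categories F"
proof -
 interpret K: two_category K by fact
 interpret L: two_category L by fact
 let ?C = "hom K x y" and ?D = "hom L z w"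
 note e1 = hom_equivD(1)[OF e] and e2 = hom_equivD(2)[OF e] and e3 = hom_equivD(3)[OF e]
 note F = ftor_inD(2,3,6-11)[OF e1]
 obtain U bt where UB: "!!c. c : Ob ?D ==> U c : Ob ?C & iso2 L (bt c) & dm L (bt c) = F_ob F (U c) & cd L (bt c) = c"
  using e3 by metis
 define lift where "lift u v x = (THE al. al : two K & dm K al = u & cd K al = v & F_ar F al = x)" for u v x
 have lift: "lift u v x : two K & dm K (lift u v x) = u & cd K (lift u v x) = v & F_ar F (lift u v x) = x"
  if "u : Ob ?C" "v : Ob ?C" "x : two L" "dm L x = F_ob F u" "cd L x = F_ob F v" for u v x
  unfolding lift_def by (rule theI') (rule e2[OF that])
 have faith: "al = al'" if "al : Ar ?C" "al' : Ar ?C" "dm K al = dm K al'" "cd K al = cd K al'" "F_ar F al = F_ar F al'" for al al'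
  using e2[of "dm K al" "cd K al" "F_ar F al"] that F(4-6)[of al] F(4-6)[of al'] by auto
 have U [simp]: "U c : one K" "src K (U c) = x" "trg K (U c) = y" if "c : Ob ?D" for c using UB[OF that] by auto
 have B [simp]: "iso2 L (bt c)" "bt c : two L" "dm L (bt c) = F_ob F (U c)" "cd L (bt c) = c" if "c : Ob ?D" for c
  using UB[OF that] by auto
 have FO [simp]: "F_ob F u : one L" "src L (F_ob F u) = z" "trg L (F_ob F u) = w"
  if "u : one K" "src K u = x" "trg K u = y" for u using F(3)[of u] that by auto
 have FA [simp]: "F_ar F a : two L" "dm L (F_ar F a) = F_ob F (dm K a)" "cd L (F_ar F a) = F_ob F (cd K a)"
  if "a : two K" "src K (dm K a) = x" "trg K (dm K a) = y" for a using F(4-6)[of a] that by auto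
 have FI [simp]: "F_ar F (id2 K u) = id2 L (F_ob F u)" if "u : one K" "src K u = x" "trg K u = y" for u
  using F(7)[of u] that by auto
 have FC [simp]: "F_ar F (b .[K] a) = F_ar F b .[L] F_ar F a"
  if "a : two K" "b : two K" "src K (dm K a) = x" "trg K (dm K a) = y" "cd K a = dm K b" for a b
  using F(8)[of a b] that K.two_simps(3,4)[of a] by auto
 define ga where "ga a = lift (U (dm L a)) (U (cd L a)) (inv2 L (bt (cd L a)) .[L] (a .[L] bt (dm L a)))" for a
 have ga [simp]: "ga a : two K" "dm K (ga a) = U (dm L a)" "cd K (ga a) = U (cd L a)"
   "F_ar F (ga a) = inv2 L (bt (cd L a)) .[L] (a .[L] bt (dm L a))"
  if "a : two L" "src L (dm L a) = z" "trg L (dm L a) = w" for a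
  using lift[of "U (dm L a)" "U (cd L a)" "inv2 L (bt (cd L a)) .[L] (a .[L] bt (dm L a))"] that
  unfolding ga_def by auto
 define G where "G = \<lparr>F_src = ?D, F_trg = ?C, F_ob = (\<lambda>c\<in>Ob ?D. U c), F_ar = (\<lambda>a\<in>Ar ?D. ga a)\<rparr>"
 have G [simp]: "F_src G = ?D" "F_trg G = ?C" by (auto simp: G_def)
 have Go [simp]: "F_ob G c = U c" if "c : one L" "src L c = z" "trg L c = w" for c
  using that by (auto simp: G_def)
 have Ga [simp]: "F_ar G a = ga a" if "a : two L" "src L (dm L a) = z" "trg L (dm L a) = w" for a
  using that by (auto simp: G_def)
 have Gf: "ftor_in G ?D ?C"
 proof (rule ftor_inI, goal_cases)
  case (11 c)
  then show ?case by (auto intro!: faith)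
 next
  case (12 a b)
  then have "src L (dm L b) = z" "trg L (dm L b) = w" using L.two_simps(3,4)[of a] by auto
  with 12 show ?case by (auto intro!: faith simp del: G)
 qed (auto simp: category_hom K L, auto simp: G_def)
 define et0 where "et0 = \<lparr>T_src = ftor_id ?C, T_trg = ftor_comp G F,
  T_at = (\<lambda>u\<in>Ob ?C. lift u (U (F_ob F u)) (inv2 L (bt (F_ob F u))))\<rparr>"
 have h: "lift u (U (F_ob F u)) (inv2 L (bt (F_ob F u))) : two K"
  "dm K (lift u (U (F_ob F u)) (inv2 L (bt (F_ob F u)))) = u"
  "cd K (lift u (U (F_ob F u)) (inv2 L (bt (F_ob F u)))) = U (F_ob F u)"
  "F_ar F (lift u (U (F_ob F u)) (inv2 L (bt (F_ob F u)))) = inv2 L (bt (F_ob F u))"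
  if "u : one K" "src K u = x" "trg K u = y" for u
  using lift[of u "U (F_ob F u)" "inv2 L (bt (F_ob F u))"] that by auto
 have en: "nt_in et0 (ftor_id ?C) (ftor_comp G F)"
 proof (rule nt_inI[OF ftor_in_id[OF category_hom[OF K]] ftor_in_comp[OF e1 Gf]], goal_cases)
  case (7 u)
  then show ?case by (auto simp: et0_def F h intro!: faith)
 qed (auto simp: et0_def h F)
 have ei: "nat_iso et0"
 proof (rule K.nat_iso_homI[OF en])
  fix u assume "u : Ob (F_src (ftor_id ?C))"
  then have u: "u : one K" "src K u = x" "trg K u = y" by auto
  note k = lift[of "U (F_ob F u)" u "bt (F_ob F u)"]
  show "iso2 K (T_at et0 u)"
   by (rule K.iso2I[of _ "lift (U (F_ob F u)) u (bt (F_ob F u))"])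
    (use u k in "auto simp: et0_def h intro!: faith")
 qed simp
 define ee where "ee = \<lparr>T_src = ftor_comp F G, T_trg = ftor_id ?D, T_at = (\<lambda>c\<in>Ob ?D. bt c)\<rparr>"
 have pn: "nt_in ee (ftor_comp F G) (ftor_id ?D)"
  by (rule nt_inI[OF ftor_in_comp[OF Gf e1] ftor_in_id[OF category_hom[OF L]]]) (auto simp: ee_def)
 have "nat_iso ee" by (rule L.nat_iso_homI[OF pn]) (auto simp: F ee_def)
 moreover have "T_src et0 = ftor_id (F_src F)" "T_trg et0 = ftor_comp G F" by (simp_all add: et0_def F)
 moreover have "T_src ee = ftor_comp F G" "T_trg ee = ftor_id (F_trg F)" by (simp_all add: ee_def F)
 ultimately show ?thesis unfolding equivalence_of_categories_def
  using ei ftor_inD(1)[OF e1] ftor_inD(1)[OF Gf] F(1,2) G(1,2)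
  by (intro conjI exI[of _ G] exI[of _ et0] exI[of _ ee]) simp_all
qed

text \<open>A functor isomorphic to the identity is faithful; this gives faithfulness of both functors, and fullness
 follows by comparing with the quasi-inverse.\<close>

lemma hom_equiv_if_equivalence:
 assumes K: "two_category K" and L: "two_category L" and f: "ftor_in F (hom K x y) (hom L z w)"
  and e: "equivalence_of_categories F"
 shows "hom_equiv K x y L z w F"
proof -
 interpret K: two_category K by fact
 interpret L: two_category L by fact
 let ?C = "hom K x y" and ?D = "hom L z w"
 note F = ftor_inD(2,3,6-11)[OF f]
 obtain G et0 ee where g: "cat_functor G" "F_src G = F_trg F" "F_trg G = F_src F"
  and h: "nat_iso et0" "T_src et0 = ftor_id (F_src F)" "T_trg et0 = ftor_comp G F"
  and p: "nat_iso ee" "T_src ee = ftor_comp F G" "T_trg ee = ftor_id (F_trg F)"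
  using e unfolding equivalence_of_categories_def by blast
 have Gf: "ftor_in G ?D ?C" using g F by (simp add: ftor_in_def)
 note G = ftor_inD(2,3,6-11)[OF Gf]
 have hn: "nt_in et0 (ftor_id ?C) (ftor_comp G F)" and pn: "nt_in ee (ftor_comp F G) (ftor_id ?D)"
  using h p F by (auto simp: nt_in_def nat_iso_def)
 note hD = nt_inD(8-11)[OF hn, simplified] and pD = nt_inD(8-11)[OF pn, unfolded ftor_comp_simps F(2) G(1), simplified]
 have hi: "iso2 K (T_at et0 u)" if "u : Ob ?C" for u
  using K.nat_iso_homD[OF h(1), of x y u] that h F by simp
 have pi: "iso2 L (T_at ee u)" if "u : Ob ?D" for u
  using L.nat_iso_homD[OF p(1), of z w u] that p F G by simp
 have FO [simp]: "F_ob F u : one L" "src L (F_ob F u) = z" "trg L (F_ob F u) = w"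
  if "u : one K" "src K u = x" "trg K u = y" for u using F(3)[of u] that by auto
 have FA [simp]: "F_ar F a : two L" "dm L (F_ar F a) = F_ob F (dm K a)" "cd L (F_ar F a) = F_ob F (cd K a)"
  if "a : two K" "src K (dm K a) = x" "trg K (dm K a) = y" for a using F(4-6)[of a] that by auto
 have GO [simp]: "F_ob G u : one K" "src K (F_ob G u) = x" "trg K (F_ob G u) = y"
  if "u : one L" "src L u = z" "trg L u = w" for u using G(3)[of u] that by auto
 have GA [simp]: "F_ar G a : two K" "dm K (F_ar G a) = F_ob G (dm L a)" "cd K (F_ar G a) = F_ob G (cd L a)"
  if "a : two L" "src L (dm L a) = z" "trg L (dm L a) = w" for a using G(4-6)[of a] that by auto
 have E [simp]: "iso2 K (T_at et0 u)" "dm K (T_at et0 u) = u" "cd K (T_at et0 u) = F_ob G (F_ob F u)"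
  if "u : one K" "src K u = x" "trg K u = y" for u using hi[of u] hD(1-3)[of u] that F(1) by simp_all
 have P [simp]: "iso2 L (T_at ee u)" "dm L (T_at ee u) = F_ob F (F_ob G u)" "cd L (T_at ee u) = u"
  if "u : one L" "src L u = z" "trg L u = w" for u using pi[of u] pD(1-3)[of u] that G(1) by simp_all
 have En: "F_ar G (F_ar F a) .[K] T_at et0 (dm K a) = T_at et0 (cd K a) .[K] a"
  if "a : two K" "src K (dm K a) = x" "trg K (dm K a) = y" for a using hD(4)[of a] that F(1) by simp
 have Pn: "a .[L] T_at ee (dm L a) = T_at ee (cd L a) .[L] F_ar F (F_ar G a)"
  if "a : two L" "src L (dm L a) = z" "trg L (dm L a) = w" for a using pD(4)[of a] that G(1) by simp
 have Ff: "a = b" if "a : two K" "b : two K" "src K (dm K a) = x" "trg K (dm K a) = y" "dm K b = dm K a"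
  "cd K b = cd K a" "F_ar F a = F_ar F b" for a b
 proof (rule K.iso2_cancel_left[of "T_at et0 (cd K a)"])
  show "T_at et0 (cd K a) .[K] a = T_at et0 (cd K a) .[K] b"
   using En[of a] En[of b] that by simp
 qed (use that in auto)
 have Gff: "a = b" if "a : two L" "b : two L" "src L (dm L a) = z" "trg L (dm L a) = w" "dm L b = dm L a"
  "cd L b = cd L a" "F_ar G a = F_ar G b" for a b
 proof (rule L.iso2_cancel_right[of _ "T_at ee (dm L a)"])
  show "a .[L] T_at ee (dm L a) = b .[L] T_at ee (dm L a)"
   using Pn[of a] Pn[of b] that by simp
 qed (use that in auto)
 show ?thesis unfolding hom_equiv_def
 proof (intro conjI allI impI ballI f, goal_cases)
  case (1 u v bt)
  then have uv: "u : one K" "src K u = x" "trg K u = y" "v : one K" "src K v = x" "trg K v = y" by auto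
  note b = 1(3-5)
  define a where "a = inv2 K (T_at et0 v) .[K] (F_ar G bt .[K] T_at et0 u)"
  have a: "a : two K" "dm K a = u" "cd K a = v" using uv b by (simp_all add: a_def)
  have "F_ar G (F_ar F a) .[K] T_at et0 u = F_ar G bt .[K] T_at et0 u"
   using En[of a] a uv b by (simp add: a_def)
  then have "F_ar G (F_ar F a) = F_ar G bt"
   by (rule K.iso2_cancel_right) (use a uv b in auto)
  then have "F_ar F a = bt" using a uv b by (intro Gff) auto
  then show ?case using a uv by (intro ex1I[of _ a]) (auto intro!: Ff)
 next
  case (2 c)
  then show ?case by (intro exI[of _ "F_ob G c"] exI[of _ "T_at ee c"]) auto
 qed
qed

lemma hom_equiv_iff:
 assumes "two_category K" "two_category L" "ftor_in F (hom K x y) (hom L z w)"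
 shows "equivalence_of_categories F \<longleftrightarrow> hom_equiv K x y L z w F"
 using hom_equiv_if_equivalence[OF assms] equivalence_if_hom_equiv[OF assms(1,2)] by blast

section \<open>Pseudonatural transformations between category-valued pseudofunctors, elementwise\<close>

locale cpn = S: two_category S + F: psf S CAT F + G: psf S CAT G
 for S :: "('s, 'p, 'q) two_cat"
  and F :: "('s, 'p, 'q, ('o, 'm) cat, ('o, 'm, 'o, 'm) ftor, ('o, 'm, 'o, 'm) ntrans) psfun"
  and G :: "('s, 'p, 'q, ('o2, 'm2) cat, ('o2, 'm2, 'o2, 'm2) ftor, ('o2, 'm2, 'o2, 'm2) ntrans) psfun" +
 fixes th :: "('s, 'p, 'o, 'm, 'o2, 'm2) cat_pstrans"
 assumes C1_in: "x : ob S ==> ftor_in (C1 th x) (P0 F x) (P0 G x)"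
  and C2_in: "f : one S ==> nt_in (C2 th f) (ftor_comp (P1 G f) (C1 th (src S f)))
   (ftor_comp (C1 th (trg S f)) (P1 F f))"
begin

lemma FG_in:
 assumes "f : one S"
 shows "ftor_in (P1 F f) (P0 F (src S f)) (P0 F (trg S f))"
  "ftor_in (P1 G f) (P0 G (src S f)) (P0 G (trg S f))"
 using F.P_simps(2-4)[OF assms] G.P_simps(2-4)[OF assms] by (auto simp: ftor_in_def)

lemma FG2_in:
 assumes "ch : two S"
 shows "nt_in (P2 F ch) (P1 F (dm S ch)) (P1 F (cd S ch))" "nt_in (P2 G ch) (P1 G (dm S ch)) (P1 G (cd S ch))"
 using F.P_simps(5-7)[OF assms] G.P_simps(5-7)[OF assms] by (auto simp: nt_in_def)

lemma FGc_in:
 assumes "f : one S" "g : one S" "trg S f = src S g"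
 shows "nt_in (Pc F g f) (ftor_comp (P1 F g) (P1 F f)) (P1 F (g *[S] f))"
  "nt_in (Pc G g f) (ftor_comp (P1 G g) (P1 G f)) (P1 G (g *[S] f))"
 using F.Pc_simps(2-4)[OF assms] G.Pc_simps(2-4)[OF assms] by (auto simp: nt_in_def)

lemma FGu_in:
 assumes "x : ob S"
 shows "nt_in (Pu F x) (ftor_id (P0 F x)) (P1 F (id1 S x))" "nt_in (Pu G x) (ftor_id (P0 G x)) (P1 G (id1 S x))"
 using F.Pu_simps(2-4)[OF assms] G.Pu_simps(2-4)[OF assms] by (auto simp: nt_in_def)

lemma cat_F: "x : ob S ==> category (P0 F x)" and cat_G: "x : ob S ==> category (P0 G x)"
 using F.P_simps(1) G.P_simps(1) by auto

lemma natural_iff: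
 assumes "ch : two S" and x: "src S (dm S ch) = x" and y: "trg S (dm S ch) = y"
 shows "nt_vcomp (C2 th (cd S ch)) (nt_hcomp (P2 G ch) (nt_id (C1 th x)))
   = nt_vcomp (nt_hcomp (nt_id (C1 th y)) (P2 F ch)) (C2 th (dm S ch)) \<longleftrightarrow>
  (ALL u:Ob (P0 F x). Cmp (P0 G y) (T_at (C2 th (cd S ch)) u) (T_at (P2 G ch) (F_ob (C1 th x) u))
   = Cmp (P0 G y) (F_ar (C1 th y) (T_at (P2 F ch) u)) (T_at (C2 th (dm S ch)) u))"
  (is "?l = ?r \<longleftrightarrow> _")
proof -
 have xy: "x : ob S" "y : ob S" "src S (cd S ch) = x" "trg S (cd S ch) = y" using assms by auto
 interpret Gy: category "P0 G y" by (rule cat_G[OF xy(2)])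
 interpret Gx: category "P0 G x" by (rule cat_G[OF xy(1)])
 have d: "dm S ch : one S" "cd S ch : one S" using assms(1) by auto
 note f = FG_in[OF d(1), unfolded x y] FG_in[OF d(2), unfolded xy]
  C1_in[OF xy(1)] C1_in[OF xy(2)]
 note n = FG2_in[OF assms(1)] C2_in[OF d(1), unfolded x y] C2_in[OF d(2), unfolded xy]
 have l: "nt_in ?l (ftor_comp (P1 G (dm S ch)) (C1 th x)) (ftor_comp (C1 th y) (P1 F (cd S ch)))"
  by (rule nt_in_vcomp[OF nt_in_hcomp[OF nt_in_id[OF f(5)] f(5) n(2) f(2)] n(4)])
 have r: "nt_in ?r (ftor_comp (P1 G (dm S ch)) (C1 th x)) (ftor_comp (C1 th y) (P1 F (cd S ch)))"
  by (rule nt_in_vcomp[OF n(3) nt_in_hcomp[OF n(1) f(1) nt_in_id[OF f(6)] f(6)]])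
 note fd = ftor_inD(2,3,6-10)[OF f(1)] ftor_inD(2,3,6-10)[OF f(2)] ftor_inD(2,3,6-10)[OF f(3)] ftor_inD(2,3,6-10)[OF f(4)]
  ftor_inD(2,3,6-10)[OF f(5)] ftor_inD(2,3,6-10)[OF f(6)]
 note nd = nt_inD(2,3,8-10)[OF n(1), unfolded fd(1,2)] nt_inD(2,3,8-10)[OF n(2), unfolded fd(8,9)]
  nt_inD(2,3)[OF n(3)] nt_inD(2,3)[OF n(4)]
 have "T_at ?l u = Cmp (P0 G y) (T_at (C2 th (cd S ch)) u) (T_at (P2 G ch) (F_ob (C1 th x) u))" if "u : Ob (P0 F x)" for u
  using that by (simp add: fd nd)
 moreover have "T_at ?r u = Cmp (P0 G y) (F_ar (C1 th y) (T_at (P2 F ch) u)) (T_at (C2 th (dm S ch)) u)" if "u : Ob (P0 F x)" for u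
  using that by (simp add: fd nd)
 moreover have "?l = ?r \<longleftrightarrow> (ALL u:Ob (P0 F x). T_at ?l u = T_at ?r u)"
  using nt_in_eqI[OF l r, unfolded ftor_comp_simps fd] by metis
 ultimately show ?thesis by simp
qed

lemma comp_iff:
 assumes "f : one S" "g : one S" "trg S f = src S g" and x: "src S f = x" and y: "src S g = y" and z: "trg S g = z"
 shows "nt_vcomp (C2 th (g *[S] f)) (nt_hcomp (Pc G g f) (nt_id (C1 th x)))
   = nt_vcomp (nt_hcomp (nt_id (C1 th z)) (Pc F g f))
     (nt_vcomp (nt_hcomp (C2 th g) (nt_id (P1 F f))) (nt_hcomp (nt_id (P1 G g)) (C2 th f))) \<longleftrightarrow>
  (ALL u:Ob (P0 F x). Cmp (P0 G z) (T_at (C2 th (g *[S] f)) u) (T_at (Pc G g f) (F_ob (C1 th x) u))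
   = Cmp (P0 G z) (F_ar (C1 th z) (T_at (Pc F g f) u))
     (Cmp (P0 G z) (T_at (C2 th g) (F_ob (P1 F f) u)) (F_ar (P1 G g) (T_at (C2 th f) u))))"
  (is "?l = ?r \<longleftrightarrow> _")
proof -
 have xy: "x : ob S" "y : ob S" "z : ob S" "trg S f = y" using assms by auto
 have gf: "g *[S] f : one S" "src S (g *[S] f) = x" "trg S (g *[S] f) = z" using assms by auto
 interpret Gx: category "P0 G x" by (rule cat_G[OF xy(1)])
 interpret Gz: category "P0 G z" by (rule cat_G[OF xy(3)])
 interpret Gy: category "P0 G y" by (rule cat_G[OF xy(2)])
 interpret Fy: category "P0 F y" by (rule cat_F[OF xy(2)])
 note f = FG_in[OF assms(1), unfolded x xy(4)] FG_in[OF assms(2), unfolded y z]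
  C1_in[OF xy(1)] C1_in[OF xy(2)] C1_in[OF xy(3)] FG_in[OF gf(1), unfolded gf(2,3)]
 note n = FGc_in[OF assms(1-3)] C2_in[OF assms(1), unfolded x xy(4)] C2_in[OF assms(2), unfolded y z]
   C2_in[OF gf(1), unfolded gf(2,3)]
 note a = ftor_comp_assoc[OF f(5,2,4)] ftor_comp_assoc[OF f(1,6,4)] ftor_comp_assoc[OF f(1,3,7)]
 have l: "nt_in ?l (ftor_comp (P1 G g) (ftor_comp (P1 G f) (C1 th x))) (ftor_comp (C1 th z) (P1 F (g *[S] f)))"
  unfolding a(1)[symmetric] by (rule nt_in_vcomp[OF nt_in_hcomp[OF nt_in_id[OF f(5)] f(5) n(2) ftor_in_comp[OF f(2,4)]] n(5)])
 have r: "nt_in ?r (ftor_comp (P1 G g) (ftor_comp (P1 G f) (C1 th x))) (ftor_comp (C1 th z) (P1 F (g *[S] f)))"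
  by (rule nt_in_vcomp[OF nt_in_vcomp[OF nt_in_hcomp[OF n(3) ftor_in_comp[OF f(5,2)] nt_in_id[OF f(4)] f(4), folded a(2)]
    nt_in_hcomp[OF nt_in_id[OF f(1)] f(1) n(4) ftor_in_comp[OF f(6,4)], unfolded a(3)]]
    nt_in_hcomp[OF n(1) ftor_in_comp[OF f(1,3)] nt_in_id[OF f(7)] f(7)]])
 note fd = ftor_inD(2,3,6-10)[OF f(1)] ftor_inD(2,3,6-10)[OF f(2)] ftor_inD(2,3,6-10)[OF f(3)] ftor_inD(2,3,6-10)[OF f(4)]
  ftor_inD(2,3,6-10)[OF f(5)] ftor_inD(2,3,6-10)[OF f(6)] ftor_inD(2,3,6-10)[OF f(7)]
  ftor_inD(2,3,6-10)[OF f(8)] ftor_inD(2,3,6-10)[OF f(9)]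
 note nd = nt_inD(2,3,8-10)[OF n(1), unfolded fd ftor_comp_simps] nt_inD(2,3,8-10)[OF n(2), unfolded fd ftor_comp_simps]
  nt_inD(2,3,8-10)[OF n(3), unfolded fd ftor_comp_simps] nt_inD(2,3,8-10)[OF n(4), unfolded fd ftor_comp_simps] nt_inD(2,3)[OF n(5)]
 have "T_at ?l u = Cmp (P0 G z) (T_at (C2 th (g *[S] f)) u) (T_at (Pc G g f) (F_ob (C1 th x) u))" if "u : Ob (P0 F x)" for u
  using that by (simp add: fd nd)
 moreover have "T_at ?r u = Cmp (P0 G z) (F_ar (C1 th z) (T_at (Pc F g f) u))
     (Cmp (P0 G z) (T_at (C2 th g) (F_ob (P1 F f) u)) (F_ar (P1 G g) (T_at (C2 th f) u)))" if "u : Ob (P0 F x)" for u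
  using that by (simp add: fd nd)
 moreover have "?l = ?r \<longleftrightarrow> (ALL u:Ob (P0 F x). T_at ?l u = T_at ?r u)"
  using nt_in_eqI[OF l r, unfolded ftor_comp_simps fd] by metis
 ultimately show ?thesis by simp
qed

lemma id_iff:
 assumes x: "x : ob S"
 shows "nt_vcomp (C2 th (id1 S x)) (nt_hcomp (Pu G x) (nt_id (C1 th x))) = nt_hcomp (nt_id (C1 th x)) (Pu F x) \<longleftrightarrow>
  (ALL u:Ob (P0 F x). Cmp (P0 G x) (T_at (C2 th (id1 S x)) u) (T_at (Pu G x) (F_ob (C1 th x) u))
   = F_ar (C1 th x) (T_at (Pu F x) u))"
  (is "?l = ?r \<longleftrightarrow> _")
proof -
 interpret Gx: category "P0 G x" by (rule cat_G[OF x])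
 have i: "id1 S x : one S" using x by simp
 note f = FG_in[OF i, unfolded S.id1_simps[OF x]] C1_in[OF x] ftor_in_id[OF cat_G[OF x]] ftor_in_id[OF cat_F[OF x]]
 note n = FGu_in[OF x] C2_in[OF i, unfolded S.id1_simps[OF x]]
 note a = ftor_comp_id[OF f(3)]
 have l: "nt_in ?l (C1 th x) (ftor_comp (C1 th x) (P1 F (id1 S x)))"
  by (rule nt_in_vcomp[OF nt_in_hcomp[OF nt_in_id[OF f(3)] f(3) n(2) f(4), unfolded a] n(3)])
 have r: "nt_in ?r (C1 th x) (ftor_comp (C1 th x) (P1 F (id1 S x)))"
  by (rule nt_in_hcomp[OF n(1) f(5) nt_in_id[OF f(3)] f(3), unfolded a])
 note fd = ftor_inD(2,3,6-10)[OF f(1)] ftor_inD(2,3,6-10)[OF f(2)] ftor_inD(2,3,6-10)[OF f(3)]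
 note nd = nt_inD(2,3,8-10)[OF n(1), unfolded fd ftor_id_simps ftor_comp_simps] nt_inD(2,3,8-10)[OF n(2), unfolded fd ftor_id_simps ftor_comp_simps] nt_inD(2,3)[OF n(3)]
 have "T_at ?l u = Cmp (P0 G x) (T_at (C2 th (id1 S x)) u) (T_at (Pu G x) (F_ob (C1 th x) u))" if "u : Ob (P0 F x)" for u
  using that by (simp add: fd nd)
 moreover have "T_at ?r u = F_ar (C1 th x) (T_at (Pu F x) u)" if "u : Ob (P0 F x)" for u
  using that by (simp add: fd nd)
 moreover have "?l = ?r \<longleftrightarrow> (ALL u:Ob (P0 F x). T_at ?l u = T_at ?r u)"
  using nt_in_eqI[OF l r, unfolded ftor_comp_simps fd] by metis
 ultimately show ?thesis by simp
qed

lemma cat_pseudonaturalI: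
 assumes "!!f. f : one S ==> nat_iso (C2 th f)"
  and "!!ch u. [|ch : two S; u : Ob (P0 F (src S (dm S ch)))|] ==>
   Cmp (P0 G (trg S (dm S ch))) (T_at (C2 th (cd S ch)) u) (T_at (P2 G ch) (F_ob (C1 th (src S (dm S ch))) u))
   = Cmp (P0 G (trg S (dm S ch))) (F_ar (C1 th (trg S (dm S ch))) (T_at (P2 F ch) u)) (T_at (C2 th (dm S ch)) u)"
  and "!!f g u. [|f : one S; g : one S; trg S f = src S g; u : Ob (P0 F (src S f))|] ==>
   Cmp (P0 G (trg S g)) (T_at (C2 th (g *[S] f)) u) (T_at (Pc G g f) (F_ob (C1 th (src S f)) u))
   = Cmp (P0 G (trg S g)) (F_ar (C1 th (trg S g)) (T_at (Pc F g f) u))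
     (Cmp (P0 G (trg S g)) (T_at (C2 th g) (F_ob (P1 F f) u)) (F_ar (P1 G g) (T_at (C2 th f) u)))"
  and "!!x u. [|x : ob S; u : Ob (P0 F x)|] ==>
   Cmp (P0 G x) (T_at (C2 th (id1 S x)) u) (T_at (Pu G x) (F_ob (C1 th x) u)) = F_ar (C1 th x) (T_at (Pu F x) u)"
 shows "cat_pseudonatural S F G th"
proof (unfold_locales, goal_cases)
 case (1 x)
 then show ?case using C1_in[of x] by (simp add: ftor_in_def)
next
 case (2 f)
 then show ?case using C2_in[of f] assms(1)[of f] by (simp add: nt_in_def)
next
 case (3 ch)
 then show ?case using natural_iff[OF 3 refl refl] assms(2)[OF 3] by simp
next
 case (4 f g)
 then show ?case using comp_iff[OF 4 refl refl refl] assms(3)[OF 4] by simp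
next
 case (5 x)
 then show ?case using id_iff[OF 5] assms(4)[OF 5] by simp
qed

end

lemma cpnI:
 assumes "two_category S" "psf S CAT F" "psf S CAT G"
  "!!x. x : ob S ==> ftor_in (C1 th x) (P0 F x) (P0 G x)"
  "!!f. f : one S ==> nt_in (C2 th f) (ftor_comp (P1 G f) (C1 th (src S f))) (ftor_comp (C1 th (trg S f)) (P1 F f))"
 shows "cpn S F G th"
 using assms by (simp add: cpn_def cpn_axioms_def)

locale cpn_full = cpn S F G th + cat_pseudonatural S F G th for S F G th
begin

lemma natural:
 assumes "ch : two S" "src S (dm S ch) = x" "trg S (dm S ch) = y" "u : Ob (P0 F x)"
 shows "Cmp (P0 G y) (T_at (C2 th (cd S ch)) u) (T_at (P2 G ch) (F_ob (C1 th x) u))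
   = Cmp (P0 G y) (F_ar (C1 th y) (T_at (P2 F ch) u)) (T_at (C2 th (dm S ch)) u)"
 using natural_iff[OF assms(1-3)] C2_natural[OF assms(1)] assms by simp

lemma comp:
 assumes "f : one S" "g : one S" "trg S f = src S g" "src S f = x" "trg S g = z" "u : Ob (P0 F x)"
 shows "Cmp (P0 G z) (T_at (C2 th (g *[S] f)) u) (T_at (Pc G g f) (F_ob (C1 th x) u))
   = Cmp (P0 G z) (F_ar (C1 th z) (T_at (Pc F g f) u))
     (Cmp (P0 G z) (T_at (C2 th g) (F_ob (P1 F f) u)) (F_ar (P1 G g) (T_at (C2 th f) u)))"
 using comp_iff[OF assms(1-4) refl assms(5)] C2_comp[OF assms(1-3)] assms by simp

lemma unit:
 assumes "x : ob S" "u : Ob (P0 F x)"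
 shows "Cmp (P0 G x) (T_at (C2 th (id1 S x)) u) (T_at (Pu G x) (F_ob (C1 th x) u)) = F_ar (C1 th x) (T_at (Pu F x) u)"
 using id_iff[OF assms(1)] C2_id[OF assms(1)] assms by simp

end

lemma cpn_fullI:
 assumes "two_category S" "cat_pseudonatural S F G th"
 shows "cpn_full S F G th"
proof -
 interpret cat_pseudonatural S F G th by fact
 have "psf S CAT F" "psf S CAT G" using C_src C_trg assms(1) two_category_CAT by (auto simp: psf_def)
 then have "cpn S F G th" using C1 C2 assms(1)
  by (intro cpnI) (auto simp: ftor_in_def nt_in_def nat_iso_def)
 then show ?thesis using assms(2) by (simp add: cpn_full_def)
qed

section \<open>The comparison functor of a pseudo-Kan extension and uniqueness\<close>

lemma hom_equiv_reflects_iso: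
 assumes K: "two_category K" and L: "two_category L" and e: "hom_equiv K x y L z w F"
  and a: "al : two K" "src K (dm K al) = x" "trg K (dm K al) = y" and i: "iso2 L (F_ar F al)"
 shows "iso2 K al"
proof -
 interpret K: two_category K by fact
 interpret L: two_category L by fact
 note F = ftor_inD[OF hom_equivD(1)[OF e]]
 have o: "dm K al : Ob (hom K x y)" "cd K al : Ob (hom K x y)" using a by auto
 have fa: "dm L (F_ar F al) = F_ob F (dm K al)" "cd L (F_ar F al) = F_ob F (cd K al)"
  using F(8)[of al] F(9)[of al] a by auto
 obtain bt where b: "bt : two K" "dm K bt = cd K al" "cd K bt = dm K al" "F_ar F bt = inv2 L (F_ar F al)"
  using hom_equivD(2)[OF e o(2,1), of "inv2 L (F_ar F al)"] i fa by auto
 have u: "gm = id2 K v" if "gm : two K" "dm K gm = v" "cd K gm = v" "v : Ob (hom K x y)" "F_ar F gm = id2 L (F_ob F v)" for gm v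
 proof -
  have "F_ar F (id2 K v) = id2 L (F_ob F v)" using F(10)[of v] that(4) by simp
  then show ?thesis
   using hom_equivD(2)[OF e that(4) that(4), of "id2 L (F_ob F v)"] F(6)[of v] that K.id2_simps[of v] by auto
 qed
 have c: "F_ar F (bt .[K] al) = F_ar F bt .[L] F_ar F al" "F_ar F (al .[K] bt) = F_ar F al .[L] F_ar F bt"
  using F(11)[of al bt] F(11)[of bt al] a b by simp_all
 show ?thesis
 proof (rule K.iso2I[of _ bt])
  show "bt .[K] al = id2 K (dm K al)"
   by (rule u) (use a b c o i fa in simp_all)
  show "al .[K] bt = id2 K (cd K al)"
   by (rule u) (use a b c o i fa in simp_all)
 qed (use a b in auto)
qed

text \<open>For a 2-functor \<open>T : M \<rightarrow> M'\<close> and a 1-cell \<open>e : T R \<rightarrow> D\<close>, the functors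
  \<open>al \<mapsto> e \<odot> T al\<close> from \<open>M(K,R)\<close> to \<open>M'(T K,D)\<close> are strictly natural in \<open>K\<close>.\<close>

definition post_functor where
 "post_functor M M' T e D R K = \<lparr>F_src = hom M K R, F_trg = hom M' (P0 T K) D,
   F_ob = (\<lambda>al\<in>Ob (hom M K R). e *[M'] P1 T al), F_ar = (\<lambda>m\<in>Ar (hom M K R). id2 M' e **[M'] P2 T m)\<rparr>"

locale post = T: sfun M M' T for M M' T +
 fixes e D R
 assumes R [simp]: "R : ob M" and e [simp]: "e : one M'" "src M' e = P0 T R" "trg M' e = D"
begin

lemma D [simp]: "D : ob M'" using T.H.one_simps(2)[OF e(1)] by simp

lemma post_simps [simp]:
 "[|al : one M; src M al = K; trg M al = R|] ==> F_ob (post_functor M M' T e D R K) al = e *[M'] P1 T al"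
 "[|m : two M; src M (dm M m) = K; trg M (dm M m) = R|] ==>
  F_ar (post_functor M M' T e D R K) m = id2 M' e **[M'] P2 T m"
 "F_src (post_functor M M' T e D R K) = hom M K R" "F_trg (post_functor M M' T e D R K) = hom M' (P0 T K) D"
 by (auto simp: post_functor_def)

lemma post_in: "K : ob M ==> ftor_in (post_functor M M' T e D R K) (hom M K R) (hom M' (P0 T K) D)"
 by (rule ftor_inI)
  (auto simp: category_hom T.A.tcat T.H.tcat, auto simp: post_functor_def hom_def)

lemma post_natural:
 assumes "bt : one M"
 shows "ftor_comp (hom_map M' (P1 T bt) (id1 M' D)) (post_functor M M' T e D R (trg M bt))
  = ftor_comp (post_functor M M' T e D R (src M bt)) (hom_map M bt (id1 M R))"
 by (rule ftor_in_eqI[OF ftor_in_comp[OF post_in T.H.ftor_in_hom_map] ftor_in_comp[OF T.A.ftor_in_hom_map post_in]])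
  (use assms in auto)

lemma cat_pseudonatural_post:
 assumes C1: "!!K. K : ob M ==> C1 th K = post_functor M M' T e D R K"
  and C2: "!!bt. bt : one M ==> C2 th bt = nt_id (ftor_comp (C1 th (src M bt)) (P1 (corep M R) bt))"
 shows "cat_pseudonatural (op2 M) (corep M R) (psf_comp (op2 M) CAT (corep M' D) (psf_op T)) th"
proof -
 have O: "two_category (op2 M)" by (rule two_category_op2) unfold_locales
 interpret F: sfun "op2 M" CAT "corep M R" by (rule T.A.sfun_corep) simp
 have G: "psf (op2 M) CAT (psf_comp (op2 M) CAT (corep M' D) (psf_op T))"
  using T.H.sfun_corep[OF D] by (intro psf_psf_comp[OF psf_psf_op[OF T.psf_axioms']]) (simp add: sfun_def)
 have P [simp]: "P0 (psf_op T) = P0 T" "P1 (psf_op T) = P1 T" "P2 (psf_op T) = P2 T" "Pu (psf_op T) = Pu T"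
  "Pc (psf_op T) g f = Pc T f g" for f g by (simp_all add: psf_op_def)
 have C2': "C2 th bt = nt_id (ftor_comp (post_functor M M' T e D R (src M bt)) (hom_map M bt (id1 M R)))"
  if "bt : one M" for bt using that by (simp add: C1 C2)
 have hh: "ftor_in (ftor_comp (post_functor M M' T e D R (src M bt)) (hom_map M bt (id1 M R))) (hom M (trg M bt) R) (hom M' (P0 T (src M bt)) D)"
  if "bt : one M" for bt
  by (rule ftor_in_comp[OF T.A.ftor_in_hom_map post_in]) (use that in auto)
 interpret cpn "op2 M" "corep M R" "psf_comp (op2 M) CAT (corep M' D) (psf_op T)" th
 proof (rule cpnI[OF O F.psf_axioms' G])
  show "ftor_in (C1 th x) (P0 (corep M R) x) (P0 (psf_comp (op2 M) CAT (corep M' D) (psf_op T)) x)" if "x : ob (op2 M)" for x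
   using that post_in[of x] by (simp add: C1)
  show "nt_in (C2 th f) (ftor_comp (P1 (psf_comp (op2 M) CAT (corep M' D) (psf_op T)) f) (C1 th (src (op2 M) f)))
    (ftor_comp (C1 th (trg (op2 M) f)) (P1 (corep M R) f))" if "f : one (op2 M)" for f
   using that nt_in_id[OF hh[of f]] post_natural[of f] by (simp add: C1 C2')
 qed
 show ?thesis
 proof (rule cat_pseudonaturalI, goal_cases)
  case (1 f)
  then have f: "f : one M" by simp
  show ?case unfolding C2'[OF f]
   by (rule T.H.nat_iso_homI[OF nt_in_id[OF hh[OF f]]]) (use f in auto)
 next
  case (2 ch u)
  then show ?case by (simp add: C2' C1)
 next
  case (3 f g u)
  then show ?case by (simp add: C2' C1 T.Pc_id)
 next
  case (4 x u)
  then show ?case by (simp add: C2' C1 T.Pu_id)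
 qed
qed

end

text \<open>Both objects represent the same presheaf, so each comparison 1-cell is obtained by lifting the other
 universal 1-cell, and the composites are isomorphic to identities because both functors reflect
 isomorphisms.\<close>

lemma post_unique:
 assumes p: "post M M' T e D R" and p': "post M M' T e' D R'"
  and q: "!!K. K : ob M ==> hom_equiv M K R M' (P0 T K) D (post_functor M M' T e D R K)"
  and q': "!!K. K : ob M ==> hom_equiv M K R' M' (P0 T K) D (post_functor M M' T e' D R' K)"
 shows "EX sg. equivalence1 M sg & src M sg = R & trg M sg = R'"
proof -
 interpret p: post M M' T e D R by fact
 interpret p': post M M' T e' D R' by fact
 have h: "EX et0. iso2 M et0 & dm M et0 = id1 M Q & cd M et0 = ta *[M] sg"
  if "post M M' T i D Q" "hom_equiv M Q Q M' (P0 T Q) D (post_functor M M' T i D Q Q)"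
   "sg : one M" "ta : one M" "src M sg = Q" "trg M sg = src M ta" "trg M ta = Q"
   "iso2 M' bt" "dm M' bt = j *[M'] P1 T sg" "cd M' bt = i" "iso2 M' bt'" "dm M' bt' = i *[M'] P1 T ta" "cd M' bt' = j"
   "j : one M'" "src M' j = P0 T (src M ta)" for Q i sg ta bt bt' j
 proof -
  interpret q: post M M' T i D Q by (rule that(1))
  let ?x = "inv2 M' (bt .[M'] (bt' **[M'] id2 M' (P1 T sg)))"
  have x: "iso2 M' ?x" "dm M' ?x = i" "cd M' ?x = i *[M'] (P1 T ta *[M'] P1 T sg)"
   using that(3-) p.T.H.two_simps(4)[of bt'] by auto
  have "EX! al. al : two M & dm M al = id1 M Q & cd M al = ta *[M] sg & F_ar (post_functor M M' T i D Q Q) al = ?x"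
   by (rule hom_equivD(2)[OF that(2)]) (use that(3-7) x in auto)
  then obtain al where a: "al : two M" "dm M al = id1 M Q" "cd M al = ta *[M] sg" "F_ar (post_functor M M' T i D Q Q) al = ?x"
   by blast
  have "iso2 M al"
   by (rule hom_equiv_reflects_iso[OF p.T.A.tcat p.T.H.tcat that(2)]) (use a x in auto)
  then show ?thesis using a by blast
 qed
 have "e : Ob (hom M' (P0 T R) D)" "e' : Ob (hom M' (P0 T R') D)" by simp_all
 with hom_equivD(3)[OF q'[OF p.R]] hom_equivD(3)[OF q[OF p'.R]] obtain sg bt ta bt' where
  s0: "sg : Ob (hom M R R')" "iso2 M' bt" "dm M' bt = F_ob (post_functor M M' T e' D R' R) sg" "cd M' bt = e" and
  t0: "ta : Ob (hom M R' R)" "iso2 M' bt'" "dm M' bt' = F_ob (post_functor M M' T e D R R') ta" "cd M' bt' = e'"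
  by blast
 then have s: "sg : one M" "src M sg = R" "trg M sg = R'" "iso2 M' bt" "dm M' bt = e' *[M'] P1 T sg" "cd M' bt = e"
  and t: "ta : one M" "src M ta = R'" "trg M ta = R" "iso2 M' bt'" "dm M' bt' = e *[M'] P1 T ta" "cd M' bt' = e'"
  by simp_all
 obtain et0 where h1: "iso2 M et0" "dm M et0 = id1 M R" "cd M et0 = ta *[M] sg"
  using h[OF p q[of R] s(1) t(1), of bt e' bt'] s t by auto
 obtain et0' where h2: "iso2 M et0'" "dm M et0' = id1 M R'" "cd M et0' = sg *[M] ta"
  using h[OF p' q'[of R'] t(1) s(1), of bt' e bt] s t by auto
 have "equivalence1 M sg" unfolding equivalence1_def
  using s(1-3) t(1-3) h1 p.T.A.iso2_inv2[OF h2(1)] p.T.A.inv2_simps(2,3)[OF h2(1)] h2 by metis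
 then show ?thesis using s by blast
qed

lemma PS_iso2_at:
 assumes A: "two_category A" and H: "two_category H" and i: "iso2 (PS A H) m" and x: "x : ob A"
 shows "iso2 H (M_at m x)"
proof -
 interpret P: two_category "PS A H" by (rule two_category_PS[OF A H])
 interpret H: two_category H by fact
 let ?n = "inv2 (PS A H) m"
 have m: "modification A H m" "modification A H ?n" using P.iso2_in[OF i] P.inv2_simps(1)[OF i] by simp_all
 note d = modification.M_at[OF m(1) x] modification.M_at[OF m(2) x]
 have "M_at (?n .[PS A H] m) x = id2 H (N1 (M_src m) x)" "M_at (m .[PS A H] ?n) x = id2 H (N1 (M_trg m) x)"
  using P.inv2_simps[OF i] x by simp_all
 then show ?thesis using d x P.inv2_simps(2,3)[OF i]
  by (intro H.iso2I[of _ "M_at ?n x"]) simp_all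
qed

lemma pseudonatural_equivalenceI:
 assumes B: "two_category B" and H: "two_category H" and e: "equivalence1 (PS B H) sg"
 shows "pseudonatural_equivalence B H sg"
proof -
 note at = PS_iso2_at[OF B H]
 obtain ta et0 ee where *: "pseudonatural B H sg" "pseudonatural B H ta" "N_src ta = N_trg sg" "N_trg ta = N_src sg"
  "iso2 (PS B H) et0" "M_src et0 = ps_id B H (N_src sg)" "M_trg et0 = ps_comp B H ta sg"
  "iso2 (PS B H) ee" "M_src ee = ps_comp B H sg ta" "M_trg ee = ps_id B H (N_trg sg)"
  using e unfolding equivalence1_def by auto
 have m: "modification B H et0" "modification B H ee"
  using two_category.iso2_in[OF two_category_PS[OF B H]] *(5,8) by auto
 show ?thesis unfolding pseudonatural_equivalence_def
 proof (intro conjI ballI *(1))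
  fix x assume x: "x : ob B"
  note s = pseudonatural.N1[OF *(1) x] and t = pseudonatural.N1[OF *(2) x]
  note dn = modification.M_at[OF m(1) x] modification.M_at[OF m(2) x]
  show "equivalence1 H (N1 sg x)" unfolding equivalence1_def
   using s t *(3,4,6,7,9,10) dn x at[OF *(5) x] at[OF *(8) x]
   by (intro conjI bexI[of _ "N1 ta x"] exI[of _ "M_at et0 x"] exI[of _ "M_at ee x"]) simp_all
 qed
qed

locale psran_data = A: two_category A + B: two_category B + H: two_category H + t: psf A B t +
  R: psf B H R + ee: pst A H "psf_comp A H R t" D ee
 for A :: "('a, 'p, 'q) two_cat" and B :: "('b, 'f, 't) two_cat" and H :: "('h, 'g, 'u) two_cat" (structure)
  and D t R ee
begin

sublocale T: sfun "PS B H" "PS A H" "precomp A B H t"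
 by (rule sfun_precomp) (unfold_locales)

sublocale post "PS B H" "PS A H" "precomp A B H t" ee D R
 by unfold_locales (auto simp: R.pseudofunctor_axioms ee.pseudonatural)

lemma psran_functor_eq:
 assumes "pseudofunctor B H K"
 shows "psran_functor A B H t D R ee K = post_functor (PS B H) (PS A H) (precomp A B H t) ee D R K"
 using assms unfolding psran_functor_def post_functor_def by (auto intro!: restrict_ext)

lemma psran_map_pseudonatural:
 "cat_pseudonatural (op2 (PS B H)) (corep (PS B H) R)
  (psf_comp (op2 (PS B H)) CAT (corep (PS A H) D) (psf_op (precomp A B H t))) (psran_map A B H t D R ee)"
proof (rule cat_pseudonatural_post)
 show "C1 (psran_map A B H t D R ee) K = post_functor (PS B H) (PS A H) (precomp A B H t) ee D R K" if "K : ob (PS B H)" for K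
  using that by (simp add: psran_map_def psran_functor_eq)
 show "C2 (psran_map A B H t D R ee) bt = nt_id (ftor_comp (C1 (psran_map A B H t D R ee) (src (PS B H) bt)) (P1 (corep (PS B H) R) bt))" for bt
  by (simp add: psran_map_def)
qed

lemma is_psran_iff:
 "is_psran A B H t D R ee \<longleftrightarrow> (ALL K. pseudofunctor B H K -->
  hom_equiv (PS B H) K R (PS A H) (psf_comp A H K t) D (post_functor (PS B H) (PS A H) (precomp A B H t) ee D R K))"
proof -
 have "equivalence_of_categories (C1 (psran_map A B H t D R ee) K) \<longleftrightarrow>
  hom_equiv (PS B H) K R (PS A H) (psf_comp A H K t) D (post_functor (PS B H) (PS A H) (precomp A B H t) ee D R K)"
  if "pseudofunctor B H K" for K
  using hom_equiv_iff[OF T.A.tcat T.H.tcat post_in[of K]] that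
  by (simp add: psran_map_def psran_functor_eq)
 then show ?thesis
  using psran_map_pseudonatural R.pseudofunctor_axioms ee.pseudonatural
  unfolding is_psran_def cat_pseudonatural_equivalence_def by auto
qed

end

lemma psran_dataI:
 assumes "two_category A" "two_category B" "two_category H" "pseudofunctor A B t" "is_psran A B H t D R ee"
 shows "psran_data A B H D t R ee"
proof -
 have e: "pseudofunctor B H R" "pseudonatural A H ee" "N_src ee = psf_comp A H R t" "N_trg ee = D"
  using assms(5) by (auto simp: is_psran_def)
 have "pst A H (psf_comp A H R t) D ee" using e pst_iff[OF assms(1,3)] by simp
 then show ?thesis using assms e by (simp add: psran_data_def psf_def)
qed

text \<open>Extensions along the same pseudofunctor represent the same presheaf on \<open>[B,H]\<close>.\<close>

lemma psran_unique:
 assumes AB: "two_category A" "two_category B" "two_category H" "pseudofunctor A B t"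
  and r: "is_psran A B H t D R ee" and r': "is_psran A B H t D R' ee'"
 shows "EX sg. pseudonatural_equivalence B H sg & N_src sg = R & N_trg sg = R'"
proof -
 interpret p: psran_data A B H D t R ee by (rule psran_dataI[OF AB r])
 interpret p': psran_data A B H D t R' ee' by (rule psran_dataI[OF AB r'])
 have "EX sg. equivalence1 (PS B H) sg & src (PS B H) sg = R & trg (PS B H) sg = R'"
  by (rule post_unique[OF p.post_axioms p'.post_axioms])
   (use p.is_psran_iff p'.is_psran_iff r r' in auto)
 then show ?thesis using pseudonatural_equivalenceI[OF AB(2,3)] by auto
qed

section \<open>Parametrised representability\<close>

text \<open>\<open>N\<close> and \<open>S\<close> are contravariant 2-functors into \<open>M\<close>.  The presheaves to be represented are
  \<open>X \<mapsto> M(S b, N X)\<close>.\<close>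

locale param = H: two_category H + B: two_category B + M: two_category M +
  N: sfun "op2 H" M N + S: sfun "op2 B" M S
 for H :: "('h, 'f, 't) two_cat" and B :: "('b, 'g, 'u) two_cat" and M :: "('m, 'p, 'q) two_cat" (structure) and N S
begin

lemma N_simps [simp]:
 "X : ob H ==> P0 N X : ob M"
 "f : one H ==> P1 N f : one M" "f : one H ==> src M (P1 N f) = P0 N (trg H f)"
 "f : one H ==> trg M (P1 N f) = P0 N (src H f)"
 "ph : two H ==> P2 N ph : two M" "ph : two H ==> dm M (P2 N ph) = P1 N (dm H ph)"
 "ph : two H ==> cd M (P2 N ph) = P1 N (cd H ph)"
 "X : ob H ==> P1 N (id1 H X) = id1 M (P0 N X)" "f : one H ==> P2 N (id2 H f) = id2 M (P1 N f)"
 "[|f : one H; g : one H; trg H f = src H g|] ==> P1 N (g *[H] f) = P1 N f \<odot> P1 N g"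
 "[|al : two H; bt : two H; cd H al = dm H bt|] ==> P2 N (bt .[H] al) = P2 N bt \<cdot> P2 N al"
 "[|al : two H; bt : two H; trg H (dm H al) = src H (dm H bt)|] ==> P2 N (bt **[H] al) = P2 N al \<star> P2 N bt"
 using N.P_simps(1)[of X] N.P_simps(2-4)[of f] N.P_simps(5-7)[of ph] N.P1_id[of X] N.P_simps(8)[of f] N.P1_comp[of g f]
  N.P_simps(9)[of al bt] N.P2_hcomp[of bt al] by simp_all

lemma S_simps [simp]:
 "x : ob B ==> P0 S x : ob M"
 "f : one B ==> P1 S f : one M" "f : one B ==> src M (P1 S f) = P0 S (trg B f)"
 "f : one B ==> trg M (P1 S f) = P0 S (src B f)"
 "ph : two B ==> P2 S ph : two M" "ph : two B ==> dm M (P2 S ph) = P1 S (dm B ph)"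
 "ph : two B ==> cd M (P2 S ph) = P1 S (cd B ph)"
 "x : ob B ==> P1 S (id1 B x) = id1 M (P0 S x)" "f : one B ==> P2 S (id2 B f) = id2 M (P1 S f)"
 "[|f : one B; g : one B; trg B f = src B g|] ==> P1 S (g *[B] f) = P1 S f \<odot> P1 S g"
 "[|al : two B; bt : two B; cd B al = dm B bt|] ==> P2 S (bt .[B] al) = P2 S bt \<cdot> P2 S al"
 "[|al : two B; bt : two B; trg B (dm B al) = src B (dm B bt)|] ==> P2 S (bt **[B] al) = P2 S al \<star> P2 S bt"
 using S.P_simps(1)[of x] S.P_simps(2-4)[of f] S.P_simps(5-7)[of ph] S.P1_id[of x] S.P_simps(8)[of f] S.P1_comp[of g f]
  S.P_simps(9)[of al bt] S.P2_hcomp[of bt al] by simp_all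

end

text \<open>A family of universal elements: \<open>f \<mapsto> N f \<odot> lam b\<close> is an equivalence
  \<open>H(X, l b) \<rightarrow> M(S b, N X)\<close>.\<close>

locale universal_family = param +
 fixes l lam
 assumes l [simp]: "b : ob B ==> l b : ob H"
  and lam [simp]: "b : ob B ==> lam b : one M" "b : ob B ==> src M (lam b) = P0 S b"
   "b : ob B ==> trg M (lam b) = P0 N (l b)"
  and full_faithful: "[|b : ob B; f : one H; f' : one H; trg H f = l b; trg H f' = l b; src H f' = src H f;
   m : two M; dm M m = P1 N f \<odot> lam b; cd M m = P1 N f' \<odot> lam b|] ==>
   EX! n. n : two H & dm H n = f & cd H n = f' & P2 N n <| lam b = m"
  and ess_surj: "[|b : ob B; X : ob H; c : one M; src M c = P0 S b; trg M c = P0 N X|] ==>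
   EX f bt. f : one H & src H f = X & trg H f = l b & iso2 M bt & dm M bt = P1 N f \<odot> lam b & cd M bt = c"

text \<open>A pseudofunctor structure on \<open>b \<mapsto> l b\<close> making \<open>lam\<close> pseudonatural, with constraint cells \<open>om\<close>.\<close>

locale universal_psf = universal_family H B M N S l lam + L: psf B H L
 for H :: "('h, 'f, 't) two_cat" and B :: "('b, 'g, 'u) two_cat" and M :: "('m, 'p, 'q) two_cat" (structure)
  and N S l lam L +
 fixes om
 assumes L0 [simp]: "b : ob B ==> P0 L b = l b"
  and om [simp]: "g : one B ==> iso2 M (om g)"
   "g : one B ==> dm M (om g) = P1 N (P1 L g) \<odot> lam (trg B g)"
   "g : one B ==> cd M (om g) = lam (src B g) \<odot> P1 S g"
  and om_nat: "[|gm : two B; dm B gm = g; cd B gm = g'; src B g = b; trg B g = b'|] ==>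
   om g' \<cdot> (P2 N (P2 L gm) <| lam b') = (lam b |> P2 S gm) \<cdot> om g"
  and om_comp: "[|g : one B; h : one B; trg B g = src B h; trg B h = c|] ==>
   om (h *[B] g) \<cdot> (P2 N (Pc L h g) <| lam c)
   = (om g <| P1 S h) \<cdot> (P1 N (P1 L g) |> om h)"
  and om_unit: "b : ob B ==> om (id1 B b) \<cdot> (P2 N (Pu L b) <| lam b) = id2 M (lam b)"
begin

lemma om_in [simp]: "g : one B ==> om g : two M"
 using M.iso2_in[OF om(1)] .

end

context universal_family
begin

definition lift where
 "lift b f f' m = (THE n. n : two H & dm H n = f & cd H n = f' & P2 N n <| lam b = m)"

lemma lift [simp]:
 assumes "b : ob B" "f : one H" "f' : one H" "trg H f = l b" "trg H f' = l b" "src H f' = src H f"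
  "m : two M" "dm M m = P1 N f \<odot> lam b" "cd M m = P1 N f' \<odot> lam b"
 shows "lift b f f' m : two H" "dm H (lift b f f' m) = f" "cd H (lift b f f' m) = f'"
  "P2 N (lift b f f' m) <| lam b = m"
 using theI'[OF full_faithful[OF assms]] unfolding lift_def by blast+

text \<open>A 2-cell whiskered with the cone is a morphism of cones, and universality makes lifts of such morphisms
 unique.\<close>

lemma faithful:
 assumes "b : ob B" "n : two H" "n' : two H" "trg H (dm H n) = l b" "dm H n' = dm H n" "cd H n' = cd H n"
  "P2 N n <| lam b = P2 N n' <| lam b"
 shows "n = n'"
proof -
 have "EX! n. n : two H & dm H n = dm H n' & cd H n = cd H n' & P2 N n <| lam b = P2 N n' <| lam b"
  by (rule full_faithful) (use assms H.two_simps(3,4)[of n] H.two_simps(1,2)[of n'] in simp_all)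
 then show ?thesis using assms by metis
qed

lemma lift_iso:
 assumes "b : ob B" "f : one H" "f' : one H" "trg H f = l b" "trg H f' = l b" "src H f' = src H f"
  "iso2 M m" "dm M m = P1 N f \<odot> lam b" "cd M m = P1 N f' \<odot> lam b"
 shows "iso2 H (lift b f f' m)"
proof (rule H.iso2I[of _ "lift b f' f (inv2 M m)"])
 note a = assms(1-6) assms(8,9) M.iso2_in[OF assms(7)] M.inv2_simps[OF assms(7)]
 show "lift b f' f (inv2 M m) .[H] lift b f f' m = id2 H (dm H (lift b f f' m))"
  by (rule faithful[of b]) (simp_all add: a)
 show "lift b f f' m .[H] lift b f' f (inv2 M m) = id2 H (cd H (lift b f f' m))"
  by (rule faithful[of b]) (simp_all add: a)
qed (use assms in simp_all)

text \<open>The 1-cells \<open>L1 g\<close> represent the restricted universal elements.\<close>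

lemma ex_L1: "EX L1 om. ALL g : one B. L1 g : one H & src H (L1 g) = l (src B g) & trg H (L1 g) = l (trg B g)
  & iso2 M (om g) & dm M (om g) = P1 N (L1 g) \<odot> lam (trg B g) & cd M (om g) = lam (src B g) \<odot> P1 S g"
proof -
 have "EX f bt. f : one H & src H f = l (src B g) & trg H f = l (trg B g)
  & iso2 M bt & dm M bt = P1 N f \<odot> lam (trg B g) & cd M bt = lam (src B g) \<odot> P1 S g" if "g : one B" for g
  by (rule ess_surj) (use that in simp_all)
 then show ?thesis by metis
qed

text \<open>All cells and equations of the pseudofunctor come from the representation: a 2-cell into \<open>L1
 g\<close> is determined by its whiskering with \<open>lam\<close>, so the laws follow from those of
 \<open>S\<close>.\<close>

lemma ex_universal_psf: "EX L om. universal_psf H B M N S l lam L om"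
proof -
 obtain L1 om where L1om: "ALL g : one B. L1 g : one H & src H (L1 g) = l (src B g) & trg H (L1 g) = l (trg B g)
  & iso2 M (om g) & dm M (om g) = P1 N (L1 g) \<odot> lam (trg B g) & cd M (om g) = lam (src B g) \<odot> P1 S g"
  using ex_L1 by blast
 have L1 [simp]: "L1 g : one H" "src H (L1 g) = l (src B g)" "trg H (L1 g) = l (trg B g)" if "g : one B" for g
  using L1om that by auto
 have om [simp]: "iso2 M (om g)" "dm M (om g) = P1 N (L1 g) \<odot> lam (trg B g)"
  "cd M (om g) = lam (src B g) \<odot> P1 S g" if "g : one B" for g
  using L1om that by auto
 have om2 [simp]: "om g : two M" if "g : one B" for g using that by simp
text \<open>Cells into some \<open>L1 g\<close> are compared after whiskering with \<open>lam\<close> and composing with \<open>om g\<close>.\<close>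
 have eqI: "n = n'" if "g : one B" "n : two H" "n' : two H" "cd H n = L1 g" "cd H n' = L1 g" "dm H n' = dm H n"
  "trg B g = b" "om g \<cdot> (P2 N n <| lam b) = om g \<cdot> (P2 N n' <| lam b)" for g n n' b
 proof (rule faithful[of b])
  have s: "src H (dm H n) = l (src B g)" "trg H (dm H n) = l b"
   using H.two_simps(3,4)[OF that(2)] that(1,4,7) by simp_all
  show "P2 N n <| lam b = P2 N n' <| lam b"
   by (rule M.iso2_cancel_left[OF that(8)]) (use that(1-7) s in auto)
  show "trg H (dm H n) = l b" by (rule s)
 qed (use that in auto)
 define L2 where "L2 gm = lift (trg B (dm B gm)) (L1 (dm B gm)) (L1 (cd B gm))
  (inv2 M (om (cd B gm)) \<cdot> ((lam (src B (dm B gm)) |> P2 S gm) \<cdot> om (dm B gm)))" for gm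
 define Lc where "Lc h g = lift (trg B h) (L1 h *[H] L1 g) (L1 (h *[B] g))
  (inv2 M (om (h *[B] g)) \<cdot> ((om g <| P1 S h) \<cdot> (P1 N (L1 g) |> om h)))" for h g
 define Lu where "Lu b = lift b (id1 H (l b)) (L1 (id1 B b)) (inv2 M (om (id1 B b)))" for b
 have L2 [simp]: "L2 gm : two H" "dm H (L2 gm) = L1 (dm B gm)" "cd H (L2 gm) = L1 (cd B gm)" if "gm : two B" for gm
  unfolding L2_def by (rule lift; use that in simp)+
 have Lc [simp]: "iso2 H (Lc h g)" "Lc h g : two H" "dm H (Lc h g) = L1 h *[H] L1 g" "cd H (Lc h g) = L1 (h *[B] g)"
  if "g : one B" "h : one B" "trg B g = src B h" for h g
  unfolding Lc_def by (rule lift_iso lift; use that in simp)+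
 have Lu [simp]: "iso2 H (Lu b)" "Lu b : two H" "dm H (Lu b) = id1 H (l b)" "cd H (Lu b) = L1 (id1 B b)"
  if "b : ob B" for b
  unfolding Lu_def by (rule lift_iso lift; use that in simp)+
 have nat: "om g' \<cdot> (P2 N (L2 gm) <| lam b') = (lam b |> P2 S gm) \<cdot> om g"
  if "gm : two B" "dm B gm = g" "cd B gm = g'" "src B g = b" "trg B g = b'" for gm g g' b b'
 proof -
  have t: "g : one B" "g' : one B" "src B g' = b" "trg B g' = b'" "b : ob B" "b' : ob B"
   using that(1-5) B.two_simps[OF that(1)] B.one_simps[of g] by auto
  have "P2 N (L2 gm) <| lam b' = inv2 M (om g') \<cdot> ((lam b |> P2 S gm) \<cdot> om g)"
   unfolding L2_def that(2-5) by (rule lift; use that t in simp)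
  then show ?thesis using that t by simp
 qed
 have cmp: "om (h *[B] g) \<cdot> (P2 N (Lc h g) <| lam c)
   = (om g <| P1 S h) \<cdot> (P1 N (L1 g) |> om h)"
  if "g : one B" "h : one B" "trg B g = src B h" "trg B h = c" for g h c
 proof -
  have "P2 N (Lc h g) <| lam c
   = inv2 M (om (h *[B] g)) \<cdot> ((om g <| P1 S h) \<cdot> (P1 N (L1 g) |> om h))"
   unfolding Lc_def that(4) by (rule lift; use that B.one_simps in auto)
  then show ?thesis using that B.one_simps(2)[of h] by simp
 qed
 have unit: "om (id1 B b) \<cdot> (P2 N (Lu b) <| lam b) = id2 M (lam b)" if "b : ob B" for b
 proof -
  have "P2 N (Lu b) <| lam b = inv2 M (om (id1 B b))"
   unfolding Lu_def by (rule lift; use that in simp)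
  then show ?thesis using that by simp
 qed
 define L where "L = \<lparr>P0 = restrict l (ob B), P1 = restrict L1 (one B), P2 = restrict L2 (two B),
  Pc = restrict_comp B Lc, Pu = restrict Lu (ob B)\<rparr>"
 have L [simp]: "!!b. b : ob B ==> P0 L b = l b" "!!g. g : one B ==> P1 L g = L1 g" "!!gm. gm : two B ==> P2 L gm = L2 gm"
  "!!g h. [|g : one B; h : one B; trg B g = src B h|] ==> Pc L h g = Lc h g" "!!b. b : ob B ==> Pu L b = Lu b"
  by (simp_all add: L_def)
 have "psf B H L"
 proof (unfold_locales, goal_cases)
  case (9 f)
  show ?case
   by (rule eqI[of f _ _ "trg B f"]) (use 9 in \<open>simp_all add: nat[OF _ refl refl refl refl]\<close>, use 9 nat[of "id2 B f"] in simp)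
 next
  case (10 al bt)
  have t: "src B (dm B bt) = src B (dm B al)" "trg B (dm B bt) = trg B (dm B al)"
   using B.two_simps(3,4)[OF 10(1)] 10(3) by simp_all
  have a: "om (cd B bt) \<cdot> (P2 N (L2 bt) <| lam (trg B (dm B al)))
    = (lam (src B (dm B al)) |> P2 S bt) \<cdot> om (dm B bt)"
   by (rule nat) (use 10 t in auto)
  have b: "om (dm B bt) \<cdot> (P2 N (L2 al) <| lam (trg B (dm B al)))
    = (lam (src B (dm B al)) |> P2 S al) \<cdot> om (dm B al)"
   by (rule nat) (use 10 t in auto)
  have c: "om (cd B bt) \<cdot> (P2 N (L2 (bt .[B] al)) <| lam (trg B (dm B al)))
    = (lam (src B (dm B al)) |> P2 S (bt .[B] al)) \<cdot> om (dm B al)"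
   by (rule nat) (use 10 in auto)
  show ?case
  proof (rule eqI[of "cd B bt" _ _ "trg B (dm B al)"])
   show "om (cd B bt) \<cdot> (P2 N (P2 L (bt .[B] al)) <| lam (trg B (dm B al)))
    = om (cd B bt) \<cdot> (P2 N (P2 L bt .[H] P2 L al) <| lam (trg B (dm B al)))"
    using 10 t by (simp add: c M.vreassoc[OF a] b)
  qed (use 10 t in auto)
 next
  case (13 al bt)
  let ?b = "src B (dm B al)" and ?b' = "src B (dm B bt)" and ?c = "trg B (dm B bt)"
  let ?g = "dm B al" and ?g' = "cd B al" and ?h = "dm B bt" and ?h' = "cd B bt"
  have n: "om (?h' *[B] ?g') \<cdot> (P2 N (L2 (bt **[B] al)) <| lam ?c)
    = (lam ?b |> (P2 S al \<star> P2 S bt)) \<cdot> om (?h *[B] ?g)"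
   using nat[of "bt **[B] al", OF _ refl refl refl refl] 13 by simp
  have c1: "om (?h *[B] ?g) \<cdot> (P2 N (Lc ?h ?g) <| lam ?c)
   = (om ?g <| P1 S ?h) \<cdot> (P1 N (L1 ?g) |> om ?h)"
   by (rule cmp) (use 13 in auto)
  have c2: "om (?h' *[B] ?g') \<cdot> (P2 N (Lc ?h' ?g') <| lam ?c)
   = (om ?g' <| P1 S ?h') \<cdot> (P1 N (L1 ?g') |> om ?h')"
   by (rule cmp) (use 13 in auto)
  have s: "P2 N (L2 al) \<star> (P2 N (L2 bt) <| lam ?c)
    = (P1 N (L1 ?g') |> (P2 N (L2 bt) <| lam ?c)) \<cdot> (P2 N (L2 al) <| (P1 N (L1 ?h) \<odot> lam ?c))"
   using M.hcomp_split(2)[of "P2 N (L2 bt) <| lam ?c" "P2 N (L2 al)"] 13 by simp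
  have s': "P2 S al \<star> P2 S bt = (P2 S al <| P1 S ?h') \<cdot> (P1 S ?g |> P2 S bt)"
   using M.hcomp_split(1)[of "P2 S bt" "P2 S al"] 13 by simp
  have n1: "(P1 N (L1 ?g') |> om ?h') \<cdot> (P1 N (L1 ?g') |> (P2 N (L2 bt) <| lam ?c))
    = ((P1 N (L1 ?g') \<odot> lam ?b') |> P2 S bt) \<cdot> (P1 N (L1 ?g') |> om ?h)"
   using arg_cong[OF nat[of bt, OF _ refl refl refl refl], of "%z. P1 N (L1 ?g') |> z"] 13 by simp
  have e1: "(P1 N (L1 ?g') |> om ?h) \<cdot> (P2 N (L2 al) <| (P1 N (L1 ?h) \<odot> lam ?c))
    = (P2 N (L2 al) <| (lam ?b' \<odot> P1 S ?h)) \<cdot> (P1 N (L1 ?g) |> om ?h)"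
   by (rule M.exchange[symmetric]) (use 13 in auto)
  have e2: "(om ?g' <| P1 S ?h') \<cdot> ((P1 N (L1 ?g') \<odot> lam ?b') |> P2 S bt)
    = ((lam ?b \<odot> P1 S ?g') |> P2 S bt) \<cdot> (om ?g' <| P1 S ?h)"
   by (rule M.exchange) (use 13 in auto)
  have n2: "(om ?g' <| P1 S ?h) \<cdot> (P2 N (L2 al) <| (lam ?b' \<odot> P1 S ?h))
    = (lam ?b |> (P2 S al <| P1 S ?h)) \<cdot> (om ?g <| P1 S ?h)"
   using arg_cong[OF nat[of al, OF _ refl refl refl refl], of "%z. z <| P1 S ?h"] 13 by simp
  have e3: "(lam ?b |> (P2 S al <| P1 S ?h')) \<cdot> ((lam ?b \<odot> P1 S ?g) |> P2 S bt)
    = ((lam ?b \<odot> P1 S ?g') |> P2 S bt) \<cdot> (lam ?b |> (P2 S al <| P1 S ?h))"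
   using M.exchange[of "P2 S bt" "lam ?b |> P2 S al", OF _ _ _ refl refl refl refl] 13 by simp
  show ?case
  proof (rule eqI[of "?h' *[B] ?g'" _ _ ?c])
   have "om (?h' *[B] ?g') \<cdot> (P2 N (P2 L (bt **[B] al) .[H] Pc L ?h ?g) <| lam ?c)
    = (lam ?b |> (P2 S al \<star> P2 S bt)) \<cdot> ((om ?g <| P1 S ?h) \<cdot> (P1 N (L1 ?g) |> om ?h))"
    using 13 by (simp add: M.vreassoc[OF n] c1)
   also have "\<dots> = ((lam ?b \<odot> P1 S ?g') |> P2 S bt) \<cdot> ((lam ?b |> (P2 S al <| P1 S ?h)) \<cdot>
     ((om ?g <| P1 S ?h) \<cdot> (P1 N (L1 ?g) |> om ?h)))"
    using 13 by (simp add: s' M.vreassoc[OF e3])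
   also have "\<dots> = om (?h' *[B] ?g') \<cdot> (P2 N (Pc L ?h' ?g' .[H] (P2 L bt **[H] P2 L al)) <| lam ?c)"
    using 13 by (simp add: M.vreassoc[OF c2] s M.vreassoc[OF n1] e1 M.vreassoc[OF e2] M.vreassoc[OF n2])
   finally show "om (?h' *[B] ?g') \<cdot> (P2 N (P2 L (bt **[B] al) .[H] Pc L ?h ?g) <| lam ?c)
    = om (?h' *[B] ?g') \<cdot> (P2 N (Pc L ?h' ?g' .[H] (P2 L bt **[H] P2 L al)) <| lam ?c)" .
  qed (use 13 in auto)
 next
  case (14 f g h)
  let ?d = "trg B h"
  have c1: "om (h *[B] (g *[B] f)) \<cdot> (P2 N (Lc (h *[B] g) f) <| lam ?d)
   = (om f <| (P1 S g \<odot> P1 S h)) \<cdot> (P1 N (L1 f) |> om (h *[B] g))"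
   using cmp[of f "h *[B] g" ?d] 14 by simp
  have c2: "(P1 N (L1 f) |> om (h *[B] g)) \<cdot> (P1 N (L1 f) |> (P2 N (Lc h g) <| lam ?d))
   = (P1 N (L1 f) |> (om g <| P1 S h)) \<cdot> ((P1 N (L1 f) \<odot> P1 N (L1 g)) |> om h)"
   using arg_cong[OF cmp[OF 14(2,3) 14(5) refl], of "%z. P1 N (L1 f) |> z"] 14 by simp
  have c3: "om (h *[B] (g *[B] f)) \<cdot> (P2 N (Lc h (g *[B] f)) <| lam ?d)
   = (om (g *[B] f) <| P1 S h) \<cdot> (P1 N (L1 (g *[B] f)) |> om h)"
   using cmp[of "g *[B] f" h ?d] 14 by simp
  have e: "(P1 N (L1 (g *[B] f)) |> om h) \<cdot> (P2 N (Lc g f) <| (P1 N (L1 h) \<odot> lam ?d))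
   = (P2 N (Lc g f) <| (lam (src B h) \<odot> P1 S h)) \<cdot> ((P1 N (L1 f) \<odot> P1 N (L1 g)) |> om h)"
   by (rule M.exchange[symmetric]) (use 14 in auto)
  have c4: "(om (g *[B] f) <| P1 S h) \<cdot> (P2 N (Lc g f) <| (lam (src B h) \<odot> P1 S h))
   = (om f <| (P1 S g \<odot> P1 S h)) \<cdot> (P1 N (L1 f) |> (om g <| P1 S h))"
   using arg_cong[OF cmp[OF 14(1,2) 14(4) refl], of "%z. z <| P1 S h"] 14 by simp
  show ?case
  proof (rule eqI[of "h *[B] (g *[B] f)" _ _ ?d])
   show "om (h *[B] (g *[B] f)) \<cdot> (P2 N (Pc L (h *[B] g) f .[H] (Pc L h g <|[H] P1 L f)) <| lam ?d)
    = om (h *[B] (g *[B] f)) \<cdot> (P2 N (Pc L h (g *[B] f) .[H] (P1 L h |>[H] Pc L g f)) <| lam ?d)"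
    using 14 by (simp add: M.vreassoc[OF c1] c2 M.vreassoc[OF c3] e M.vreassoc[OF c4])
  qed (use 14 in auto)
 next
  case (15 f)
  let ?x = "src B f" and ?y = "trg B f"
  have c: "om f \<cdot> (P2 N (Lc f (id1 B ?x)) <| lam ?y)
   = (om (id1 B ?x) <| P1 S f) \<cdot> (P1 N (L1 (id1 B ?x)) |> om f)"
   using cmp[of "id1 B ?x" f ?y] 15 by simp
  have e: "(P1 N (L1 (id1 B ?x)) |> om f) \<cdot> (P2 N (Lu ?x) <| (P1 N (L1 f) \<odot> lam ?y))
   = (P2 N (Lu ?x) <| (lam ?x \<odot> P1 S f)) \<cdot> om f"
   using M.exchange[of "om f" "P2 N (Lu ?x)", OF _ _ _ refl refl refl refl] 15 by simp
  have u: "(om (id1 B ?x) <| P1 S f) \<cdot> (P2 N (Lu ?x) <| (lam ?x \<odot> P1 S f)) = id2 M (lam ?x \<odot> P1 S f)"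
   using arg_cong[OF unit[of ?x], of "%z. z <| P1 S f"] 15 by simp
  show ?case
  proof (rule eqI[of f _ _ ?y])
   show "om f \<cdot> (P2 N (Pc L f (id1 B ?x) .[H] (P1 L f |>[H] Pu L ?x)) <| lam ?y)
     = om f \<cdot> (P2 N (id2 H (P1 L f)) <| lam ?y)"
    using 15 by (simp add: M.vreassoc[OF c] e M.vreassoc1[OF u])
  qed (use 15 in auto)
 next
  case (16 f)
  let ?x = "src B f" and ?y = "trg B f"
  have c: "om f \<cdot> (P2 N (Lc (id1 B ?y) f) <| lam ?y)
   = om f \<cdot> (P1 N (L1 f) |> om (id1 B ?y))"
   using cmp[of f "id1 B ?y" ?y] 16 by simp
  have u: "(P1 N (L1 f) |> om (id1 B ?y)) \<cdot> (P1 N (L1 f) |> (P2 N (Lu ?y) <| lam ?y))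
   = id2 M (P1 N (L1 f) \<odot> lam ?y)"
   using arg_cong[OF unit[of ?y], of "%z. P1 N (L1 f) |> z"] 16 by simp
  show ?case
  proof (rule eqI[of f _ _ ?y])
   show "om f \<cdot> (P2 N (Pc L (id1 B ?y) f .[H] (Pu L ?y <|[H] P1 L f)) <| lam ?y)
     = om f \<cdot> (P2 N (id2 H (P1 L f)) <| lam ?y)"
    using 16 by (simp add: M.vreassoc[OF c] u)
  qed (use 16 in auto)
 qed (simp_all, simp_all add: L_def)
 then interpret L: psf B H L .
 have "universal_psf H B M N S l lam L om"
  by unfold_locales (simp_all add: nat cmp unit)
 then show ?thesis by blast
qed

end

context two_category
begin

lemma whisker_inv2 [simp]:
 assumes "iso2 K al" "g : one K" "trg K (dm K al) = src K g"
 shows "(g |> inv2 K al) \<cdot> (g |> al) = id2 K (g \<odot> dm K al)"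
  "(g |> al) \<cdot> (g |> inv2 K al) = id2 K (g \<odot> cd K al)"
  "[|z : two K; cd K z = g \<odot> dm K al|] ==> (g |> inv2 K al) \<cdot> ((g |> al) \<cdot> z) = z"
  "[|z : two K; cd K z = g \<odot> cd K al|] ==> (g |> al) \<cdot> ((g |> inv2 K al) \<cdot> z) = z"
proof -
 have a: "al : two K" using assms by simp
 show 1: "(g |> inv2 K al) \<cdot> (g |> al) = id2 K (g \<odot> dm K al)"
  by (subst whisker_vcomp(1)[symmetric]) (use assms a in simp_all)
 show 2: "(g |> al) \<cdot> (g |> inv2 K al) = id2 K (g \<odot> cd K al)"
  by (subst whisker_vcomp(1)[symmetric]) (use assms a in simp_all)
 show "(g |> inv2 K al) \<cdot> ((g |> al) \<cdot> z) = z" if "z : two K" "cd K z = g \<odot> dm K al"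
  by (subst vreassoc1[OF 1]) (use assms a that in simp_all)
 show "(g |> al) \<cdot> ((g |> inv2 K al) \<cdot> z) = z" if "z : two K" "cd K z = g \<odot> cd K al"
  by (subst vreassoc1[OF 2]) (use assms a that in simp_all)
qed

lemma inv2_whisker [simp]:
 assumes "iso2 K al" "f : one K" "trg K f = src K (dm K al)"
 shows "(inv2 K al <| f) \<cdot> (al <| f) = id2 K (dm K al \<odot> f)"
  "(al <| f) \<cdot> (inv2 K al <| f) = id2 K (cd K al \<odot> f)"
  "[|z : two K; cd K z = dm K al \<odot> f|] ==> (inv2 K al <| f) \<cdot> ((al <| f) \<cdot> z) = z"
  "[|z : two K; cd K z = cd K al \<odot> f|] ==> (al <| f) \<cdot> ((inv2 K al <| f) \<cdot> z) = z"
proof -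
 have a: "al : two K" using assms by simp
 show 1: "(inv2 K al <| f) \<cdot> (al <| f) = id2 K (dm K al \<odot> f)"
  by (subst whisker_vcomp(2)[symmetric]) (use assms a in simp_all)
 show 2: "(al <| f) \<cdot> (inv2 K al <| f) = id2 K (cd K al \<odot> f)"
  by (subst whisker_vcomp(2)[symmetric]) (use assms a in simp_all)
 show "(inv2 K al <| f) \<cdot> ((al <| f) \<cdot> z) = z" if "z : two K" "cd K z = dm K al \<odot> f"
  by (subst vreassoc1[OF 1]) (use assms a that in simp_all)
 show "(al <| f) \<cdot> ((inv2 K al <| f) \<cdot> z) = z" if "z : two K" "cd K z = cd K al \<odot> f"
  by (subst vreassoc1[OF 2]) (use assms a that in simp_all)
qed

lemma whisker_inv2_whisker [simp]:
 assumes "iso2 K al" "f : one K" "trg K f = src K (dm K al)" "g : one K" "trg K (dm K al) = src K g"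
 shows "(g |> (inv2 K al <| f)) \<cdot> (g |> (al <| f)) = id2 K (g \<odot> (dm K al \<odot> f))"
  "(g |> (al <| f)) \<cdot> (g |> (inv2 K al <| f)) = id2 K (g \<odot> (cd K al \<odot> f))"
  "[|z : two K; cd K z = g \<odot> (dm K al \<odot> f)|] ==>
   (g |> (inv2 K al <| f)) \<cdot> ((g |> (al <| f)) \<cdot> z) = z"
  "[|z : two K; cd K z = g \<odot> (cd K al \<odot> f)|] ==>
   (g |> (al <| f)) \<cdot> ((g |> (inv2 K al <| f)) \<cdot> z) = z"
 using whisker_inv2(1,2)[of "al <| f" g] whisker_inv2(3,4)[of "al <| f" g z] assms by simp_all

end

text \<open>Representing equivalences \<open>Ph b X : H(X, l b) \<rightarrow> M(S b, N X)\<close>, with isomorphisms \<open>rh\<close> showing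
  that they are given by the universal elements.\<close>

locale representing_family = param +
 fixes l Ph lam rh
 assumes l [simp]: "b : ob B ==> l b : ob H"
  and Ph: "[|b : ob B; X : ob H|] ==> hom_equiv H X (l b) M (P0 S b) (P0 N X) (Ph b X)"
  and lam: "b : ob B ==> lam b = F_ob (Ph b (l b)) (id1 H (l b))"
  and rh [simp]: "[|b : ob B; k : one H; trg H k = l b|] ==> iso2 M (rh b k)"
   "[|b : ob B; k : one H; trg H k = l b|] ==> dm M (rh b k) = P1 N k \<odot> lam b"
   "[|b : ob B; k : one H; trg H k = l b|] ==> cd M (rh b k) = F_ob (Ph b (src H k)) k"
  and rh_nat: "[|b : ob B; ph : two H; dm H ph = k; cd H ph = k'; trg H k = l b; src H k = X|] ==>
   rh b k' \<cdot> (P2 N ph <| lam b) = F_ar (Ph b X) ph \<cdot> rh b k"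
begin

lemma Ph_simps [simp]:
 assumes b: "b : ob B" and X: "X : ob H"
 shows "[|k : one H; src H k = X; trg H k = l b|] ==> F_ob (Ph b X) k : one M"
  "[|k : one H; src H k = X; trg H k = l b|] ==> src M (F_ob (Ph b X) k) = P0 S b"
  "[|k : one H; src H k = X; trg H k = l b|] ==> trg M (F_ob (Ph b X) k) = P0 N X"
  "[|ph : two H; src H (dm H ph) = X; trg H (dm H ph) = l b|] ==> F_ar (Ph b X) ph : two M"
  "[|ph : two H; src H (dm H ph) = X; trg H (dm H ph) = l b|] ==> dm M (F_ar (Ph b X) ph) = F_ob (Ph b X) (dm H ph)"
  "[|ph : two H; src H (dm H ph) = X; trg H (dm H ph) = l b|] ==> cd M (F_ar (Ph b X) ph) = F_ob (Ph b X) (cd H ph)"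
  "F_src (Ph b X) = hom H X (l b)" "F_trg (Ph b X) = hom M (P0 S b) (P0 N X)"
  "ftor_in (Ph b X) (hom H X (l b)) (hom M (P0 S b) (P0 N X))"
 using ftor_inD(2,3,6-9)[OF hom_equivD(1)[OF Ph[OF b X]]] hom_equivD(1)[OF Ph[OF b X]] by auto

lemma rh_in [simp]: "[|b : ob B; k : one H; trg H k = l b|] ==> rh b k : two M"
 using M.iso2_in[OF rh(1)] .

lemma lam_simps [simp]:
 assumes "b : ob B" shows "lam b : one M" "src M (lam b) = P0 S b" "trg M (lam b) = P0 N (l b)"
 using assms by (simp_all add: lam)

sublocale universal_family H B M N S l lam
proof (unfold_locales, goal_cases)
 case (5 b f f' m)
 let ?X = "src H f"
 note b = 5(1-9)
 have X: "?X : ob H" using b by simp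
 let ?bt = "rh b f' \<cdot> (m \<cdot> inv2 M (rh b f))"
 have e: "P2 N n <| lam b = m \<longleftrightarrow> F_ar (Ph b ?X) n = ?bt" if "n : two H" "dm H n = f" "cd H n = f'" for n
 proof
  have *: "rh b f' \<cdot> (P2 N n <| lam b) = F_ar (Ph b ?X) n \<cdot> rh b f"
   by (rule rh_nat) (use that b in auto)
  show "F_ar (Ph b ?X) n = ?bt" if m: "P2 N n <| lam b = m"
  proof (rule M.iso2_cancel_right[of _ "rh b f"])
   show "F_ar (Ph b ?X) n \<cdot> rh b f = ?bt \<cdot> rh b f"
    using * b by (simp add: m)
  qed (use b that \<open>n : two H\<close> \<open>dm H n = f\<close> \<open>cd H n = f'\<close> in auto)
  show "P2 N n <| lam b = m" if m: "F_ar (Ph b ?X) n = ?bt"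
  proof (rule M.iso2_cancel_left[of "rh b f'"])
   show "rh b f' \<cdot> (P2 N n <| lam b) = rh b f' \<cdot> m"
    using * b by (simp add: m)
  qed (use b that \<open>n : two H\<close> \<open>dm H n = f\<close> \<open>cd H n = f'\<close> in auto)
 qed
 have "EX! n. n : two H & dm H n = f & cd H n = f' & F_ar (Ph b ?X) n = ?bt"
  by (rule hom_equivD(2)[OF Ph[OF b(1) X]]) (use b in auto)
 moreover have "(n : two H & dm H n = f & cd H n = f' & F_ar (Ph b ?X) n = ?bt) \<longleftrightarrow>
  (n : two H & dm H n = f & cd H n = f' & P2 N n <| lam b = m)" for n
  using e[of n] by blast
 ultimately show ?case by simp
next
 case (6 b X c)
 have "c : Ob (hom M (P0 S b) (P0 N X))" using 6 by simp
 from hom_equivD(3)[OF Ph[OF 6(1,2)] this] obtain f bt where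
  "f : one H" "src H f = X" "trg H f = l b" "iso2 M bt" "dm M bt = F_ob (Ph b X) f" "cd M bt = c" by auto
 note f = this
 have "iso2 M (bt \<cdot> rh b f)" "dm M (bt \<cdot> rh b f) = P1 N f \<odot> lam b" "cd M (bt \<cdot> rh b f) = c"
  using f 6(1,2) by simp_all
 then show ?case using f(1-3) by blast
qed simp_all

end

locale representing_psf = representing_family H B M N S l Ph lam rh + universal_psf H B M N S l lam L om
 for H :: "('h, 'f, 't) two_cat" and B :: "('b, 'g, 'u) two_cat" and M :: "('m, 'p, 'q) two_cat" (structure)
  and N S l Ph lam rh L om
begin

text \<open>The jointly pseudonatural equivalence: the constraint cells are those of the strict family
  \<open>k \<mapsto> N k \<odot> lam b\<close>, conjugated by \<open>rh\<close>.\<close>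

definition Thcell where
 "Thcell f g k = rh (trg B g) (P1 L g *[H] (k *[H] f)) \<cdot>
   (((P1 N f \<odot> P1 N k) |> inv2 M (om g)) \<cdot>
   (P1 N f |> (inv2 M (rh (src B g) k) <| P1 S g)))"

lemma Thcell:
 assumes "f : one H" "g : one B" "k : one H" "src H k = trg H f" "trg H k = l (src B g)"
 shows "iso2 M (Thcell f g k)" "Thcell f g k : two M"
  "dm M (Thcell f g k) = P1 N f \<odot> (F_ob (Ph (src B g) (trg H f)) k \<odot> P1 S g)"
  "cd M (Thcell f g k) = F_ob (Ph (trg B g) (src H f)) (P1 L g *[H] (k *[H] f))"
  "Thcell f g k \<cdot> (P1 N f |> (rh (src B g) k <| P1 S g))
   = rh (trg B g) (P1 L g *[H] (k *[H] f)) \<cdot> ((P1 N f \<odot> P1 N k) |> inv2 M (om g))"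
proof -
 have b: "src B g : ob B" "trg B g : ob B" "trg H f : ob H" "src H f : ob H" using assms by auto
 have r: "(P1 N f |> (inv2 M (rh (src B g) k) <| P1 S g)) \<cdot>
   (P1 N f |> (rh (src B g) k <| P1 S g)) = id2 M (P1 N f \<odot> (P1 N k \<odot> (lam (src B g) \<odot> P1 S g)))"
  using assms b by simp
 show "iso2 M (Thcell f g k)" "Thcell f g k : two M"
  "dm M (Thcell f g k) = P1 N f \<odot> (F_ob (Ph (src B g) (trg H f)) k \<odot> P1 S g)"
  "cd M (Thcell f g k) = F_ob (Ph (trg B g) (src H f)) (P1 L g *[H] (k *[H] f))"
  unfolding Thcell_def using assms b by simp_all
 show "Thcell f g k \<cdot> (P1 N f |> (rh (src B g) k <| P1 S g))
   = rh (trg B g) (P1 L g *[H] (k *[H] f)) \<cdot> ((P1 N f \<odot> P1 N k) |> inv2 M (om g))"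
  unfolding Thcell_def using assms b by (simp add: r)
qed

lemma Thcell_eqI:
 assumes "f : one H" "g : one B" "k : one H" "src H k = trg H f" "trg H k = l (src B g)"
  and "x : two M" "y : two M" "dm M x = P1 N f \<odot> (F_ob (Ph (src B g) (trg H f)) k \<odot> P1 S g)"
   "dm M y = P1 N f \<odot> (F_ob (Ph (src B g) (trg H f)) k \<odot> P1 S g)"
  and "x \<cdot> (P1 N f |> (rh (src B g) k <| P1 S g)) = y \<cdot> (P1 N f |> (rh (src B g) k <| P1 S g))"
 shows "x = y"
 by (rule M.iso2_cancel_right[OF assms(10)]) (use assms(1-9) in simp_all)

lemma Thcell_natural_arg:
 assumes "f : one H" "g : one B" "kk : two H" "dm H kk = k" "cd H kk = k'" "src H k = trg H f" "trg H k = l (src B g)"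
  "src B g = b" "trg B g = b'" "trg H f = X" "src H f = X'"
 shows "Thcell f g k' \<cdot> (P1 N f |> (F_ar (Ph b X) kk <| P1 S g))
  = F_ar (Ph b' X') (P1 L g |>[H] (kk <|[H] f)) \<cdot> Thcell f g k"
proof (rule Thcell_eqI[of f g k])
 have k: "k : one H" "k' : one H" "src H k' = src H k" "trg H k' = trg H k"
  using assms(3-5) H.two_simps[of kk] by auto
 note t = Thcell[OF assms(1,2) k(1) assms(6,7)] Thcell[OF assms(1,2) k(2), unfolded k, OF assms(6,7)]
 note a = assms(1-3,6,7) k
 have b: "b : ob B" "b' : ob B" "X : ob H" "X' : ob H" using assms by auto
 note t' = t[unfolded assms(8-11)]
 have a': "src H k = X" "trg H k = l b" "src H k' = X" "trg H k' = l b" using a assms by auto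
 have r1: "rh b k' \<cdot> (P2 N kk <| lam b) = F_ar (Ph b X) kk \<cdot> rh b k"
  by (rule rh_nat) (use assms a b a' in simp_all)
 have r1': "(P1 N f |> (F_ar (Ph b X) kk <| P1 S g)) \<cdot> (P1 N f |> (rh b k <| P1 S g))
  = (P1 N f |> (rh b k' <| P1 S g)) \<cdot> (P1 N f |> (P2 N kk <| (lam b \<odot> P1 S g)))"
  using arg_cong[OF r1[symmetric], of "%z. P1 N f |> (z <| P1 S g)"] assms(1,2,4,5,8-11) a(3) a' b k by simp
 have e: "((P1 N f \<odot> P1 N k') |> inv2 M (om g)) \<cdot> (P1 N f |> (P2 N kk <| (lam b \<odot> P1 S g)))
  = (P1 N f |> (P2 N kk <| (P1 N (P1 L g) \<odot> lam b'))) \<cdot> ((P1 N f \<odot> P1 N k) |> inv2 M (om g))"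
  using M.exchange[of "inv2 M (om g)" "P1 N f |> P2 N kk", OF _ _ _ refl refl refl refl] assms(1,2,4,5,8-11) a(3) a' b k by simp
 have r2: "rh b' (P1 L g *[H] (k' *[H] f)) \<cdot> (P1 N f |> (P2 N kk <| (P1 N (P1 L g) \<odot> lam b')))
  = F_ar (Ph b' X') (P1 L g |>[H] (kk <|[H] f)) \<cdot> rh b' (P1 L g *[H] (k *[H] f))"
  using rh_nat[of b' "P1 L g |>[H] (kk <|[H] f)" _ _ X', OF _ _ refl refl] assms(1,2,4,5,8-11) a(3) a' b k by simp
 show "(Thcell f g k' \<cdot> (P1 N f |> (F_ar (Ph b X) kk <| P1 S g))) \<cdot> (P1 N f |> (rh (src B g) k <| P1 S g))
  = (F_ar (Ph b' X') (P1 L g |>[H] (kk <|[H] f)) \<cdot> Thcell f g k) \<cdot> (P1 N f |> (rh (src B g) k <| P1 S g))"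
  using assms(1,2,4,5,8-11) a(3) a' b k t'
  by (simp add: r1' M.vreassoc[OF t'(10)] e M.vreassoc[OF r2])
qed (use assms H.two_simps[of kk] Thcell[of f g k] Thcell[of f g k'] B.one_simps[of g] H.one_simps[of f] in simp_all)

lemma Thcell_natural:
 assumes "ph : two H" "gm : two B" "k : one H" "dm H ph = f" "cd H ph = f'" "dm B gm = g" "cd B gm = g'"
  "src B g = b" "trg B g = b'" "trg H f = X" "src H f = X'" "src H k = X" "trg H k = l b"
 shows "Thcell f' g' k \<cdot> (P2 N ph \<star> (F_ob (Ph b X) k |> P2 S gm))
  = F_ar (Ph b' X') (P2 L gm **[H] (k |>[H] ph)) \<cdot> Thcell f g k"
proof (rule Thcell_eqI[of f g k])
 have fg: "f : one H" "f' : one H" "g : one B" "g' : one B" "src H f' = X'" "trg H f' = X" "src B g' = b" "trg B g' = b'"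
  using assms H.two_simps[of ph] B.two_simps[of gm] by auto
 have b: "b : ob B" "b' : ob B" "X : ob H" "X' : ob H" using assms fg by auto
 note a = assms b fg
 note t = Thcell[of f g k, simplified a, simplified] Thcell[of f' g' k, simplified a, simplified]
 have s: "(P2 N ph \<star> (F_ob (Ph b X) k |> P2 S gm)) \<cdot> (P1 N f |> (rh b k <| P1 S g))
  = P2 N ph \<star> (rh b k \<star> P2 S gm)"
  using M.interchange[of "id2 M (P1 S g)" "P2 S gm" "rh b k" "id2 M (F_ob (Ph b X) k)"]
   M.interchange[of "rh b k <| P1 S g" "F_ob (Ph b X) k |> P2 S gm" "id2 M (P1 N f)" "P2 N ph"] a by simp
 have s': "P2 N ph \<star> (rh b k \<star> P2 S gm) = (P1 N f' |> (rh b k <| P1 S g')) \<cdot>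
   (P2 N ph \<star> ((P1 N k \<odot> lam b) |> P2 S gm))"
  using M.interchange[of "P2 S gm" "id2 M (P1 S g')" "id2 M (P1 N k \<odot> lam b)" "rh b k" ]
   M.interchange[of "(P1 N k \<odot> lam b) |> P2 S gm" "rh b k <| P1 S g'" "P2 N ph" "id2 M (P1 N f')"] a by simp
 have n: "(P2 N (P2 L gm) <| lam b') \<cdot> inv2 M (om g) = inv2 M (om g') \<cdot> (lam b |> P2 S gm)"
  by (rule M.iso2_conj[OF om_nat[symmetric]]) (use a in simp_all)
 have e: "((P1 N f' \<odot> P1 N k) |> inv2 M (om g')) \<cdot> (P2 N ph \<star> ((P1 N k \<odot> lam b) |> P2 S gm))
  = (P2 N ph \<star> (P1 N k |> (P2 N (P2 L gm) <| lam b'))) \<cdot> ((P1 N f \<odot> P1 N k) |> inv2 M (om g))"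
 proof -
  have "((P1 N f' \<odot> P1 N k) |> inv2 M (om g')) \<cdot> ((P2 N ph <| P1 N k) \<star> (lam b |> P2 S gm))
   = (id2 M (P1 N f' \<odot> P1 N k) \<cdot> (P2 N ph <| P1 N k)) \<star> (inv2 M (om g') \<cdot> (lam b |> P2 S gm))"
   by (rule M.interchange[symmetric]) (use a in simp_all)
  also have "\<dots> = ((P2 N ph <| P1 N k) \<cdot> id2 M (P1 N f \<odot> P1 N k)) \<star> ((P2 N (P2 L gm) <| lam b') \<cdot> inv2 M (om g))"
   unfolding n using a by simp
  also have "\<dots> = ((P2 N ph <| P1 N k) \<star> (P2 N (P2 L gm) <| lam b')) \<cdot> ((P1 N f \<odot> P1 N k) |> inv2 M (om g))"
   by (rule M.interchange) (use a in simp_all)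
  finally show ?thesis using a by simp
 qed
 have r: "rh b' (P1 L g' *[H] (k *[H] f')) \<cdot> (P2 N ph \<star> (P1 N k |> (P2 N (P2 L gm) <| lam b')))
  = F_ar (Ph b' X') (P2 L gm **[H] (k |>[H] ph)) \<cdot> rh b' (P1 L g *[H] (k *[H] f))"
  using rh_nat[of b' "P2 L gm **[H] (k |>[H] ph)" _ _ X', OF _ _ refl refl] a by simp
 show "(Thcell f' g' k \<cdot> (P2 N ph \<star> (F_ob (Ph b X) k |> P2 S gm))) \<cdot> (P1 N f |> (rh (src B g) k <| P1 S g))
  = (F_ar (Ph b' X') (P2 L gm **[H] (k |>[H] ph)) \<cdot> Thcell f g k) \<cdot> (P1 N f |> (rh (src B g) k <| P1 S g))"
  using a t by (simp add: s s' M.vreassoc[OF t(10)] e M.vreassoc[OF r])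
qed (use assms H.two_simps[of ph] B.two_simps[of gm] B.one_simps[of g] H.one_simps[of f] Thcell[of f g k] Thcell[of f' g' k] in simp_all)

text \<open>The constraint cell of a composite splits by the compatibility of \<open>om\<close> with composition in
 \<open>B\<close>, after \<open>rh\<close> has been moved past the action of \<open>N\<close>.\<close>

lemma Thcell_comp:
 assumes "f : one H" "f' : one H" "g : one B" "g' : one B" "k : one H" "trg H f' = src H f" "trg B g = src B g'"
  "src H k = trg H f" "trg H k = l (src B g)" "src H f' = X''" "trg B g' = b''"
 shows "Thcell (f *[H] f') (g' *[B] g) k = F_ar (Ph b'' X'') (Pc L g' g <|[H] (k *[H] (f *[H] f')))
  \<cdot> (Thcell f' g' (P1 L g *[H] (k *[H] f)) \<cdot> (P1 N f' |> (Thcell f g k <| P1 S g')))"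
proof (rule Thcell_eqI[of "f *[H] f'" "g' *[B] g" k])
 have b: "src B g : ob B" "src B g' : ob B" "b'' : ob B" "X'' : ob H" "trg H f : ob H" "src H f : ob H"
  "src H (P1 L g *[H] (k *[H] f)) = trg H f'" "trg H (P1 L g *[H] (k *[H] f)) = l (src B g')"
  "P1 L g *[H] (k *[H] f) : one H"
  using assms by auto
 note a = assms b
 note t1 = Thcell[OF assms(1,3,5,8,9)] and t2 = Thcell[OF assms(2,4) b(9) b(7,8)]
  and t3 = Thcell[of "f *[H] f'" "g' *[B] g" k, simplified a H.comp1_simps B.comp1_simps, simplified]
 have t3': "Thcell (f *[H] f') (g' *[B] g) k \<cdot> ((P1 N f' \<odot> P1 N f) |> (rh (src B g) k <| (P1 S g \<odot> P1 S g')))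
  = rh b'' (P1 L (g' *[B] g) *[H] (k *[H] (f *[H] f'))) \<cdot> ((P1 N f' \<odot> (P1 N f \<odot> P1 N k)) |> inv2 M (om (g' *[B] g)))"
  using Thcell(5)[of "f *[H] f'" "g' *[B] g" k] a by simp
 have u1: "(P1 N f' |> (Thcell f g k <| P1 S g')) \<cdot> ((P1 N f' \<odot> P1 N f) |> (rh (src B g) k <| (P1 S g \<odot> P1 S g')))
  = (P1 N f' |> (rh (src B g') (P1 L g *[H] (k *[H] f)) <| P1 S g')) \<cdot>
   ((P1 N f' \<odot> (P1 N f \<odot> P1 N k)) |> (inv2 M (om g) <| P1 S g'))"
  using arg_cong[OF t1(5), of "%z. P1 N f' |> (z <| P1 S g')"] a t1(1-4) by simp
 have u2: "Thcell f' g' (P1 L g *[H] (k *[H] f)) \<cdot> (P1 N f' |> (rh (src B g') (P1 L g *[H] (k *[H] f)) <| P1 S g'))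
  = rh b'' (P1 L g' *[H] (P1 L g *[H] (k *[H] (f *[H] f')))) \<cdot>
   ((P1 N f' \<odot> (P1 N f \<odot> (P1 N k \<odot> P1 N (P1 L g)))) |> inv2 M (om g'))"
  using t2(5) a by simp
 have r: "F_ar (Ph b'' X'') (Pc L g' g <|[H] (k *[H] (f *[H] f'))) \<cdot> rh b'' (P1 L g' *[H] (P1 L g *[H] (k *[H] (f *[H] f'))))
  = rh b'' (P1 L (g' *[B] g) *[H] (k *[H] (f *[H] f'))) \<cdot>
   ((P1 N f' \<odot> (P1 N f \<odot> P1 N k)) |> (P2 N (Pc L g' g) <| lam b''))"
  using rh_nat[of b'' "Pc L g' g <|[H] (k *[H] (f *[H] f'))" _ _ X'', OF _ _ refl refl] a by simp
 have c: "(P2 N (Pc L g' g) <| lam b'') \<cdot> ((P1 N (P1 L g) |> inv2 M (om g')) \<cdot> (inv2 M (om g) <| P1 S g'))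
   = inv2 M (om (g' *[B] g))"
 proof -
  have q: "om (g' *[B] g) \<cdot> (P2 N (Pc L g' g) <| lam b'')
   = (om g <| P1 S g') \<cdot> (P1 N (P1 L g) |> om g')"
   by (rule om_comp) (use a in simp_all)
  show ?thesis
  proof (rule M.iso2_cancel_left[of "om (g' *[B] g)"])
   show "om (g' *[B] g) \<cdot> ((P2 N (Pc L g' g) <| lam b'') \<cdot> ((P1 N (P1 L g) |> inv2 M (om g')) \<cdot> (inv2 M (om g) <| P1 S g')))
    = om (g' *[B] g) \<cdot> inv2 M (om (g' *[B] g))"
    using a by (simp add: M.vreassoc[OF q])
  qed (use a in simp_all)
 qed
 have c': "((P1 N f' \<odot> (P1 N f \<odot> P1 N k)) |> (P2 N (Pc L g' g) <| lam b'')) \<cdot>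
   (((P1 N f' \<odot> (P1 N f \<odot> (P1 N k \<odot> P1 N (P1 L g)))) |> inv2 M (om g')) \<cdot>
   ((P1 N f' \<odot> (P1 N f \<odot> P1 N k)) |> (inv2 M (om g) <| P1 S g')))
  = (P1 N f' \<odot> (P1 N f \<odot> P1 N k)) |> inv2 M (om (g' *[B] g))"
  using arg_cong[OF c, of "%z. (P1 N f' \<odot> (P1 N f \<odot> P1 N k)) |> z"] a by simp
 show "Thcell (f *[H] f') (g' *[B] g) k \<cdot> (P1 N (f *[H] f') |> (rh (src B (g' *[B] g)) k <| P1 S (g' *[B] g)))
  = (F_ar (Ph b'' X'') (Pc L g' g <|[H] (k *[H] (f *[H] f')))
  \<cdot> (Thcell f' g' (P1 L g *[H] (k *[H] f)) \<cdot> (P1 N f' |> (Thcell f g k <| P1 S g'))))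
  \<cdot> (P1 N (f *[H] f') |> (rh (src B (g' *[B] g)) k <| P1 S (g' *[B] g)))"
  using a t1(1-4) t2(1-4) by (simp add: t3' u1 M.vreassoc[OF u2] M.vreassoc[OF r] c')
qed (use assms B.one_simps[of g] B.one_simps[of g'] H.one_simps[of f] H.one_simps[of f'] Thcell[of f g k] Thcell[of "f *[H] f'" "g' *[B] g" k] Thcell[of f' g' "P1 L g *[H] (k *[H] f)"] in simp_all)

lemma Thcell_id:
 assumes "f : one H" "b : ob B" "k : one H" "src H k = trg H f" "trg H k = l b" "src H f = X'"
 shows "Thcell f (id1 B b) k \<cdot> (P1 N f |> rh b k)
  = F_ar (Ph b X') (Pu L b <|[H] (k *[H] f)) \<cdot> rh b (k *[H] f)"
proof -
 have X: "X' : ob H" using assms by auto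
 have o: "inv2 M (om (id1 B b)) = P2 N (Pu L b) <| lam b"
  by (rule M.inv2_eqI) (use assms om_unit[of b] in simp_all)
 have r: "F_ar (Ph b X') (Pu L b <|[H] (k *[H] f)) \<cdot> rh b (k *[H] f)
  = rh b (P1 L (id1 B b) *[H] (k *[H] f)) \<cdot> ((P1 N f \<odot> P1 N k) |> (P2 N (Pu L b) <| lam b))"
  using rh_nat[of b "Pu L b <|[H] (k *[H] f)" _ _ X', OF _ _ refl refl] assms X by simp
 show ?thesis
  using Thcell(5)[of f "id1 B b" k] assms X by (simp add: o r)
qed

end

lemma hom_family_simps [simp]:
 "[|X : ob H; b : ob B|] ==> P0 (hom_family B H L) (X, b) = hom H X (P0 L b)"
 "[|f : one H; g : one B|] ==> P1 (hom_family B H L) (f, g) = hom_map H f (P1 L g)"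
 "[|ph : two H; gm : two B|] ==> P2 (hom_family B H L) (ph, gm) = hom_map2 H ph (P2 L gm)"
 "[|f : one H; f' : one H; trg H f' = src H f; g : one B; g' : one B; trg B g = src B g'|] ==>
  Pc (hom_family B H L) (f', g') (f, g) = hom_map2 H (id2 H (f *[H] f')) (Pc L g' g)"
 "[|X : ob H; b : ob B|] ==> Pu (hom_family B H L) (X, b) = hom_map2 H (id2 H (id1 H X)) (Pu L b)"
 by (simp_all add: hom_family_def)

context param
begin

definition fam where
 "fam = strict (prod2 (op2 H) B) CAT (%(x, y). hom M (P0 S y) (P0 N x))
  (%(f, g). hom_map M (P1 S g) (P1 N f)) (%(ph, gm). hom_map2 M (P2 S gm) (P2 N ph))"

lemma sfun_fam: "sfun (prod2 (op2 H) B) CAT fam"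
 unfolding fam_def by (rule sfun_hom_bifunctor) unfold_locales

lemma fam_simps [simp]:
 "[|X : ob H; b : ob B|] ==> P0 fam (X, b) = hom M (P0 S b) (P0 N X)"
 "[|f : one H; g : one B|] ==> P1 fam (f, g) = hom_map M (P1 S g) (P1 N f)"
 "[|ph : two H; gm : two B|] ==> P2 fam (ph, gm) = hom_map2 M (P2 S gm) (P2 N ph)"
 "[|f : one H; f' : one H; trg H f' = src H f; g : one B; g' : one B; trg B g = src B g'|] ==>
  Pc fam (f', g') (f, g) = nt_id (hom_map M (P1 S (g' *[B] g)) (P1 N (f *[H] f')))"
 "[|X : ob H; b : ob B|] ==> Pu fam (X, b) = nt_id (ftor_id (hom M (P0 S b) (P0 N X)))"
 by (simp_all add: fam_def)

lemma prod_two_category: "two_category (prod2 (op2 H) B)"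
 by (rule two_category_prod2[OF two_category_op2]) unfold_locales

end

context representing_psf
begin

definition Th where
 "Th = \<lparr>C1 = (%(X, b). Ph b X), C2 = (%(f, g). \<lparr>
   T_src = ftor_comp (hom_map M (P1 S g) (P1 N f)) (Ph (src B g) (trg H f)),
   T_trg = ftor_comp (Ph (trg B g) (src H f)) (hom_map H f (P1 L g)),
   T_at = (\<lambda>k\<in>Ob (hom H (trg H f) (l (src B g))). Thcell f g k)\<rparr>)\<rparr>"

lemma Th_simps [simp]:
 "C1 Th (X, b) = Ph b X"
 "T_src (C2 Th (f, g)) = ftor_comp (hom_map M (P1 S g) (P1 N f)) (Ph (src B g) (trg H f))"
 "T_trg (C2 Th (f, g)) = ftor_comp (Ph (trg B g) (src H f)) (hom_map H f (P1 L g))"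
 "[|k : one H; src H k = trg H f; trg H k = l (src B g)|] ==> T_at (C2 Th (f, g)) k = Thcell f g k"
 by (simp_all add: Th_def)

lemma C2_Th_in:
 assumes "f : one H" "g : one B"
 shows "nt_in (C2 Th (f, g)) (ftor_comp (hom_map M (P1 S g) (P1 N f)) (Ph (src B g) (trg H f)))
  (ftor_comp (Ph (trg B g) (src H f)) (hom_map H f (P1 L g)))"
proof (rule nt_inI[OF ftor_in_comp ftor_in_comp])
 show "ftor_in (Ph (src B g) (trg H f)) (hom H (trg H f) (l (src B g))) (hom M (P0 S (src B g)) (P0 N (trg H f)))"
  "ftor_in (Ph (trg B g) (src H f)) (hom H (src H f) (l (trg B g))) (hom M (P0 S (trg B g)) (P0 N (src H f)))"
  "ftor_in (hom_map M (P1 S g) (P1 N f)) (hom M (P0 S (src B g)) (P0 N (trg H f))) (hom M (P0 S (trg B g)) (P0 N (src H f)))"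
  "ftor_in (hom_map H f (P1 L g)) (hom H (trg H f) (l (src B g))) (hom H (src H f) (l (trg B g)))"
  using assms by simp_all
next
 fix kk assume "kk : Ar (hom H (trg H f) (l (src B g)))"
 then have k: "kk : two H" "src H (dm H kk) = trg H f" "trg H (dm H kk) = l (src B g)" by auto
 note t = Thcell[of f g "dm H kk"] Thcell[of f g "cd H kk"]
 show "Cmp (hom M (P0 S (trg B g)) (P0 N (src H f))) (F_ar (ftor_comp (Ph (trg B g) (src H f)) (hom_map H f (P1 L g))) kk)
     (T_at (C2 Th (f, g)) (Dom (hom H (trg H f) (l (src B g))) kk)) =
    Cmp (hom M (P0 S (trg B g)) (P0 N (src H f))) (T_at (C2 Th (f, g)) (Cod (hom H (trg H f) (l (src B g))) kk))
     (F_ar (ftor_comp (hom_map M (P1 S g) (P1 N f)) (Ph (src B g) (trg H f))) kk)"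
  using k assms Thcell_natural_arg[OF assms k(1) refl refl k(2,3) refl refl refl refl] by simp
qed (use assms Thcell[of f g] in "simp_all, simp add: Th_def hom_def")

lemma Th_equivalence: "cat_pseudonatural_equivalence (prod2 (op2 H) B) (hom_family B H L) fam Th"
proof -
 interpret G: sfun "prod2 (op2 H) B" CAT fam by (rule sfun_fam)
 interpret F: psf "prod2 (op2 H) B" CAT "hom_family B H L" by (rule psf_hom_family) unfold_locales
 interpret cpn "prod2 (op2 H) B" "hom_family B H L" fam Th
 proof (rule cpnI[OF prod_two_category F.psf_axioms' G.psf_axioms'])
  show "ftor_in (C1 Th x) (P0 (hom_family B H L) x) (P0 fam x)" if "x : ob (prod2 (op2 H) B)" for x
   using that by (cases x) simp
  show "nt_in (C2 Th f) (ftor_comp (P1 fam f) (C1 Th (src (prod2 (op2 H) B) f)))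
    (ftor_comp (C1 Th (trg (prod2 (op2 H) B) f)) (P1 (hom_family B H L) f))" if "f : one (prod2 (op2 H) B)" for f
   using that by (cases f) (simp add: C2_Th_in)
 qed
 have "cat_pseudonatural (prod2 (op2 H) B) (hom_family B H L) fam Th"
 proof (rule cat_pseudonaturalI, goal_cases)
  case (1 fg)
  then obtain f g where fg: "fg = (f, g)" "f : one H" "g : one B" by (cases fg) simp
  show ?case unfolding fg(1)
   by (rule M.nat_iso_homI[OF C2_Th_in[OF fg(2,3)]]) (use fg Thcell[of f g] in simp_all)
 next
  case (2 ch k)
  obtain ph gm where x: "ch = (ph, gm)" "ph : two H" "gm : two B" using 2(1) by (cases ch) simp
  show ?case using 2 x(2,3) Thcell_natural[OF x(2,3) _ refl refl refl refl refl refl refl refl, of k]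
   unfolding x(1) by simp
 next
  case (3 f g k)
  obtain f1 f2 where f: "f = (f1, f2)" "f1 : one H" "f2 : one B" using 3(1) by (cases f) simp
  obtain g1 g2 where g: "g = (g1, g2)" "g1 : one H" "g2 : one B" using 3(2) by (cases g) simp
  have k: "trg H g1 = src H f1" "trg B f2 = src B g2" "k : one H" "src H k = trg H f1" "trg H k = l (src B f2)"
   using 3(3,4) f g by simp_all
  show ?case unfolding f(1) g(1)
   using f(2,3) g(2,3) k Thcell_comp[OF f(2) g(2) f(3) g(3) k(3,1,2,4,5) refl refl]
    Thcell(1-4)[of f1 f2 k] Thcell(1-4)[of g1 g2 "P1 L f2 *[H] (k *[H] f1)"] by simp
 next
  case (4 x k)
  obtain X b where x: "x = (X, b)" "X : ob H" "b : ob B" using 4(1) by (cases x) simp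
  have k: "k : one H" "src H k = X" "trg H k = l b" using 4 x by simp_all
  have "Thcell (id1 H X) (id1 B b) k = F_ar (Ph b X) (Pu L b <|[H] k)"
  proof (rule M.iso2_cancel_right[of _ "rh b k"])
   show "Thcell (id1 H X) (id1 B b) k \<cdot> rh b k = F_ar (Ph b X) (Pu L b <|[H] k) \<cdot> rh b k"
    using Thcell_id[of "id1 H X" b k X] x(2,3) k by simp
  qed (use x(2,3) k Thcell[of "id1 H X" "id1 B b" k] in simp_all)
  then show ?case unfolding x(1)
   using x(2,3) k Thcell[of "id1 H X" "id1 B b" k] by simp
 qed
 moreover have "equivalence_of_categories (C1 Th x)" if "x : ob (prod2 (op2 H) B)" for x
  using that equivalence_if_hom_equiv[OF H.tcat M.tcat Ph]
  by (cases x) simp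
 ultimately show ?thesis by (simp add: cat_pseudonatural_equivalence_def)
qed

end

locale bilimit_choice = param +
 fixes l th
 assumes l [simp]: "b : ob B ==> l b : ob H"
  and th: "b : ob B ==> cat_pseudonatural_equivalence (op2 H) (corep H (l b))
   (psf_comp (op2 H) CAT (rep M (P0 S b)) N) (th b)"
begin

definition Ph where "Ph b X = C1 (th b) X"
definition lam where "lam b = F_ob (Ph b (l b)) (id1 H (l b))"
definition rh where "rh b k = T_at (C2 (th b) k) (id1 H (l b))"

lemma th_cpn: assumes "b : ob B"
 shows "cpn_full (op2 H) (corep H (l b)) (psf_comp (op2 H) CAT (rep M (P0 S b)) N) (th b)"
 using th[OF assms] two_category_op2[OF H.tcat]
 by (intro cpn_fullI) (simp_all add: cat_pseudonatural_equivalence_def)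

lemma Ph_equiv: assumes "b : ob B" "X : ob H"
 shows "hom_equiv H X (l b) M (P0 S b) (P0 N X) (Ph b X)"
proof -
 interpret t: cpn_full "op2 H" "corep H (l b)" "psf_comp (op2 H) CAT (rep M (P0 S b)) N" "th b"
  by (rule th_cpn[OF assms(1)])
 have "ftor_in (Ph b X) (hom H X (l b)) (hom M (P0 S b) (P0 N X))"
  using t.C1_in[of X] assms by (simp add: Ph_def)
 then show ?thesis using th[OF assms(1)] assms
  by (intro hom_equiv_if_equivalence) (simp_all add: cat_pseudonatural_equivalence_def Ph_def H.tcat M.tcat)
qed

lemma th2:
 assumes b: "b : ob B" and f: "f : one H" "k : one H" "src H k = trg H f" "trg H k = l b"
 shows "iso2 M (T_at (C2 (th b) f) k)" "T_at (C2 (th b) f) k : two M"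
  "dm M (T_at (C2 (th b) f) k) = P1 N f \<odot> F_ob (Ph b (trg H f)) k"
  "cd M (T_at (C2 (th b) f) k) = F_ob (Ph b (src H f)) (k *[H] f)"
  "T_at (C2 (th b) f) k \<cdot> (P1 N f |> rh b k) = rh b (k *[H] f)"
proof -
 interpret t: cpn_full "op2 H" "corep H (l b)" "psf_comp (op2 H) CAT (rep M (P0 S b)) N" "th b"
  by (rule th_cpn[OF assms(1)])
 interpret G: sfun "op2 H" CAT "psf_comp (op2 H) CAT (rep M (P0 S b)) N"
  by (rule sfun_psf_comp[OF N.sfun_axioms M.sfun_rep]) (use b in simp)
 note e = ftor_inD(2,3,6-10)[OF hom_equivD(1)[OF Ph_equiv[OF b]]]
 have n: "nt_in (C2 (th b) f) (ftor_comp (hom_map M (id1 M (P0 S b)) (P1 N f)) (Ph b (trg H f)))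
  (ftor_comp (Ph b (src H f)) (hom_map H f (id1 H (l b))))" if "f : one H" for f
  using t.C2_in[of f] that b by (simp add: Ph_def)
 have a: "iso2 M (T_at (C2 (th b) f) k) & T_at (C2 (th b) f) k : two M &
  dm M (T_at (C2 (th b) f) k) = P1 N f \<odot> F_ob (Ph b (trg H f)) k &
  cd M (T_at (C2 (th b) f) k) = F_ob (Ph b (src H f)) (k *[H] f)"
  if "f : one H" "k : one H" "src H k = trg H f" "trg H k = l b" for f k
 proof -
  have o: "F_ob (Ph b (trg H f)) k : one M" "src M (F_ob (Ph b (trg H f)) k) = P0 S b"
   "trg M (F_ob (Ph b (trg H f)) k) = P0 N (trg H f)"
   using e(3)[of "trg H f" k] that by simp_all
  have "iso2 M (T_at (C2 (th b) f) k)"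
  proof (rule M.nat_iso_homD[where x = "P0 S b" and y = "P0 N (src H f)"])
   show "nat_iso (C2 (th b) f)" using t.C2[of f] that by simp
   show "F_trg (T_src (C2 (th b) f)) = hom M (P0 S b) (P0 N (src H f))"
    "k : Ob (F_src (T_src (C2 (th b) f)))"
    unfolding nt_inD(2)[OF n[OF that(1)]] using that e b by simp_all
  qed
  moreover note nt_inD(8-10)[OF n[OF that(1)], of k]
  ultimately show ?thesis using that e b o by simp
 qed
 show "iso2 M (T_at (C2 (th b) f) k)" "T_at (C2 (th b) f) k : two M"
  "dm M (T_at (C2 (th b) f) k) = P1 N f \<odot> F_ob (Ph b (trg H f)) k"
  "cd M (T_at (C2 (th b) f) k) = F_ob (Ph b (src H f)) (k *[H] f)"
  using a[OF f] by auto
 have i: "id1 H (l b) : one H" "src H (id1 H (l b)) = l b" "trg H (id1 H (l b)) = l b" using b by simp_all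
 have o: "lam b : one M" "src M (lam b) = P0 S b" "trg M (lam b) = P0 N (l b)"
  using e(3)[of "l b" "id1 H (l b)"] b by (simp_all add: lam_def)
 have o': "F_ob (Ph b X) k : one M" "src M (F_ob (Ph b X) k) = P0 S b" "trg M (F_ob (Ph b X) k) = P0 N X"
  if "X : ob H" "k : one H" "src H k = X" "trg H k = l b" for X k
  using e(3)[of X k] that by simp_all
 show "T_at (C2 (th b) f) k \<cdot> (P1 N f |> rh b k) = rh b (k *[H] f)"
  using t.comp[of k f "l b" "src H f" "id1 H (l b)"] f b a[of k "id1 H (l b)"] a[of "k *[H] f" "id1 H (l b)"] a[OF f] o
   o'[of "src H f" "k *[H] f"] o'[of "trg H f" k] e(7)[of "src H f" "k *[H] f"]
   N.Pc_id[of k f]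
  by (simp add: G.Pc_id rh_def lam_def Ph_def[symmetric])
qed

sublocale representing_family H B M N S l Ph lam rh
proof (unfold_locales, goal_cases)
 case (2 b X) then show ?case by (rule Ph_equiv)
next
 case (4 b k) then show ?case using th2(1)[of b k "id1 H (l b)"] by (simp add: rh_def)
next
 case (5 b k) then show ?case using th2(3)[of b k "id1 H (l b)"] by (simp add: rh_def lam_def)
next
 case (6 b k) then show ?case using th2(4)[of b k "id1 H (l b)"] by (simp add: rh_def)
next
 case (7 b ph k k' X)
 interpret t: cpn_full "op2 H" "corep H (l b)" "psf_comp (op2 H) CAT (rep M (P0 S b)) N" "th b"
  by (rule th_cpn[OF 7(1)])
 have k: "k : one H" "X : ob H" using 7 H.two_simps(1)[of ph] H.one_simps(1)[of k] by auto
 have o: "lam b : one M" "src M (lam b) = P0 S b" "trg M (lam b) = P0 N (l b)"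
  using ftor_inD(6)[OF hom_equivD(1)[OF Ph_equiv], of b "l b" "id1 H (l b)"] 7 by (simp_all add: lam_def)
 show ?case
  using t.natural[of ph "l b" X "id1 H (l b)"] 7 k o by (simp add: rh_def Ph_def[symmetric] lam_def[symmetric])
qed (simp_all add: lam_def)

text \<open>At \<open>(X, id)\<close> the conjugated constraint cells reduce to those of the given \<open>th b\<close>
 and the unit constraint of \<open>L\<close>.\<close>

lemma ex_extension:
 "EX L Th. psf B H L & cat_pseudonatural_equivalence (prod2 (op2 H) B) (hom_family B H L) fam Th
  & extends_bilimits B H L Th l th"
proof -
 obtain L om where u: "universal_psf H B M N S l lam L om" using ex_universal_psf by blast
 interpret u: universal_psf H B M N S l lam L om by (rule u)
 interpret r: representing_psf H B M N S l Ph lam rh L om by unfold_locales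
 have "extends_bilimits B H L r.Th l th"
  unfolding extends_bilimits_def
 proof (intro ballI conjI)
  fix b X assume b: "b : ob B"
  show "P0 L b = l b" using b by simp
  show "C1 r.Th (X, b) = C1 (th b) X" by (simp add: Ph_def)
 next
  fix b f assume b: "b : ob B" and f: "f : one H"
  interpret t: cpn_full "op2 H" "corep H (l b)" "psf_comp (op2 H) CAT (rep M (P0 S b)) N" "th b"
   by (rule th_cpn[OF b])
  have i: "id1 B b : one B" "src B (id1 B b) = b" "trg B (id1 B b) = b" using b by simp_all
  have n: "nt_in (C2 (th b) f) (ftor_comp (hom_map M (id1 M (P0 S b)) (P1 N f)) (Ph b (trg H f)))
   (ftor_comp (Ph b (src H f)) (hom_map H f (id1 H (l b))))"
   using t.C2_in[of f] f b by (simp add: Ph_def)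
  have p: "nt_in (hom_map2 H (id2 H f) (Pu L b)) (hom_map H f (id1 H (l b))) (hom_map H f (P1 L (id1 B b)))"
   using b f by simp
  have q: "nt_in (nt_vcomp (nt_hcomp (nt_id (C1 (th b) (src H f))) (hom_map2 H (id2 H f) (Pu L b))) (C2 (th b) f))
   (ftor_comp (hom_map M (id1 M (P0 S b)) (P1 N f)) (Ph b (trg H f)))
   (ftor_comp (Ph b (src H f)) (hom_map H f (P1 L (id1 B b))))"
   unfolding Ph_def[symmetric]
   by (rule nt_in_vcomp[OF n nt_in_hcomp[OF p H.ftor_in_hom_map nt_in_id[OF Ph_simps(9)] Ph_simps(9)]]) (use b f in simp_all)
  show "C2 r.Th (f, id1 B b) = nt_vcomp (nt_hcomp (nt_id (C1 (th b) (src H f))) (hom_map2 H (id2 H f) (Pu L b))) (C2 (th b) f)"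
  proof (rule nt_in_eqI[OF r.C2_Th_in[OF f i(1), unfolded i S_simps(8)[OF b]] q])
   fix k assume "k : Ob (F_src (ftor_comp (hom_map M (id1 M (P0 S b)) (P1 N f)) (Ph b (trg H f))))"
   then have k: "k : one H" "src H k = trg H f" "trg H k = l b" using b f by simp_all
   note t2 = th2[OF b f k]
   have "r.Thcell f (id1 B b) k = F_ar (Ph b (src H f)) (Pu L b <|[H] (k *[H] f)) \<cdot> T_at (C2 (th b) f) k"
   proof (rule M.iso2_cancel_right[of _ "P1 N f |> rh b k"])
    show "r.Thcell f (id1 B b) k \<cdot> (P1 N f |> rh b k)
     = (F_ar (Ph b (src H f)) (Pu L b <|[H] (k *[H] f)) \<cdot> T_at (C2 (th b) f) k) \<cdot> (P1 N f |> rh b k)"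
     using r.Thcell_id[OF f b k(1,2,3) refl] t2 b f k by simp
   qed (use r.Thcell[OF f i(1) k(1,2)] t2(1-4) b f k in simp_all)
   moreover have "F_ar (Ph b (src H f)) (T_at (hom_map2 H (id2 H f) (Pu L b)) k) = F_ar (Ph b (src H f)) (Pu L b <|[H] (k *[H] f))"
    using b f k by simp
   ultimately show "T_at (C2 r.Th (f, id1 B b)) k = T_at (nt_vcomp (nt_hcomp (nt_id (C1 (th b) (src H f))) (hom_map2 H (id2 H f) (Pu L b))) (C2 (th b) f)) k"
    using b f k t2 nt_inD(2,3)[OF n] unfolding Ph_def[symmetric] by simp
  qed
 qed
 then show ?thesis using r.Th_equivalence u.L.psf_axioms' by blast
qed

end

text \<open>A jointly pseudonatural equivalence determines universal elements and constraint cells.\<close>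

locale joint_family = param H B M N S + L: psf B H L
 for H :: "('h, 'f, 't) two_cat" and B :: "('b, 'g, 'u) two_cat" and M :: "('m, 'p, 'q) two_cat" (structure)
  and N S L +
 fixes Th
 assumes Th: "cat_pseudonatural_equivalence (prod2 (op2 H) B) (hom_family B H L) fam Th"
begin

sublocale cpn_full "prod2 (op2 H) B" "hom_family B H L" fam Th
 using Th prod_two_category by (intro cpn_fullI) (simp_all add: cat_pseudonatural_equivalence_def)

definition Ph where "Ph b X = C1 Th (X, b)"
definition gam where "gam f g k = T_at (C2 Th (f, g)) k"
definition lam where "lam b = F_ob (Ph b (P0 L b)) (id1 H (P0 L b))"
definition rh where "rh b k = F_ar (Ph b (src H k)) (inv2 H (Pu L b) <|[H] k) \<cdot> gam k (id1 B b) (id1 H (P0 L b))"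
definition om where "om g = inv2 M (gam (id1 H (P0 L (src B g))) g (id1 H (P0 L (src B g)))) \<cdot> rh (trg B g) (P1 L g)"

lemma Ph_equiv:
 assumes "b : ob B" "X : ob H"
 shows "hom_equiv H X (P0 L b) M (P0 S b) (P0 N X) (Ph b X)"
proof -
 have "(X, b) : ob (prod2 (op2 H) B)" using assms by simp
 moreover have "ftor_in (Ph b X) (hom H X (P0 L b)) (hom M (P0 S b) (P0 N X))"
  using C1_in[of "(X, b)"] assms by (simp add: Ph_def)
 ultimately show ?thesis using Th assms
  by (intro hom_equiv_if_equivalence)
   (simp_all add: cat_pseudonatural_equivalence_def Ph_def H.tcat M.tcat)
qed

lemma Ph_simps [simp]:
 assumes b: "b : ob B" and X: "X : ob H"
 shows "[|k : one H; src H k = X; trg H k = P0 L b|] ==> F_ob (Ph b X) k : one M"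
  "[|k : one H; src H k = X; trg H k = P0 L b|] ==> src M (F_ob (Ph b X) k) = P0 S b"
  "[|k : one H; src H k = X; trg H k = P0 L b|] ==> trg M (F_ob (Ph b X) k) = P0 N X"
  "[|ph : two H; src H (dm H ph) = X; trg H (dm H ph) = P0 L b|] ==> F_ar (Ph b X) ph : two M"
  "[|ph : two H; src H (dm H ph) = X; trg H (dm H ph) = P0 L b|] ==> dm M (F_ar (Ph b X) ph) = F_ob (Ph b X) (dm H ph)"
  "[|ph : two H; src H (dm H ph) = X; trg H (dm H ph) = P0 L b|] ==> cd M (F_ar (Ph b X) ph) = F_ob (Ph b X) (cd H ph)"
  "F_src (Ph b X) = hom H X (P0 L b)" "F_trg (Ph b X) = hom M (P0 S b) (P0 N X)"
  "[|k : one H; src H k = X; trg H k = P0 L b|] ==> F_ar (Ph b X) (id2 H k) = id2 M (F_ob (Ph b X) k)"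
 using ftor_inD(2,3,6-10)[OF hom_equivD(1)[OF Ph_equiv[OF b X]]] by auto

lemma Ph_vcomp:
 assumes "b : ob B" "X : ob H" "ph : two H" "ps : two H" "src H (dm H ph) = X" "trg H (dm H ph) = P0 L b" "cd H ph = dm H ps"
 shows "F_ar (Ph b X) ps \<cdot> F_ar (Ph b X) ph = F_ar (Ph b X) (ps .[H] ph)"
proof -
 have "src H (dm H ps) = X" "trg H (dm H ps) = P0 L b" using assms H.two_simps(3,4)[of ph] by auto
 then show ?thesis using ftor_inD(11)[OF hom_equivD(1)[OF Ph_equiv[OF assms(1,2)]], of ph ps] assms by simp
qed

lemma Ph_iso [simp]:
 assumes "b : ob B" "X : ob H" "iso2 H ph" "src H (dm H ph) = X" "trg H (dm H ph) = P0 L b"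
 shows "iso2 M (F_ar (Ph b X) ph)"
proof -
 have i: "inv2 H ph : two H" "src H (dm H (inv2 H ph)) = X" "trg H (dm H (inv2 H ph)) = P0 L b" "ph : two H"
  using assms H.two_simps(3,4)[of ph] by auto
 show ?thesis
  by (rule M.iso2I[of _ "F_ar (Ph b X) (inv2 H ph)"]) (use assms i in "simp_all add: Ph_vcomp")
qed

lemma lam_simps [simp]:
 assumes "b : ob B" shows "lam b : one M" "src M (lam b) = P0 S b" "trg M (lam b) = P0 N (P0 L b)"
 using assms by (simp_all add: lam_def)

lemma gam [simp]:
 assumes f: "f : one H" "g : one B" "k : one H" "src H k = trg H f" "trg H k = P0 L (src B g)"
 shows "iso2 M (gam f g k)" "gam f g k : two M"
  "dm M (gam f g k) = P1 N f \<odot> (F_ob (Ph (src B g) (trg H f)) k \<odot> P1 S g)"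
  "cd M (gam f g k) = F_ob (Ph (trg B g) (src H f)) (P1 L g *[H] (k *[H] f))"
proof -
 have fg: "(f, g) : one (prod2 (op2 H) B)" using f by simp
 have n: "nt_in (C2 Th (f, g)) (ftor_comp (hom_map M (P1 S g) (P1 N f)) (Ph (src B g) (trg H f)))
  (ftor_comp (Ph (trg B g) (src H f)) (hom_map H f (P1 L g)))"
  using C2_in[OF fg] f by (simp add: Ph_def)
 have o: "src B g : ob B" "trg B g : ob B" "trg H f : ob H" "src H f : ob H" using f by simp_all
 show "iso2 M (gam f g k)" unfolding gam_def
 proof (rule M.nat_iso_homD[where x = "P0 S (trg B g)" and y = "P0 N (src H f)"])
  show "nat_iso (C2 Th (f, g))" using C2[OF fg] by simp
  show "F_trg (T_src (C2 Th (f, g))) = hom M (P0 S (trg B g)) (P0 N (src H f))"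
   "k : Ob (F_src (T_src (C2 Th (f, g))))"
   unfolding nt_inD(2)[OF n] using f o by simp_all
 qed
 then show "gam f g k : two M" by simp
 show "dm M (gam f g k) = P1 N f \<odot> (F_ob (Ph (src B g) (trg H f)) k \<odot> P1 S g)"
  "cd M (gam f g k) = F_ob (Ph (trg B g) (src H f)) (P1 L g *[H] (k *[H] f))"
  using nt_inD(9,10)[OF n, of k] f o by (simp_all add: gam_def)
qed

lemma gam_arg:
 assumes f: "f : one H" "g : one B" "kk : two H" "dm H kk = k" "cd H kk = k'" "src H k = trg H f" "trg H k = P0 L (src B g)"
  "src B g = b" "trg B g = b'" "trg H f = X" "src H f = X'"
 shows "gam f g k' \<cdot> (P1 N f |> (F_ar (Ph b X) kk <| P1 S g))
  = F_ar (Ph b' X') (P1 L g |>[H] (kk <|[H] f)) \<cdot> gam f g k"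
proof -
 have fg: "(f, g) : one (prod2 (op2 H) B)" using f by simp
 have o: "src B g : ob B" "trg B g : ob B" "trg H f : ob H" "src H f : ob H" using f(1,2) by simp_all
 have n: "nt_in (C2 Th (f, g)) (ftor_comp (hom_map M (P1 S g) (P1 N f)) (Ph (src B g) (trg H f)))
  (ftor_comp (Ph (trg B g) (src H f)) (hom_map H f (P1 L g)))"
  using C2_in[OF fg] f(1,2) by (simp add: Ph_def)
 have k: "k : one H" "k' : one H" "src H k' = trg H f" "trg H k' = P0 L (src B g)"
  using f H.two_simps[of kk] by auto
 show ?thesis unfolding gam_def
  using nt_inD(11)[OF n, of kk] f(1,2,3,6,7) o k unfolding f(8-11)[symmetric] by (simp add: f(4,5))
qed

lemma gam_nat:
 assumes "ph : two H" "gm : two B" "k : one H" "dm H ph = f" "cd H ph = f'" "dm B gm = g" "cd B gm = g'"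
  "src B g = b" "trg B g = b'" "trg H f = X" "src H f = X'" "src H k = X" "trg H k = P0 L b"
 shows "gam f' g' k \<cdot> (P2 N ph \<star> (F_ob (Ph b X) k |> P2 S gm))
  = F_ar (Ph b' X') (P2 L gm **[H] (k |>[H] ph)) \<cdot> gam f g k"
proof -
 have fg: "f : one H" "g : one B" using assms(1,2,4,6) by auto
 have o: "b : ob B" "b' : ob B" "X : ob H" "X' : ob H" using fg assms(8-11) by auto
 show ?thesis
  using natural[of "(ph, gm)" "(X, b)" "(X', b')" k] assms o fg by (simp add: Ph_def[symmetric] gam_def[symmetric])
qed

lemma gam_comp:
 assumes "f : one H" "f' : one H" "g : one B" "g' : one B" "k : one H" "trg H f' = src H f" "trg B g = src B g'"
  "src H k = trg H f" "trg H k = P0 L (src B g)" "src H f' = X''" "trg B g' = b''"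
 shows "gam (f *[H] f') (g' *[B] g) k = F_ar (Ph b'' X'') (Pc L g' g <|[H] (k *[H] (f *[H] f')))
  \<cdot> (gam f' g' (P1 L g *[H] (k *[H] f)) \<cdot> (P1 N f' |> (gam f g k <| P1 S g')))"
proof -
 have o: "src B g : ob B" "src B g' : ob B" "b'' : ob B" "X'' : ob H" "trg H f : ob H" "src H f : ob H"
  using assms by auto
 note t = gam[of f g k] gam[of f' g' "P1 L g *[H] (k *[H] f)"] gam[of "f *[H] f'" "g' *[B] g" k]
 have p: "(f, g) : one (prod2 (op2 H) B)" "(f', g') : one (prod2 (op2 H) B)"
  "trg (prod2 (op2 H) B) (f, g) = src (prod2 (op2 H) B) (f', g')"
  "src (prod2 (op2 H) B) (f, g) = (trg H f, src B g)" "trg (prod2 (op2 H) B) (f', g') = (X'', b'')"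
  "k : Ob (P0 (hom_family B H L) (trg H f, src B g))"
  using assms o by simp_all
 show ?thesis
  using comp[OF p] assms o t by (simp add: Ph_def[symmetric] gam_def[symmetric])
qed

lemma gam_id:
 assumes "b : ob B" "X : ob H" "k : one H" "src H k = X" "trg H k = P0 L b"
 shows "gam (id1 H X) (id1 B b) k = F_ar (Ph b X) (Pu L b <|[H] k)"
 using unit[of "(X, b)" k] assms gam[of "id1 H X" "id1 B b" k] by (simp add: Ph_def[symmetric] gam_def[symmetric])

lemma gam_unit:
 assumes "b : ob B" "k : one H" "trg H k = P0 L b" "src H k = X"
 shows "gam k (id1 B b) (id1 H (P0 L b)) = F_ar (Ph b X) (Pu L b <|[H] k) \<cdot> rh b k"
proof -
 have o: "X : ob H" using assms by auto
 have "F_ar (Ph b X) (Pu L b <|[H] k) \<cdot> F_ar (Ph b X) (inv2 H (Pu L b) <|[H] k) = id2 M (F_ob (Ph b X) (P1 L (id1 B b) *[H] k))"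
  using assms o by (simp add: Ph_vcomp)
 then show ?thesis using assms o by (simp add: rh_def M.vreassoc1)
qed

lemma rh_simps [simp]:
 assumes "b : ob B" "k : one H" "trg H k = P0 L b"
 shows "iso2 M (rh b k)" "rh b k : two M" "dm M (rh b k) = P1 N k \<odot> lam b" "cd M (rh b k) = F_ob (Ph b (src H k)) k"
proof -
 have o: "src H k : ob H" using assms by auto
 show "iso2 M (rh b k)" "rh b k : two M" "dm M (rh b k) = P1 N k \<odot> lam b" "cd M (rh b k) = F_ob (Ph b (src H k)) k"
  using assms o unfolding rh_def lam_def by simp_all
qed

lemma rh_nat:
 assumes "b : ob B" "ph : two H" "dm H ph = k" "cd H ph = k'" "trg H k = P0 L b" "src H k = X"
 shows "rh b k' \<cdot> (P2 N ph <| lam b) = F_ar (Ph b X) ph \<cdot> rh b k"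
proof -
 have k: "k : one H" "k' : one H" "trg H k' = P0 L b" "src H k' = X" "X : ob H"
  using assms H.two_simps[of ph] by auto
 have e: "Pu L b **[H] ph = (Pu L b <|[H] k') .[H] ph" "inv2 H (Pu L b) <|[H] k' : two H"
  "P2 L (id2 B (id1 B b)) = id2 H (P1 L (id1 B b))"
  using H.hcomp_split(1)[of ph "Pu L b"] assms k by simp_all
 have x: "(inv2 H (Pu L b) <|[H] k') .[H] (P1 L (id1 B b) |>[H] ph) = ph .[H] (inv2 H (Pu L b) <|[H] k)"
  using H.exchange[of ph "inv2 H (Pu L b)", OF _ _ _ refl refl refl refl] assms k by simp
 have g: "gam k' (id1 B b) (id1 H (P0 L b)) \<cdot> (P2 N ph <| lam b)
  = F_ar (Ph b X) (P1 L (id1 B b) |>[H] ph) \<cdot> gam k (id1 B b) (id1 H (P0 L b))"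
  using gam_nat[of ph "id2 B (id1 B b)" "id1 H (P0 L b)" k k' "id1 B b" "id1 B b" b b "P0 L b" X] assms k
  by (simp add: lam_def)
 have y: "F_ar (Ph b X) (inv2 H (Pu L b) <|[H] k') \<cdot> F_ar (Ph b X) (P1 L (id1 B b) |>[H] ph)
  = F_ar (Ph b X) ph \<cdot> F_ar (Ph b X) (inv2 H (Pu L b) <|[H] k)"
  using assms k by (simp add: Ph_vcomp x)
 show ?thesis using assms k by (simp add: rh_def g M.vreassoc[OF y] lam_def[symmetric])
qed

text \<open>The transformations \<open>rh\<close> are compatible with restriction along 1-cells of \<open>H\<close> and of \<open>B\<close>.\<close>

lemma rh_restrict:
 assumes "b : ob B" "x : one H" "k : one H" "trg H x = P0 L b" "trg H k = src H x" "src H k = X"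
 shows "gam k (id1 B b) x \<cdot> (P1 N k |> rh b x) = gam (x *[H] k) (id1 B b) (id1 H (P0 L b))"
proof -
 have o: "X : ob H" "src H x : ob H" using assms by auto
 let ?i = "id1 B b" and ?e = "id1 H (P0 L b)"
 have c: "gam (x *[H] k) ?i ?e = F_ar (Ph b X) (Pc L ?i ?i <|[H] (x *[H] k)) \<cdot>
  (gam k ?i (P1 L ?i *[H] x) \<cdot> (P1 N k |> gam x ?i ?e))"
  using gam_comp[of x k ?i ?i ?e X b] assms o by simp
 have a: "gam k ?i (P1 L ?i *[H] x) \<cdot> (P1 N k |> F_ar (Ph b (src H x)) (Pu L b <|[H] x))
  = F_ar (Ph b X) (P1 L ?i |>[H] (Pu L b <|[H] (x *[H] k))) \<cdot> gam k ?i x"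
  using gam_arg[of k ?i "Pu L b <|[H] x" x "P1 L ?i *[H] x" b b "src H x" X] assms o by simp
 have u: "(Pc L ?i ?i <|[H] (x *[H] k)) .[H] (P1 L ?i |>[H] (Pu L b <|[H] (x *[H] k))) = id2 H (P1 L ?i *[H] (x *[H] k))"
  using arg_cong[OF L.Pu_right[of ?i], of "%z. z <|[H] (x *[H] k)"] assms by simp
 have u': "F_ar (Ph b X) (Pc L ?i ?i <|[H] (x *[H] k)) \<cdot> F_ar (Ph b X) (P1 L ?i |>[H] (Pu L b <|[H] (x *[H] k)))
  = id2 M (F_ob (Ph b X) (P1 L ?i *[H] (x *[H] k)))"
  using assms o by (simp add: Ph_vcomp u)
 show ?thesis unfolding c gam_unit[OF assms(1,2,4) refl]
  using assms o by (simp add: M.vreassoc[OF a] M.vreassoc1[OF u'])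
qed

lemma gam_left:
 assumes "b : ob B" "k : one H" "h : one B" "trg H k = P0 L b" "src B h = b" "src H k = X"
 shows "gam k h (id1 H (P0 L b)) = gam (id1 H X) h k \<cdot> (rh b k <| P1 S h)"
proof -
 let ?i = "id1 B b" and ?e = "id1 H (P0 L b)" and ?b' = "trg B h"
 have o: "X : ob H" "?b' : ob B" using assms by auto
 have c: "gam k h ?e = F_ar (Ph ?b' X) (Pc L h ?i <|[H] k) \<cdot>
  (gam (id1 H X) h (P1 L ?i *[H] k) \<cdot> (gam k ?i ?e <| P1 S h))"
  using gam_comp[of k "id1 H X" ?i h ?e X ?b'] assms o by simp
 have a: "gam (id1 H X) h (P1 L ?i *[H] k) \<cdot> (F_ar (Ph b X) (Pu L b <|[H] k) <| P1 S h)
  = F_ar (Ph ?b' X) (P1 L h |>[H] (Pu L b <|[H] k)) \<cdot> gam (id1 H X) h k"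
  using gam_arg[of "id1 H X" h "Pu L b <|[H] k" k "P1 L ?i *[H] k" b ?b' X X] assms o by simp
 have u: "(Pc L h ?i <|[H] k) .[H] (P1 L h |>[H] (Pu L b <|[H] k)) = id2 H (P1 L h *[H] k)"
  using arg_cong[OF L.Pu_right[of h], of "%z. z <|[H] k"] assms by simp
 have u': "F_ar (Ph ?b' X) (Pc L h ?i <|[H] k) \<cdot> F_ar (Ph ?b' X) (P1 L h |>[H] (Pu L b <|[H] k))
  = id2 M (F_ob (Ph ?b' X) (P1 L h *[H] k))"
  using assms o by (simp add: Ph_vcomp u)
 show ?thesis unfolding c gam_unit[OF assms(1,2,4,6)]
  using assms o by (simp add: M.vreassoc[OF a] M.vreassoc1[OF u'])
qed

lemma om_simps [simp]:
 assumes "g : one B"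
 shows "iso2 M (om g)" "om g : two M" "dm M (om g) = P1 N (P1 L g) \<odot> lam (trg B g)"
  "cd M (om g) = lam (src B g) \<odot> P1 S g"
 using assms by (simp_all add: om_def lam_def[symmetric])

lemma gam_right:
 assumes "b : ob B" "k : one H" "h : one B" "trg H k = P0 L b" "src B h = b" "src H k = X" "trg B h = b'"
 shows "gam k h (id1 H (P0 L b)) \<cdot> (P1 N k |> om h) = rh b' (P1 L h *[H] k)"
proof -
 let ?i = "id1 B b'" and ?e = "id1 H (P0 L b)" and ?e' = "id1 H (P0 L b')"
 let ?t = "gam ?e h ?e"
 have o: "X : ob H" "b' : ob B" using assms by auto
 have c: "gam k h ?e = F_ar (Ph b' X) (Pc L ?i h <|[H] k) \<cdot>
  (gam k ?i (P1 L h) \<cdot> (P1 N k |> ?t))"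
  using gam_comp[of ?e k h ?i ?e X b'] assms o by simp
 have r: "gam k ?i (P1 L h) \<cdot> (P1 N k |> rh b' (P1 L h)) = gam (P1 L h *[H] k) ?i ?e'"
  by (rule rh_restrict) (use assms o in simp_all)
 have u: "(Pc L ?i h <|[H] k) .[H] (Pu L b' <|[H] (P1 L h *[H] k)) = id2 H (P1 L h *[H] k)"
  using arg_cong[OF L.Pu_left[of h], of "%z. z <|[H] k"] assms o by simp
 have u': "F_ar (Ph b' X) (Pc L ?i h <|[H] k) \<cdot> F_ar (Ph b' X) (Pu L b' <|[H] (P1 L h *[H] k))
  = id2 M (F_ob (Ph b' X) (P1 L h *[H] k))"
  using assms o by (simp add: Ph_vcomp u)
 have q: "(P1 N k |> ?t) \<cdot> (P1 N k |> om h) = P1 N k |> rh b' (P1 L h)"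
  using assms o by (simp add: om_def)
 have g: "gam (P1 L h *[H] k) ?i ?e' = F_ar (Ph b' X) (Pu L b' <|[H] (P1 L h *[H] k)) \<cdot> rh b' (P1 L h *[H] k)"
  by (rule gam_unit) (use assms o in simp_all)
 have "gam k h ?e \<cdot> (P1 N k |> om h) = F_ar (Ph b' X) (Pc L ?i h <|[H] k) \<cdot>
   (gam k ?i (P1 L h) \<cdot> (P1 N k |> rh b' (P1 L h)))"
  unfolding c using assms o by (simp add: q lam_def[symmetric])
 also have "\<dots> = rh b' (P1 L h *[H] k)"
  unfolding r g using assms o by (simp add: M.vreassoc1[OF u'])
 finally show ?thesis .
qed

sublocale representing_family H B M N S "P0 L" Ph lam rh
 by (unfold_locales) (simp_all add: Ph_equiv rh_nat, simp add: lam_def)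

sublocale universal_psf H B M N S "P0 L" lam L om
proof (unfold_locales, goal_cases)
 case (5 gm g g' b b')
 have o: "g : one B" "g' : one B" "b : ob B" "b' : ob B" "src B g' = b" "trg B g' = b'"
  using 5 B.two_simps[of gm] by auto
 let ?e = "id1 H (P0 L b)"
 have r: "rh b' (P1 L g') \<cdot> (P2 N (P2 L gm) <| lam b') = F_ar (Ph b' (P0 L b)) (P2 L gm) \<cdot> rh b' (P1 L g)"
  by (rule rh_nat) (use 5 o in simp_all)
 have g: "gam ?e g' ?e \<cdot> (lam b |> P2 S gm) = F_ar (Ph b' (P0 L b)) (P2 L gm) \<cdot> gam ?e g ?e"
  using gam_nat[of "id2 H ?e" gm ?e ?e ?e g g' b b' "P0 L b" "P0 L b"] 5 o by (simp add: lam_def)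
 have g': "(lam b |> P2 S gm) \<cdot> inv2 M (gam ?e g ?e) = inv2 M (gam ?e g' ?e) \<cdot> F_ar (Ph b' (P0 L b)) (P2 L gm)"
  by (rule M.iso2_conj[OF g[symmetric]]) (use 5 o in "simp_all add: lam_def[symmetric]")
 show ?case using 5 o by (simp add: om_def r M.vreassoc[OF g'] lam_def[symmetric])
next
 case (6 g h c)
 let ?b = "src B g" and ?b' = "src B h"
 let ?e = "id1 H (P0 L ?b)" and ?e' = "id1 H (P0 L ?b')"
 have o: "?b : ob B" "?b' : ob B" "c : ob B" using 6 by auto
 have t: "gam ?e (h *[B] g) ?e = F_ar (Ph c (P0 L ?b)) (Pc L h g) \<cdot> (gam ?e h (P1 L g) \<cdot> (gam ?e g ?e <| P1 S h))"
  using gam_comp[of ?e ?e g h ?e "P0 L ?b" c] 6 o by simp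
 have l: "gam (P1 L g) h ?e' = gam ?e h (P1 L g) \<cdot> (rh ?b' (P1 L g) <| P1 S h)"
  by (rule gam_left) (use 6 o in simp_all)
 have r: "gam (P1 L g) h ?e' \<cdot> (P1 N (P1 L g) |> om h) = rh c (P1 L h *[H] P1 L g)"
  by (rule gam_right) (use 6 o in simp_all)
 have n: "rh c (P1 L (h *[B] g)) \<cdot> (P2 N (Pc L h g) <| lam c) = F_ar (Ph c (P0 L ?b)) (Pc L h g) \<cdot> rh c (P1 L h *[H] P1 L g)"
  by (rule rh_nat) (use 6 o in simp_all)
 have w: "(gam ?e g ?e <| P1 S h) \<cdot> (om g <| P1 S h) = rh ?b' (P1 L g) <| P1 S h"
  using 6 o by (simp add: om_def lam_def[symmetric])
 have G: "gam ?e (h *[B] g) ?e \<cdot> om (h *[B] g) = rh c (P1 L (h *[B] g))"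
  using 6 o by (simp add: om_def)
 show ?case
 proof (rule M.iso2_cancel_left[of "gam ?e (h *[B] g) ?e"])
  have "gam ?e (h *[B] g) ?e \<cdot> (om (h *[B] g) \<cdot> (P2 N (Pc L h g) <| lam c))
   = F_ar (Ph c (P0 L ?b)) (Pc L h g) \<cdot> rh c (P1 L h *[H] P1 L g)"
   using 6 o by (simp add: M.vreassoc1[OF G] n lam_def[symmetric])
  also have "\<dots> = F_ar (Ph c (P0 L ?b)) (Pc L h g) \<cdot> (gam ?e h (P1 L g) \<cdot> ((gam ?e g ?e <| P1 S h) \<cdot>
   ((om g <| P1 S h) \<cdot> (P1 N (P1 L g) |> om h))))"
   unfolding r[symmetric] l using 6 o by (simp add: M.vreassoc1[OF w] lam_def[symmetric])
  also have "\<dots> = gam ?e (h *[B] g) ?e \<cdot> ((om g <| P1 S h) \<cdot> (P1 N (P1 L g) |> om h))"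
   unfolding t using 6 o by (simp add: lam_def[symmetric])
  finally show "gam ?e (h *[B] g) ?e \<cdot> (om (h *[B] g) \<cdot> (P2 N (Pc L h g) <| lam c))
   = gam ?e (h *[B] g) ?e \<cdot> ((om g <| P1 S h) \<cdot> (P1 N (P1 L g) |> om h))" .
 qed (use 6 o in "simp_all add: lam_def[symmetric]")
next
 case (7 b)
 let ?i = "id1 B b" and ?e = "id1 H (P0 L b)"
 have r: "rh b (P1 L ?i) \<cdot> (P2 N (Pu L b) <| lam b) = F_ar (Ph b (P0 L b)) (Pu L b) \<cdot> rh b ?e"
  by (rule rh_nat) (use 7 in simp_all)
 have g: "gam ?e ?i ?e = F_ar (Ph b (P0 L b)) (Pu L b)"
  using gam_id[of b "P0 L b" ?e] 7 by simp
 have e: "gam ?e ?i ?e \<cdot> om ?i = rh b (P1 L ?i)" using 7 by (simp add: om_def)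
 have i: "rh b ?e = id2 M (lam b)"
  using 7 by (simp add: rh_def g Ph_vcomp lam_def)
 show ?case
 proof (rule M.iso2_cancel_left[of "gam ?e ?i ?e"])
  show "gam ?e ?i ?e \<cdot> (om ?i \<cdot> (P2 N (Pu L b) <| lam b)) = gam ?e ?i ?e \<cdot> id2 M (lam b)"
   using 7 by (simp add: M.vreassoc1[OF e[unfolded g]] r i g lam_def[symmetric])
 qed (use 7 in "simp_all add: lam_def[symmetric]")
qed simp_all

end

section \<open>Cones and families of cones\<close>

locale kan_setup = A: two_category A + B: two_category B + H: two_category H + t: psf A B t + D: psf A H D
 for A :: "('a, 'p, 'q) two_cat" and B :: "('b, 'f, 't) two_cat" and H :: "('h, 'g, 'u) two_cat" (structure) and t D

text \<open>The data of a pseudonatural transformation \<open>B(b,t-) \<rightarrow> H(X,D-)\<close>, spelled out.\<close>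

locale cone = kan_setup A B H t D
 for A :: "('a, 'p, 'q) two_cat" and B :: "('b, 'f, 't) two_cat" and H :: "('h, 'g, 'u) two_cat" (structure) and t D +
 fixes b :: 'b and X :: 'h and c1 :: "'a \<Rightarrow> 'f \<Rightarrow> 'g" and c2 :: "'a \<Rightarrow> 't \<Rightarrow> 'u" and c3 :: "'p \<Rightarrow> 'f \<Rightarrow> 'u"
 assumes bX [simp]: "b : ob B" "X : ob H"
  and c1 [simp]: "[|a : ob A; u : one B; src B u = b; trg B u = P0 t a|] ==> c1 a u : one H"
   "[|a : ob A; u : one B; src B u = b; trg B u = P0 t a|] ==> src H (c1 a u) = X"
   "[|a : ob A; u : one B; src B u = b; trg B u = P0 t a|] ==> trg H (c1 a u) = P0 D a"
  and c2 [simp]: "[|a : ob A; mu : two B; src B (dm B mu) = b; trg B (dm B mu) = P0 t a|] ==> c2 a mu : two H"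
   "[|a : ob A; mu : two B; src B (dm B mu) = b; trg B (dm B mu) = P0 t a|] ==> dm H (c2 a mu) = c1 a (dm B mu)"
   "[|a : ob A; mu : two B; src B (dm B mu) = b; trg B (dm B mu) = P0 t a|] ==> cd H (c2 a mu) = c1 a (cd B mu)"
  and c2_id: "[|a : ob A; u : one B; src B u = b; trg B u = P0 t a|] ==> c2 a (id2 B u) = id2 H (c1 a u)"
  and c2_vcomp: "[|a : ob A; mu : two B; nu : two B; src B (dm B mu) = b; trg B (dm B mu) = P0 t a; cd B mu = dm B nu|] ==>
   c2 a (nu .[B] mu) = c2 a nu \<cdot> c2 a mu"
  and c3 [simp]: "[|f : one A; u : one B; src B u = b; trg B u = P0 t (src A f)|] ==> iso2 H (c3 f u)"
   "[|f : one A; u : one B; src B u = b; trg B u = P0 t (src A f)|] ==> dm H (c3 f u) = P1 D f \<odot> c1 (src A f) u"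
   "[|f : one A; u : one B; src B u = b; trg B u = P0 t (src A f)|] ==> cd H (c3 f u) = c1 (trg A f) (P1 t f *[B] u)"
  and c3_nat: "[|f : one A; mu : two B; dm B mu = u; cd B mu = v; src B u = b; trg B u = P0 t (src A f); trg A f = a'|] ==>
   c3 f v \<cdot> (P1 D f |> c2 (src A f) mu) = c2 a' (P1 t f |>[B] mu) \<cdot> c3 f u"
  and c3_nat2: "[|ch : two A; dm A ch = f; cd A ch = f'; u : one B; src B u = b; src A f = a; trg A f = a'; trg B u = P0 t a|] ==>
   c3 f' u \<cdot> (P2 D ch <| c1 a u) = c2 a' (P2 t ch <|[B] u) \<cdot> c3 f u"
  and c3_comp: "[|f : one A; g : one A; trg A f = src A g; u : one B; src B u = b; src A f = a; trg A g = a''; trg B u = P0 t a|] ==>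
   c3 (g *[A] f) u \<cdot> (Pc D g f <| c1 a u)
   = c2 a'' (Pc t g f <|[B] u) \<cdot> (c3 g (P1 t f *[B] u) \<cdot> (P1 D g |> c3 f u))"
  and c3_id: "[|a : ob A; u : one B; src B u = b; trg B u = P0 t a|] ==>
   c3 (id1 A a) u \<cdot> (Pu D a <| c1 a u) = c2 a (Pu t a <|[B] u)"
begin

lemma c3_in [simp]: "[|f : one A; u : one B; src B u = b; trg B u = P0 t (src A f)|] ==> c3 f u : two H"
 using H.iso2_in[OF c3(1)] .

lemma c2_iso [simp]:
 assumes "a : ob A" "iso2 B mu" "src B (dm B mu) = b" "trg B (dm B mu) = P0 t a"
 shows "iso2 H (c2 a mu)"
proof -
 have i: "mu : two B" "src B (dm B (inv2 B mu)) = b" "trg B (dm B (inv2 B mu)) = P0 t a"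
  using assms B.iso2_in[OF assms(2)] by simp_all
 show ?thesis
  by (rule H.iso2I[of _ "c2 a (inv2 B mu)"])
   (use assms i in "simp_all add: c2_vcomp[symmetric] c2_id")
qed

end

definition cone_mor where
 "cone_mor A B H t D b c1 c2 c3 d1 d2 d3 m \<longleftrightarrow>
  (ALL a:ob A. ALL u. u : one B --> src B u = b --> trg B u = P0 t a -->
   m a u : two H & dm H (m a u) = c1 a u & cd H (m a u) = d1 a u) &
  (ALL a:ob A. ALL mu. mu : two B --> src B (dm B mu) = b --> trg B (dm B mu) = P0 t a -->
   m a (cd B mu) .[H] c2 a mu = d2 a mu .[H] m a (dm B mu)) &
  (ALL f:one A. ALL u. u : one B --> src B u = b --> trg B u = P0 t (src A f) -->
   m (trg A f) (P1 t f *[B] u) .[H] c3 f u = d3 f u .[H] (P1 D f |>[H] m (src A f) u))"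

lemma cone_morD:
 assumes "cone_mor A B H t D b c1 c2 c3 d1 d2 d3 m"
 shows "[|a : ob A; u : one B; src B u = b; trg B u = P0 t a|] ==> m a u : two H"
  "[|a : ob A; u : one B; src B u = b; trg B u = P0 t a|] ==> dm H (m a u) = c1 a u"
  "[|a : ob A; u : one B; src B u = b; trg B u = P0 t a|] ==> cd H (m a u) = d1 a u"
  "[|a : ob A; mu : two B; dm B mu = u; cd B mu = v; src B u = b; trg B u = P0 t a|] ==>
    m a v .[H] c2 a mu = d2 a mu .[H] m a u"
  "[|f : one A; u : one B; src B u = b; trg B u = P0 t (src A f); trg A f = a'|] ==>
   m a' (P1 t f *[B] u) .[H] c3 f u = d3 f u .[H] (P1 D f |>[H] m (src A f) u)"
 using assms unfolding cone_mor_def by blast+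

lemma cone_morI:
 assumes "!!a u. [|a : ob A; u : one B; src B u = b; trg B u = P0 t a|] ==>
   m a u : two H & dm H (m a u) = c1 a u & cd H (m a u) = d1 a u"
  "!!a mu. [|a : ob A; mu : two B; src B (dm B mu) = b; trg B (dm B mu) = P0 t a|] ==>
   m a (cd B mu) .[H] c2 a mu = d2 a mu .[H] m a (dm B mu)"
  "!!f u. [|f : one A; u : one B; src B u = b; trg B u = P0 t (src A f)|] ==>
   m (trg A f) (P1 t f *[B] u) .[H] c3 f u = d3 f u .[H] (P1 D f |>[H] m (src A f) u)"
 shows "cone_mor A B H t D b c1 c2 c3 d1 d2 d3 m"
 using assms unfolding cone_mor_def by blast

context kan_setup
begin

abbreviation "CM \<equiv> cone_mor A B H t D"
abbreviation "CN \<equiv> cone A B H t D"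

lemma cone_restrict:
 assumes "CN b X c1 c2 c3" and x: "x : one H" "trg H x = X" "src H x = Y"
 shows "CN b Y (r1 H c1 x) (r2 H c2 x) (r2 H c3 x)"
proof -
 interpret c: cone A B H t D b X c1 c2 c3 by fact
 have Y: "Y : ob H" using x by auto
 show ?thesis
 proof (unfold_locales, goal_cases)
  case (10 a mu nu)
  then have "src B (dm B nu) = b" "trg B (dm B nu) = P0 t a" using B.two_simps(3,4)[of mu] by auto
  with 10 show ?case using x by (simp add: c.c2_vcomp)
 next
  case (14 f mu u v a')
  then have *: "u : one B" "v : one B" "src B v = b" "trg B v = P0 t (src A f)" "a' : ob A"
   using B.two_simps[of mu] A.one_simps(2)[of f] by auto
  show ?case using arg_cong[OF c.c3_nat[OF 14], of "%z. z <| x"] 14 * x by simp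
 next
  case (15 ch f f' u a a')
  then have *: "f : one A" "f' : one A" "src A f' = a" "trg A f' = a'" "a : ob A" "a' : ob A"
   using A.two_simps[of ch] by auto
  show ?case using arg_cong[OF c.c3_nat2[OF 15], of "%z. z <| x"] 15 * x by simp
 next
  case (16 f g u a a'')
  then have *: "a : ob A" "a'' : ob A" by auto
  show ?case using arg_cong[OF c.c3_comp[OF 16], of "%z. z <| x"] 16 * x by simp
 next
  case (17 a u)
  then show ?case using arg_cong[OF c.c3_id[OF 17], of "%z. z <| x"] x by simp
 qed (use x Y in "simp_all add: c.c2_id")
qed

lemma cone_mor_restrict:
 assumes "CN b X c1 c2 c3" "CN b X d1 d2 d3" and m: "CM b c1 c2 c3 d1 d2 d3 m"
  and x: "x : one H" "trg H x = X"
 shows "CM b (r1 H c1 x) (r2 H c2 x) (r2 H c3 x)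
  (r1 H d1 x) (r2 H d2 x) (r2 H d3 x) (%a u. m a u <| x)"
proof -
 interpret c: cone A B H t D b X c1 c2 c3 by fact
 interpret d: cone A B H t D b X d1 d2 d3 by fact
 note [simp] = cone_morD(1-3)[OF m]
 show ?thesis
 proof (rule cone_morI, goal_cases)
  case (2 a mu)
  then show ?case using arg_cong[OF cone_morD(4)[OF m 2(1,2) refl refl 2(3,4)], of "%z. z <| x"] x by simp
 next
  case (3 f u)
  then show ?case using arg_cong[OF cone_morD(5)[OF m 3 refl], of "%z. z <| x"] x by simp
 qed (use x in simp_all)
qed

lemma cone_mor_comp:
 assumes "CN b X c1 c2 c3" "CN b X d1 d2 d3" "CN b X e1 e2 e3"
  and m: "CM b c1 c2 c3 d1 d2 d3 m" and n: "CM b d1 d2 d3 e1 e2 e3 n"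
 shows "CM b c1 c2 c3 e1 e2 e3 (%a u. n a u \<cdot> m a u)"
proof -
 interpret c: cone A B H t D b X c1 c2 c3 by fact
 interpret d: cone A B H t D b X d1 d2 d3 by fact
 interpret e: cone A B H t D b X e1 e2 e3 by fact
 note [simp] = cone_morD(1-3)[OF m] cone_morD(1-3)[OF n]
 show ?thesis
 proof (rule cone_morI, goal_cases)
  case (2 a mu)
  then show ?case
   using cone_morD(4)[OF m 2(1,2) refl refl 2(3,4)]
   by (simp add: H.vreassoc[OF cone_morD(4)[OF n 2(1,2) refl refl 2(3,4)]])
 next
  case (3 f u)
  then show ?case
   using cone_morD(5)[OF m 3 refl]
   by (simp add: H.vreassoc[OF cone_morD(5)[OF n 3 refl]])
 qed simp_all
qed

lemma cone_mor_inv: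
 assumes "CN b X c1 c2 c3" "CN b X d1 d2 d3" and m: "CM b c1 c2 c3 d1 d2 d3 m"
  and i: "!!a u. [|a : ob A; u : one B; src B u = b; trg B u = P0 t a|] ==> iso2 H (m a u)"
 shows "CM b d1 d2 d3 c1 c2 c3 (%a u. inv2 H (m a u))"
proof -
 interpret c: cone A B H t D b X c1 c2 c3 by fact
 interpret d: cone A B H t D b X d1 d2 d3 by fact
 note [simp] = cone_morD(1-3)[OF m] i
 show ?thesis
 proof (rule cone_morI, goal_cases)
  case (2 a mu)
  show ?case
   by (rule H.iso2_conj[OF cone_morD(4)[OF m 2(1,2) refl refl 2(3,4), symmetric], symmetric]) (use 2 in simp_all)
 next
  case (3 f u)
  have "c3 f u \<cdot> inv2 H (P1 D f |> m (src A f) u) = inv2 H (m (trg A f) (P1 t f *[B] u)) \<cdot> d3 f u"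
   by (rule H.iso2_conj[OF cone_morD(5)[OF m 3 refl, symmetric]]) (use 3 in simp_all)
  then show ?case using 3 by simp
 qed simp_all
qed

end

text \<open>A family of cones over all \<open>b\<close>, with vertices \<open>K b\<close>, that is pseudonatural in \<open>b\<close>.\<close>

locale bicone = kan_setup A B H t D + K: psf B H K
 for A :: "('a, 'p, 'q) two_cat" and B :: "('b, 'f, 't) two_cat" and H :: "('h, 'g, 'u) two_cat" (structure) and t D K +
 fixes c1 :: "'a \<Rightarrow> 'f \<Rightarrow> 'g" and c2 :: "'a \<Rightarrow> 't \<Rightarrow> 'u" and c3 :: "'p \<Rightarrow> 'f \<Rightarrow> 'u" and w :: "'f \<Rightarrow> 'a \<Rightarrow> 'f \<Rightarrow> 'u"
 assumes cone: "b : ob B ==> CN b (P0 K b) c1 c2 c3"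
  and w [simp]: "[|g : one B; a : ob A; u : one B; trg B g = src B u; trg B u = P0 t a|] ==> iso2 H (w g a u)"
   "[|g : one B; a : ob A; u : one B; trg B g = src B u; trg B u = P0 t a|] ==> dm H (w g a u) = c1 a u \<odot> P1 K g"
   "[|g : one B; a : ob A; u : one B; trg B g = src B u; trg B u = P0 t a|] ==> cd H (w g a u) = c1 a (u *[B] g)"
  and w_nat: "[|g : one B; a : ob A; mu : two B; dm B mu = u; cd B mu = v; trg B g = src B u; trg B u = P0 t a|] ==>
   w g a v \<cdot> (c2 a mu <| P1 K g) = c2 a (mu <|[B] g) \<cdot> w g a u"
  and w_c3: "[|g : one B; f : one A; u : one B; trg B g = src B u; trg B u = P0 t (src A f); trg A f = a'|] ==>
   w g a' (P1 t f *[B] u) \<cdot> (c3 f u <| P1 K g)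
   = c3 f (u *[B] g) \<cdot> (P1 D f |> w g (src A f) u)"
  and w_nat2: "[|gm : two B; dm B gm = g; cd B gm = g'; a : ob A; u : one B; trg B g = src B u; trg B u = P0 t a|] ==>
   w g' a u \<cdot> (c1 a u |> P2 K gm) = c2 a (u |>[B] gm) \<cdot> w g a u"
  and w_comp: "[|g : one B; h : one B; a : ob A; u : one B; trg B g = src B h; trg B h = src B u; trg B u = P0 t a|] ==>
   w (h *[B] g) a u \<cdot> (c1 a u |> Pc K h g) = w g a (u *[B] h) \<cdot> (w h a u <| P1 K g)"
  and w_id: "[|a : ob A; u : one B; src B u = b; trg B u = P0 t a|] ==>
   w (id1 B b) a u \<cdot> (c1 a u |> Pu K b) = id2 H (c1 a u)"
begin

lemma w_in [simp]:
 "[|g : one B; a : ob A; u : one B; trg B g = src B u; trg B u = P0 t a|] ==> w g a u : two H"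
 using H.iso2_in[OF w(1)] .

lemma c_simps [simp]:
 "[|a : ob A; u : one B; trg B u = P0 t a|] ==> c1 a u : one H"
 "[|a : ob A; u : one B; trg B u = P0 t a|] ==> src H (c1 a u) = P0 K (src B u)"
 "[|a : ob A; u : one B; trg B u = P0 t a|] ==> trg H (c1 a u) = P0 D a"
 "[|a : ob A; mu : two B; trg B (dm B mu) = P0 t a|] ==> c2 a mu : two H"
 "[|a : ob A; mu : two B; trg B (dm B mu) = P0 t a|] ==> dm H (c2 a mu) = c1 a (dm B mu)"
 "[|a : ob A; mu : two B; trg B (dm B mu) = P0 t a|] ==> cd H (c2 a mu) = c1 a (cd B mu)"
 "[|f : one A; u : one B; trg B u = P0 t (src A f)|] ==> iso2 H (c3 f u)"
 "[|f : one A; u : one B; trg B u = P0 t (src A f)|] ==> c3 f u : two H"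
 "[|f : one A; u : one B; trg B u = P0 t (src A f)|] ==> dm H (c3 f u) = P1 D f \<odot> c1 (src A f) u"
 "[|f : one A; u : one B; trg B u = P0 t (src A f)|] ==> cd H (c3 f u) = c1 (trg A f) (P1 t f *[B] u)"
 using cone.c1[OF cone[of "src B u"], of a u] cone.c2[OF cone[of "src B (dm B mu)"], of a mu]
  cone.c3[OF cone[of "src B u"], of f u] cone.c3_in[OF cone[of "src B u"], of f u] by simp_all

end

text \<open>Universality: the cones induce equivalences from \<open>H(X, K b)\<close> to categories of cones.\<close>

definition universal_bicone where
 "universal_bicone A B H t D K c1 c2 c3 \<longleftrightarrow> (ALL b:ob B. ALL X:ob H.
  (ALL x y m. x : one H --> src H x = X --> trg H x = P0 K b --> y : one H --> src H y = X --> trg H y = P0 K b -->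
   cone_mor A B H t D b (r1 H c1 x) (r2 H c2 x) (r2 H c3 x)
    (r1 H c1 y) (r2 H c2 y) (r2 H c3 y) m -->
   (EX! n. n : two H & dm H n = x & cd H n = y &
    (ALL a:ob A. ALL u. u : one B --> src B u = b --> trg B u = P0 t a --> c1 a u |>[H] n = m a u))) &
  (ALL d1 d2 d3. cone A B H t D b X d1 d2 d3 -->
   (EX x s. x : one H & src H x = X & trg H x = P0 K b &
    cone_mor A B H t D b (r1 H c1 x) (r2 H c2 x) (r2 H c3 x) d1 d2 d3 s &
    (ALL a:ob A. ALL u. u : one B --> src B u = b --> trg B u = P0 t a --> iso2 H (s a u)))))"

lemma universal_biconeD:
 assumes "universal_bicone A B H t D K c1 c2 c3" "b : ob B" "X : ob H"
 shows "[|x : one H; src H x = X; trg H x = P0 K b; y : one H; src H y = X; trg H y = P0 K b;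
   cone_mor A B H t D b (r1 H c1 x) (r2 H c2 x) (r2 H c3 x)
    (r1 H c1 y) (r2 H c2 y) (r2 H c3 y) m|] ==>
   EX! n. n : two H & dm H n = x & cd H n = y &
    (ALL a:ob A. ALL u. u : one B --> src B u = b --> trg B u = P0 t a --> c1 a u |>[H] n = m a u)"
  "cone A B H t D b X d1 d2 d3 ==>
   EX x s. x : one H & src H x = X & trg H x = P0 K b &
    cone_mor A B H t D b (r1 H c1 x) (r2 H c2 x) (r2 H c3 x) d1 d2 d3 s &
    (ALL a:ob A. ALL u. u : one B --> src B u = b --> trg B u = P0 t a --> iso2 H (s a u))"
 using assms unfolding universal_bicone_def by blast+

locale ubicone = bicone A B H t D K c1 c2 c3 w
 for A :: "('a, 'p, 'q) two_cat" and B :: "('b, 'f, 't) two_cat" and H :: "('h, 'g, 'u) two_cat" (structure) and t D K c1 c2 c3 w +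
 assumes universal: "universal_bicone A B H t D K c1 c2 c3"
begin

lemma faithful:
 assumes "b : ob B" "n : two H" "n' : two H" "dm H n' = dm H n" "cd H n' = cd H n" "trg H (dm H n) = P0 K b"
  and e: "!!a u. [|a : ob A; u : one B; src B u = b; trg B u = P0 t a|] ==> c1 a u |> n = c1 a u |> n'"
 shows "n = n'"
proof -
 let ?x = "dm H n" and ?y = "cd H n"
 interpret c: cone A B H t D b "P0 K b" c1 c2 c3 by (rule cone[OF assms(1)])
 have o: "src H ?x : ob H" "?x : one H" "?y : one H" "src H ?y = src H ?x" "trg H ?y = P0 K b"
  using assms H.two_simps[of n] by auto
 have "CM b (r1 H c1 ?x) (r2 H c2 ?x) (r2 H c3 ?x)
    (r1 H c1 ?y) (r2 H c2 ?y) (r2 H c3 ?y) (%a u. c1 a u |> n)"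
 proof (rule cone_morI, goal_cases)
  case (2 a mu)
  show ?case
   by (rule H.exchange[symmetric]) (use 2 assms(1-6) o in simp_all)
 next
  case (3 f u)
  show ?case using H.exchange[of n "c3 f u", OF _ _ _ refl refl refl refl] 3 assms(1-6) o by simp
 qed (use assms(1-6) o in simp_all)
 from universal_biconeD(1)[OF universal assms(1) o(1) o(2) refl assms(6) o(3-5) this]
 have "EX! k. k : two H & dm H k = ?x & cd H k = ?y &
   (ALL a:ob A. ALL u. u : one B --> src B u = b --> trg B u = P0 t a --> c1 a u |> k = c1 a u |> n)" .
 moreover have "n' : two H & dm H n' = ?x & cd H n' = ?y &
   (ALL a:ob A. ALL u. u : one B --> src B u = b --> trg B u = P0 t a --> c1 a u |> n' = c1 a u |> n)"
  using assms e by metis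
 ultimately show ?thesis using assms(2) by blast
qed

lemma lift_exists:
 assumes "b : ob B" "X : ob H" "x : one H" "src H x = X" "trg H x = P0 K b" "y : one H" "src H y = X" "trg H y = P0 K b"
   "CM b (r1 H c1 x) (r2 H c2 x) (r2 H c3 x)
    (r1 H c1 y) (r2 H c2 y) (r2 H c3 y) m"
 obtains n where "n : two H" "dm H n = x" "cd H n = y"
    "!!a u. [|a:ob A; u : one B; src B u = b; trg B u = P0 t a|] ==> c1 a u |> n = m a u"
 using universal_biconeD(1)[OF universal assms] by blast

lemma lift_iso_exists:
 assumes "b : ob B" "X : ob H" "x : one H" "src H x = X" "trg H x = P0 K b" "y : one H" "src H y = X" "trg H y = P0 K b"
  and m: "CM b (r1 H c1 x) (r2 H c2 x) (r2 H c3 x)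
    (r1 H c1 y) (r2 H c2 y) (r2 H c3 y) m"
  and i: "!!a u. [|a:ob A; u : one B; src B u = b; trg B u = P0 t a|] ==> iso2 H (m a u)"
 obtains n where "iso2 H n" "dm H n = x" "cd H n = y"
    "!!a u. [|a:ob A; u : one B; src B u = b; trg B u = P0 t a|] ==> c1 a u |> n = m a u"
proof -
 obtain n where n: "n : two H" "dm H n = x" "cd H n = y"
    "!!a u. [|a:ob A; u : one B; src B u = b; trg B u = P0 t a|] ==> c1 a u |> n = m a u"
  using lift_exists[OF assms(1-8) m] by metis
 have m': "CM b (r1 H c1 y) (r2 H c2 y) (r2 H c3 y)
   (r1 H c1 x) (r2 H c2 x) (r2 H c3 x) (%a u. inv2 H (m a u))"
  by (rule cone_mor_inv[OF cone_restrict[OF cone] cone_restrict[OF cone] m i]) (use assms(1-8) in auto)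
 obtain n' where n': "n' : two H" "dm H n' = y" "cd H n' = x"
    "!!a u. [|a:ob A; u : one B; src B u = b; trg B u = P0 t a|] ==> c1 a u |> n' = inv2 H (m a u)"
  using lift_exists[OF assms(1,2) assms(6-8) assms(3-5) m'] by metis
 have mm: "m a u : two H" "dm H (m a u) = c1 a u \<odot> x" "cd H (m a u) = c1 a u \<odot> y"
  if "a:ob A" "u : one B" "src B u = b" "trg B u = P0 t a" for a u
  using cone_morD(1-3)[OF m] that by auto
 have "iso2 H n"
 proof (rule H.iso2I[of _ n'])
  show "n' \<cdot> n = id2 H (dm H n)"
   by (rule faithful[of b]) (use assms(1-8) n n' i mm in simp_all)
  show "n \<cdot> n' = id2 H (cd H n)"
   by (rule faithful[of b]) (use assms(1-8) n n' i mm in simp_all)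
 qed (use n n' in simp_all)
 then show ?thesis using that n by blast
qed

end

text \<open>The family of cones \<open>u \<mapsto> al a \<odot> K u\<close> of a transformation \<open>al : K t \<rightarrow> D\<close>.\<close>

definition tc1 where "tc1 H K al a u = N1 al a *[H] P1 K u"
definition tc2 where "tc2 H K al a mu = N1 al a |>[H] P2 K mu"
definition tc3 where "tc3 A H t K al f u = (N1 al (trg A f) |>[H] Pc K (P1 t f) u) .[H] (N2 al f <|[H] P1 K u)"
definition tw where "tw H K al g a u = N1 al a |>[H] Pc K u g"

locale kan_trans = kan_setup A B H t D + K: psf B H K + al: pst A H "psf_comp A H K t" D al
 for A :: "('a, 'p, 'q) two_cat" and B :: "('b, 'f, 't) two_cat" and H :: "('h, 'g, 'u) two_cat" (structure) and t D K al
begin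

lemma Pc_nat_left:
 assumes "mu : two B" "g : one B" "trg B g = src B u" "dm B mu = u" "cd B mu = v"
 shows "P2 K (mu <|[B] g) \<cdot> Pc K u g = Pc K v g \<cdot> (P2 K mu <| P1 K g)"
 using K.Pc_natural[of "id2 B g" mu] assms by simp

lemma Pc_nat_right:
 assumes "gm : two B" "u : one B" "trg B g = src B u" "dm B gm = g" "cd B gm = g'"
 shows "P2 K (u |>[B] gm) \<cdot> Pc K u g = Pc K u g' \<cdot> (P1 K u |> P2 K gm)"
 using K.Pc_natural[of gm "id2 B u"] assms by simp

lemma trans_cone:
 assumes b: "b : ob B"
 shows "CN b (P0 K b) (tc1 H K al) (tc2 H K al) (tc3 A H t K al)"
proof (unfold_locales, goal_cases)
 case (14 f mu u v a')
 have o: "u : one B" "v : one B" "src B v = b" "trg B v = P0 t (src A f)" "a' : ob A" "src A f : ob A"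
  using 14 B.two_simps[of mu] A.one_simps[of f] by auto
 have e: "(N2 al f <| P1 K v) \<cdot> ((P1 D f \<odot> N1 al (src A f)) |> P2 K mu)
  = ((N1 al a' \<odot> P1 K (P1 t f)) |> P2 K mu) \<cdot> (N2 al f <| P1 K u)"
  by (rule H.exchange) (use 14 o in simp_all)
 have p: "(N1 al a' |> Pc K (P1 t f) v) \<cdot> ((N1 al a' \<odot> P1 K (P1 t f)) |> P2 K mu)
  = (N1 al a' |> P2 K (P1 t f |>[B] mu)) \<cdot> (N1 al a' |> Pc K (P1 t f) u)"
  using arg_cong[OF Pc_nat_right[of mu "P1 t f" u v], of "%z. N1 al a' |> z"] 14 o by simp
 show ?case using 14 o by (simp add: tc1_def tc2_def tc3_def e H.vreassoc[OF p])
next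
 case (15 ch f f' u a a')
 have o: "f : one A" "f' : one A" "src A f' = a" "trg A f' = a'" "a : ob A" "a' : ob A"
  using 15 A.two_simps[of ch] A.one_simps[of f] by auto
 have e: "(N2 al f' <| P1 K u) \<cdot> (P2 D ch <| (N1 al a \<odot> P1 K u))
  = (N1 al a' |> (P2 K (P2 t ch) <| P1 K u)) \<cdot> (N2 al f <| P1 K u)"
  using arg_cong[OF al.N2_nat[of ch f f' a a'], of "%z. z <| P1 K u"] 15 o by simp
 have p: "(N1 al a' |> Pc K (P1 t f') u) \<cdot> (N1 al a' |> (P2 K (P2 t ch) <| P1 K u))
  = (N1 al a' |> P2 K (P2 t ch <|[B] u)) \<cdot> (N1 al a' |> Pc K (P1 t f) u)"
  using arg_cong[OF Pc_nat_left[of "P2 t ch" u "P1 t f" "P1 t f'"], of "%z. N1 al a' |> z"] 15 o by simp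
 show ?case using 15 o by (simp add: tc1_def tc2_def tc3_def e H.vreassoc[OF p])
next
 case (16 f g u a a'')
 have o: "a : ob A" "a'' : ob A" "src A g : ob A" using 16 A.one_simps[of f] A.one_simps[of g] by auto
 let ?tf = "P1 t f" and ?tg = "P1 t g" and ?a' = "src A g"
 have n: "(N2 al (g *[A] f) <| P1 K u) \<cdot> (Pc D g f <| (N1 al a \<odot> P1 K u))
  = (N1 al a'' |> (P2 K (Pc t g f) <| P1 K u)) \<cdot> ((N1 al a'' |> (Pc K ?tg ?tf <| P1 K u)) \<cdot>
   ((N2 al g <| (P1 K ?tf \<odot> P1 K u)) \<cdot> (P1 D g |> (N2 al f <| P1 K u))))"
  using arg_cong[OF al.N2_cmp[OF 16(1-3) 16(6,7)], of "%z. z <| P1 K u"] 16 o by simp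
 have p1: "(N1 al a'' |> Pc K (P1 t (g *[A] f)) u) \<cdot> (N1 al a'' |> (P2 K (Pc t g f) <| P1 K u))
  = (N1 al a'' |> P2 K (Pc t g f <|[B] u)) \<cdot> (N1 al a'' |> Pc K (?tg *[B] ?tf) u)"
  using arg_cong[OF Pc_nat_left[of "Pc t g f" u "?tg *[B] ?tf" "P1 t (g *[A] f)"], of "%z. N1 al a'' |> z"] 16 o by simp
 have p2: "(N1 al a'' |> Pc K (?tg *[B] ?tf) u) \<cdot> (N1 al a'' |> (Pc K ?tg ?tf <| P1 K u))
  = (N1 al a'' |> Pc K ?tg (?tf *[B] u)) \<cdot> ((N1 al a'' \<odot> P1 K ?tg) |> Pc K ?tf u)"
  using arg_cong[OF K.Pc_assoc[of u ?tf ?tg], of "%z. N1 al a'' |> z"] 16 o by simp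
 have e: "(N2 al g <| P1 K (?tf *[B] u)) \<cdot> ((P1 D g \<odot> N1 al ?a') |> Pc K ?tf u)
  = ((N1 al a'' \<odot> P1 K ?tg) |> Pc K ?tf u) \<cdot> (N2 al g <| (P1 K ?tf \<odot> P1 K u))"
  by (rule H.exchange) (use 16 o in simp_all)
 show ?case using 16 o
  by (simp add: tc1_def tc2_def tc3_def n H.vreassoc[OF p1] H.vreassoc[OF p2] H.vreassoc[OF e])
next
 case (17 a u)
 let ?i = "id1 A a"
 have n: "(N2 al ?i <| P1 K u) \<cdot> (Pu D a <| (N1 al a \<odot> P1 K u))
  = (N1 al a |> (P2 K (Pu t a) <| P1 K u)) \<cdot> (N1 al a |> (Pu K (P0 t a) <| P1 K u))"
  using arg_cong[OF al.N2_unit[OF 17(1)], of "%z. z <| P1 K u"] 17 by simp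
 have p1: "(N1 al a |> Pc K (P1 t ?i) u) \<cdot> (N1 al a |> (P2 K (Pu t a) <| P1 K u))
  = (N1 al a |> P2 K (Pu t a <|[B] u)) \<cdot> (N1 al a |> Pc K (id1 B (P0 t a)) u)"
  using arg_cong[OF Pc_nat_left[of "Pu t a" u "id1 B (P0 t a)" "P1 t ?i"], of "%z. N1 al a |> z"] 17 by simp
 have p2: "(N1 al a |> Pc K (id1 B (P0 t a)) u) \<cdot> (N1 al a |> (Pu K (P0 t a) <| P1 K u))
  = id2 H (N1 al a \<odot> P1 K u)"
  using arg_cong[OF K.Pu_left[of u], of "%z. N1 al a |> z"] 17 by simp
 show ?case using 17 by (simp add: tc1_def tc2_def tc3_def n H.vreassoc[OF p1] p2)
qed (use b in "simp_all add: tc1_def tc2_def tc3_def")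

text \<open>The constraint cells of \<open>K\<close> make the cones \<open>al a *[H] K u\<close> pseudonatural in
 \<open>b\<close>.\<close>

lemma trans_bicone: "bicone A B H t D K (tc1 H K al) (tc2 H K al) (tc3 A H t K al) (tw H K al)"
proof (intro bicone.intro bicone_axioms.intro, goal_cases)
 case 1 show ?case by unfold_locales
next
 case 2 show ?case by unfold_locales
next
 case (3 b) then show ?case by (rule trans_cone)
next
 case (7 g a mu u v)
 have o: "u : one B" "v : one B" "src B v = src B u" "trg B v = P0 t a" using 7 B.two_simps[of mu] by auto
 show ?case
  using arg_cong[OF Pc_nat_left[of mu g u v], of "%z. N1 al a |> z"] 7 o by (simp add: tc1_def tc2_def tw_def)
next
 case (8 g f u a')
 have o: "src A f : ob A" "a' : ob A" using 8 A.one_simps[of f] by auto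
 let ?tf = "P1 t f"
 have p: "(N1 al a' |> Pc K (?tf *[B] u) g) \<cdot> (N1 al a' |> (Pc K ?tf u <| P1 K g))
  = (N1 al a' |> Pc K ?tf (u *[B] g)) \<cdot> ((N1 al a' \<odot> P1 K ?tf) |> Pc K u g)"
  using arg_cong[OF K.Pc_assoc[of g u ?tf], of "%z. N1 al a' |> z"] 8 o by simp
 have e: "(N2 al f <| P1 K (u *[B] g)) \<cdot> ((P1 D f \<odot> N1 al (src A f)) |> Pc K u g)
  = ((N1 al a' \<odot> P1 K ?tf) |> Pc K u g) \<cdot> (N2 al f <| (P1 K u \<odot> P1 K g))"
  by (rule H.exchange) (use 8 o in simp_all)
 show ?case using 8 o by (simp add: tc1_def tc2_def tc3_def tw_def H.vreassoc[OF p] e)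
next
 case (9 gm g g' a u)
 have o: "g : one B" "g' : one B" "src B g' = src B g" "trg B g' = src B u" using 9 B.two_simps[of gm] by auto
 show ?case
  using arg_cong[OF Pc_nat_right[of gm u g g'], of "%z. N1 al a |> z"] 9 o by (simp add: tc1_def tc2_def tw_def)
next
 case (10 g h a u)
 then show ?case
  using arg_cong[OF K.Pc_assoc[of g h u], of "%z. N1 al a |> z"] by (simp add: tc1_def tc2_def tw_def)
next
 case (11 a u b)
 have o: "b : ob B" using 11 by auto
 show ?case
  using arg_cong[OF K.Pu_right[of u], of "%z. N1 al a |> z"] 11 o by (simp add: tc1_def tc2_def tw_def)
qed (simp_all add: tc1_def tw_def)

end

section \<open>Transformations into a universal family of cones\<close>

text \<open>A pseudofunctor \<open>K\<close> with a family of cones factors through a universal one.\<close>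

locale bicone_pair = c: ubicone A B H t D R c1 c2 c3 w + d: bicone A B H t D K d1 d2 d3 v
 for A :: "('a, 'p, 'q) two_cat" and B :: "('b, 'f, 't) two_cat" and H :: "('h, 'g, 'u) two_cat" (structure)
  and t D R c1 c2 c3 w K d1 d2 d3 v
begin

lemma bicone_shift:
 assumes g: "g : one B" "src B g = b" "trg B g = b'"
  and cn: "bicone A B H t D Q e1 e2 e3 z"
 shows "c.CM b' (r1 H e1 (P1 Q g)) (r2 H e2 (P1 Q g)) (r2 H e3 (P1 Q g))
  (%a u. e1 a (u *[B] g)) (%a mu. e2 a (mu <|[B] g)) (%f u. e3 f (u *[B] g)) (%a u. z g a u)"
proof -
 interpret e: bicone A B H t D Q e1 e2 e3 z by fact
 show ?thesis
  by (rule cone_morI) (use g e.w_nat[OF g(1) _ _ refl refl] e.w_c3[OF g(1)] in simp_all)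
qed

lemma cone_shift:
 assumes g: "g : one B" "src B g = b" "trg B g = b'"
  and cn: "bicone A B H t D Q e1 e2 e3 z"
 shows "c.CN b' (P0 Q b) (%a u. e1 a (u *[B] g)) (%a mu. e2 a (mu <|[B] g)) (%f u. e3 f (u *[B] g))"
proof -
 interpret e: bicone A B H t D Q e1 e2 e3 z by fact
 have b: "b : ob B" "b' : ob B" using g by auto
 interpret ec: cone A B H t D b "P0 Q b" e1 e2 e3 by (rule e.cone[OF b(1)])
 show ?thesis
 proof (unfold_locales, goal_cases)
  case (10 a mu nu)
  then have o: "src B (dm B nu) = b'" "trg B (dm B nu) = P0 t a" using c.B.two_simps(3,4)[of mu] by auto
  have "(nu .[B] mu) <|[B] g = (nu <|[B] g) .[B] (mu <|[B] g)" using 10 g by simp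
  then show ?case using 10 o g ec.c2_vcomp[of a "mu <|[B] g" "nu <|[B] g"] by (simp del: c.B.whisker_vcomp)
 next
  case (14 f mu u v a')
  then have o: "u : one B" "v : one B" "src B v = b'" "trg B v = P0 t (src A f)" "a' : ob A"
   using c.B.two_simps[of mu] c.A.one_simps(2)[of f] by auto
  show ?case using ec.c3_nat[of f "mu <|[B] g" "u *[B] g" "v *[B] g" a'] 14 o g by simp
 next
  case (15 ch f f' u a a')
  then have o: "f : one A" "f' : one A" "src A f' = a" "trg A f' = a'" "a : ob A" "a' : ob A"
   using c.A.two_simps[of ch] by auto
  show ?case using ec.c3_nat2[of ch f f' "u *[B] g" a a'] 15 o g by simp
 next
  case (16 f h u a a'')
  then have o: "a : ob A" "a'' : ob A" by auto
  show ?case using ec.c3_comp[of f h "u *[B] g" a a''] 16 o g by simp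
 next
  case (17 a u)
  then show ?case using ec.c3_id[of a "u *[B] g"] g by simp
 qed (use b g in "simp_all add: ec.c2_id")
qed

text \<open>The components are obtained by lifting the cones of \<open>K\<close> and the constraint cells by lifting
 the isomorphism of cones between \<open>R g *[H] x b\<close> and \<open>x b' *[H] K g\<close>; the axioms
 can be checked after whiskering with the universal cones, where they are the axioms for \<open>w\<close>
 and \<open>v\<close>.\<close>

lemma ex_factorisation:
 "EX sg s. pst B H K R sg &
  (ALL b:ob B. c.CM b (r1 H c1 (N1 sg b)) (r2 H c2 (N1 sg b)) (r2 H c3 (N1 sg b)) d1 d2 d3 s) &
  (ALL a:ob A. ALL u. u : one B --> trg B u = P0 t a --> iso2 H (s a u)) &
  (ALL g:one B. ALL a:ob A. ALL u. u : one B --> src B u = trg B g --> trg B u = P0 t a -->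
   v g a u \<cdot> ((s a u <| P1 K g) \<cdot> (c1 a u |> N2 sg g))
   = s a (u *[B] g) \<cdot> (w g a u <| N1 sg (src B g)))"
proof -
 have "ALL b:ob B. EX x s. x : one H & src H x = P0 K b & trg H x = P0 R b &
  c.CM b (r1 H c1 x) (r2 H c2 x) (r2 H c3 x) d1 d2 d3 s &
  (ALL a:ob A. ALL u. u : one B --> src B u = b --> trg B u = P0 t a --> iso2 H (s a u))"
  using universal_biconeD(2)[OF c.universal _ _ d.cone] by simp
 then obtain x s' where xs: "ALL b:ob B. x b : one H & src H (x b) = P0 K b & trg H (x b) = P0 R b &
  c.CM b (r1 H c1 (x b)) (r2 H c2 (x b)) (r2 H c3 (x b)) d1 d2 d3 (s' b) &
  (ALL a:ob A. ALL u. u : one B --> src B u = b --> trg B u = P0 t a --> iso2 H (s' b a u))"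
  by metis
 have x [simp]: "x b : one H" "src H (x b) = P0 K b" "trg H (x b) = P0 R b" if "b : ob B" for b using xs that by auto
 define s where "s a u = s' (src B u) a u" for a u
 have s'm: "c.CM b (r1 H c1 (x b)) (r2 H c2 (x b)) (r2 H c3 (x b)) d1 d2 d3 (s' b)"
  if "b : ob B" for b using xs that by auto
 have sm: "c.CM b (r1 H c1 (x b)) (r2 H c2 (x b)) (r2 H c3 (x b)) d1 d2 d3 s"
  if b: "b : ob B" for b
  by (rule cone_morI) (use cone_morD[OF s'm[OF b]] in "simp_all add: s_def")
 have si [simp]: "iso2 H (s a u)" if "a : ob A" "u : one B" "trg B u = P0 t a" for a u
  using xs that c.B.one_simps(1)[of u] by (simp add: s_def)
 have st [simp]: "s a u : two H" "dm H (s a u) = c1 a u \<odot> x (src B u)" "cd H (s a u) = d1 a u"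
  if "a : ob A" "u : one B" "trg B u = P0 t a" for a u
  using cone_morD(1-3)[OF sm[of "src B u"], of a u] that by auto
 have ex: "EX n. iso2 H n & dm H n = P1 R g \<odot> x (src B g) & cd H n = x (trg B g) \<odot> P1 K g &
   (ALL a:ob A. ALL u. u : one B --> src B u = trg B g --> trg B u = P0 t a -->
   v g a u \<cdot> ((s a u <| P1 K g) \<cdot> (c1 a u |> n))
   = s a (u *[B] g) \<cdot> (w g a u <| x (src B g)))" if g: "g : one B" for g
 proof -
  let ?b = "src B g" and ?b' = "trg B g"
  have b: "?b : ob B" "?b' : ob B" using g by auto
  have cb: "c.CN ?b' (P0 R ?b') c1 c2 c3" "c.CN ?b' (P0 K ?b') d1 d2 d3" "c.CN ?b (P0 R ?b) c1 c2 c3" "c.CN ?b (P0 K ?b) d1 d2 d3"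
   using c.cone d.cone b by auto
  let ?m = "%a u. (inv2 H (s a u <| P1 K g) \<cdot> inv2 H (v g a u)) \<cdot> (s a (u *[B] g) \<cdot> (w g a u <| x ?b))"
  have m1: "c.CM ?b' (r1 H c1 (P1 R g \<odot> x ?b)) (r2 H c2 (P1 R g \<odot> x ?b)) (r2 H c3 (P1 R g \<odot> x ?b))
   (%a u. c1 a (u *[B] g) \<odot> x ?b) (%a mu. c2 a (mu <|[B] g) <| x ?b) (%f u. c3 f (u *[B] g) <| x ?b) (%a u. w g a u <| x ?b)"
  proof -
   have "c.CM ?b' (%a u. (c1 a u \<odot> P1 R g) \<odot> x ?b) (%a mu. (c2 a mu <| P1 R g) <| x ?b) (%f u. (c3 f u <| P1 R g) <| x ?b)
   (%a u. c1 a (u *[B] g) \<odot> x ?b) (%a mu. c2 a (mu <|[B] g) <| x ?b) (%f u. c3 f (u *[B] g) <| x ?b) (%a u. w g a u <| x ?b)"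
    by (rule c.cone_mor_restrict[OF c.cone_restrict[OF cb(1)] cone_shift[OF g refl refl c.bicone_axioms] bicone_shift[OF g refl refl c.bicone_axioms]])
     (use b g in simp_all)
   note m = cone_morD[OF this]
   show ?thesis
   proof (rule cone_morI, goal_cases)
    case (1 a u) then show ?case using m(1-3)[of a u] b g by simp
   next
    case (2 a mu) then show ?case using m(4)[of a mu, OF _ _ refl refl] b g by simp
   next
    case (3 f u) then show ?case using m(5)[of f u, OF _ _ _ _ refl] b g by simp
   qed
  qed
  have m2: "c.CM ?b' (%a u. c1 a (u *[B] g) \<odot> x ?b) (%a mu. c2 a (mu <|[B] g) <| x ?b) (%f u. c3 f (u *[B] g) <| x ?b)
   (%a u. d1 a (u *[B] g)) (%a mu. d2 a (mu <|[B] g)) (%f u. d3 f (u *[B] g)) (%a u. s a (u *[B] g))"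
  proof (rule cone_morI, goal_cases)
   case (1 a u) then show ?case using g by simp
  next
   case (2 a mu) then show ?case using cone_morD(4)[OF sm[OF b(1)], of a "mu <|[B] g"] g by simp
  next
   case (3 f u) then show ?case using cone_morD(5)[OF sm[OF b(1)], of f "u *[B] g"] g by simp
  qed
  have m3: "c.CM ?b' (%a u. d1 a (u *[B] g)) (%a mu. d2 a (mu <|[B] g)) (%f u. d3 f (u *[B] g))
   (r1 H d1 (P1 K g)) (r2 H d2 (P1 K g)) (r2 H d3 (P1 K g)) (%a u. inv2 H (v g a u))"
   by (rule c.cone_mor_inv[OF c.cone_restrict[OF cb(2)] cone_shift[OF g refl refl d.bicone_axioms] bicone_shift[OF g refl refl d.bicone_axioms]])
    (use b g in simp_all)
  have m4: "c.CM ?b' (r1 H d1 (P1 K g)) (r2 H d2 (P1 K g)) (r2 H d3 (P1 K g))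
    (%a u. (c1 a u \<odot> x ?b') \<odot> P1 K g) (%a mu. (c2 a mu <| x ?b') <| P1 K g) (%f u. (c3 f u <| x ?b') <| P1 K g)
    (%a u. inv2 H (s a u <| P1 K g))"
   by (rule c.cone_mor_inv[OF c.cone_restrict[OF c.cone_restrict[OF cb(1)]] c.cone_restrict[OF cb(2)]
     c.cone_mor_restrict[OF c.cone_restrict[OF cb(1)] cb(2) sm[OF b(2)]]]) (use b g in simp_all)
  have m: "c.CM ?b' (r1 H c1 (P1 R g \<odot> x ?b)) (r2 H c2 (P1 R g \<odot> x ?b)) (r2 H c3 (P1 R g \<odot> x ?b))
    (r1 H c1 (x ?b' \<odot> P1 K g)) (r2 H c2 (x ?b' \<odot> P1 K g)) (r2 H c3 (x ?b' \<odot> P1 K g)) ?m"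
  proof -
   have cx: "c.CN ?b' (P0 K ?b) (r1 H c1 (P1 R g \<odot> x ?b)) (r2 H c2 (P1 R g \<odot> x ?b)) (r2 H c3 (P1 R g \<odot> x ?b))"
    "c.CN ?b' (P0 K ?b) (%a u. c1 a (u *[B] g) \<odot> x ?b) (%a mu. c2 a (mu <|[B] g) <| x ?b) (%f u. c3 f (u *[B] g) <| x ?b)"
    "c.CN ?b' (P0 K ?b) (%a u. (c1 a u \<odot> x ?b') \<odot> P1 K g) (%a mu. (c2 a mu <| x ?b') <| P1 K g) (%f u. (c3 f u <| x ?b') <| P1 K g)"
    "c.CN ?b' (P0 K ?b) (r1 H d1 (P1 K g)) (r2 H d2 (P1 K g)) (r2 H d3 (P1 K g))"
    using b g by (auto intro!: c.cone_restrict[OF cb(1)] c.cone_restrict[OF cb(2)] c.cone_restrict[OF cone_shift[OF g refl refl c.bicone_axioms]]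
     c.cone_restrict[OF c.cone_restrict[OF cb(1)]])
   note cs = cone_shift[OF g refl refl d.bicone_axioms]
   note M = cone_morD[OF c.cone_mor_comp[OF cx(1) cs cx(3) c.cone_mor_comp[OF cx(1,2) cs m1 m2] c.cone_mor_comp[OF cs cx(4,3) m3 m4]]]
   show ?thesis
   proof (rule cone_morI, goal_cases)
    case (1 a u) then show ?case using M(1-3)[of a u] b g by simp
   next
    case (2 a mu)
    then have "?m a (cd B mu) \<cdot> (c2 a mu <| (P1 R g \<odot> x ?b)) = ((c2 a mu <| x ?b') <| P1 K g) \<cdot> ?m a (dm B mu)"
     using M(4)[of a mu, OF _ _ refl refl] by blast
    then show ?case using 2 b g by simp
   next
    case (3 f u)
    then have "?m (trg A f) (P1 t f *[B] u) \<cdot> (c3 f u <| (P1 R g \<odot> x ?b)) = ((c3 f u <| x ?b') <| P1 K g) \<cdot> (P1 D f |> ?m (src A f) u)"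
     using M(5)[of f u, OF _ _ _ _ refl] by blast
    then show ?case using 3 b g by simp
   qed
  qed
  obtain n where n: "iso2 H n" "dm H n = P1 R g \<odot> x ?b" "cd H n = x ?b' \<odot> P1 K g"
    "!!a u. [|a:ob A; u : one B; src B u = ?b'; trg B u = P0 t a|] ==> c1 a u |> n = ?m a u"
   by (rule c.lift_iso_exists[OF b(2) _ _ _ _ _ _ _ m, of "P0 K ?b"]) (use b g in simp_all)
  have "v g a u \<cdot> ((s a u <| P1 K g) \<cdot> (c1 a u |> n))
   = s a (u *[B] g) \<cdot> (w g a u <| x ?b)"
   if "a:ob A" "u : one B" "src B u = ?b'" "trg B u = P0 t a" for a u
   unfolding n(4)[OF that] using that b g by simp
  then show ?thesis using n(1-3) by blast
 qed
 then obtain y where y: "ALL g:one B. iso2 H (y g) & dm H (y g) = P1 R g \<odot> x (src B g) & cd H (y g) = x (trg B g) \<odot> P1 K g &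
   (ALL a:ob A. ALL u. u : one B --> src B u = trg B g --> trg B u = P0 t a -->
   v g a u \<cdot> ((s a u <| P1 K g) \<cdot> (c1 a u |> y g))
   = s a (u *[B] g) \<cdot> (w g a u <| x (src B g)))"
  by metis
 have yt [simp]: "iso2 H (y g)" "y g : two H" "dm H (y g) = P1 R g \<odot> x (src B g)" "cd H (y g) = x (trg B g) \<odot> P1 K g"
  if "g : one B" for g using y that c.H.iso2_in by auto
 have ye: "v g a u \<cdot> ((s a u <| P1 K g) \<cdot> (c1 a u |> y g))
   = s a (u *[B] g) \<cdot> (w g a u <| x b)"
  if "g : one B" "a:ob A" "u : one B" "src B u = trg B g" "trg B u = P0 t a" "src B g = b" for g a u b
  using y that by blast
text \<open>Cells into \<open>x b' \<odot> K g\<close> are compared after composing with the isomorphisms \<open>s\<close> and \<open>v\<close>.\<close>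
 have eqI: "n = n'" if g: "g : one B" "trg B g = b'" and n: "n : two H" "n' : two H" "dm H n' = dm H n" "cd H n = x b' \<odot> P1 K g" "cd H n' = x b' \<odot> P1 K g"
   and e: "!!a u. [|a : ob A; u : one B; src B u = b'; trg B u = P0 t a|] ==>
    v g a u \<cdot> ((s a u <| P1 K g) \<cdot> (c1 a u |> n)) = v g a u \<cdot> ((s a u <| P1 K g) \<cdot> (c1 a u |> n'))"
   for g b' n n'
 proof (rule c.faithful[of b'])
  show b': "b' : ob B" using g by auto
  have tn: "trg H (dm H n) = P0 R b'" "trg H (dm H n') = P0 R b'" "src H (dm H n) = P0 K (src B g)"
   using c.H.two_simps(3,4)[OF n(1)] n(3,4) g b' by simp_all
  then show "trg H (dm H n) = P0 R b'" by simp
  fix a u assume u: "a : ob A" "u : one B" "src B u = b'" "trg B u = P0 t a"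
  have "(s a u <| P1 K g) \<cdot> (c1 a u |> n) = (s a u <| P1 K g) \<cdot> (c1 a u |> n')"
   by (rule c.H.iso2_cancel_left[OF e[OF u]]) (use u g n tn b' in simp_all)
  then show "c1 a u |> n = c1 a u |> n'"
   by (rule c.H.iso2_cancel_left) (use u g n tn b' in simp_all)
 qed (use n in simp_all)
 define sg where "sg = \<lparr>N_src = K, N_trg = R, N1 = restrict x (ob B), N2 = restrict y (one B)\<rparr>"
 have sg [simp]: "b : ob B ==> N1 sg b = x b" "g : one B ==> N2 sg g = y g" for b g by (simp_all add: sg_def)
 have "pst B H K R sg"
 proof (rule pstI, goal_cases)
  case (11 ch)
  let ?g = "dm B ch" and ?g' = "cd B ch"
  let ?b = "src B ?g" and ?b' = "trg B ?g"
  have o: "?g : one B" "?g' : one B" "?b : ob B" "?b' : ob B" "src B ?g' = ?b" "trg B ?g' = ?b'" using 11 by auto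
  show ?case
  proof (rule eqI[of ?g' ?b'], goal_cases)
   case (8 a u)
   have e1: "(c1 a u |> y ?g') : two H" using 8 11 o by simp
   have a1: "(w ?g' a u <| x ?b) \<cdot> (c1 a u |> (P2 R ch <| x ?b))
    = (c2 a (u |>[B] ch) <| x ?b) \<cdot> (w ?g a u <| x ?b)"
    using arg_cong[OF c.w_nat2[of ch ?g ?g' a u], of "%z. z <| x ?b"] 8 11 o by simp
   have a2: "s a (u *[B] ?g') \<cdot> (c2 a (u |>[B] ch) <| x ?b) = d2 a (u |>[B] ch) \<cdot> s a (u *[B] ?g)"
    by (rule cone_morD(4)[OF sm[OF o(3)]]) (use 8 11 o in simp_all)
   have l: "v ?g' a u \<cdot> ((s a u <| P1 K ?g') \<cdot> (c1 a u |> (y ?g' \<cdot> (P2 R ch <| x ?b))))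
    = d2 a (u |>[B] ch) \<cdot> (s a (u *[B] ?g) \<cdot> (w ?g a u <| x ?b))"
   proof -
    have "v ?g' a u \<cdot> ((s a u <| P1 K ?g') \<cdot> (c1 a u |> (y ?g' \<cdot> (P2 R ch <| x ?b))))
     = (v ?g' a u \<cdot> ((s a u <| P1 K ?g') \<cdot> (c1 a u |> y ?g'))) \<cdot> (c1 a u |> (P2 R ch <| x ?b))"
     using 8 11 o by simp
    also have "\<dots> = (s a (u *[B] ?g') \<cdot> (w ?g' a u <| x ?b)) \<cdot> (c1 a u |> (P2 R ch <| x ?b))"
     by (subst ye[of ?g' a u ?b]) (use 8 11 o in simp_all)
    also have "\<dots> = d2 a (u |>[B] ch) \<cdot> (s a (u *[B] ?g) \<cdot> (w ?g a u <| x ?b))"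
     using 8 11 o by (simp add: a1 c.H.vreassoc[OF a2])
    finally show ?thesis .
   qed
   have b1: "(s a u <| P1 K ?g') \<cdot> ((c1 a u \<odot> x ?b') |> P2 K ch)
    = (d1 a u |> P2 K ch) \<cdot> (s a u <| P1 K ?g)"
    by (rule c.H.exchange) (use 8 11 o in simp_all)
   have b2: "v ?g' a u \<cdot> (d1 a u |> P2 K ch) = d2 a (u |>[B] ch) \<cdot> v ?g a u"
    by (rule d.w_nat2) (use 8 11 o in simp_all)
   have "v ?g' a u \<cdot> ((s a u <| P1 K ?g') \<cdot> (c1 a u |> ((x ?b' |> P2 K ch) \<cdot> y ?g)))
    = d2 a (u |>[B] ch) \<cdot> (v ?g a u \<cdot> ((s a u <| P1 K ?g) \<cdot> (c1 a u |> y ?g)))"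
    using 8 11 o by (simp add: c.H.vreassoc[OF b1] c.H.vreassoc[OF b2])
   also have "\<dots> = d2 a (u |>[B] ch) \<cdot> (s a (u *[B] ?g) \<cdot> (w ?g a u <| x ?b))"
    by (subst ye[of ?g a u ?b]) (use 8 11 o in simp_all)
   finally show ?case using l 8 11 o by simp
  qed (use 11 o in simp_all)
 next
  case (12 f g)
  let ?b = "src B f" and ?b' = "src B g" and ?b'' = "trg B g"
  have o: "?b : ob B" "?b' : ob B" "?b'' : ob B" using 12 by auto
  show ?case
  proof (rule eqI[of "g *[B] f" ?b''], goal_cases)
   case (8 a u)
   have u': "u *[B] g : one B" "src B (u *[B] g) = trg B f" "trg B (u *[B] g) = P0 t a" using 8 12 by simp_all
   have a1: "(w (g *[B] f) a u <| x ?b) \<cdot> (c1 a u |> (Pc R g f <| x ?b))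
    = (w f a (u *[B] g) <| x ?b) \<cdot> (w g a u <| (P1 R f \<odot> x ?b))"
    using arg_cong[OF c.w_comp[of f g a u], of "%z. z <| x ?b"] 8 12 o by simp
   have "v (g *[B] f) a u \<cdot> ((s a u <| P1 K (g *[B] f)) \<cdot> (c1 a u |> (y (g *[B] f) \<cdot> (Pc R g f <| x ?b))))
    = (v (g *[B] f) a u \<cdot> ((s a u <| P1 K (g *[B] f)) \<cdot> (c1 a u |> y (g *[B] f)))) \<cdot> (c1 a u |> (Pc R g f <| x ?b))"
    using 8 12 o by simp
   also have "\<dots> = (s a (u *[B] (g *[B] f)) \<cdot> (w (g *[B] f) a u <| x ?b)) \<cdot> (c1 a u |> (Pc R g f <| x ?b))"
    by (subst ye[of "g *[B] f" a u ?b]) (use 8 12 o in simp_all)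
   also have "\<dots> = (s a (u *[B] (g *[B] f)) \<cdot> (w f a (u *[B] g) <| x ?b)) \<cdot> (w g a u <| (P1 R f \<odot> x ?b))"
    using 8 12 o by (simp add: a1)
   also have "\<dots> = (v f a (u *[B] g) \<cdot> ((s a (u *[B] g) <| P1 K f) \<cdot> (c1 a (u *[B] g) |> y f))) \<cdot> (w g a u <| (P1 R f \<odot> x ?b))"
    using ye[of f a "u *[B] g" ?b] 8 12 o u' by simp
   finally have l: "v (g *[B] f) a u \<cdot> ((s a u <| P1 K (g *[B] f)) \<cdot> (c1 a u |> (y (g *[B] f) \<cdot> (Pc R g f <| x ?b))))
    = (v f a (u *[B] g) \<cdot> ((s a (u *[B] g) <| P1 K f) \<cdot> (c1 a (u *[B] g) |> y f))) \<cdot> (w g a u <| (P1 R f \<odot> x ?b))" .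
   have b1: "(s a u <| P1 K (g *[B] f)) \<cdot> ((c1 a u \<odot> x ?b'') |> Pc K g f)
    = (d1 a u |> Pc K g f) \<cdot> (s a u <| (P1 K g \<odot> P1 K f))"
    by (rule c.H.exchange) (use 8 12 o in simp_all)
   have b2: "v (g *[B] f) a u \<cdot> (d1 a u |> Pc K g f) = v f a (u *[B] g) \<cdot> (v g a u <| P1 K f)"
    by (rule d.w_comp) (use 8 12 o in simp_all)
   have b3: "(v g a u <| P1 K f) \<cdot> ((s a u <| (P1 K g \<odot> P1 K f)) \<cdot> (c1 a u |> (y g <| P1 K f)))
    = (s a (u *[B] g) <| P1 K f) \<cdot> (w g a u <| (x ?b' \<odot> P1 K f))"
    using arg_cong[OF ye[of g a u ?b'], of "%z. z <| P1 K f"] 8 12 o by simp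
   have b4: "(w g a u <| (x ?b' \<odot> P1 K f)) \<cdot> ((c1 a u \<odot> P1 R g) |> y f)
    = (c1 a (u *[B] g) |> y f) \<cdot> (w g a u <| (P1 R f \<odot> x ?b))"
    by (rule c.H.exchange) (use 8 12 o in simp_all)
   have "v (g *[B] f) a u \<cdot> ((s a u <| P1 K (g *[B] f)) \<cdot> (c1 a u |>
     ((x ?b'' |> Pc K g f) \<cdot> ((y g <| P1 K f) \<cdot> (P1 R g |> y f)))))
    = v f a (u *[B] g) \<cdot> (((v g a u <| P1 K f) \<cdot> ((s a u <| (P1 K g \<odot> P1 K f)) \<cdot> (c1 a u |> (y g <| P1 K f)))) \<cdot>
     ((c1 a u \<odot> P1 R g) |> y f))"
    using 8 12 o by (simp add: c.H.vreassoc[OF b1] c.H.vreassoc[OF b2])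
   also have "\<dots> = (v f a (u *[B] g) \<cdot> ((s a (u *[B] g) <| P1 K f) \<cdot> (c1 a (u *[B] g) |> y f))) \<cdot> (w g a u <| (P1 R f \<odot> x ?b))"
    unfolding b3 using 8 12 o by (simp add: b4)
   finally show ?case using l 8 12 o by simp
  qed (use 12 o in simp_all)
 next
  case (13 b)
  show ?case
  proof (rule eqI[of "id1 B b" b], goal_cases)
   case (8 a u)
   have l: "v (id1 B b) a u \<cdot> ((s a u <| P1 K (id1 B b)) \<cdot> (c1 a u |> (y (id1 B b) \<cdot> (Pu R b <| x b)))) = s a u"
   proof -
    have a1: "(w (id1 B b) a u <| x b) \<cdot> (c1 a u |> (Pu R b <| x b)) = id2 H (c1 a u \<odot> x b)"
     using arg_cong[OF c.w_id[of a u b], of "%z. z <| x b"] 8 13 by simp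
    have "v (id1 B b) a u \<cdot> ((s a u <| P1 K (id1 B b)) \<cdot> (c1 a u |> (y (id1 B b) \<cdot> (Pu R b <| x b))))
     = (v (id1 B b) a u \<cdot> ((s a u <| P1 K (id1 B b)) \<cdot> (c1 a u |> y (id1 B b)))) \<cdot> (c1 a u |> (Pu R b <| x b))"
     using 8 13 by simp
    also have "\<dots> = (s a u \<cdot> (w (id1 B b) a u <| x b)) \<cdot> (c1 a u |> (Pu R b <| x b))"
     using ye[of "id1 B b" a u b] 8 13 by simp
    also have "\<dots> = s a u" using 8 13 by (simp add: a1)
    finally show ?thesis .
   qed
   have b1: "(s a u <| P1 K (id1 B b)) \<cdot> ((c1 a u \<odot> x b) |> Pu K b) = (d1 a u |> Pu K b) \<cdot> s a u"
    using c.H.exchange[of "Pu K b" "s a u", OF _ _ _ refl refl refl refl] 8 13 by simp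
   have b2: "v (id1 B b) a u \<cdot> (d1 a u |> Pu K b) = id2 H (d1 a u)"
    by (rule d.w_id) (use 8 13 in simp_all)
   show ?case using l 8 13 by (simp add: b1 c.H.vreassoc1[OF b2])
  qed (use 13 in simp_all)
 qed (simp_all add: c.B.tcat c.H.tcat c.K.pseudofunctor_axioms d.K.pseudofunctor_axioms, simp_all add: sg_def)
 moreover have "c.CM b (r1 H c1 (N1 sg b)) (r2 H c2 (N1 sg b)) (r2 H c3 (N1 sg b)) d1 d2 d3 s"
  if "b : ob B" for b using sm[OF that] that by simp
 moreover have "v g a u \<cdot> ((s a u <| P1 K g) \<cdot> (c1 a u |> N2 sg g))
   = s a (u *[B] g) \<cdot> (w g a u <| N1 sg (src B g))"
  if "g : one B" "a : ob A" "u : one B" "src B u = trg B g" "trg B u = P0 t a" for g a u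
  using ye[OF that refl] that by simp
 ultimately show ?thesis
  by (intro exI[of _ sg] exI[of _ s]) (simp add: si)
qed

end

section \<open>Pointwise universality implies the universal property\<close>

lemma (in kan_setup) mdf_cone_mor:
 assumes K: "psf B H K" and m: "mdf A H (psf_comp A H K t) D al al' m" and b: "b : ob B"
 shows "CM b (tc1 H K al) (tc2 H K al) (tc3 A H t K al) (tc1 H K al') (tc2 H K al') (tc3 A H t K al') (%a u. M_at m a <| P1 K u)"
proof -
 interpret K: psf B H K by fact
 interpret m: mdf A H "psf_comp A H K t" D al al' m by fact
 show ?thesis
 proof (rule cone_morI, goal_cases)
  case (1 a u) then show ?case by (simp add: tc1_def)
 next
  case (2 a mu)
  then show ?case using H.exchange[of "P2 K mu" "M_at m a", OF _ _ _ refl refl refl refl] by (simp add: tc2_def)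
 next
  case (3 f u)
  let ?a = "src A f" and ?a' = "trg A f" and ?tf = "P1 t f"
  have e: "(M_at m ?a' <| P1 K (?tf *[B] u)) \<cdot> (N1 al ?a' |> Pc K ?tf u)
   = (N1 al' ?a' |> Pc K ?tf u) \<cdot> (M_at m ?a' <| (P1 K ?tf \<odot> P1 K u))"
   by (rule H.exchange) (use 3 in simp_all)
  have n: "(M_at m ?a' <| (P1 K ?tf \<odot> P1 K u)) \<cdot> (N2 al f <| P1 K u)
   = (N2 al' f <| P1 K u) \<cdot> (P1 D f |> (M_at m ?a <| P1 K u))"
   using arg_cong[OF m.M_nat[OF 3(1) refl refl], of "%z. z <| P1 K u"] 3 by simp
  show ?case using 3 by (simp add: tc3_def H.vreassoc[OF e] n)
 qed
qed

context psran_data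
begin

sublocale kan_trans A B H t D R ee
 by unfold_locales

lemma post_at:
 assumes "pst B H K R sg"
 shows "pst A H (psf_comp A H K t) D (ps_comp A H ee (ps_whisker_right A H sg t))"
 by (rule pst_ps_comp[OF pst_whisker_right[OF assms t.psf_axioms'] ee.pst_axioms])

text \<open>The constraint cells of \<open>sg\<close> compare the cones of \<open>ee\<close> at \<open>sg b\<close> with those of \<open>ee (sg t)\<close>.\<close>

lemma compare_cone_mor:
 assumes s: "pst B H K R sg" and b: "b : ob B"
 shows "CM b (r1 H (tc1 H R ee) (N1 sg b)) (r2 H (tc2 H R ee) (N1 sg b)) (r2 H (tc3 A H t R ee) (N1 sg b))
  (tc1 H K (ps_comp A H ee (ps_whisker_right A H sg t))) (tc2 H K (ps_comp A H ee (ps_whisker_right A H sg t)))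
  (tc3 A H t K (ps_comp A H ee (ps_whisker_right A H sg t))) (%a u. N1 ee a |> N2 sg u)"
proof -
 interpret s: pst B H K R sg by fact
 show ?thesis
 proof (rule cone_morI, goal_cases)
  case (1 a u) then show ?case using b by (simp add: tc1_def)
 next
  case (2 a mu)
  then show ?case
   using arg_cong[OF s.N2_nat[OF 2(2) refl refl refl refl], of "%z. N1 ee a |> z"] 2 b by (simp add: tc2_def)
 next
  case (3 f u)
  let ?a = "src A f" and ?a' = "trg A f" and ?tf = "P1 t f"
  have n: "(N1 ee ?a' |> N2 sg (?tf *[B] u)) \<cdot> (N1 ee ?a' |> (Pc R ?tf u <| N1 sg b))
   = ((N1 ee ?a' \<odot> N1 sg (P0 t ?a')) |> Pc K ?tf u) \<cdot> ((N1 ee ?a' |> (N2 sg ?tf <| P1 K u)) \<cdot>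
     ((N1 ee ?a' \<odot> P1 R ?tf) |> N2 sg u))"
   using arg_cong[OF s.N2_cmp[of u ?tf b "P0 t ?a'"], of "%z. N1 ee ?a' |> z"] 3 b by simp
  have e: "((N1 ee ?a' \<odot> P1 R ?tf) |> N2 sg u) \<cdot> (N2 ee f <| (P1 R u \<odot> N1 sg b))
   = (N2 ee f <| (N1 sg (P0 t ?a) \<odot> P1 K u)) \<cdot> ((P1 D f \<odot> N1 ee ?a) |> N2 sg u)"
   by (rule H.exchange[symmetric]) (use 3 b in simp_all)
  show ?case using 3 b by (simp add: tc3_def H.vreassoc[OF n] e)
 qed
qed

text \<open>Fullness and faithfulness: a modification \<open>ee(sg t) \<Rightarrow> ee(ta t)\<close> gives, for every
 \<open>b\<close>, a morphism between the cones of \<open>sg b\<close> and \<open>ta b\<close>, which lifts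
 uniquely.  Essential surjectivity: a transformation \<open>K t \<rightarrow> D\<close> gives a family of
 cones on \<open>K\<close>, which factors through the universal one; evaluating the factorisation at
 identities gives the required isomorphism.\<close>

lemma psran_if_universal:
 assumes u: "universal_bicone A B H t D R (tc1 H R ee) (tc2 H R ee) (tc3 A H t R ee)"
 shows "is_psran A B H t D R ee"
 unfolding is_psran_iff
proof (intro allI impI)
 fix K assume K0: "pseudofunctor B H K"
 interpret K: psf B H K using K0 by (simp add: psf_def B.tcat H.tcat)
 interpret u: ubicone A B H t D R "tc1 H R ee" "tc2 H R ee" "tc3 A H t R ee" "tw H R ee"
  using u trans_bicone by (simp add: ubicone_def ubicone_axioms_def)
 let ?P = "post_functor (PS B H) (PS A H) (precomp A B H t) ee D R K"
 note pB = pst_iff[OF B.tcat H.tcat] and mB = mdf_iff[OF B.tcat H.tcat]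
 note pA = pst_iff[OF A.tcat H.tcat] and mA = mdf_iff[OF A.tcat H.tcat]
 have Po: "F_ob ?P sg = ps_comp A H ee (ps_whisker_right A H sg t)" if "pst B H K R sg" for sg
  using that by (simp add: pB)
 have Pa: "F_ar ?P n = id2 (PS A H) ee **[PS A H] modif_whisker_right A H n t" if "mdf B H K R sg ta n" for sg ta n
  using that by (simp add: mB)
 show "hom_equiv (PS B H) K R (PS A H) (psf_comp A H K t) D ?P"
  unfolding hom_equiv_def
 proof (intro conjI allI impI ballI, goal_cases)
  case 1
  show ?case using post_in[of K] K0 by simp
 next
  case (2 sg ta m)
  have s: "pst B H K R sg" and t: "pst B H K R ta" using 2(1,2) by (simp_all add: pB)
  let ?es = "ps_comp A H ee (ps_whisker_right A H sg t)" and ?et = "ps_comp A H ee (ps_whisker_right A H ta t)"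
  have m: "mdf A H (psf_comp A H K t) D ?es ?et m"
   using 2(3-5) post_at[OF s] by (simp add: Po[OF s] Po[OF t] mA pA)
  interpret s: pst B H K R sg by (rule s)
  interpret t': pst B H K R ta by (rule t)
  interpret m: mdf A H "psf_comp A H K t" D ?es ?et m by (rule m)
  have mt [simp]: "M_at m a : two H" "dm H (M_at m a) = N1 ee a \<odot> N1 sg (P0 t a)" "cd H (M_at m a) = N1 ee a \<odot> N1 ta (P0 t a)"
   if "a : ob A" for a using m.M_simps[OF that] that by simp_all
  have "EX n. n : two H & dm H n = N1 sg b & cd H n = N1 ta b &
   (ALL a:ob A. ALL u. u : one B --> src B u = b --> trg B u = P0 t a -->
    (N1 ee a |> N2 ta u) \<cdot> ((N1 ee a \<odot> P1 R u) |> n)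
    = (M_at m a <| P1 K u) \<cdot> (N1 ee a |> N2 sg u))" if b: "b : ob B" for b
  proof -
   let ?q = "%a u. inv2 H (N1 ee a |> N2 ta u) \<cdot> ((M_at m a <| P1 K u) \<cdot> (N1 ee a |> N2 sg u))"
   have ks: "kan_trans A B H t D K ?es" and kt: "kan_trans A B H t D K ?et"
    using post_at[OF s] post_at[OF t] by (simp_all add: kan_trans_def kan_setup_axioms K.psf_axioms')
   note cs = kan_trans.trans_cone[OF ks b] and ct = kan_trans.trans_cone[OF kt b]
   note rs = cone_restrict[OF trans_cone[OF b] s.N1_simps(1)[OF b] s.N1_simps(3)[OF b] s.N1_simps(2)[OF b]]
    and rt = cone_restrict[OF trans_cone[OF b] t'.N1_simps(1)[OF b] t'.N1_simps(3)[OF b] t'.N1_simps(2)[OF b]]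
   have i: "CM b (tc1 H K ?et) (tc2 H K ?et) (tc3 A H t K ?et) (r1 H (tc1 H R ee) (N1 ta b)) (r2 H (tc2 H R ee) (N1 ta b))
    (r2 H (tc3 A H t R ee) (N1 ta b)) (%a u. inv2 H (N1 ee a |> N2 ta u))"
    by (rule cone_mor_inv[OF rt ct compare_cone_mor[OF t b]]) (use b in simp)
   have q: "CM b (r1 H (tc1 H R ee) (N1 sg b)) (r2 H (tc2 H R ee) (N1 sg b)) (r2 H (tc3 A H t R ee) (N1 sg b))
    (r1 H (tc1 H R ee) (N1 ta b)) (r2 H (tc2 H R ee) (N1 ta b)) (r2 H (tc3 A H t R ee) (N1 ta b)) ?q"
    by (rule cone_mor_comp[OF rs ct rt cone_mor_comp[OF rs cs ct compare_cone_mor[OF s b] mdf_cone_mor[OF K.psf_axioms' m b]] i])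
   obtain n where n: "n : two H" "dm H n = N1 sg b" "cd H n = N1 ta b"
    "!!a u. [|a:ob A; u : one B; src B u = b; trg B u = P0 t a|] ==> tc1 H R ee a u |> n = ?q a u"
    by (rule u.lift_exists[OF b _ _ _ _ _ _ _ q, of "P0 K b"]) (use b in simp_all)
   have "(N1 ee a |> N2 ta u) \<cdot> ((N1 ee a \<odot> P1 R u) |> n)
    = (M_at m a <| P1 K u) \<cdot> (N1 ee a |> N2 sg u)"
    if "a:ob A" "u : one B" "src B u = b" "trg B u = P0 t a" for a u
    using n(4)[OF that] that b by (simp add: tc1_def)
   then show ?thesis using n(1-3) by blast
  qed
  then obtain n where n0: "ALL b:ob B. n b : two H & dm H (n b) = N1 sg b & cd H (n b) = N1 ta b &
   (ALL a:ob A. ALL u. u : one B --> src B u = b --> trg B u = P0 t a -->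
    (N1 ee a |> N2 ta u) \<cdot> ((N1 ee a \<odot> P1 R u) |> n b)
    = (M_at m a <| P1 K u) \<cdot> (N1 ee a |> N2 sg u))"
   by metis
  have n [simp]: "n b : two H" "dm H (n b) = N1 sg b" "cd H (n b) = N1 ta b" if "b : ob B" for b using n0 that by auto
  have ne: "(N1 ee a |> N2 ta u) \<cdot> ((N1 ee a \<odot> P1 R u) |> n b)
    = (M_at m a <| P1 K u) \<cdot> (N1 ee a |> N2 sg u)"
   if "a:ob A" "u : one B" "src B u = b" "trg B u = P0 t a" for a u b
  proof -
   have "b : ob B" using that by auto
   then show ?thesis using n0 that by blast
  qed
text \<open>Determination of a cell into \<open>ta b \<odot> k\<close> by its composites with the universal cone.\<close>
  define nn where "nn = \<lparr>M_src = sg, M_trg = ta, M_at = restrict n (ob B)\<rparr>"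
  have nnm: "mdf B H K R sg ta nn"
  proof (rule mdfI[OF s t], goal_cases)
   case (5 g)
   let ?b = "src B g" and ?b' = "trg B g"
   have o: "?b : ob B" "?b' : ob B" using 5 by auto
   have "N2 ta g \<cdot> (P1 R g |> n ?b) = (n ?b' <| P1 K g) \<cdot> N2 sg g"
   proof (rule u.faithful[of ?b'], goal_cases)
    case (7 a v)
    let ?e = "N1 ee a"
    have k: "(?e |> (N2 ta v <| P1 K g)) \<cdot> ((?e \<odot> P1 R v) |> N2 ta g)
     = ((?e \<odot> N1 ta (P0 t a)) |> inv2 H (Pc K v g)) \<cdot> ((?e |> N2 ta (v *[B] g)) \<cdot> (?e |> (Pc R v g <| N1 ta ?b)))"
     using arg_cong[OF t'.N2_cmp[OF 5 7(2) 7(3)[symmetric] refl 7(4)], of "%z. ?e |> z"] 5 7 o by simp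
    have k': "(?e |> (N2 sg v <| P1 K g)) \<cdot> ((?e \<odot> P1 R v) |> N2 sg g)
     = ((?e \<odot> N1 sg (P0 t a)) |> inv2 H (Pc K v g)) \<cdot> ((?e |> N2 sg (v *[B] g)) \<cdot> (?e |> (Pc R v g <| N1 sg ?b)))"
     using arg_cong[OF s.N2_cmp[OF 5 7(2) 7(3)[symmetric] refl 7(4)], of "%z. ?e |> z"] 5 7 o by simp
    have x1: "(?e |> (Pc R v g <| N1 ta ?b)) \<cdot> ((?e \<odot> (P1 R v \<odot> P1 R g)) |> n ?b)
     = ((?e \<odot> P1 R (v *[B] g)) |> n ?b) \<cdot> (?e |> (Pc R v g <| N1 sg ?b))"
     using H.exchange[of "n ?b" "?e |> Pc R v g", OF _ _ _ refl refl refl refl] 5 7 o by simp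
    have x2: "(?e |> N2 ta (v *[B] g)) \<cdot> ((?e \<odot> P1 R (v *[B] g)) |> n ?b)
     = (M_at m a <| P1 K (v *[B] g)) \<cdot> (?e |> N2 sg (v *[B] g))"
     by (rule ne) (use 5 7 o in simp_all)
    have x3: "(M_at m a <| (P1 K v \<odot> P1 K g)) \<cdot> ((?e \<odot> N1 sg (P0 t a)) |> inv2 H (Pc K v g))
     = ((?e \<odot> N1 ta (P0 t a)) |> inv2 H (Pc K v g)) \<cdot> (M_at m a <| P1 K (v *[B] g))"
     by (rule H.exchange) (use 5 7 o in simp_all)
    have x4: "(?e |> (N2 ta v <| P1 K g)) \<cdot> ((?e \<odot> P1 R v) |> (n ?b' <| P1 K g))
     = (M_at m a <| (P1 K v \<odot> P1 K g)) \<cdot> (?e |> (N2 sg v <| P1 K g))"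
     using arg_cong[OF ne[OF 7(1,2,3,4)], of "%z. z <| P1 K g"] 5 7 o by simp
    show ?case
    proof (rule H.iso2_cancel_left[of "?e |> (N2 ta v <| P1 K g)"], goal_cases)
     case 1
     show ?case using 5 7 o
      by (simp add: tc1_def H.vreassoc[OF k] x1 H.vreassoc[OF x2] H.vreassoc[OF x4] k' H.vreassoc[OF x3])
    qed (use 5 7 o in "simp_all add: tc1_def")
   qed (use 5 o in simp_all)
   then show ?case using 5 o by (simp add: nn_def)
  qed (simp_all add: nn_def)
  have Fn: "F_ar ?P n' = m \<longleftrightarrow> (ALL a:ob A. N1 ee a |> M_at n' (P0 t a) = M_at m a)" if n': "mdf B H K R sg ta n'" for n'
  proof -
   have e: "mdf A H (psf_comp A H K t) D ?es ?et (F_ar ?P n')"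
    unfolding Pa[OF n'] by (rule mdf_hcomp[OF mdf_whisker_right[OF n' t.psf_axioms'] mdf_id2[OF ee.pst_axioms]])
   have c: "M_at (F_ar ?P n') a = N1 ee a |> M_at n' (P0 t a)" if "a : ob A" for a
    using that by (simp add: Pa[OF n'])
   show ?thesis using mdf_eqI[OF e m] c by auto
  qed
  have nm: "N1 ee a |> n (P0 t a) = M_at m a" if a: "a : ob A" for a
  proof -
   let ?b = "P0 t a" let ?i = "id1 B ?b" let ?e = "N1 ee a"
   have q: "(?e |> N2 ta ?i) \<cdot> ((?e \<odot> P1 R ?i) |> n ?b)
    = (M_at m a <| P1 K ?i) \<cdot> (?e |> N2 sg ?i)"
    by (rule ne) (use a in simp_all)
   have x: "((?e \<odot> P1 R ?i) |> n ?b) \<cdot> (?e |> (Pu R ?b <| N1 sg ?b))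
    = (?e |> (Pu R ?b <| N1 ta ?b)) \<cdot> (?e |> n ?b)"
    using H.exchange[of "n ?b" "?e |> Pu R ?b", OF _ _ _ refl refl refl refl] a by simp
   have ut: "(?e |> N2 ta ?i) \<cdot> (?e |> (Pu R ?b <| N1 ta ?b)) = (?e \<odot> N1 ta ?b) |> Pu K ?b"
    using arg_cong[OF t'.N2_unit[of ?b], of "%z. ?e |> z"] a by simp
   have us: "(?e |> N2 sg ?i) \<cdot> (?e |> (Pu R ?b <| N1 sg ?b)) = (?e \<odot> N1 sg ?b) |> Pu K ?b"
    using arg_cong[OF s.N2_unit[of ?b], of "%z. ?e |> z"] a by simp
   have y: "(M_at m a <| P1 K ?i) \<cdot> ((?e \<odot> N1 sg ?b) |> Pu K ?b)
    = ((?e \<odot> N1 ta ?b) |> Pu K ?b) \<cdot> M_at m a"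
    using H.exchange[of "Pu K ?b" "M_at m a", OF _ _ _ refl refl refl refl] a by simp
   show ?thesis
   proof (rule H.iso2_cancel_left[of "(?e \<odot> N1 ta ?b) |> Pu K ?b"])
    have "((?e \<odot> N1 ta ?b) |> Pu K ?b) \<cdot> (?e |> n ?b)
     = (?e |> N2 ta ?i) \<cdot> ((?e |> (Pu R ?b <| N1 ta ?b)) \<cdot> (?e |> n ?b))"
     using a by (simp add: H.vreassoc1[OF ut])
    also have "\<dots> = ((?e \<odot> N1 ta ?b) |> Pu K ?b) \<cdot> M_at m a"
     unfolding x[symmetric] using a by (simp add: H.vreassoc[OF q] us y)
    finally show "((?e \<odot> N1 ta ?b) |> Pu K ?b) \<cdot> (?e |> n ?b) = ((?e \<odot> N1 ta ?b) |> Pu K ?b) \<cdot> M_at m a" .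
   qed (use a in simp_all)
  qed
  have un: "n' = nn" if n': "mdf B H K R sg ta n'" and e: "ALL a:ob A. N1 ee a |> M_at n' (P0 t a) = M_at m a" for n'
  proof (rule mdf_eqI[OF n' nnm])
   interpret n': mdf B H K R sg ta n' by (rule n')
   fix b assume b: "b : ob B"
   have "M_at n' b = n b"
   proof (rule u.faithful[of b], goal_cases)
    case (7 a v)
    let ?e = "N1 ee a"
    have q: "(?e |> N2 ta v) \<cdot> ((?e \<odot> P1 R v) |> M_at n' b)
     = (M_at m a <| P1 K v) \<cdot> (?e |> N2 sg v)"
    proof -
     have "(?e |> N2 ta v) \<cdot> ((?e \<odot> P1 R v) |> M_at n' b)
      = ((?e |> M_at n' (P0 t a)) <| P1 K v) \<cdot> (?e |> N2 sg v)"
      using arg_cong[OF n'.M_nat[OF 7(2,3,4)], of "%z. ?e |> z"] 7 b by simp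
     then show ?thesis using e 7(1) by simp
    qed
    show ?case
     by (rule H.iso2_cancel_left[of "?e |> N2 ta v"])
      (use 7 b q ne[OF 7(1-4)] in "simp_all add: tc1_def")
   qed (use b in simp_all)
   then show "M_at n' b = M_at nn b" using b by (simp add: nn_def)
  qed
  show ?case
  proof (rule ex1I[of _ nn], goal_cases)
   case 1
   have "F_ar ?P nn = m" unfolding Fn[OF nnm] using nm by (simp add: nn_def)
   then show ?case using nnm by (simp add: mB)
  next
   case (2 n')
   then have n': "mdf B H K R sg ta n'" by (simp add: mB)
   show ?case by (rule un[OF n']) (use 2 Fn[OF n'] in blast)
  qed
 next
  case (3 al)
  have a: "pst A H (psf_comp A H K t) D al" using 3 by (simp add: pA)
  interpret k: kan_trans A B H t D K al
   using a by (simp add: kan_trans_def kan_setup_axioms K.psf_axioms')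
  interpret p: bicone_pair A B H t D R "tc1 H R ee" "tc2 H R ee" "tc3 A H t R ee" "tw H R ee" K "tc1 H K al" "tc2 H K al" "tc3 A H t K al" "tw H K al"
   using u.ubicone_axioms k.trans_bicone by (simp add: bicone_pair_def)
  obtain sg s where f: "pst B H K R sg"
   "ALL b:ob B. CM b (r1 H (tc1 H R ee) (N1 sg b)) (r2 H (tc2 H R ee) (N1 sg b)) (r2 H (tc3 A H t R ee) (N1 sg b))
    (tc1 H K al) (tc2 H K al) (tc3 A H t K al) s"
   "ALL a:ob A. ALL u. u : one B --> trg B u = P0 t a --> iso2 H (s a u)"
   "ALL g:one B. ALL a:ob A. ALL u. u : one B --> src B u = trg B g --> trg B u = P0 t a -->
    tw H K al g a u \<cdot> ((s a u <| P1 K g) \<cdot> (tc1 H R ee a u |> N2 sg g))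
    = s a (u *[B] g) \<cdot> (tw H R ee g a u <| N1 sg (src B g))"
   using p.ex_factorisation by blast
  interpret s: pst B H K R sg by (rule f(1))
  let ?es = "ps_comp A H ee (ps_whisker_right A H sg t)"
  have es: "pst A H (psf_comp A H K t) D ?es" by (rule post_at[OF f(1)])
  have si [simp]: "iso2 H (s a u)" if "a : ob A" "u : one B" "trg B u = P0 t a" for a u using f(3) that by blast
  have sm: "CM b (r1 H (tc1 H R ee) (N1 sg b)) (r2 H (tc2 H R ee) (N1 sg b)) (r2 H (tc3 A H t R ee) (N1 sg b))
    (tc1 H K al) (tc2 H K al) (tc3 A H t K al) s" if "b : ob B" for b using f(2) that by blast
  have st [simp]: "s a u : two H" "dm H (s a u) = N1 ee a \<odot> (P1 R u \<odot> N1 sg (src B u))" "cd H (s a u) = N1 al a \<odot> P1 K u"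
   if "a : ob A" "u : one B" "trg B u = P0 t a" for a u
   using cone_morD(1-3)[OF sm[of "src B u"], of a u] that by (simp_all add: tc1_def)
  define x where "x a = inv2 H (N1 al a |> Pu K (P0 t a)) \<cdot> (s a (id1 B (P0 t a)) \<cdot> (N1 ee a |> (Pu R (P0 t a) <| N1 sg (P0 t a))))" for a
  have x [simp]: "iso2 H (x a)" "x a : two H" "dm H (x a) = N1 ee a \<odot> N1 sg (P0 t a)" "cd H (x a) = N1 al a" if "a : ob A" for a
   using that by (simp_all add: x_def)
  have sx: "s a v = (x a <| P1 K v) \<cdot> (N1 ee a |> N2 sg v)" if v: "a : ob A" "v : one B" "trg B v = P0 t a" for a v
  proof -
   let ?b = "P0 t a" and ?e = "N1 ee a" and ?c = "src B v" let ?i = "id1 B ?b"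
   have c: "?c : ob B" using v by auto
   have q: "(N1 al a |> Pc K ?i v) \<cdot> ((s a ?i <| P1 K v) \<cdot> ((?e \<odot> P1 R ?i) |> N2 sg v))
    = s a v \<cdot> (?e |> (Pc R ?i v <| N1 sg ?c))"
    using f(4)[rule_format, OF v(2) v(1), of ?i] v by (simp add: tc1_def tw_def)
   have pu: "(?e |> (Pc R ?i v <| N1 sg ?c)) \<cdot> (?e |> (Pu R ?b <| (P1 R v \<odot> N1 sg ?c))) = id2 H (?e \<odot> (P1 R v \<odot> N1 sg ?c))"
    using arg_cong[OF R.Pu_left[of v], of "%z. ?e |> (z <| N1 sg ?c)"] v c by simp
   have e: "((?e \<odot> P1 R ?i) |> N2 sg v) \<cdot> (?e |> (Pu R ?b <| (P1 R v \<odot> N1 sg ?c)))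
    = (?e |> (Pu R ?b <| (N1 sg ?b \<odot> P1 K v))) \<cdot> (?e |> N2 sg v)"
    using H.exchange[of "N2 sg v" "?e |> Pu R ?b", OF _ _ _ refl refl refl refl] v c by simp
   have y: "(s a ?i <| P1 K v) \<cdot> (?e |> (Pu R ?b <| (N1 sg ?b \<odot> P1 K v)))
    = (N1 al a |> (Pu K ?b <| P1 K v)) \<cdot> (x a <| P1 K v)"
   proof -
    have "(N1 al a |> Pu K ?b) \<cdot> x a = s a ?i \<cdot> (?e |> (Pu R ?b <| N1 sg ?b))"
     using v by (simp add: x_def)
    from arg_cong[OF this[symmetric], of "%z. z <| P1 K v"] show ?thesis using v c by simp
   qed
   have pk: "(N1 al a |> Pc K ?i v) \<cdot> (N1 al a |> (Pu K ?b <| P1 K v)) = id2 H (N1 al a \<odot> P1 K v)"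
    using arg_cong[OF K.Pu_left[of v], of "%z. N1 al a |> z"] v c by simp
   have "s a v = (s a v \<cdot> (?e |> (Pc R ?i v <| N1 sg ?c))) \<cdot> (?e |> (Pu R ?b <| (P1 R v \<odot> N1 sg ?c)))"
    using v c by (simp add: pu)
   also have "\<dots> = (x a <| P1 K v) \<cdot> (?e |> N2 sg v)"
    unfolding q[symmetric] using v c by (simp add: e H.vreassoc[OF y] H.vreassoc1[OF pk])
   finally show ?thesis .
  qed
  define xx where "xx = \<lparr>M_src = ?es, M_trg = al, M_at = restrict x (ob A)\<rparr>"
  have xm: "mdf A H (psf_comp A H K t) D ?es al xx"
  proof (rule mdfI[OF es a], goal_cases)
   case (5 g)
   let ?a = "src A g" and ?a' = "trg A g" let ?b = "P0 t ?a" and ?tg = "P1 t g" let ?i = "id1 B ?b"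
   have o: "?a : ob A" "?a' : ob A" using 5 by auto
   have c3: "s ?a' ?tg \<cdot> (tc3 A H t R ee g ?i <| N1 sg ?b) = tc3 A H t K al g ?i \<cdot> (P1 D g |> s ?a ?i)"
    using cone_morD(5)[OF sm[of ?b] 5, of ?i ?a'] 5 o by simp
   have tr: "tc3 A H t Q dl g ?i \<cdot> ((P1 D g \<odot> N1 dl ?a) |> Pu Q ?b) = N2 dl g" if kq: "kan_trans A B H t D Q dl" for Q dl
   proof -
    interpret k: kan_trans A B H t D Q dl by (rule kq)
    have e: "(N2 dl g <| P1 Q ?i) \<cdot> ((P1 D g \<odot> N1 dl ?a) |> Pu Q ?b) = ((N1 dl ?a' \<odot> P1 Q ?tg) |> Pu Q ?b) \<cdot> N2 dl g"
     using H.exchange[of "Pu Q ?b" "N2 dl g", OF _ _ _ refl refl refl refl] 5 o by simp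
    have pq: "(N1 dl ?a' |> Pc Q ?tg ?i) \<cdot> ((N1 dl ?a' \<odot> P1 Q ?tg) |> Pu Q ?b) = id2 H (N1 dl ?a' \<odot> P1 Q ?tg)"
     using arg_cong[OF k.K.Pu_right[of ?tg], of "%z. N1 dl ?a' |> z"] 5 o by simp
    show ?thesis using 5 o by (simp add: tc3_def e H.vreassoc1[OF pq])
   qed
   have tR: "(tc3 A H t R ee g ?i <| N1 sg ?b) \<cdot> ((P1 D g \<odot> N1 ee ?a) |> (Pu R ?b <| N1 sg ?b)) = N2 ee g <| N1 sg ?b"
    using arg_cong[OF tr[OF kan_trans_axioms], of "%z. z <| N1 sg ?b"] 5 o by (simp add: tc3_def)
   have c3t: "tc3 A H t R ee g ?i : two H" "dm H (tc3 A H t R ee g ?i) = P1 D g \<odot> (N1 ee ?a \<odot> P1 R ?i)" "cd H (tc3 A H t R ee g ?i) = N1 ee ?a' \<odot> P1 R ?tg"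
     "tc3 A H t K al g ?i : two H" "dm H (tc3 A H t K al g ?i) = P1 D g \<odot> (N1 al ?a \<odot> P1 K ?i)" "cd H (tc3 A H t K al g ?i) = N1 al ?a' \<odot> P1 K ?tg"
    using 5 o by (simp_all add: tc3_def)
   have sy: "s ?a ?i \<cdot> (N1 ee ?a |> (Pu R ?b <| N1 sg ?b)) = (N1 al ?a |> Pu K ?b) \<cdot> x ?a"
    using 5 o by (simp add: x_def)
   have sy': "(P1 D g |> s ?a ?i) \<cdot> ((P1 D g \<odot> N1 ee ?a) |> (Pu R ?b <| N1 sg ?b))
     = ((P1 D g \<odot> N1 al ?a) |> Pu K ?b) \<cdot> (P1 D g |> x ?a)"
    using arg_cong[OF sy, of "%z. P1 D g |> z"] 5 o by simp
   have "s ?a' ?tg \<cdot> (N2 ee g <| N1 sg ?b) = N2 al g \<cdot> (P1 D g |> x ?a)"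
   proof -
    have "s ?a' ?tg \<cdot> (N2 ee g <| N1 sg ?b) = (s ?a' ?tg \<cdot> (tc3 A H t R ee g ?i <| N1 sg ?b)) \<cdot> ((P1 D g \<odot> N1 ee ?a) |> (Pu R ?b <| N1 sg ?b))"
     using 5 o c3t by (simp add: tR)
    also have "\<dots> = tc3 A H t K al g ?i \<cdot> (((P1 D g \<odot> N1 al ?a) |> Pu K ?b) \<cdot> (P1 D g |> x ?a))"
     unfolding c3 using 5 o c3t by (simp add: sy')
    also have "\<dots> = N2 al g \<cdot> (P1 D g |> x ?a)"
     using 5 o c3t by (simp add: H.vreassoc1[OF tr[OF k.kan_trans_axioms]])
    finally show ?thesis .
   qed
   then show ?case using 5 o sx[of ?a' ?tg] by (simp add: xx_def)
  qed (simp_all add: xx_def)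
  have "iso2 (PS A H) xx"
  proof (rule T.H.iso2I)
   let ?y = "\<lparr>M_src = al, M_trg = ?es, M_at = (\<lambda>a\<in>ob A. inv2 H (x a))\<rparr>"
   interpret xm: mdf A H "psf_comp A H K t" D ?es al xx by (rule xm)
   have xa: "M_at xx a = x a" if "a : ob A" for a using that by (simp add: xx_def)
   have ym: "mdf A H (psf_comp A H K t) D al ?es ?y"
   proof (rule mdfI[OF a es], goal_cases)
    case (5 g)
    have o: "src A g : ob A" "trg A g : ob A" using 5 by auto
    have "N2 ?es g \<cdot> inv2 H (P1 D g |> x (src A g)) = inv2 H (x (trg A g) <| P1 K (P1 t g)) \<cdot> N2 al g"
     by (rule H.iso2_conj[OF xm.M_nat[OF 5 refl refl, unfolded xa[OF o(1)] xa[OF o(2)] psf_comp_simps(2)[OF 5]]])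
       (use 5 o in simp_all)
    then show ?case using 5 o by simp
   qed simp_all
   show "xx : two (PS A H)" "?y : two (PS A H)" "dm (PS A H) ?y = cd (PS A H) xx" "cd (PS A H) ?y = dm (PS A H) xx"
    using xm ym by (simp_all add: mA)
   have "?y .[PS A H] xx = id2 (PS A H) ?es"
    by (rule mdf_eqI[OF mdf_vcomp[OF xm ym] mdf_id2[OF es]]) (simp add: xa)
   then show "?y .[PS A H] xx = id2 (PS A H) (dm (PS A H) xx)" by simp
   have "xx .[PS A H] ?y = id2 (PS A H) al"
    by (rule mdf_eqI[OF mdf_vcomp[OF ym xm] mdf_id2[OF a]]) (simp add: xa)
   then show "xx .[PS A H] ?y = id2 (PS A H) (cd (PS A H) xx)" by simp
  qed
  moreover have "dm (PS A H) xx = F_ob ?P sg" "cd (PS A H) xx = al" "sg : Ob (hom (PS B H) K R)"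
   using Po[OF f(1)] f(1) by (simp_all add: xx_def pB)
  ultimately show ?case by blast
 qed
qed

end

section \<open>Cones as pseudonatural transformations\<close>

text \<open>With values in \<open>CAT\<close> the two notions of pseudonatural transformation have the same axioms, so
 that the elementwise description applies.\<close>

lemma pst_CAT_iff:
 assumes "two_category A"
 shows "pst A CAT F G nu \<longleftrightarrow> cat_pseudonatural A F G \<lparr>C1 = N1 nu, C2 = N2 nu\<rparr> & N_src nu = F & N_trg nu = G
  & N1 nu : extensional (ob A) & N2 nu : extensional (one A)"
 unfolding pst_iff[OF assms two_category_CAT] pseudonatural_def cat_pseudonatural_def by auto

lemma rep_comp_simps [simp]:
 assumes "psf A K F" "X : ob K"
 shows "a : ob A ==> P0 (psf_comp A CAT (rep K X) F) a = hom K X (P0 F a)"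
  "f : one A ==> P1 (psf_comp A CAT (rep K X) F) f = hom_map K (id1 K X) (P1 F f)"
  "[|ch : two A; u : one K; src K u = X; trg K u = P0 F (src A (dm A ch))|] ==>
    T_at (P2 (psf_comp A CAT (rep K X) F) ch) u = P2 F ch <|[K] u"
  "[|f : one A; g : one A; trg A f = src A g; u : one K; src K u = X; trg K u = P0 F (src A f)|] ==>
    T_at (Pc (psf_comp A CAT (rep K X) F) g f) u = Pc F g f <|[K] u"
  "[|a : ob A; u : one K; src K u = X; trg K u = P0 F a|] ==>
    T_at (Pu (psf_comp A CAT (rep K X) F) a) u = Pu F a <|[K] u"
proof -
 interpret F: psf A K F by fact
 show "a : ob A ==> P0 (psf_comp A CAT (rep K X) F) a = hom K X (P0 F a)"
  "f : one A ==> P1 (psf_comp A CAT (rep K X) F) f = hom_map K (id1 K X) (P1 F f)"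
  "[|ch : two A; u : one K; src K u = X; trg K u = P0 F (src A (dm A ch))|] ==>
    T_at (P2 (psf_comp A CAT (rep K X) F) ch) u = P2 F ch <|[K] u"
  using assms(2) by simp_all
 show "[|f : one A; g : one A; trg A f = src A g; u : one K; src K u = X; trg K u = P0 F (src A f)|] ==>
    T_at (Pc (psf_comp A CAT (rep K X) F) g f) u = Pc F g f <|[K] u"
  "[|a : ob A; u : one K; src K u = X; trg K u = P0 F a|] ==>
    T_at (Pu (psf_comp A CAT (rep K X) F) a) u = Pu F a <|[K] u"
  using assms(2) by (simp_all add: F.H.nt_id_hom del: F.H.hom_map2_id)
qed

text \<open>The action of \<open>X \<mapsto> H(X,F-)\<close> on cells is by precomposition.\<close>

lemma nerve_simps:
 assumes "two_category A" "psf A K F"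
 shows "X : ob K ==> P0 (nerve A K F) X = psf_comp A CAT (rep K X) F"
  "[|x : one K; a : ob A|] ==> N1 (P1 (nerve A K F) x) a = hom_map K x (id1 K (P0 F a))"
  "[|x : one K; f : one A|] ==> N2 (P1 (nerve A K F) x) f = nt_id (hom_map K x (P1 F f))"
  "[|ph : two K; a : ob A|] ==> M_at (P2 (nerve A K F) ph) a = hom_map2 K ph (id2 K (id1 K (P0 F a)))"
  "x : one K ==> N_src (P1 (nerve A K F) x) = psf_comp A CAT (rep K (trg K x)) F"
  "x : one K ==> N_trg (P1 (nerve A K F) x) = psf_comp A CAT (rep K (src K x)) F"
proof -
 interpret F: psf A K F by fact
 interpret Y: sfun "op2 K" "PS K CAT" "yoneda K" by (rule F.H.sfun_yoneda)
 have y1: "F.H.yoneda1 x : one (PS K CAT)" if "x : one K" for x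
  using F.H.pst_yoneda1[OF that] by (simp add: pst_iff[OF F.H.tcat two_category_CAT])
 have y2: "F.H.yoneda2 ph : two (PS K CAT)" if "ph : two K" for ph
  using F.H.mdf_yoneda2[OF that] by (simp add: mdf_iff[OF F.H.tcat two_category_CAT])
 have y0: "rep K X : ob (PS K CAT)" if "X : ob K" for X
  using F.H.psf_rep[OF that] by (simp add: psf_def)
 show "X : ob K ==> P0 (nerve A K F) X = psf_comp A CAT (rep K X) F"
  "[|x : one K; a : ob A|] ==> N1 (P1 (nerve A K F) x) a = hom_map K x (id1 K (P0 F a))"
  "[|x : one K; f : one A|] ==> N2 (P1 (nerve A K F) x) f = nt_id (hom_map K x (P1 F f))"
  "[|ph : two K; a : ob A|] ==> M_at (P2 (nerve A K F) ph) a = hom_map2 K ph (id2 K (id1 K (P0 F a)))"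
  "x : one K ==> N_src (P1 (nerve A K F) x) = psf_comp A CAT (rep K (trg K x)) F"
  "x : one K ==> N_trg (P1 (nerve A K F) x) = psf_comp A CAT (rep K (src K x)) F"
  using y0 y1 y2 by (simp_all add: nerve_def precomp_def F.H.yoneda_eq)
qed

definition pt1 where "pt1 nu a u = F_ob (N1 nu a) u"
definition pt2 where "pt2 nu a mu = F_ar (N1 nu a) mu"
definition pt3 where "pt3 nu f u = T_at (N2 nu f) u"
definition mt where "mt m a u = T_at (M_at m a) u"

locale kan_cat = kan_setup A B H t D
 for A :: "('a, 'p, 'q) two_cat" and B :: "('b, 'f, 't) two_cat" and H :: "('h, 'f, 't) two_cat" (structure) and t D
begin

abbreviation "W b \<equiv> psf_comp A CAT (rep B b) t"
abbreviation "V X \<equiv> psf_comp A CAT (rep H X) D"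

text \<open>Only the values of a cone at 1-cells out of \<open>b\<close> matter; this allows a single function to
 describe the cones of all \<open>b\<close>.\<close>

lemma cone_cong:
 assumes "CN b X c1 c2 c3"
  and e1 [simp]: "!!a u. [|a : ob A; u : one B; src B u = b; trg B u = P0 t a|] ==> d1 a u = c1 a u"
  and e2 [simp]: "!!a mu. [|a : ob A; mu : two B; src B (dm B mu) = b; trg B (dm B mu) = P0 t a|] ==> d2 a mu = c2 a mu"
  and e3 [simp]: "!!f u. [|f : one A; u : one B; src B u = b; trg B u = P0 t (src A f)|] ==> d3 f u = c3 f u"
 shows "CN b X d1 d2 d3"
proof -
 interpret c: cone A B H t D b X c1 c2 c3 by fact
 show ?thesis
 proof (unfold_locales, goal_cases)
  case (10 a mu nu)
  then have "src B (dm B nu) = b" "trg B (dm B nu) = P0 t a" using B.two_simps(3,4)[of mu] by auto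
  with 10 show ?case by (simp add: c.c2_vcomp)
 next
  case (14 f mu u v a')
  then have *: "u : one B" "v : one B" "src B v = b" "trg B v = P0 t (src A f)" "a' : ob A"
   using B.two_simps[of mu] A.one_simps(2)[of f] by auto
  show ?case using c.c3_nat[OF 14] 14 * by simp
 next
  case (15 ch f f' u a a')
  then have *: "f : one A" "f' : one A" "src A f' = a" "trg A f' = a'" "a : ob A" "a' : ob A"
   using A.two_simps[of ch] by auto
  show ?case using c.c3_nat2[OF 15] 15 * by simp
 next
  case (16 f g u a a'')
  then have *: "a : ob A" "a'' : ob A" by auto
  show ?case using c.c3_comp[OF 16] 16 * by simp
 next
  case (17 a u)
  then show ?case using c.c3_id[OF 17] by simp
 qed (simp_all add: c.c2_id)
qed

lemma cone_mor_cong: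
 assumes m: "CM b c1 c2 c3 d1 d2 d3 m" and b: "b : ob B"
  and e: "!!a u. [|a : ob A; u : one B; src B u = b; trg B u = P0 t a|] ==> c1' a u = c1 a u"
  "!!a mu. [|a : ob A; mu : two B; src B (dm B mu) = b; trg B (dm B mu) = P0 t a|] ==> c2' a mu = c2 a mu"
  "!!f u. [|f : one A; u : one B; src B u = b; trg B u = P0 t (src A f)|] ==> c3' f u = c3 f u"
  "!!a u. [|a : ob A; u : one B; src B u = b; trg B u = P0 t a|] ==> d1' a u = d1 a u"
  "!!a mu. [|a : ob A; mu : two B; src B (dm B mu) = b; trg B (dm B mu) = P0 t a|] ==> d2' a mu = d2 a mu"
  "!!f u. [|f : one A; u : one B; src B u = b; trg B u = P0 t (src A f)|] ==> d3' f u = d3 f u"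
 shows "CM b c1' c2' c3' d1' d2' d3' m"
 by (rule cone_morI) (use cone_morD[OF m] in "simp_all add: e")

lemma V_psf: "X : ob H ==> psf A CAT (V X)" and W_psf: "b : ob B ==> psf A CAT (W b)"
 using psf_psf_comp[OF D.psf_axioms' H.psf_rep] psf_psf_comp[OF t.psf_axioms' B.psf_rep] by auto

lemmas VW_simps [simp] = rep_comp_simps[OF D.psf_axioms'] rep_comp_simps[OF t.psf_axioms']

lemma pt_in:
 assumes n: "pst A CAT (W b) (V X) nu" and b: "b : ob B" "X : ob H"
 shows "a : ob A ==> ftor_in (N1 nu a) (hom B b (P0 t a)) (hom H X (P0 D a))"
  "f : one A ==> nt_in (N2 nu f) (ftor_comp (hom_map H (id1 H X) (P1 D f)) (N1 nu (src A f)))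
    (ftor_comp (N1 nu (trg A f)) (hom_map B (id1 B b) (P1 t f)))"
  "f : one A ==> nat_iso (N2 nu f)"
proof -
 interpret nu: pst A CAT "W b" "V X" nu by fact
 show "a : ob A ==> ftor_in (N1 nu a) (hom B b (P0 t a)) (hom H X (P0 D a))"
  using nu.N1_simps[of a] b by (simp add: ftor_in_def)
 show "f : one A ==> nt_in (N2 nu f) (ftor_comp (hom_map H (id1 H X) (P1 D f)) (N1 nu (src A f)))
    (ftor_comp (N1 nu (trg A f)) (hom_map B (id1 B b) (P1 t f)))"
  using nu.N2_simps[of f] b by (simp add: nt_in_def)
 show "f : one A ==> nat_iso (N2 nu f)" using nu.N2_simps(1)[of f] by simp
qed

lemma pt_cone:
 assumes n: "pst A CAT (W b) (V X) nu" and b: "b : ob B" "X : ob H"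
 shows "CN b X (pt1 nu) (pt2 nu) (pt3 nu)"
proof -
 interpret nu: pst A CAT "W b" "V X" nu by fact
 interpret c: cpn_full A "W b" "V X" "\<lparr>C1 = N1 nu, C2 = N2 nu\<rparr>"
  using n by (intro cpn_fullI A.tcat) (simp add: pst_CAT_iff A.tcat)
 note i = pt_in[OF n b]
 note f = ftor_inD[OF i(1), simplified]
 note N = nt_inD(8-11)[OF i(2), simplified]
 have x [simp]: "a : ob A ==> F_src (N1 nu a) = hom B b (P0 t a)" "a : ob A ==> F_trg (N1 nu a) = hom H X (P0 D a)" for a
  using f(2,3) by auto
 show ?thesis
 proof (unfold_locales, goal_cases)
  case (10 a mu nu')
  then have "src B (dm B nu') = b" "trg B (dm B nu') = P0 t a" using B.two_simps(3,4)[of mu] by auto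
  with 10 show ?case by (simp add: pt2_def f(11))
 next
  case (11 f u)
  show ?case using 11 b H.nat_iso_homD[OF i(3)[OF 11(1)], of X "P0 D (trg A f)" u] nt_inD(2)[OF i(2)[OF 11(1)]]
   by (simp add: pt3_def)
 next
  case (12 f u)
  then show ?case using N(2)[of f u] f(6)[of "src A f" u] b by (simp add: pt3_def pt1_def)
 next
  case (13 f u)
  then show ?case using N(3)[of f u] f(6)[of "src A f" u] b by (simp add: pt3_def pt1_def)
 next
  case (14 f mu u v a')
  then have *: "u : one B" "v : one B" "src B v = b" "trg B v = P0 t (src A f)" "a' : ob A"
   using B.two_simps[of mu] A.one_simps(2)[of f] by auto
  show ?case using N(4)[of f mu] f(7-9)[of "src A f" mu] 14 * b by (simp add: pt1_def pt2_def pt3_def)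
 next
  case (15 ch f f' u a a')
  then have *: "f : one A" "f' : one A" "src A f' = a" "trg A f' = a'" "a : ob A" "a' : ob A"
   using A.two_simps[of ch] by auto
  show ?case using c.natural[of ch a a' u] f(6)[of a u] 15 * b by (simp add: pt1_def pt2_def pt3_def)
 next
  case (16 f g u a a'')
  then have *: "a : ob A" "a'' : ob A" by auto
  show ?case using c.comp[of f g a a'' u] f(6)[of a u] N(1-3)[of f u] 16 * b by (simp add: pt1_def pt2_def pt3_def)
 next
  case (17 a u)
  then show ?case using c.unit[of a u] f(6)[of a u] b by (simp add: pt1_def pt2_def pt3_def)
 qed (use b f in "simp_all add: pt1_def pt2_def")
qed

text \<open>The transformation with given components at every object; it is inverse to reading off \<open>pt1\<close>,
 \<open>pt2\<close> and \<open>pt3\<close>.\<close>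

definition pack where
 "pack b X c1 c2 c3 = (let F = (\<lambda>a\<in>ob A. \<lparr>F_src = hom B b (P0 t a), F_trg = hom H X (P0 D a),
   F_ob = (\<lambda>u\<in>Ob (hom B b (P0 t a)). c1 a u), F_ar = (\<lambda>mu\<in>Ar (hom B b (P0 t a)). c2 a mu)\<rparr>)
  in \<lparr>N_src = W b, N_trg = V X, N1 = F,
   N2 = (\<lambda>f\<in>one A. \<lparr>T_src = ftor_comp (hom_map H (id1 H X) (P1 D f)) (F (src A f)),
    T_trg = ftor_comp (F (trg A f)) (hom_map B (id1 B b) (P1 t f)),
    T_at = (\<lambda>u\<in>Ob (hom B b (P0 t (src A f))). c3 f u)\<rparr>)\<rparr>)"

lemma pack_simps [simp]:
 "[|a : ob A; u : one B; src B u = b; trg B u = P0 t a|] ==> F_ob (N1 (pack b X c1 c2 c3) a) u = c1 a u"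
 "[|a : ob A; mu : two B; src B (dm B mu) = b; trg B (dm B mu) = P0 t a|] ==> F_ar (N1 (pack b X c1 c2 c3) a) mu = c2 a mu"
 "[|f : one A; u : one B; src B u = b; trg B u = P0 t (src A f)|] ==> T_at (N2 (pack b X c1 c2 c3) f) u = c3 f u"
 "a : ob A ==> F_src (N1 (pack b X c1 c2 c3) a) = hom B b (P0 t a)"
 "a : ob A ==> F_trg (N1 (pack b X c1 c2 c3) a) = hom H X (P0 D a)"
 "f : one A ==> T_src (N2 (pack b X c1 c2 c3) f) = ftor_comp (hom_map H (id1 H X) (P1 D f)) (N1 (pack b X c1 c2 c3) (src A f))"
 "f : one A ==> T_trg (N2 (pack b X c1 c2 c3) f) = ftor_comp (N1 (pack b X c1 c2 c3) (trg A f)) (hom_map B (id1 B b) (P1 t f))"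
 "N_src (pack b X c1 c2 c3) = W b" "N_trg (pack b X c1 c2 c3) = V X"
 by (simp_all add: pack_def Let_def)

lemma pack_pt [simp]:
 "[|a : ob A; u : one B; src B u = b; trg B u = P0 t a|] ==> pt1 (pack b X c1 c2 c3) a u = c1 a u"
 "[|a : ob A; mu : two B; src B (dm B mu) = b; trg B (dm B mu) = P0 t a|] ==> pt2 (pack b X c1 c2 c3) a mu = c2 a mu"
 "[|f : one A; u : one B; src B u = b; trg B u = P0 t (src A f)|] ==> pt3 (pack b X c1 c2 c3) f u = c3 f u"
 by (simp_all add: pt1_def pt2_def pt3_def)

lemma pack_ext:
 "N1 (pack b X c1 c2 c3) : extensional (ob A)" "N2 (pack b X c1 c2 c3) : extensional (one A)"
 "a : ob A ==> F_ob (N1 (pack b X c1 c2 c3) a) : extensional (Ob (hom B b (P0 t a)))"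
 "a : ob A ==> F_ar (N1 (pack b X c1 c2 c3) a) : extensional (Ar (hom B b (P0 t a)))"
 "f : one A ==> T_at (N2 (pack b X c1 c2 c3) f) : extensional (Ob (hom B b (P0 t (src A f))))"
 by (simp_all add: pack_def Let_def)

lemma pack_pst:
 assumes "CN b X c1 c2 c3"
 shows "pst A CAT (W b) (V X) (pack b X c1 c2 c3)"
proof -
 interpret c: cone A B H t D b X c1 c2 c3 by fact
 note b = c.bX
 let ?p = "pack b X c1 c2 c3"
 have f: "ftor_in (N1 ?p a) (hom B b (P0 t a)) (hom H X (P0 D a))" if "a : ob A" for a
 proof (rule ftor_inI, goal_cases)
  case (12 mu nu)
  then have "src B (dm B nu) = b" "trg B (dm B nu) = P0 t a" using B.two_simps(3,4)[of mu] by auto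
  with 12 show ?case using that by (simp add: c.c2_vcomp)
 qed (use that in "simp_all add: pack_ext category_hom B.tcat H.tcat c.c2_id")
 have n: "nt_in (N2 ?p f) (ftor_comp (hom_map H (id1 H X) (P1 D f)) (N1 ?p (src A f)))
    (ftor_comp (N1 ?p (trg A f)) (hom_map B (id1 B b) (P1 t f)))" if "f : one A" for f
 proof (rule nt_inI[where C = "hom B b (P0 t (src A f))" and D = "hom H X (P0 D (trg A f))"], goal_cases)
  case 1 show ?case by (rule ftor_in_comp[OF f H.ftor_in_hom_map]) (use that in simp_all)
 next
  case 2 show ?case by (rule ftor_in_comp[OF B.ftor_in_hom_map f]) (use that in simp_all)
 next
  case (9 mu)
  then have "src B (cd B mu) = b" "trg B (cd B mu) = P0 t (src A f)" using B.two_simps(3,4)[of mu] by auto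
  then show ?case using 9 that c.c3_nat[OF that, of mu "dm B mu" "cd B mu" "trg A f"] by simp
 qed (use that in "simp_all add: pack_ext")
 interpret c': cpn A "W b" "V X" "\<lparr>C1 = N1 ?p, C2 = N2 ?p\<rparr>"
  by (rule cpnI) (use f n b V_psf W_psf A.tcat in simp_all)
 have i: "nat_iso (N2 ?p f)" if "f : one A" for f
  by (rule H.nat_iso_homI[OF n[OF that], of X "P0 D (trg A f)"]) (use that in simp_all)
 have "cat_pseudonatural A (W b) (V X) \<lparr>C1 = N1 ?p, C2 = N2 ?p\<rparr>"
 proof (rule c'.cat_pseudonaturalI, goal_cases)
  case (1 f) then show ?case using i by simp
 next
  case (2 ch u)
  then show ?case using b c.c3_nat2[OF 2(1) refl refl, of u] by simp
 next
  case (3 f g u)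
  then show ?case using b c.c3_comp[OF 3(1-3), of u] by simp
 next
  case (4 a u)
  then show ?case using b c.c3_id[OF 4(1), of u] by simp
 qed
 then show ?thesis by (simp add: pst_CAT_iff A.tcat pack_ext)
qed

lemma mt_cone_mor:
 assumes m: "mdf A CAT (W b) (V X) nu nu' m" and b: "b : ob B" "X : ob H"
 shows "CM b (pt1 nu) (pt2 nu) (pt3 nu) (pt1 nu') (pt2 nu') (pt3 nu') (mt m)"
proof -
 interpret m: mdf A CAT "W b" "V X" nu nu' m by fact
 note i = pt_in[OF m.al.pst_axioms b] and j = pt_in[OF m.bt.pst_axioms b]
 note f = ftor_inD[OF i(1), simplified] ftor_inD[OF j(1), simplified]
 have n: "a : ob A ==> nt_in (M_at m a) (N1 nu a) (N1 nu' a)" for a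
  using m.M_simps[of a] by (simp add: nt_in_def)
 note N = nt_inD(8-11)[OF n, simplified]
 note I = nt_inD(2,3,8-10)[OF i(2), simplified] nt_inD(2,3,8-10)[OF j(2), simplified]
 have x [simp]: "a : ob A ==> F_src (N1 nu a) = hom B b (P0 t a)" "a : ob A ==> F_trg (N1 nu a) = hom H X (P0 D a)"
  "a : ob A ==> F_src (N1 nu' a) = hom B b (P0 t a)" "a : ob A ==> F_trg (N1 nu' a) = hom H X (P0 D a)" for a
  using f(2,3,13,14) by auto
 show ?thesis
 proof (rule cone_morI, goal_cases)
  case (1 a u)
  then show ?case using N(1-3)[of a u] by (simp add: mt_def pt1_def)
 next
  case (2 a mu)
  then show ?case using N(4)[of a mu] by (simp add: mt_def pt2_def)
 next
  case (3 g u)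
  have o: "src A g : ob A" "trg A g : ob A" using 3 by auto
  show ?case using arg_cong[OF m.M_nat[OF 3(1) refl refl], of "%z. T_at z u"] 3 o b N(1-3)[of "src A g" u] f(6)[of "src A g" u]
    f(17)[of "src A g" u] N(1-3)[of "trg A g" "P1 t g *[B] u"] f(6,17)[of "trg A g" "P1 t g *[B] u"]
   by (simp add: mt_def pt3_def I nt_inD(2,3)[OF n] f(10))
 qed
qed

definition pack_mor where
 "pack_mor b nu nu' m = \<lparr>M_src = nu, M_trg = nu', M_at = (\<lambda>a\<in>ob A. \<lparr>T_src = N1 nu a, T_trg = N1 nu' a,
   T_at = (\<lambda>u\<in>Ob (hom B b (P0 t a)). m a u)\<rparr>)\<rparr>"

lemma pack_mor_simps [simp]:
 "M_src (pack_mor b nu nu' m) = nu" "M_trg (pack_mor b nu nu' m) = nu'"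
 "[|a : ob A; u : one B; src B u = b; trg B u = P0 t a|] ==> mt (pack_mor b nu nu' m) a u = m a u"
 by (simp_all add: pack_mor_def mt_def)

lemma pack_mor_mdf:
 assumes nu: "pst A CAT (W b) (V X) nu" and nu': "pst A CAT (W b) (V X) nu'" and b: "b : ob B" "X : ob H"
  and m: "CM b (pt1 nu) (pt2 nu) (pt3 nu) (pt1 nu') (pt2 nu') (pt3 nu') m"
 shows "mdf A CAT (W b) (V X) nu nu' (pack_mor b nu nu' m)"
proof -
 interpret nu: pst A CAT "W b" "V X" nu by fact
 interpret nu': pst A CAT "W b" "V X" nu' by fact
 note i = pt_in[OF nu b] and j = pt_in[OF nu' b]
 note f = ftor_inD[OF i(1), simplified] ftor_inD[OF j(1), simplified]
 have x [simp]: "a : ob A ==> F_src (N1 nu a) = hom B b (P0 t a)" "a : ob A ==> F_trg (N1 nu a) = hom H X (P0 D a)"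
  "a : ob A ==> F_src (N1 nu' a) = hom B b (P0 t a)" "a : ob A ==> F_trg (N1 nu' a) = hom H X (P0 D a)" for a
  using f(2,3,13,14) by auto
 note cm = cone_morD[OF m]
 have at: "M_at (pack_mor b nu nu' m) a = \<lparr>T_src = N1 nu a, T_trg = N1 nu' a, T_at = (\<lambda>u\<in>Ob (hom B b (P0 t a)). m a u)\<rparr>"
  if "a : ob A" for a using that by (simp add: pack_mor_def)
 have n: "nt_in (M_at (pack_mor b nu nu' m) a) (N1 nu a) (N1 nu' a)" if "a : ob A" for a
 proof (rule nt_inI[OF i(1)[OF that] j(1)[OF that]], goal_cases)
  case (7 mu)
  then show ?case using that cm(4)[OF that, of mu "dm B mu" "cd B mu"] by (simp add: at pt2_def)
 qed (use that cm(1-3)[of a] f(6,17)[of a] in "simp_all add: at pt1_def")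
 note I = nt_inD(2,3,8-10)[OF i(2), simplified] nt_inD(2,3,8-10)[OF j(2), simplified]
 show ?thesis
 proof (rule mdfI[OF nu nu'], goal_cases)
  case (4 a) then show ?case using n[OF 4] by (simp add: nt_in_def)
 next
  case (5 g)
  have o: "src A g : ob A" "trg A g : ob A" using 5 by auto
  let ?m = "M_at (pack_mor b nu nu' m)"
  have l: "nt_in (nt_vcomp (N2 nu' g) (nt_hcomp (nt_id (hom_map H (id1 H X) (P1 D g))) (?m (src A g))))
    (ftor_comp (hom_map H (id1 H X) (P1 D g)) (N1 nu (src A g))) (ftor_comp (N1 nu' (trg A g)) (hom_map B (id1 B b) (P1 t g)))"
   by (rule nt_in_vcomp[OF nt_in_hcomp[OF n[OF o(1)] i(1)[OF o(1)] nt_in_id[OF H.ftor_in_hom_map] H.ftor_in_hom_map] j(2)[OF 5]])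
    (use 5 b in simp_all)
  have r: "nt_in (nt_vcomp (nt_hcomp (?m (trg A g)) (nt_id (hom_map B (id1 B b) (P1 t g)))) (N2 nu g))
    (ftor_comp (hom_map H (id1 H X) (P1 D g)) (N1 nu (src A g))) (ftor_comp (N1 nu' (trg A g)) (hom_map B (id1 B b) (P1 t g)))"
   by (rule nt_in_vcomp[OF i(2)[OF 5] nt_in_hcomp[OF nt_in_id[OF B.ftor_in_hom_map] B.ftor_in_hom_map n[OF o(2)] i(1)[OF o(2)]]])
    (use 5 b in simp_all)
  have "nt_vcomp (N2 nu' g) (nt_hcomp (nt_id (hom_map H (id1 H X) (P1 D g))) (?m (src A g)))
   = nt_vcomp (nt_hcomp (?m (trg A g)) (nt_id (hom_map B (id1 B b) (P1 t g)))) (N2 nu g)"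
  proof (rule nt_in_eqI[OF l r], goal_cases)
   case (1 u)
   then have u: "u : one B" "src B u = b" "trg B u = P0 t (src A g)" using o 5 by simp_all
   show ?case using 5 o u b cm(1-3)[OF o(1) u] cm(5)[OF 5 u refl] f(6)[OF o(1), of u] f(17)[OF o(1), of u]
     cm(1-3)[OF o(2), of "P1 t g *[B] u"] f(6)[OF o(2), of "P1 t g *[B] u"]
    by (simp add: I at pt1_def pt3_def f(10))
  qed
  then show ?case using 5 b by simp
 qed (simp_all add: pack_mor_def)
qed

end

section \<open>Universal transformations as universal families of cones\<close>

context kan_cat
begin

sublocale param H B "PS A CAT" "nerve A H D" "nerve A B t"
 unfolding param_def
 using sfun_nerve[OF A.tcat H.tcat D.pseudofunctor_axioms]
  sfun_nerve[OF A.tcat B.tcat t.pseudofunctor_axioms]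
  two_category_PS[OF A.tcat two_category_CAT] H.tcat B.tcat by blast

abbreviation "ND \<equiv> nerve A H D"
abbreviation "NT \<equiv> nerve A B t"

lemmas psti = pst_iff[OF A.tcat two_category_CAT]
 and mdfi = mdf_iff[OF A.tcat two_category_CAT]
lemmas ND_simps [simp] = nerve_simps[OF A.tcat D.psf_axioms']
 and NT_simps [simp] = nerve_simps[OF A.tcat t.psf_axioms']

lemma ND_pst: "x : one H ==> pst A CAT (V (trg H x)) (V (src H x)) (P1 ND x)"
 using N_simps(2)[of x] by (simp add: psti)

lemma NT_pst: "g : one B ==> pst A CAT (W (trg B g)) (W (src B g)) (P1 NT g)"
 using S_simps(2)[of g] by (simp add: psti)

lemma ND_mdf: "ph : two H ==> mdf A CAT (V (trg H (dm H ph))) (V (src H (dm H ph))) (P1 ND (dm H ph)) (P1 ND (cd H ph)) (P2 ND ph)"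
 using N_simps(5-7)[of ph] by (simp add: mdfi)

text \<open>Composing with \<open>H(x,D-)\<close> restricts the cone along \<open>x\<close>.\<close>

lemma pt_restrict:
 assumes n: "pst A CAT (W b) (V X) nu" and b: "b : ob B" and x: "x : one H" "trg H x = X"
 shows "pst A CAT (W b) (V (src H x)) (ps_comp A CAT (P1 ND x) nu)"
  "[|a : ob A; u : one B; src B u = b; trg B u = P0 t a|] ==> pt1 (ps_comp A CAT (P1 ND x) nu) a u = pt1 nu a u \<odot> x"
  "[|a : ob A; mu : two B; src B (dm B mu) = b; trg B (dm B mu) = P0 t a|] ==> pt2 (ps_comp A CAT (P1 ND x) nu) a mu = pt2 nu a mu <| x"
  "[|f : one A; u : one B; src B u = b; trg B u = P0 t (src A f)|] ==> pt3 (ps_comp A CAT (P1 ND x) nu) f u = pt3 nu f u <| x"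
proof -
 have X: "X : ob H" using x by auto
 note i = pt_in[OF n b X]
 note fs [simp] = ftor_inD(2,3)[OF i(1)]
 note I = nt_inD(2,3,8-10)[OF i(2), simplified]
 interpret c: cone A B H t D b X "pt1 nu" "pt2 nu" "pt3 nu" by (rule pt_cone[OF n b X])
 note c1 = c.c1[unfolded pt1_def] and c2 = c.c2[unfolded pt1_def pt2_def] and c3 = c.c3[unfolded pt1_def pt3_def] c.c3_in[unfolded pt3_def]
  and c2_id = c.c2_id[unfolded pt1_def pt2_def]
 show "pst A CAT (W b) (V (src H x)) (ps_comp A CAT (P1 ND x) nu)"
  using pst_ps_comp[OF n ND_pst[OF x(1), unfolded x(2)]] .
 show "pt1 (ps_comp A CAT (P1 ND x) nu) a u = pt1 nu a u \<odot> x" if "a : ob A" "u : one B" "src B u = b" "trg B u = P0 t a" for a u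
  using that x c1[of a u] by (simp add: pt1_def)
 show "pt2 (ps_comp A CAT (P1 ND x) nu) a mu = pt2 nu a mu <| x" if "a : ob A" "mu : two B" "src B (dm B mu) = b" "trg B (dm B mu) = P0 t a" for a mu
  using that x c2[of a mu] c1[of a "dm B mu"] by (simp add: pt2_def)
 show "pt3 (ps_comp A CAT (P1 ND x) nu) f u = pt3 nu f u <| x" if "f : one A" "u : one B" "src B u = b" "trg B u = P0 t (src A f)" for f u
  using that x c3[of f u] c1[of "src A f" u] c1[of "trg A f" "P1 t f *[B] u"] c2_id[of "src A f" u] by (simp add: pt3_def I)
qed

text \<open>Composing with \<open>B(g,t-)\<close> evaluates the cone at composites with \<open>g\<close>.\<close>

lemma pt_shift:
 assumes n: "pst A CAT (W b) (V X) nu" and X: "X : ob H" and g: "g : one B" "src B g = b"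
 shows "pst A CAT (W (trg B g)) (V X) (ps_comp A CAT nu (P1 NT g))"
  "[|a : ob A; u : one B; src B u = trg B g; trg B u = P0 t a|] ==> pt1 (ps_comp A CAT nu (P1 NT g)) a u = pt1 nu a (u *[B] g)"
  "[|a : ob A; mu : two B; src B (dm B mu) = trg B g; trg B (dm B mu) = P0 t a|] ==> pt2 (ps_comp A CAT nu (P1 NT g)) a mu = pt2 nu a (mu <|[B] g)"
  "[|f : one A; u : one B; src B u = trg B g; trg B u = P0 t (src A f)|] ==> pt3 (ps_comp A CAT nu (P1 NT g)) f u = pt3 nu f (u *[B] g)"
proof -
 have b: "b : ob B" using g by auto
 note i = pt_in[OF n b X]
 note fs [simp] = ftor_inD(2,3)[OF i(1)]
 note I = nt_inD(2,3,8-10)[OF i(2), simplified]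
 interpret c: cone A B H t D b X "pt1 nu" "pt2 nu" "pt3 nu" by (rule pt_cone[OF n b X])
 note c1 = c.c1[unfolded pt1_def] and c2 = c.c2[unfolded pt1_def pt2_def] and c3 = c.c3[unfolded pt1_def pt3_def] c.c3_in[unfolded pt3_def]
  and c2_id = c.c2_id[unfolded pt1_def pt2_def]
 show "pst A CAT (W (trg B g)) (V X) (ps_comp A CAT nu (P1 NT g))"
  using pst_ps_comp[OF NT_pst[OF g(1), unfolded g(2)] n] .
 show "pt1 (ps_comp A CAT nu (P1 NT g)) a u = pt1 nu a (u *[B] g)" if "a : ob A" "u : one B" "src B u = trg B g" "trg B u = P0 t a" for a u
  using that g by (simp add: pt1_def)
 show "pt2 (ps_comp A CAT nu (P1 NT g)) a mu = pt2 nu a (mu <|[B] g)" if "a : ob A" "mu : two B" "src B (dm B mu) = trg B g" "trg B (dm B mu) = P0 t a" for a mu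
  using that g by (simp add: pt2_def)
 show "pt3 (ps_comp A CAT nu (P1 NT g)) f u = pt3 nu f (u *[B] g)" if "f : one A" "u : one B" "src B u = trg B g" "trg B u = P0 t (src A f)" for f u
  using that g c3[of f "u *[B] g"] c1[of "trg A f" "P1 t f *[B] (u *[B] g)"] c1[of "src A f" "u *[B] g"] c2_id[of "src A f" "u *[B] g"] c2_id[of "trg A f" "P1 t f *[B] (u *[B] g)"] by (simp add: pt3_def I)
qed

lemma mt_simps:
 assumes a: "a : ob A" "u : one B" "trg B u = P0 t a"
 shows "[|mdf A CAT (W b) (V X) nu nu' n; b : ob B; X : ob H; src B u = b|] ==> mt (m .[PS A CAT] n) a u = mt m a u \<cdot> mt n a u"
  "[|pst A CAT (W b) (V X) nu; b : ob B; X : ob H; src B u = b|] ==> mt (id2 (PS A CAT) nu) a u = id2 H (pt1 nu a u)"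
  "[|pst A CAT (W b) (V X) nu; b : ob B; ph : two H; trg H (dm H ph) = X; src B u = b|] ==>
   mt (P2 ND ph **[PS A CAT] id2 (PS A CAT) nu) a u = pt1 nu a u |> ph"
  "[|pst A CAT (W b) (V X) nu; X : ob H; gm : two B; src B (dm B gm) = b; src B u = trg B (dm B gm)|] ==>
   mt (id2 (PS A CAT) nu **[PS A CAT] P2 NT gm) a u = pt2 nu a (u |>[B] gm)"
  "[|mdf A CAT (W b) (V X) nu nu' n; b : ob B; x : one H; trg H x = X; src B u = b|] ==>
   mt (id2 (PS A CAT) (P1 ND x) **[PS A CAT] n) a u = mt n a u <| x"
  "[|mdf A CAT (W b) (V X) nu nu' n; X : ob H; g : one B; src B g = b; src B u = trg B g|] ==>
   mt (n **[PS A CAT] id2 (PS A CAT) (P1 NT g)) a u = mt n a (u *[B] g)"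
proof -
 note PS_simps [simp]
 {
  assume n: "mdf A CAT (W b) (V X) nu nu' n" and b: "b : ob B" "X : ob H" "src B u = b"
  interpret n: mdf A CAT "W b" "V X" nu nu' n by (rule n)
  show "mt (m .[PS A CAT] n) a u = mt m a u \<cdot> mt n a u"
   using a b n.M_simps[OF a(1)] ftor_inD(2,3)[OF pt_in(1)[OF n.al.pst_axioms b(1,2) a(1)]] by (simp add: mt_def)
 next
  assume n: "pst A CAT (W b) (V X) nu" and b: "b : ob B" "X : ob H" "src B u = b"
  show "mt (id2 (PS A CAT) nu) a u = id2 H (pt1 nu a u)"
   using a b ftor_inD(2,3)[OF pt_in(1)[OF n b(1,2) a(1)]] by (simp add: mt_def pt1_def)
 next
  assume n: "pst A CAT (W b) (V X) nu" and b: "b : ob B" "ph : two H" "trg H (dm H ph) = X" "src B u = b"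
  have X: "X : ob H" using b by auto
  interpret c: cone A B H t D b X "pt1 nu" "pt2 nu" "pt3 nu" by (rule pt_cone[OF n b(1) X])
  show "mt (P2 ND ph **[PS A CAT] id2 (PS A CAT) nu) a u = pt1 nu a u |> ph"
   using a b ftor_inD(2,3)[OF pt_in(1)[OF n b(1) X a(1)]] c.c1[unfolded pt1_def, of a u]
    ftor_inD(10)[OF pt_in(1)[OF n b(1) X a(1)], of u] by (simp add: mt_def pt1_def)
 next
  assume n: "pst A CAT (W b) (V X) nu" and b: "X : ob H" "gm : two B" "src B (dm B gm) = b" "src B u = trg B (dm B gm)"
  have b0: "b : ob B" using b by auto
  interpret c: cone A B H t D b X "pt1 nu" "pt2 nu" "pt3 nu" by (rule pt_cone[OF n b0 b(1)])
  show "mt (id2 (PS A CAT) nu **[PS A CAT] P2 NT gm) a u = pt2 nu a (u |>[B] gm)"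
   using a b ftor_inD(2,3)[OF pt_in(1)[OF n b0 b(1) a(1)]] c.c2[unfolded pt1_def pt2_def, of a "u |>[B] gm"]
    by (simp add: mt_def pt2_def)
 next
  assume n: "mdf A CAT (W b) (V X) nu nu' n" and b: "b : ob B" "x : one H" "trg H x = X" "src B u = b"
  have X: "X : ob H" using b by auto
  interpret n: mdf A CAT "W b" "V X" nu nu' n by (rule n)
  note m = cone_morD(1-3)[OF mt_cone_mor[OF n b(1) X], of a u, unfolded mt_def pt1_def]
  interpret c: cone A B H t D b X "pt1 nu'" "pt2 nu'" "pt3 nu'" by (rule pt_cone[OF n.bt.pst_axioms b(1) X])
  interpret c0: cone A B H t D b X "pt1 nu" "pt2 nu" "pt3 nu" by (rule pt_cone[OF n.al.pst_axioms b(1) X])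
  show "mt (id2 (PS A CAT) (P1 ND x) **[PS A CAT] n) a u = mt n a u <| x"
   using a b m n.M_simps[OF a(1)] ftor_inD(2,3)[OF pt_in(1)[OF n.al.pst_axioms b(1) X a(1)]] c.c1[unfolded pt1_def, of a u]
    c0.c1[unfolded pt1_def, of a u]
   by (simp add: mt_def)
 next
  assume n: "mdf A CAT (W b) (V X) nu nu' n" and b: "X : ob H" "g : one B" "src B g = b" "src B u = trg B g"
  have b0: "b : ob B" using b by auto
  interpret n: mdf A CAT "W b" "V X" nu nu' n by (rule n)
  note m = cone_morD(1-3)[OF mt_cone_mor[OF n b0 b(1)], of a "u *[B] g", unfolded mt_def pt1_def]
  interpret c0: cone A B H t D b X "pt1 nu" "pt2 nu" "pt3 nu" by (rule pt_cone[OF n.al.pst_axioms b0 b(1)])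
  show "mt (n **[PS A CAT] id2 (PS A CAT) (P1 NT g)) a u = mt n a (u *[B] g)"
   using a b m n.M_simps[OF a(1)] ftor_inD(2,3)[OF pt_in(1)[OF n.al.pst_axioms b0 b(1) a(1)]]
    c0.c1[unfolded pt1_def, of a "u *[B] g"] c0.c2_id[unfolded pt1_def pt2_def, of a "u *[B] g"]
   by (simp add: mt_def)
 }
qed

end

locale kan_universal = kan_cat A B H t D + universal_psf H B "PS A CAT" "nerve A H D" "nerve A B t" l lam L om
 for A :: "('a, 'p, 'q) two_cat" and B :: "('b, 'f, 't) two_cat" and H :: "('h, 'f, 't) two_cat" (structure) and t D l lam L om
begin

definition uc1 where "uc1 a u = pt1 (lam (src B u)) a u"
definition uc2 where "uc2 a mu = pt2 (lam (src B (dm B mu))) a mu"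
definition uc3 where "uc3 f u = pt3 (lam (src B u)) f u"
definition uw where "uw g = mt (om g)"

lemma lam_pst: "b : ob B ==> pst A CAT (W b) (V (P0 L b)) (lam b)"
 using lam[of b] by (simp add: psti)

lemma om_mdf: "g : one B ==> mdf A CAT (W (trg B g)) (V (P0 L (src B g))) (ps_comp A CAT (P1 ND (P1 L g)) (lam (trg B g)))
  (ps_comp A CAT (lam (src B g)) (P1 NT g)) (om g)"
 using om_in[of g] om(2,3)[of g] lam_pst[of "trg B g"] pt_restrict(1)[OF lam_pst[of "trg B g"], of "P1 L g"]
 by (simp add: mdfi psti)

lemma lam_cone: "b : ob B ==> CN b (P0 L b) (pt1 (lam b)) (pt2 (lam b)) (pt3 (lam b))"
 by (rule pt_cone[OF lam_pst]) auto

lemma uc_cone: "b : ob B ==> CN b (P0 L b) uc1 uc2 uc3"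
 by (rule cone_cong[OF lam_cone]) (simp_all add: uc1_def uc2_def uc3_def)

lemma uw_cone_mor:
 assumes g: "g : one B"
 shows "CM (trg B g) (r1 H uc1 (P1 L g)) (r2 H uc2 (P1 L g)) (r2 H uc3 (P1 L g))
  (%a u. uc1 a (u *[B] g)) (%a mu. uc2 a (mu <|[B] g)) (%f u. uc3 f (u *[B] g)) (uw g)"
proof -
 have o: "src B g : ob B" "trg B g : ob B" using g by auto
 note r = pt_restrict[OF lam_pst[OF o(2)] o(2), of "P1 L g"] and s = pt_shift[OF lam_pst[OF o(1)] _ g refl]
 show ?thesis unfolding uw_def
  by (rule cone_mor_cong[OF mt_cone_mor[OF om_mdf[OF g]]]) (use g o r s in "simp_all add: uc1_def uc2_def uc3_def")
qed

lemma uw_iso: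
 assumes g: "g : one B" and a: "a : ob A" "u : one B" "trg B g = src B u" "trg B u = P0 t a"
 shows "iso2 H (uw g a u)"
proof -
 have o: "src B g : ob B" "trg B g : ob B" using g by auto
 interpret m: mdf A CAT "W (trg B g)" "V (P0 L (src B g))" "ps_comp A CAT (P1 ND (P1 L g)) (lam (trg B g))"
  "ps_comp A CAT (lam (src B g)) (P1 NT g)" "om g" by (rule om_mdf[OF g])
 have "iso2 CAT (M_at (om g) a)" by (rule PS_iso2_at[OF A.tcat two_category_CAT om(1)[OF g] a(1)])
 then have n: "nat_iso (M_at (om g) a)" by simp
 have P: "P0 L (src B g) : ob H" using o by simp
 note f = ftor_inD(2,3)[OF pt_in(1)[OF m.al.pst_axioms o(2) P a(1)]]
 have d: "T_src (M_at (om g) a) = N1 (ps_comp A CAT (P1 ND (P1 L g)) (lam (trg B g))) a" using m.M_simps(2)[OF a(1)] by simp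
 show ?thesis unfolding uw_def mt_def
  by (rule H.nat_iso_homD[OF n]) (unfold d f, use a in simp_all)
qed

text \<open>The components of \<open>om g\<close> are the constraint cells, and each law for them is a law of
 \<open>om\<close> evaluated at an object of \<open>B(b,t a)\<close>.\<close>

lemma universal_bicone_exists: "bicone A B H t D L uc1 uc2 uc3 uw"
proof (intro bicone.intro bicone_axioms.intro, goal_cases)
 case 1 show ?case by unfold_locales
next
 case 2 show ?case by unfold_locales
next
 case (3 b) then show ?case by (rule uc_cone)
next
 case (4 g a u) then show ?case by (intro uw_iso)
next
 case (5 g a u) then show ?case using cone_morD(2)[OF uw_cone_mor[OF 5(1)], of a u] by simp
next
 case (6 g a u) then show ?case using cone_morD(3)[OF uw_cone_mor[OF 6(1)], of a u] by simp
next
 case (7 g a mu u v)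
 then show ?case using cone_morD(4)[OF uw_cone_mor[OF 7(1)], of a mu u v] by simp
next
 case (8 g f u a')
 then show ?case using cone_morD(5)[OF uw_cone_mor[OF 8(1)], of f u a'] by simp
next
 case (9 gm g g' a u)
 let ?b = "src B g" and ?b' = "trg B g"
 have o: "g : one B" "g' : one B" "src B g' = src B g" "trg B g' = src B u" "?b : ob B" "?b' : ob B" "src B u : ob B"
  using 9 B.two_simps[of gm] B.one_simps[of g] by auto
 have P: "P0 L ?b : ob H" "P0 L ?b' : ob H" using o by simp_all
 have m: "mdf A CAT (W ?b') (V (P0 L ?b)) (ps_comp A CAT (P1 ND (P1 L g)) (lam ?b')) (ps_comp A CAT (P1 ND (P1 L g')) (lam ?b')) (P2 ND (P2 L gm) **[PS A CAT] id2 (PS A CAT) (lam ?b'))"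
  using mdf_hcomp[OF mdf_id2[OF lam_pst[OF o(6)]], of "V (P0 L ?b)" "P1 ND (P1 L g)" "P1 ND (P1 L g')" "P2 ND (P2 L gm)"] ND_mdf[of "P2 L gm"] 9 o
  by simp
 note e = arg_cong[OF om_nat[OF 9(1-3) refl refl], of "%z. mt z a u"]
 note l = mt_simps(1)[OF 9(4,5,7) m o(6) P(1) 9(6)[symmetric], of "om g'"]
 have l': "mt (P2 ND (P2 L gm) **[PS A CAT] id2 (PS A CAT) (lam ?b')) a u = pt1 (lam ?b') a u |> P2 L gm"
  by (rule mt_simps(3)[OF 9(4,5,7) lam_pst[OF o(6)] o(6) _ _ 9(6)[symmetric]]) (use 9 o in simp_all)
 note r = mt_simps(1)[OF 9(4,5,7) om_mdf[OF o(1)] o(6) P(1) 9(6)[symmetric], of "id2 (PS A CAT) (lam ?b) **[PS A CAT] P2 NT gm"]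
 have r': "mt (id2 (PS A CAT) (lam ?b) **[PS A CAT] P2 NT gm) a u = pt2 (lam ?b) a (u |>[B] gm)"
  by (rule mt_simps(4)[OF 9(4,5,7) lam_pst[OF o(5)] P(1) 9(1)]) (use 9 in simp_all)
 show ?case using e[unfolded l r l' r'] 9 o by (simp add: uw_def uc1_def uc2_def)
next
 case (10 g h a u)
 let ?b = "src B g" and ?c = "trg B h"
 have o: "?b : ob B" "?c : ob B" "src B h : ob B" "src B u : ob B" "h *[B] g : one B" using 10 by auto
 have P: "P0 L ?b : ob H" "P0 L ?c : ob H" "P0 L (src B h) : ob H" using o by simp_all
 have lc: "pst A CAT (W ?c) (V (P0 L ?c)) (lam ?c)" by (rule lam_pst[OF o(2)])
 have m: "mdf A CAT (W ?c) (V (P0 L ?b)) (ps_comp A CAT (P1 ND (P1 L h \<odot> P1 L g)) (lam ?c)) (ps_comp A CAT (P1 ND (P1 L (h *[B] g))) (lam ?c)) (P2 ND (Pc L h g) **[PS A CAT] id2 (PS A CAT) (lam ?c))"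
  using mdf_hcomp[OF mdf_id2[OF lc], of "V (P0 L ?b)" "P1 ND (P1 L h \<odot> P1 L g)" "P1 ND (P1 L (h *[B] g))" "P2 ND (Pc L h g)"]
    ND_mdf[of "Pc L h g"] 10 o by simp
 have m2: "mdf A CAT (W ?c) (V (P0 L ?b)) (ps_comp A CAT (P1 ND (P1 L g)) (ps_comp A CAT (P1 ND (P1 L h)) (lam ?c))) (ps_comp A CAT (P1 ND (P1 L g)) (ps_comp A CAT (lam (src B h)) (P1 NT h))) (id2 (PS A CAT) (P1 ND (P1 L g)) **[PS A CAT] om h)"
  using mdf_hcomp[OF om_mdf[OF 10(2)] mdf_id2, of "V (P0 L ?b)" "P1 ND (P1 L g)"] ND_pst[of "P1 L g"] 10 o by simp
 note e = arg_cong[OF om_comp[OF 10(1,2,5) refl], of "%z. mt z a u"]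
 note l = mt_simps(1)[OF 10(3,4,7) m o(2) P(1) 10(6)[symmetric], of "om (h *[B] g)"]
 note r = mt_simps(1)[OF 10(3,4,7) m2 o(2) P(1) 10(6)[symmetric], of "om g **[PS A CAT] id2 (PS A CAT) (P1 NT h)"]
 have l': "mt (P2 ND (Pc L h g) **[PS A CAT] id2 (PS A CAT) (lam ?c)) a u = pt1 (lam ?c) a u |> Pc L h g"
  by (rule mt_simps(3)[OF 10(3,4,7) lc o(2) _ _ 10(6)[symmetric]]) (use 10 in simp_all)
 have r': "mt (id2 (PS A CAT) (P1 ND (P1 L g)) **[PS A CAT] om h) a u = mt (om h) a u <| P1 L g"
  by (rule mt_simps(5)[OF 10(3,4,7) om_mdf[OF 10(2)] o(2) _ _ 10(6)[symmetric]]) (use 10 in simp_all)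
 have r'': "mt (om g **[PS A CAT] id2 (PS A CAT) (P1 NT h)) a u = mt (om g) a (u *[B] h)"
  by (rule mt_simps(6)[OF 10(3,4,7) om_mdf[OF 10(1)] P(1) 10(2)]) (use 10 in simp_all)
 show ?case using e[unfolded l r l' r' r''] 10 by (simp add: uw_def uc1_def)
next
 case (11 a u b)
 have o: "b : ob B" using 11 by auto
 have P: "P0 L b : ob H" using o by simp
 have lc: "pst A CAT (W b) (V (P0 L b)) (lam b)" by (rule lam_pst[OF o])
 have m: "mdf A CAT (W b) (V (P0 L b)) (ps_comp A CAT (P1 ND (id1 H (P0 L b))) (lam b)) (ps_comp A CAT (P1 ND (P1 L (id1 B b))) (lam b)) (P2 ND (Pu L b) **[PS A CAT] id2 (PS A CAT) (lam b))"
  using mdf_hcomp[OF mdf_id2[OF lc], of "V (P0 L b)" "P1 ND (id1 H (P0 L b))" "P1 ND (P1 L (id1 B b))" "P2 ND (Pu L b)"]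
    ND_mdf[of "Pu L b"] 11 o by simp
 note e = arg_cong[OF om_unit[OF o], of "%z. mt z a u"]
 note l = mt_simps(1)[OF 11(1,2,4) m o P 11(3), of "om (id1 B b)"]
 have l': "mt (P2 ND (Pu L b) **[PS A CAT] id2 (PS A CAT) (lam b)) a u = pt1 (lam b) a u |> Pu L b"
  by (rule mt_simps(3)[OF 11(1,2,4) lc o _ _ 11(3)]) (use o in simp_all)
 note r = mt_simps(2)[OF 11(1,2,4) lc o P 11(3)]
 show ?case using e[unfolded l l' r] 11 by (simp add: uw_def uc1_def)
qed

lemma uc_universal: "universal_bicone A B H t D L uc1 uc2 uc3"
 unfolding universal_bicone_def
proof (intro ballI conjI allI impI, goal_cases)
 case (1 b X x y m)
 let ?rx = "ps_comp A CAT (P1 ND x) (lam b)" and ?ry = "ps_comp A CAT (P1 ND y) (lam b)"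
 note l = lam_pst[OF 1(1)]
 note rx = pt_restrict[OF l 1(1,3,5)] and ry = pt_restrict[OF l 1(1,6,8)]
 note px = rx(1)[unfolded 1(4)] and py = ry(1)[unfolded 1(7)]
 have m': "CM b (pt1 ?rx) (pt2 ?rx) (pt3 ?rx) (pt1 ?ry) (pt2 ?ry) (pt3 ?ry) m"
  by (rule cone_mor_cong[OF 1(9,1)]) (simp_all add: rx ry uc1_def uc2_def uc3_def)
 note pm = pack_mor_mdf[OF px py 1(1,2) m']
 let ?p = "pack_mor b ?rx ?ry m"
 have "EX! n. n : two H & dm H n = x & cd H n = y & P2 ND n **[PS A CAT] id2 (PS A CAT) (lam b) = ?p"
  by (rule full_faithful[OF 1(1,3,6)]) (use 1 pm in "simp_all add: mdfi")
 moreover have "P2 ND n **[PS A CAT] id2 (PS A CAT) (lam b) = ?p \<longleftrightarrow>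
   (ALL a:ob A. ALL u. u : one B --> src B u = b --> trg B u = P0 t a --> uc1 a u |> n = m a u)"
  if n: "n : two H" "dm H n = x" "cd H n = y" for n
 proof -
  let ?q = "P2 ND n **[PS A CAT] id2 (PS A CAT) (lam b)"
  have q: "mdf A CAT (W b) (V X) ?rx ?ry ?q"
   using mdf_hcomp[OF mdf_id2[OF l], of "V X" "P1 ND x" "P1 ND y" "P2 ND n"] ND_mdf[OF n(1)] n 1 by simp
  have mq: "mt ?q a u = uc1 a u |> n" if "a : ob A" "u : one B" "src B u = b" "trg B u = P0 t a" for a u
   using mt_simps(3)[OF that(1,2,4) l 1(1) n(1)] that n 1 by (simp add: uc1_def)
  show ?thesis
  proof
   assume "?q = ?p"
   then show "ALL a:ob A. ALL u. u : one B --> src B u = b --> trg B u = P0 t a --> uc1 a u |> n = m a u"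
    by (metis mq pack_mor_simps(3))
  next
   assume r: "ALL a:ob A. ALL u. u : one B --> src B u = b --> trg B u = P0 t a --> uc1 a u |> n = m a u"
   show "?q = ?p"
   proof (rule mdf_eqI[OF q pm])
    fix a assume a: "a : ob A"
    interpret q: mdf A CAT "W b" "V X" ?rx ?ry ?q by (rule q)
    interpret p: mdf A CAT "W b" "V X" ?rx ?ry ?p by (rule pm)
    have qa: "nt_in (M_at ?q a) (N1 ?rx a) (N1 ?ry a)" using q.M_simps[OF a] by (simp add: nt_in_def)
    have pa: "nt_in (M_at ?p a) (N1 ?rx a) (N1 ?ry a)" using p.M_simps[OF a] by (simp add: nt_in_def)
    show "M_at ?q a = M_at ?p a"
    proof (rule nt_in_eqI[OF qa pa])
     fix u assume u: "u : Ob (F_src (N1 ?rx a))"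
     have s: "F_src (N1 ?rx a) = hom B b (P0 t a)" by (rule ftor_inD(2)[OF pt_in(1)[OF px 1(1,2) a]])
     have u': "u : one B" "src B u = b" "trg B u = P0 t a" using u unfolding s by simp_all
     have "mt ?q a u = mt ?p a u" using r a u' mq[OF a u'] by simp
     then show "T_at (M_at ?q a) u = T_at (M_at ?p a) u" by (simp add: mt_def)
    qed
   qed
  qed
 qed
 ultimately show ?case by (elim ex1E) (rule ex1I, blast, blast)
next
 case (2 b X d1 d2 d3)
 note l = lam_pst[OF 2(1)]
 have p: "pst A CAT (W b) (V X) (pack b X d1 d2 d3)" by (rule pack_pst[OF 2(3)])
 obtain x bt where x: "x : one H" "src H x = X" "trg H x = l b" and
   bt: "iso2 (PS A CAT) bt" "dm (PS A CAT) bt = P1 ND x *[PS A CAT] lam b" "cd (PS A CAT) bt = pack b X d1 d2 d3"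
  using ess_surj[OF 2(1,2), of "pack b X d1 d2 d3"] p 2(1,2) by (auto simp: psti)
 have xl: "trg H x = P0 L b" using x 2(1) by simp
 note rx = pt_restrict[OF l 2(1) x(1) xl]
 note px = rx(1)[unfolded x(2)]
 have m: "mdf A CAT (W b) (V X) (ps_comp A CAT (P1 ND x) (lam b)) (pack b X d1 d2 d3) bt"
  using M.iso2_in[OF bt(1)] bt(2,3) px by (simp add: mdfi psti)
 have cm: "CM b (r1 H uc1 x) (r2 H uc2 x) (r2 H uc3 x) d1 d2 d3 (mt bt)"
  by (rule cone_mor_cong[OF mt_cone_mor[OF m 2(1,2)] 2(1)]) (simp_all add: rx uc1_def uc2_def uc3_def)
 have "iso2 H (mt bt a u)" if "a : ob A" "u : one B" "src B u = b" "trg B u = P0 t a" for a u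
 proof -
  interpret m: mdf A CAT "W b" "V X" "ps_comp A CAT (P1 ND x) (lam b)" "pack b X d1 d2 d3" bt by (rule m)
  have n: "nat_iso (M_at bt a)" using PS_iso2_at[OF A.tcat two_category_CAT bt(1) that(1)] by simp
  note f = ftor_inD(2,3)[OF pt_in(1)[OF px 2(1,2) that(1)]]
  have d: "T_src (M_at bt a) = N1 (ps_comp A CAT (P1 ND x) (lam b)) a" using m.M_simps(2)[OF that(1)] by simp
  show ?thesis unfolding mt_def by (rule H.nat_iso_homD[OF n]) (unfold d f, use that in simp_all)
 qed
 then show ?case by (intro exI[of _ x] exI[of _ "mt bt"] conjI cm x(1,2) xl) blast
qed

end

text \<open>Universality is invariant under isomorphism of families of cones.\<close>

lemma (in kan_setup) universal_bicone_iso: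
 assumes u: "universal_bicone A B H t D K c1 c2 c3" and K: "psf B H K"
  and c: "!!b. b : ob B ==> CN b (P0 K b) c1 c2 c3" and e: "!!b. b : ob B ==> CN b (P0 K b) e1 e2 e3"
  and s: "!!b. b : ob B ==> CM b e1 e2 e3 c1 c2 c3 s"
  and i: "!!a u. [|a : ob A; u : one B; trg B u = P0 t a|] ==> iso2 H (s a u)"
 shows "universal_bicone A B H t D K e1 e2 e3"
 unfolding universal_bicone_def
proof (intro ballI conjI allI impI, goal_cases)
 case (1 b X x y m)
 interpret c: cone A B H t D b "P0 K b" c1 c2 c3 by (rule c[OF 1(1)])
 interpret e: cone A B H t D b "P0 K b" e1 e2 e3 by (rule e[OF 1(1)])
 note ss = cone_morD(1-3)[OF s[OF 1(1)]]
 note ex = cone_restrict[OF e[OF 1(1)] 1(3,5,4)] and ey = cone_restrict[OF e[OF 1(1)] 1(6,8,7)]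
  and cx = cone_restrict[OF c[OF 1(1)] 1(3,5,4)] and cy = cone_restrict[OF c[OF 1(1)] 1(6,8,7)]
 note sx = cone_mor_restrict[OF e[OF 1(1)] c[OF 1(1)] s[OF 1(1)] 1(3,5)]
  and sy = cone_mor_restrict[OF e[OF 1(1)] c[OF 1(1)] s[OF 1(1)] 1(6,8)]
 note mm = cone_morD(1-3)[OF 1(9)]
 let ?m = "%a u. (s a u <| y) \<cdot> (m a u \<cdot> inv2 H (s a u <| x))"
 have ix: "iso2 H (s a u <| x)" if "a : ob A" "u : one B" "src B u = b" "trg B u = P0 t a" for a u
  using i[of a u] ss[of a u] that 1 by simp
 have m': "CM b (r1 H c1 x) (r2 H c2 x) (r2 H c3 x)
   (r1 H c1 y) (r2 H c2 y) (r2 H c3 y) ?m"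
  by (rule cone_mor_comp[OF cx ey cy cone_mor_comp[OF cx ex ey cone_mor_inv[OF ex cx sx ix] 1(9)] sy])
 have eq: "e1 a u |> n = m a u \<longleftrightarrow> c1 a u |> n = ?m a u"
  if a: "a : ob A" "u : one B" "src B u = b" "trg B u = P0 t a" and n: "n : two H" "dm H n = x" "cd H n = y" for a u n
 proof -
  note t = ss[OF a] mm[OF a] i[OF a(1,2,4)]
  have ex: "(s a u <| y) \<cdot> (e1 a u |> n) = (c1 a u |> n) \<cdot> (s a u <| x)"
   by (rule H.exchange) (use a n t 1 in simp_all)
  show ?thesis
  proof
   assume "e1 a u |> n = m a u"
   then have *: "(s a u <| y) \<cdot> m a u = (c1 a u |> n) \<cdot> (s a u <| x)" using ex by simp
   show "c1 a u |> n = ?m a u"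
    using a n t 1 by (simp add: H.vreassoc[OF *])
  next
   assume "c1 a u |> n = ?m a u"
   then have "(s a u <| y) \<cdot> (e1 a u |> n) = (s a u <| y) \<cdot> m a u"
    unfolding ex using a n t 1 by simp
   then show "e1 a u |> n = m a u"
    using H.iso2_cancel_left[of "s a u <| y" "e1 a u |> n" "m a u"] a n t 1 by simp
  qed
 qed
 from universal_biconeD(1)[OF u 1(1-8) m'] obtain n where n: "n : two H" "dm H n = x" "cd H n = y"
   "ALL a:ob A. ALL u. u : one B --> src B u = b --> trg B u = P0 t a --> c1 a u |> n = ?m a u"
  and un: "!!n'. [|n' : two H; dm H n' = x; cd H n' = y;
   ALL a:ob A. ALL u. u : one B --> src B u = b --> trg B u = P0 t a --> c1 a u |> n' = ?m a u|] ==> n' = n"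
  by blast
 show ?case
 proof (rule ex1I[of _ n], goal_cases)
  case 1 show ?case using n eq by blast
 next
  case (2 n')
  show ?case by (rule un) (use 2 eq in blast)+
 qed
next
 case (2 b X d1 d2 d3)
 obtain x r where x: "x : one H" "src H x = X" "trg H x = P0 K b"
  and r: "CM b (r1 H c1 x) (r2 H c2 x) (r2 H c3 x) d1 d2 d3 r"
  and ri: "ALL a:ob A. ALL u. u : one B --> src B u = b --> trg B u = P0 t a --> iso2 H (r a u)"
  using universal_biconeD(2)[OF u 2] by blast
 interpret c: cone A B H t D b "P0 K b" c1 c2 c3 by (rule c[OF 2(1)])
 interpret e: cone A B H t D b "P0 K b" e1 e2 e3 by (rule e[OF 2(1)])
 note ex = cone_restrict[OF e[OF 2(1)] x(1,3,2)] and cx = cone_restrict[OF c[OF 2(1)] x(1,3,2)]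
 note sx = cone_mor_restrict[OF e[OF 2(1)] c[OF 2(1)] s[OF 2(1)] x(1,3)]
 note ss = cone_morD(1-3)[OF s[OF 2(1)]] and rr = cone_morD(1-3)[OF r]
 have "iso2 H (r a u \<cdot> (s a u <| x))" if "a : ob A" "u : one B" "src B u = b" "trg B u = P0 t a" for a u
 proof -
  have "iso2 H (r a u)" using ri that by blast
  then show ?thesis using i[of a u] ss[of a u] rr[of a u] that x by simp
 qed
 then show ?case using cone_mor_comp[OF ex cx 2(3) sx r] x by blast
qed

section \<open>Every universal family of cones comes from a transformation\<close>

context ubicone
begin

abbreviation "ti a \<equiv> id1 B (P0 t a)"
text \<open>At \<open>f : a \<rightarrow> a'\<close> the cone over \<open>t a\<close> at the identity is compared with
 the cone over \<open>t a'\<close>, restricted along \<open>L (t f)\<close>; both are the value at \<open>t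
 f\<close>.\<close>

definition "ep2 f = inv2 H (w (P1 t f) (trg A f) (ti (trg A f))) \<cdot> c3 f (ti (src A f))"
definition "ep = \<lparr>N_src = psf_comp A H K t, N_trg = D, N1 = (\<lambda>a\<in>ob A. c1 a (ti a)), N2 = (\<lambda>f\<in>one A. ep2 f)\<rparr>"

lemma ep_simps [simp]: "N_src ep = psf_comp A H K t" "N_trg ep = D" "a : ob A ==> N1 ep a = c1 a (ti a)" "f : one A ==> N2 ep f = ep2 f"
 by (simp_all add: ep_def)

lemma ep2 [simp]:
 assumes "f : one A"
 shows "iso2 H (ep2 f)" "ep2 f : two H" "dm H (ep2 f) = P1 D f \<odot> c1 (src A f) (ti (src A f))"
  "cd H (ep2 f) = c1 (trg A f) (ti (trg A f)) \<odot> P1 K (P1 t f)"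
 using assms by (simp_all add: ep2_def)

lemma w_ep2:
 assumes "f : one A" "src A f = a" "trg A f = a'"
 shows "w (P1 t f) a' (ti a') \<cdot> ep2 f = c3 f (ti a)"
 using assms by (auto simp: ep2_def)

lemma w_ep2':
 assumes "f : one A" "src A f = a" "trg A f = a'" "v : one B" "trg B v = P0 t a"
 shows "(w (P1 t f) a' (ti a') <| P1 K v) \<cdot> (ep2 f <| P1 K v) = c3 f (ti a) <| P1 K v"
proof -
 have o: "a : ob A" "a' : ob A" using assms by auto
 show ?thesis using arg_cong[OF w_ep2[OF assms(1-3)], of "%z. z <| P1 K v"] assms o by simp
qed

lemma w_unit:
 assumes "gm : two B" "dm B gm = g" "cd B gm = g'" "a : ob A" "trg B g = P0 t a"
 shows "w g' a (ti a) \<cdot> (c1 a (ti a) |> P2 K gm) = c2 a gm \<cdot> w g a (ti a)"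
 using w_nat2[OF assms(1-4), of "ti a"] assms by auto

lemma w_unit_comp:
 assumes "g : one B" "h : one B" "a : ob A" "trg B g = src B h" "trg B h = P0 t a"
 shows "w (h *[B] g) a (ti a) \<cdot> (c1 a (ti a) |> Pc K h g) = w g a h \<cdot> (w h a (ti a) <| P1 K g)"
 using w_comp[OF assms(1-3), of "ti a"] assms by simp

text \<open>Each axiom is checked after composing with the invertible cell \<open>w (t f)\<close>, which turns the
 cells \<open>ep2\<close> into cells \<open>c3\<close>.\<close>

lemma ep_pst: "pst A H (psf_comp A H K t) D ep"
proof (rule pstI, goal_cases)
 case 3 show ?case using psf_psf_comp[OF t.psf_axioms' K.psf_axioms'] by (simp add: psf_def)
next
 case (11 ch)
 let ?f = "dm A ch" and ?f' = "cd A ch" let ?a = "src A ?f" and ?a' = "trg A ?f"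
 have o: "?f : one A" "?f' : one A" "?a : ob A" "?a' : ob A" "src A ?f' = ?a" "trg A ?f' = ?a'" using 11 by auto
 have l: "w (P1 t ?f') ?a' (ti ?a') \<cdot> (ep2 ?f' \<cdot> (P2 D ch <| c1 ?a (ti ?a))) = c2 ?a' (P2 t ch) \<cdot> c3 ?f (ti ?a)"
  using cone.c3_nat2[OF cone[of "P0 t ?a"], of ch ?f ?f' "ti ?a" ?a ?a'] 11 o
  by (simp add: H.vreassoc1[OF w_ep2[OF o(2,5,6)]])
 have r: "w (P1 t ?f') ?a' (ti ?a') \<cdot> ((c1 ?a' (ti ?a') |> P2 K (P2 t ch)) \<cdot> ep2 ?f) = c2 ?a' (P2 t ch) \<cdot> c3 ?f (ti ?a)"
  using 11 o by (simp add: H.vreassoc[OF w_unit[of "P2 t ch" "P1 t ?f" "P1 t ?f'" ?a']] w_ep2)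
 have "ep2 ?f' \<cdot> (P2 D ch <| c1 ?a (ti ?a)) = (c1 ?a' (ti ?a') |> P2 K (P2 t ch)) \<cdot> ep2 ?f"
  by (rule H.iso2_cancel_left[of "w (P1 t ?f') ?a' (ti ?a')"]) (use l r 11 o in simp_all)
 then show ?case using 11 o by simp
next
 case (12 f g)
 let ?a = "src A f" and ?a' = "src A g" and ?a'' = "trg A g" and ?tf = "P1 t f" and ?tg = "P1 t g" and ?gf = "g *[A] f"
 have o: "?a : ob A" "?a' : ob A" "?a'' : ob A" "?gf : one A" using 12 by auto
 let ?w = "w (P1 t ?gf) ?a'' (ti ?a'')"
 have l: "?w \<cdot> (ep2 ?gf \<cdot> (Pc D g f <| c1 ?a (ti ?a)))
  = c2 ?a'' (Pc t g f) \<cdot> (c3 g ?tf \<cdot> (P1 D g |> c3 f (ti ?a)))"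
  using cone.c3_comp[OF cone[of "P0 t ?a"], of f g "ti ?a" ?a ?a''] 12 o
  by (simp add: H.vreassoc1[OF w_ep2[of ?gf ?a ?a'']])
 have n: "?w \<cdot> (c1 ?a'' (ti ?a'') |> P2 K (Pc t g f)) = c2 ?a'' (Pc t g f) \<cdot> w (?tg *[B] ?tf) ?a'' (ti ?a'')"
  by (rule w_unit) (use 12 o in simp_all)
 have c: "w (?tg *[B] ?tf) ?a'' (ti ?a'') \<cdot> (c1 ?a'' (ti ?a'') |> Pc K ?tg ?tf) = w ?tf ?a'' ?tg \<cdot> (w ?tg ?a'' (ti ?a'') <| P1 K ?tf)"
  by (rule w_unit_comp) (use 12 o in simp_all)
 have e: "(w ?tg ?a'' (ti ?a'') <| P1 K ?tf) \<cdot> (ep2 g <| P1 K ?tf) = c3 g (ti ?a') <| P1 K ?tf"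
  by (rule w_ep2') (use 12 o in simp_all)
 have d: "w ?tf ?a'' ?tg \<cdot> (c3 g (ti ?a') <| P1 K ?tf) = c3 g ?tf \<cdot> (P1 D g |> w ?tf ?a' (ti ?a'))"
  using w_c3[of ?tf g "ti ?a'" ?a''] 12 o by simp
 have f: "(P1 D g |> w ?tf ?a' (ti ?a')) \<cdot> (P1 D g |> ep2 f) = P1 D g |> c3 f (ti ?a)"
  using arg_cong[OF w_ep2[of f ?a ?a'], of "%z. P1 D g |> z"] 12 o by simp
 have r: "?w \<cdot> ((c1 ?a'' (ti ?a'') |> P2 K (Pc t g f)) \<cdot> ((c1 ?a'' (ti ?a'') |> Pc K ?tg ?tf) \<cdot>
   ((ep2 g <| P1 K ?tf) \<cdot> (P1 D g |> ep2 f)))) = c2 ?a'' (Pc t g f) \<cdot> (c3 g ?tf \<cdot> (P1 D g |> c3 f (ti ?a)))"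
  using 12 o by (simp add: H.vreassoc[OF n] H.vreassoc[OF c] H.vreassoc1[OF e] H.vreassoc[OF d] f)
 have "ep2 ?gf \<cdot> (Pc D g f <| c1 ?a (ti ?a)) = (c1 ?a'' (ti ?a'') |> P2 K (Pc t g f)) \<cdot> ((c1 ?a'' (ti ?a'') |> Pc K ?tg ?tf) \<cdot>
   ((ep2 g <| P1 K ?tf) \<cdot> (P1 D g |> ep2 f)))"
  by (rule H.iso2_cancel_left[of ?w]) (use l r 12 o in simp_all)
 then show ?case using 12 o by simp
next
 case (13 a)
 let ?i = "id1 A a" let ?w = "w (P1 t ?i) a (ti a)"
 have o: "?i : one A" "P0 t a : ob B" using 13 by auto
 have l: "?w \<cdot> (ep2 ?i \<cdot> (Pu D a <| c1 a (ti a))) = c2 a (Pu t a)"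
  using cone.c3_id[OF cone[of "P0 t a"], of a "ti a"] 13 o by (simp add: H.vreassoc1[OF w_ep2[of ?i a a]])
 have n: "?w \<cdot> (c1 a (ti a) |> P2 K (Pu t a)) = c2 a (Pu t a) \<cdot> w (ti a) a (ti a)"
  by (rule w_unit) (use 13 o in simp_all)
 have u: "w (ti a) a (ti a) \<cdot> (c1 a (ti a) |> Pu K (P0 t a)) = id2 H (c1 a (ti a))"
  by (rule w_id) (use 13 o in simp_all)
 have r: "?w \<cdot> ((c1 a (ti a) |> P2 K (Pu t a)) \<cdot> (c1 a (ti a) |> Pu K (P0 t a))) = c2 a (Pu t a)"
  using 13 o by (simp add: H.vreassoc[OF n] u)
 have "ep2 ?i \<cdot> (Pu D a <| c1 a (ti a)) = (c1 a (ti a) |> P2 K (Pu t a)) \<cdot> (c1 a (ti a) |> Pu K (P0 t a))"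
  by (rule H.iso2_cancel_left[of ?w]) (use l r 13 o in simp_all)
 then show ?case using 13 o by simp
qed (simp_all add: ep_def A.tcat H.tcat D.pseudofunctor_axioms)

text \<open>By pseudonaturality every cone is determined by its value at the identity: \<open>c1 a u\<close> is
 isomorphic to \<open>c1 a id *[H] K u\<close>.\<close>

lemma ep_cone_mor:
 assumes b: "b : ob B"
 shows "CM b (tc1 H K ep) (tc2 H K ep) (tc3 A H t K ep) c1 c2 c3 (%a u. w u a (ti a))"
proof (rule cone_morI, goal_cases)
 case (1 a u)
 then show ?case using b by (simp add: tc1_def)
next
 case (2 a mu)
 then show ?case using w_unit[of mu "dm B mu" "cd B mu" a] by (simp add: tc2_def)
next
 case (3 f u)
 let ?a = "src A f" and ?a' = "trg A f" and ?tf = "P1 t f"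
 have o: "?a : ob A" "?a' : ob A" using 3 by auto
 have c: "w (?tf *[B] u) ?a' (ti ?a') \<cdot> (c1 ?a' (ti ?a') |> Pc K ?tf u) = w u ?a' ?tf \<cdot> (w ?tf ?a' (ti ?a') <| P1 K u)"
  by (rule w_unit_comp) (use 3 o in simp_all)
 have e: "(w ?tf ?a' (ti ?a') <| P1 K u) \<cdot> (ep2 f <| P1 K u) = c3 f (ti ?a) <| P1 K u"
  by (rule w_ep2') (use 3 o in simp_all)
 have d: "w u ?a' ?tf \<cdot> (c3 f (ti ?a) <| P1 K u) = c3 f u \<cdot> (P1 D f |> w u ?a (ti ?a))"
  using w_c3[of u f "ti ?a" ?a'] 3 o by simp
 show ?case using 3 o by (simp add: tc3_def H.vreassoc[OF c] e d)
qed

lemma ex_universal_trans: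
 "EX ee. pst A H (psf_comp A H K t) D ee & universal_bicone A B H t D K (tc1 H K ee) (tc2 H K ee) (tc3 A H t K ee)"
proof -
 interpret k: kan_trans A B H t D K ep
  using ep_pst by (simp add: kan_trans_def kan_setup_axioms K.psf_axioms')
 have "universal_bicone A B H t D K (tc1 H K ep) (tc2 H K ep) (tc3 A H t K ep)"
  by (rule universal_bicone_iso[OF universal K.psf_axioms' cone k.trans_cone ep_cone_mor]) simp_all
 then show ?thesis using ep_pst by blast
qed

end

section \<open>Universal families of cones are preserved by representables\<close>

context kan_cat
begin

lemma cat_cone_in:
 assumes "cone A B CAT t (V X) b Y d1 d2 d3" and X: "X : ob H"
 shows "[|a : ob A; u : one B; src B u = b; trg B u = P0 t a|] ==> ftor_in (d1 a u) Y (hom H X (P0 D a))"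
  "[|a : ob A; mu : two B; src B (dm B mu) = b; trg B (dm B mu) = P0 t a|] ==> nt_in (d2 a mu) (d1 a (dm B mu)) (d1 a (cd B mu))"
  "[|f : one A; u : one B; src B u = b; trg B u = P0 t (src A f)|] ==> nat_iso (d3 f u)"
  "[|f : one A; u : one B; src B u = b; trg B u = P0 t (src A f)|] ==>
    nt_in (d3 f u) (ftor_comp (hom_map H (id1 H X) (P1 D f)) (d1 (src A f) u)) (d1 (trg A f) (P1 t f *[B] u))"
proof -
 interpret d: cone A B CAT t "V X" b Y d1 d2 d3 by fact
 show "[|a : ob A; u : one B; src B u = b; trg B u = P0 t a|] ==> ftor_in (d1 a u) Y (hom H X (P0 D a))"
  using d.c1[of a u] X by (simp add: ftor_in_def)
 show "[|a : ob A; mu : two B; src B (dm B mu) = b; trg B (dm B mu) = P0 t a|] ==> nt_in (d2 a mu) (d1 a (dm B mu)) (d1 a (cd B mu))"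
  using d.c2[of a mu] by (simp add: nt_in_def)
 show "[|f : one A; u : one B; src B u = b; trg B u = P0 t (src A f)|] ==> nat_iso (d3 f u)"
  using d.c3(1)[of f u] by simp
 show "[|f : one A; u : one B; src B u = b; trg B u = P0 t (src A f)|] ==>
    nt_in (d3 f u) (ftor_comp (hom_map H (id1 H X) (P1 D f)) (d1 (src A f) u)) (d1 (trg A f) (P1 t f *[B] u))"
  using d.c3[of f u] d.c3_in[of f u] X by (simp add: nt_in_def)
qed

text \<open>Evaluation of a cone of functors at an object of its vertex.\<close>

lemma cat_cone_at:
 assumes d: "cone A B CAT t (V X) b Y d1 d2 d3" and X: "X : ob H" and z: "z : Ob Y"
 shows "CN b X (%a u. F_ob (d1 a u) z) (%a mu. T_at (d2 a mu) z) (%f u. T_at (d3 f u) z)"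
proof -
 interpret d: cone A B CAT t "V X" b Y d1 d2 d3 by fact
 note i = cat_cone_in[OF d X]
 note f = ftor_inD[OF i(1), simplified]
 have f10: "F_ar (d1 a u) (Idt Y z) = id2 H (F_ob (d1 a u) z)" if "a : ob A" "u : one B" "src B u = b" "trg B u = P0 t a" for a u
  using f(10)[OF that z] .
 have n2: "T_src (d2 a mu) = d1 a (dm B mu)" "T_trg (d2 a mu) = d1 a (cd B mu)" "T_at (d2 a mu) z : two H"
  "dm H (T_at (d2 a mu) z) = F_ob (d1 a (dm B mu)) z" "cd H (T_at (d2 a mu) z) = F_ob (d1 a (cd B mu)) z"
  if "a : ob A" "mu : two B" "src B (dm B mu) = b" "trg B (dm B mu) = P0 t a" for a mu
  using nt_inD(2,3,8-10)[OF i(2)[OF that]] f(2,3)[of a "dm B mu"] that z by simp_all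
 have n3: "T_src (d3 g u) = ftor_comp (hom_map H (id1 H X) (P1 D g)) (d1 (src A g) u)" "T_trg (d3 g u) = d1 (trg A g) (P1 t g *[B] u)"
  "T_at (d3 g u) z : two H" "dm H (T_at (d3 g u) z) = P1 D g \<odot> F_ob (d1 (src A g) u) z"
  "cd H (T_at (d3 g u) z) = F_ob (d1 (trg A g) (P1 t g *[B] u)) z" "iso2 H (T_at (d3 g u) z)"
  if "g : one A" "u : one B" "src B u = b" "trg B u = P0 t (src A g)" for g u
 proof -
  have o: "src A g : ob A" using that by auto
  note x = nt_inD(2,3,8-10)[OF i(4)[OF that], simplified]
  note y = f(2,3,6)[OF o that(2-4)]
  show "T_src (d3 g u) = ftor_comp (hom_map H (id1 H X) (P1 D g)) (d1 (src A g) u)" "T_trg (d3 g u) = d1 (trg A g) (P1 t g *[B] u)"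
   "T_at (d3 g u) z : two H" "dm H (T_at (d3 g u) z) = P1 D g \<odot> F_ob (d1 (src A g) u) z"
   "cd H (T_at (d3 g u) z) = F_ob (d1 (trg A g) (P1 t g *[B] u)) z"
   using x y z that X by simp_all
  show "iso2 H (T_at (d3 g u) z)"
   by (rule H.nat_iso_homD[OF i(3)[OF that], of X "P0 D (trg A g)"]) (use x y z that X in simp_all)
 qed
 have fs [simp]: "F_src (d1 a u) = Y" "F_trg (d1 a u) = hom H X (P0 D a)" "F_ob (d1 a u) z : one H" "src H (F_ob (d1 a u) z) = X" "trg H (F_ob (d1 a u) z) = P0 D a"
  if "a : ob A" "u : one B" "src B u = b" "trg B u = P0 t a" for a u
  using f(2,3,6)[OF that] z by simp_all
 note [simp] = n2 n3 f10 X z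
 show ?thesis
 proof (unfold_locales, goal_cases)
  case (9 a u)
  then show ?case using arg_cong[OF d.c2_id[OF 9], of "%y. T_at y z"] by simp
 next
  case (10 a mu nu)
  then have "src B (dm B nu) = b" "trg B (dm B nu) = P0 t a" using B.two_simps(3,4)[of mu] by auto
  with 10 show ?case using arg_cong[OF d.c2_vcomp[OF 10], of "%y. T_at y z"] by simp
 next
  case (14 f mu u v a')
  then have *: "u : one B" "v : one B" "src B v = b" "trg B v = P0 t (src A f)" "a' : ob A"
   using B.two_simps[of mu] A.one_simps(2)[of f] by auto
  show ?case using arg_cong[OF d.c3_nat[OF 14], of "%y. T_at y z"] 14 * by simp
 next
  case (15 ch f f' u a a')
  then have *: "f : one A" "f' : one A" "src A f' = a" "trg A f' = a'" "a : ob A" "a' : ob A"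
   using A.two_simps[of ch] by auto
  show ?case using arg_cong[OF d.c3_nat2[OF 15], of "%y. T_at y z"] 15 * by simp
 next
  case (16 f g u a a'')
  then have *: "a : ob A" "a'' : ob A" "src A g : ob A" by auto
  show ?case using arg_cong[OF d.c3_comp[OF 16], of "%y. T_at y z"] 16 * by simp
 next
  case (17 a u)
  then show ?case using arg_cong[OF d.c3_id[OF 17], of "%y. T_at y z"] by simp
 qed (use d.bX in simp_all)
qed

text \<open>Equations between natural transformations hold if and only if they hold at every object.\<close>

lemma cat_cone_mor_iff:
 assumes d: "cone A B CAT t (V X) b Y d1 d2 d3" and e: "cone A B CAT t (V X) b Y e1 e2 e3" and X: "X : ob H"
 shows "cone_mor A B CAT t (V X) b d1 d2 d3 e1 e2 e3 m \<longleftrightarrow>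
  (ALL a:ob A. ALL u. u : one B --> src B u = b --> trg B u = P0 t a --> nt_in (m a u) (d1 a u) (e1 a u)) &
  (ALL z:Ob Y. CM b (%a u. F_ob (d1 a u) z) (%a mu. T_at (d2 a mu) z) (%f u. T_at (d3 f u) z)
   (%a u. F_ob (e1 a u) z) (%a mu. T_at (e2 a mu) z) (%f u. T_at (e3 f u) z) (%a u. T_at (m a u) z))"
  (is "?l \<longleftrightarrow> ?n & ?r")
proof -
 note i = cat_cone_in[OF d X] and j = cat_cone_in[OF e X]
 interpret d: cone A B CAT t "V X" b Y d1 d2 d3 by fact
 have bY: "b : ob B" "category Y" using d.bX by auto
 have n: ?n if ?l using cone_morD(1-3)[OF that] by (simp add: nt_in_def)
 have "?l \<longleftrightarrow> ?r" if n: ?n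
 proof -
  have nm: "nt_in (m a u) (d1 a u) (e1 a u)" if "a : ob A" "u : one B" "src B u = b" "trg B u = P0 t a" for a u
   using n that by blast
  note fd = ftor_inD[OF i(1), simplified] and fe = ftor_inD[OF j(1), simplified]
  have mt: "T_at (m a u) z : two H" "dm H (T_at (m a u) z) = F_ob (d1 a u) z" "cd H (T_at (m a u) z) = F_ob (e1 a u) z"
   if "a : ob A" "u : one B" "src B u = b" "trg B u = P0 t a" "z : Ob Y" for a u z
   using nt_inD(8-10)[OF nm[OF that(1-4)], of z] fd(2,3)[OF that(1-4)] that(5) by simp_all
  have 1: "nt_vcomp (m a (cd B mu)) (d2 a mu) = nt_vcomp (e2 a mu) (m a (dm B mu)) \<longleftrightarrow>
   (ALL z:Ob Y. T_at (m a (cd B mu)) z \<cdot> T_at (d2 a mu) z = T_at (e2 a mu) z \<cdot> T_at (m a (dm B mu)) z)" (is "?x = ?y \<longleftrightarrow> ?q")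
   if a: "a : ob A" "mu : two B" "src B (dm B mu) = b" "trg B (dm B mu) = P0 t a" for a mu
  proof -
   have o: "dm B mu : one B" "cd B mu : one B" "src B (cd B mu) = b" "trg B (cd B mu) = P0 t a" using a by simp_all
   note s = nt_in_vcomp[OF i(2)[OF a] nm[OF a(1) o(2-4)]] nt_in_vcomp[OF nm[OF a(1) o(1) a(3,4)] j(2)[OF a]]
   have q: "T_at ?x z = T_at (m a (cd B mu)) z \<cdot> T_at (d2 a mu) z" "T_at ?y z = T_at (e2 a mu) z \<cdot> T_at (m a (dm B mu)) z" if "z : Ob Y" for z
    using that fd(2,3)[OF a(1) o(1) a(3,4)] nt_inD(2)[OF i(2)[OF a]] nt_inD(2)[OF nm[OF a(1) o(1) a(3,4)]] by simp_all
   have "?x = ?y \<longleftrightarrow> (ALL z:Ob Y. T_at ?x z = T_at ?y z)"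
    using nt_in_eqI[OF s] fd(2)[OF a(1) o(1) a(3,4)] by metis
   then show ?thesis using q by simp
  qed
  have 2: "nt_vcomp (m (trg A f) (P1 t f *[B] u)) (d3 f u) = nt_vcomp (e3 f u) (nt_hcomp (nt_id (hom_map H (id1 H X) (P1 D f))) (m (src A f) u)) \<longleftrightarrow>
   (ALL z:Ob Y. T_at (m (trg A f) (P1 t f *[B] u)) z \<cdot> T_at (d3 f u) z = T_at (e3 f u) z \<cdot> (P1 D f |> T_at (m (src A f) u) z))"
   (is "?x = ?y \<longleftrightarrow> ?q")
   if a: "f : one A" "u : one B" "src B u = b" "trg B u = P0 t (src A f)" for f u
  proof -
   have o: "src A f : ob A" "trg A f : ob A" "P1 t f *[B] u : one B" "src B (P1 t f *[B] u) = b" "trg B (P1 t f *[B] u) = P0 t (trg A f)" using a by auto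
   have h: "ftor_in (hom_map H (id1 H X) (P1 D f)) (hom H X (P0 D (src A f))) (hom H X (P0 D (trg A f)))" using a X by simp
   note s = nt_in_vcomp[OF i(4)[OF a] nm[OF o(2-5)]] nt_in_vcomp[OF nt_in_hcomp[OF nm[OF o(1) a(2-4)] i(1)[OF o(1) a(2-4)] nt_in_id[OF h] h] j(4)[OF a]]
   note D1 = fd(2,3,6)[OF o(1) a(2-4)] and E1 = fe(2,3,6)[OF o(1) a(2-4)]
   have q: "T_at ?x z = T_at (m (trg A f) (P1 t f *[B] u)) z \<cdot> T_at (d3 f u) z" "T_at ?y z = T_at (e3 f u) z \<cdot> (P1 D f |> T_at (m (src A f) u) z)" if "z : Ob Y" for z
    using that D1 E1 nt_inD(2,3)[OF i(4)[OF a]] nt_inD(2,3)[OF nm[OF o(1) a(2-4)]] mt[OF o(1) a(2-4) that] a o X by simp_all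
   have "?x = ?y \<longleftrightarrow> (ALL z:Ob Y. T_at ?x z = T_at ?y z)"
    using nt_in_eqI[OF s] D1 by (metis ftor_comp_simps(1))
   then show ?thesis using q by simp
  qed
  show ?thesis
  proof
   assume l: ?l
   show ?r
   proof (intro ballI cone_morI, goal_cases)
    case (1 z a u) then show ?case using mt by simp
   next
    case (2 z a mu)
    then show ?case using cone_morD(4)[OF l 2(2,3) refl refl 2(4,5), simplified] 1[OF 2(2-5)] by simp
   next
    case (3 z f u)
    then show ?case using cone_morD(5)[OF l 3(2-5) refl] 2[OF 3(2-5)] X by simp
   qed
  next
   assume r: ?r
   show ?l
   proof (intro cone_morI, goal_cases)
    case (1 a u) then show ?case using nm[OF 1] by (simp add: nt_in_def)
   next
    case (2 a mu)
    have "ALL z:Ob Y. T_at (m a (cd B mu)) z \<cdot> T_at (d2 a mu) z = T_at (e2 a mu) z \<cdot> T_at (m a (dm B mu)) z"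
     using r cone_morD(4)[OF _ 2(1,2) refl refl 2(3,4)] by blast
    then show ?case using 1[OF 2] by simp
   next
    case (3 f u)
    have "ALL z:Ob Y. T_at (m (trg A f) (P1 t f *[B] u)) z \<cdot> T_at (d3 f u) z = T_at (e3 f u) z \<cdot> (P1 D f |> T_at (m (src A f) u) z)"
     using r cone_morD(5)[OF _ 3 refl] by blast
    then show ?case using 2[OF 3] 3 X by simp
   qed
  qed
 qed
 then show ?thesis using n by blast
qed

end

locale ubicone_hom = kan_cat A B H t D + ubicone A B H t D K c1 c2 c3 w
 for A :: "('a, 'p, 'q) two_cat" and B :: "('b, 'f, 't) two_cat" and H :: "('h, 'f, 't) two_cat" (structure) and t D K c1 c2 c3 w +
 fixes X K' h1 h2 h3
 assumes X [simp]: "X : ob H"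
  and K': "b : ob B ==> P0 K' b = hom H X (P0 K b)"
  and h: "b : ob B ==> cone A B CAT t (V X) b (hom H X (P0 K b)) h1 h2 h3"
  and h1: "[|a : ob A; u : one B; trg B u = P0 t a|] ==> h1 a u = hom_map H (id1 H X) (c1 a u)"
  and h2: "[|a : ob A; mu : two B; trg B (dm B mu) = P0 t a; k : one H; src H k = X; trg H k = P0 K (src B (dm B mu))|] ==>
   T_at (h2 a mu) k = c2 a mu <| k"
  and h3: "[|f : one A; u : one B; trg B u = P0 t (src A f); k : one H; src H k = X; trg H k = P0 K (src B u)|] ==>
   T_at (h3 f u) k = c3 f u <| k"
begin

text \<open>Restricting the cones of hom-functors along \<open>x : Y \<rightarrow> H(X,K b)\<close> restricts, at each
  object \<open>z\<close> of \<open>Y\<close>, the given cones along \<open>x z\<close>.\<close>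

lemma h_restrict:
 assumes x: "ftor_in x Y (hom H X (P0 K b))" and b: "b : ob B"
 shows "cone A B CAT t (V X) b Y (%a u. h1 a u *[CAT] x) (%a mu. h2 a mu **[CAT] id2 CAT x) (%f u. h3 f u **[CAT] id2 CAT x)"
  "[|z : Ob Y; a : ob A; u : one B; src B u = b; trg B u = P0 t a|] ==> F_ob (ftor_comp (h1 a u) x) z = c1 a u \<odot> F_ob x z"
  "[|z : Ob Y; a : ob A; mu : two B; src B (dm B mu) = b; trg B (dm B mu) = P0 t a|] ==> T_at (nt_hcomp (h2 a mu) (nt_id x)) z = c2 a mu <| F_ob x z"
  "[|z : Ob Y; f : one A; u : one B; src B u = b; trg B u = P0 t (src A f)|] ==> T_at (nt_hcomp (h3 f u) (nt_id x)) z = c3 f u <| F_ob x z"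
proof -
 interpret h: cone A B CAT t "V X" b "hom H X (P0 K b)" h1 h2 h3 by (rule h[OF b])
 interpret c: cone A B H t D b "P0 K b" c1 c2 c3 by (rule cone[OF b])
 note fx = ftor_inD[OF x, simplified]
 have x': "x : one CAT" "trg CAT x = hom H X (P0 K b)" "src CAT x = Y" using fx by simp_all
 show cx: "cone A B CAT t (V X) b Y (%a u. h1 a u *[CAT] x) (%a mu. h2 a mu **[CAT] id2 CAT x) (%f u. h3 f u **[CAT] id2 CAT x)"
  by (rule h.cone_restrict[OF h.cone_axioms x'])
 show "F_ob (ftor_comp (h1 a u) x) z = c1 a u \<odot> F_ob x z" if "z : Ob Y" "a : ob A" "u : one B" "src B u = b" "trg B u = P0 t a" for z a u
  using that fx by (simp add: h1)
 note ih = cat_cone_in[OF h[OF b] X]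
 have hid: "F_ar (hom_map H (id1 H X) k) (id2 H y) = id2 H (k \<odot> y)" if "k : one H" "y : one H" "src H y = X" "trg H y = src H k" for k y
  using that by simp
 show "T_at (nt_hcomp (h2 a mu) (nt_id x)) z = c2 a mu <| F_ob x z"
  if z: "z : Ob Y" "a : ob A" "mu : two B" "src B (dm B mu) = b" "trg B (dm B mu) = P0 t a" for z a mu
  using z fx(2,3) fx(6)[of z] nt_inD(2,3)[OF ih(2)[OF z(2-5)]] ih(1)[OF z(2) _ z(4,5)]
  by (simp add: h1 h2)
 show "T_at (nt_hcomp (h3 f u) (nt_id x)) z = c3 f u <| F_ob x z"
  if z: "z : Ob Y" "f : one A" "u : one B" "src B u = b" "trg B u = P0 t (src A f)" for z f u
  using z fx(2,3) fx(6)[of z] nt_inD(2,3)[OF ih(4)[OF z(2-5)]]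
  by (simp add: h1 h3)
qed

text \<open>Lifts are chosen separately at each object of the vertex \<open>Y\<close>.  By faithfulness the chosen
 1-cells and 2-cells are then functorial and natural in \<open>Y\<close>.\<close>

lemma hom_universal: "universal_bicone A B CAT t (V X) K' h1 h2 h3"
 unfolding universal_bicone_def
proof (intro ballI conjI allI impI, goal_cases)
 case (1 b Y x y m)
 have Y: "category Y" using 1 by simp
 have x: "ftor_in x Y (hom H X (P0 K b))" and y: "ftor_in y Y (hom H X (P0 K b))" using 1 by (simp_all add: K' ftor_in_def)
 note fx = ftor_inD[OF x, simplified] and fy = ftor_inD[OF y, simplified]
 note hx = h_restrict[OF x 1(1)] and hy = h_restrict[OF y 1(1)]
 interpret c: cone A B H t D b "P0 K b" c1 c2 c3 by (rule cone[OF 1(1)])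
 have m: "nt_in (m a u) (ftor_comp (h1 a u) x) (ftor_comp (h1 a u) y)" if "a : ob A" "u : one B" "src B u = b" "trg B u = P0 t a" for a u
  using 1(9)[unfolded cat_cone_mor_iff[OF hx(1) hy(1) X]] that by simp
 have mz: "CM b (r1 H c1 (F_ob x z)) (r2 H c2 (F_ob x z)) (r2 H c3 (F_ob x z))
   (r1 H c1 (F_ob y z)) (r2 H c2 (F_ob y z)) (r2 H c3 (F_ob y z)) (%a u. T_at (m a u) z)" if z: "z : Ob Y" for z
 proof (rule cone_mor_cong[OF _ 1(1)])
  show "CM b (%a u. F_ob (h1 a u *[CAT] x) z) (%a mu. T_at (h2 a mu **[CAT] id2 CAT x) z) (%f u. T_at (h3 f u **[CAT] id2 CAT x) z)
   (%a u. F_ob (h1 a u *[CAT] y) z) (%a mu. T_at (h2 a mu **[CAT] id2 CAT y) z) (%f u. T_at (h3 f u **[CAT] id2 CAT y) z) (%a u. T_at (m a u) z)"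
   using 1(9)[unfolded cat_cone_mor_iff[OF hx(1) hy(1) X]] z by blast
 qed (simp_all add: hx hy z)
 have "ALL z:Ob Y. EX n. n : two H & dm H n = F_ob x z & cd H n = F_ob y z &
  (ALL a:ob A. ALL u. u : one B --> src B u = b --> trg B u = P0 t a --> c1 a u |> n = T_at (m a u) z)"
 proof
  fix z assume z: "z : Ob Y"
  show "EX n. n : two H & dm H n = F_ob x z & cd H n = F_ob y z &
   (ALL a:ob A. ALL u. u : one B --> src B u = b --> trg B u = P0 t a --> c1 a u |> n = T_at (m a u) z)"
   using lift_exists[OF 1(1) X _ _ _ _ _ _ mz[OF z]] fx(6)[OF z] fy(6)[OF z] by metis
 qed
 then obtain N where N: "!!z. z : Ob Y ==> N z : two H & dm H (N z) = F_ob x z & cd H (N z) = F_ob y z"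
  "!!z a u. [|z : Ob Y; a:ob A; u : one B; src B u = b; trg B u = P0 t a|] ==> c1 a u |> N z = T_at (m a u) z"
  by metis
 let ?N = "\<lparr>T_src = x, T_trg = y, T_at = (\<lambda>z\<in>Ob Y. N z)\<rparr>"
 interpret Y: category Y by (rule Y)
 have n: "nt_in ?N x y"
 proof (rule nt_inI[OF x y], goal_cases)
  case (7 ps)
  let ?z = "Dom Y ps" and ?z' = "Cod Y ps"
  have o: "?z : Ob Y" "?z' : Ob Y" using 7 Y.dom_cod by auto
  note q = N(1)[OF o(1)] N(1)[OF o(2)] fx(7-9)[OF 7] fy(7-9)[OF 7] fx(6)[OF o(1)] fx(6)[OF o(2)] fy(6)[OF o(1)] fy(6)[OF o(2)]
  have "F_ar y ps \<cdot> N ?z = N ?z' \<cdot> F_ar x ps"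
  proof (rule faithful[OF 1(1)], goal_cases)
   case (6 a u)
   have mm: "T_at (m a u) ?z : two H" "dm H (T_at (m a u) ?z) = c1 a u \<odot> F_ob x ?z" "cd H (T_at (m a u) ?z) = c1 a u \<odot> F_ob y ?z"
     "T_at (m a u) ?z' : two H" "dm H (T_at (m a u) ?z') = c1 a u \<odot> F_ob x ?z'" "cd H (T_at (m a u) ?z') = c1 a u \<odot> F_ob y ?z'"
    using cone_morD(1-3)[OF mz[OF o(1)] 6] cone_morD(1-3)[OF mz[OF o(2)] 6] by simp_all
   have "(c1 a u |> F_ar y ps) \<cdot> T_at (m a u) ?z = T_at (m a u) ?z' \<cdot> (c1 a u |> F_ar x ps)"
    using nt_inD(11)[OF m[OF 6], of ps] 7 6 q fx(2,3) fy(2,3) by (simp add: h1)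
   then have "(c1 a u |> F_ar y ps) \<cdot> (c1 a u |> N ?z) = (c1 a u |> N ?z') \<cdot> (c1 a u |> F_ar x ps)"
    using N(2)[OF o(1) 6] N(2)[OF o(2) 6] by simp
   then show ?case using 6 q 1 by simp
  qed (use q in simp_all)
  then show ?case using o by simp
 qed (use N(1) fx(6) in auto)
 have at: "(ALL a:ob A. ALL u. u : one B --> src B u = b --> trg B u = P0 t a --> id2 CAT (h1 a u) **[CAT] k = m a u) \<longleftrightarrow>
   (ALL z:Ob Y. ALL a:ob A. ALL u. u : one B --> src B u = b --> trg B u = P0 t a --> c1 a u |> T_at k z = T_at (m a u) z)"
  if k: "nt_in k x y" for k
 proof -
  have q: "id2 CAT (h1 a u) **[CAT] k = m a u \<longleftrightarrow> (ALL z:Ob Y. c1 a u |> T_at k z = T_at (m a u) z)"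
   if a: "a : ob A" "u : one B" "src B u = b" "trg B u = P0 t a" for a u
  proof -
   have f: "ftor_in (h1 a u) (hom H X (P0 K b)) (hom H X (P0 D a))" by (rule cat_cone_in(1)[OF h[OF 1(1)] X a])
   have s: "nt_in (nt_hcomp (nt_id (h1 a u)) k) (ftor_comp (h1 a u) x) (ftor_comp (h1 a u) y)"
    by (rule nt_in_hcomp[OF k x nt_in_id[OF f] f])
   have "T_at (nt_hcomp (nt_id (h1 a u)) k) z = c1 a u |> T_at k z" if z: "z : Ob Y" for z
    using nt_inD(2,3,8-10)[OF k] fx(2,3,6) fy(6) a z by (simp add: h1)
   then show ?thesis using nt_in_eqI[OF s m[OF a]] fx(2) by (auto simp: ftor_comp_simps(1))
  qed
  then show ?thesis by blast
 qed
 show ?case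
 proof (rule ex1I[of _ ?N], goal_cases)
  case 1
  have "ALL z:Ob Y. ALL a:ob A. ALL u. u : one B --> src B u = b --> trg B u = P0 t a --> c1 a u |> T_at ?N z = T_at (m a u) z"
   using N(2) by simp
  then show ?case unfolding at[OF n] using n by (simp add: nt_in_def)
 next
  case (2 k)
  have k: "nt_in k x y" using 2 by (simp add: nt_in_def)
  have kz: "ALL z:Ob Y. ALL a:ob A. ALL u. u : one B --> src B u = b --> trg B u = P0 t a --> c1 a u |> T_at k z = T_at (m a u) z"
   using 2 unfolding at[OF k] by blast
  note kd = nt_inD(8-10)[OF k, unfolded fx(2,3), simplified]
  show ?case
  proof (rule nt_in_eqI[OF k n])
   fix z assume "z : Ob (F_src x)"
   then have z: "z : Ob Y" using fx by simp
   have "T_at k z = N z"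
    by (rule faithful[OF 1(1)]) (use kd[OF z] N(1)[OF z] fx(6)[OF z] kz N(2)[OF z] z in simp_all)
   then show "T_at k z = T_at ?N z" using z by simp
  qed
 qed
next
 case (2 b Y d1 d2 d3)
 have Y: "category Y" using 2 by simp
 interpret Y: category Y by (rule Y)
 note dn = cat_cone_in[OF 2(3) X]
 note fd = ftor_inD[OF dn(1), simplified]
 interpret c: cone A B H t D b "P0 K b" c1 c2 c3 by (rule cone[OF 2(1)])
 have "ALL z:Ob Y. EX x s. x : one H & src H x = X & trg H x = P0 K b &
   CM b (r1 H c1 x) (r2 H c2 x) (r2 H c3 x)
    (%a u. F_ob (d1 a u) z) (%a mu. T_at (d2 a mu) z) (%f u. T_at (d3 f u) z) s &
   (ALL a:ob A. ALL u. u : one B --> src B u = b --> trg B u = P0 t a --> iso2 H (s a u))"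
  using universal_biconeD(2)[OF universal 2(1) X cat_cone_at[OF 2(3) X]] by blast
 then obtain x0 s where x0: "!!z. z : Ob Y ==> x0 z : one H & src H (x0 z) = X & trg H (x0 z) = P0 K b"
  and s: "!!z. z : Ob Y ==> CM b (r1 H c1 (x0 z)) (r2 H c2 (x0 z)) (r2 H c3 (x0 z))
    (%a u. F_ob (d1 a u) z) (%a mu. T_at (d2 a mu) z) (%f u. T_at (d3 f u) z) (s z)"
  and si: "!!z a u. [|z : Ob Y; a : ob A; u : one B; src B u = b; trg B u = P0 t a|] ==> iso2 H (s z a u)"
  by metis
 have sd: "s z a u : two H" "dm H (s z a u) = c1 a u \<odot> x0 z" "cd H (s z a u) = F_ob (d1 a u) z"
  if "z : Ob Y" "a : ob A" "u : one B" "src B u = b" "trg B u = P0 t a" for z a u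
  using cone_morD(1-3)[OF s[OF that(1)] that(2-5)] by simp_all
 have cx: "CN b X (r1 H c1 (x0 z)) (r2 H c2 (x0 z)) (r2 H c3 (x0 z))" if "z : Ob Y" for z
  using cone_restrict[OF cone[OF 2(1)]] x0[OF that] by blast
 note cd = cat_cone_at[OF 2(3) X]
 have dm: "CM b (%a u. F_ob (d1 a u) z) (%a mu. T_at (d2 a mu) z) (%f u. T_at (d3 f u) z)
   (%a u. F_ob (d1 a u) z') (%a mu. T_at (d2 a mu) z') (%f u. T_at (d3 f u) z') (%a u. F_ar (d1 a u) ps)"
  if p: "ps : Ar Y" "Dom Y ps = z" "Cod Y ps = z'" for ps z z'
 proof (rule cone_morI, goal_cases)
  case (1 a u) then show ?case using fd(7-9)[OF 1 p(1)] p by simp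
 next
  case (2 a mu)
  then show ?case using nt_inD(11)[OF dn(2)[OF 2], of ps] p fd(2,3)[of a "dm B mu"] by simp
 next
  case (3 f u)
  have o: "src A f : ob A" using 3 by auto
  show ?case using nt_inD(11)[OF dn(4)[OF 3], of ps] p 3 fd(2,3)[OF o 3(2-4)] fd(7-9)[OF o 3(2-4) p(1)] by simp
 qed
 have "ALL ps:Ar Y. EX n. n : two H & dm H n = x0 (Dom Y ps) & cd H n = x0 (Cod Y ps) &
  (ALL a:ob A. ALL u. u : one B --> src B u = b --> trg B u = P0 t a -->
   c1 a u |> n = inv2 H (s (Cod Y ps) a u) \<cdot> (F_ar (d1 a u) ps \<cdot> s (Dom Y ps) a u))"
 proof
  fix ps assume p: "ps : Ar Y"
  let ?z = "Dom Y ps" and ?z' = "Cod Y ps"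
  have o: "?z : Ob Y" "?z' : Ob Y" using p Y.dom_cod by auto
  have i: "CM b (%a u. F_ob (d1 a u) ?z') (%a mu. T_at (d2 a mu) ?z') (%f u. T_at (d3 f u) ?z')
    (r1 H c1 (x0 ?z')) (r2 H c2 (x0 ?z')) (r2 H c3 (x0 ?z')) (%a u. inv2 H (s ?z' a u))"
   by (rule cone_mor_inv[OF cx[OF o(2)] cd[OF o(2)] s[OF o(2)] si[OF o(2)]])
  note k = cone_mor_comp[OF cx[OF o(1)] cd[OF o(2)] cx[OF o(2)] cone_mor_comp[OF cx[OF o(1)] cd[OF o(1)] cd[OF o(2)] s[OF o(1)] dm[OF p refl refl]] i]
  show "EX n. n : two H & dm H n = x0 ?z & cd H n = x0 ?z' &
  (ALL a:ob A. ALL u. u : one B --> src B u = b --> trg B u = P0 t a -->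
   c1 a u |> n = inv2 H (s ?z' a u) \<cdot> (F_ar (d1 a u) ps \<cdot> s ?z a u))"
   using lift_exists[OF 2(1) X _ _ _ _ _ _ k] x0[OF o(1)] x0[OF o(2)] by metis
 qed
 then obtain x1 where x1: "!!ps. ps : Ar Y ==> x1 ps : two H & dm H (x1 ps) = x0 (Dom Y ps) & cd H (x1 ps) = x0 (Cod Y ps)"
  and x1e: "!!ps a u. [|ps : Ar Y; a : ob A; u : one B; src B u = b; trg B u = P0 t a|] ==>
   c1 a u |> x1 ps = inv2 H (s (Cod Y ps) a u) \<cdot> (F_ar (d1 a u) ps \<cdot> s (Dom Y ps) a u)"
  by metis
 define x where "x = \<lparr>F_src = Y, F_trg = hom H X (P0 K b), F_ob = (\<lambda>z\<in>Ob Y. x0 z), F_ar = (\<lambda>ps\<in>Ar Y. x1 ps)\<rparr>"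
 have x: "ftor_in x Y (hom H X (P0 K b))"
 proof (rule ftor_inI, goal_cases)
  case (11 z)
  have z: "Idt Y z : Ar Y" "Dom Y (Idt Y z) = z" "Cod Y (Idt Y z) = z" using Y.idt[OF 11] by auto
  have "x1 (Idt Y z) = id2 H (x0 z)"
  proof (rule faithful[OF 2(1)], goal_cases)
   case (6 a u)
   show ?case using x1e[OF z(1) 6] sd[OF 11 6] si[OF 11 6] z fd(10)[OF 6 11] 6 x0[OF 11] 2(1) by simp
  qed (use x0[OF 11] x1[OF z(1)] z in simp_all)
  then show ?case using 11 z by (simp add: x_def)
 next
  case (12 ps ph)
  let ?z = "Dom Y ps" and ?z' = "Cod Y ps" and ?z'' = "Cod Y ph"
  have z: "Cmp Y ph ps : Ar Y" "Dom Y (Cmp Y ph ps) = ?z" "Cod Y (Cmp Y ph ps) = ?z''" using Y.cmp[OF 12] by auto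
  have o: "?z : Ob Y" "?z' : Ob Y" "?z'' : Ob Y" using Y.dom_cod 12 by auto
  note q = x1[OF 12(1)] x1[OF 12(2)] x1[OF z(1)] x0[OF o(1)] x0[OF o(2)] x0[OF o(3)]
  have "x1 (Cmp Y ph ps) = x1 ph \<cdot> x1 ps"
  proof (rule faithful[OF 2(1)], goal_cases)
   case (6 a u)
   note r = sd[OF o(1) 6] sd[OF o(2) 6] sd[OF o(3) 6] si[OF o(1) 6] si[OF o(2) 6] si[OF o(3) 6]
   have "c1 a u |> (x1 ph \<cdot> x1 ps) = (c1 a u |> x1 ph) \<cdot> (c1 a u |> x1 ps)"
    using q z 12(3) 6 2(1) by simp
   also have "\<dots> = c1 a u |> x1 (Cmp Y ph ps)"
    unfolding x1e[OF 12(2) 6] x1e[OF 12(1) 6] x1e[OF z(1) 6]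
    using r z 12(3) fd(7-9)[OF 6 12(1)] fd(7-9)[OF 6 12(2)] fd(11)[OF 6 12] by simp
   finally show ?case by simp
  qed (use q z 12(3) in simp_all)
  then show ?case using 12 z by (simp add: x_def)
 qed (use x0 x1 Y.dom_cod 2(1) Y in "simp_all add: x_def category_hom H.tcat")
 have fx: "F_ob x z = x0 z" "F_ar x ps = x1 ps" if "z : Ob Y" "ps : Ar Y" for z ps using that by (simp_all add: x_def)
 have fx0: "F_ob x z = x0 z" if "z : Ob Y" for z using that by (simp add: x_def)
 have fxs: "F_src x = Y" "F_trg x = hom H X (P0 K b)" by (simp_all add: x_def)
 define sg where "sg a u = \<lparr>T_src = ftor_comp (h1 a u) x, T_trg = d1 a u, T_at = (\<lambda>z\<in>Ob Y. s z a u)\<rparr>" for a u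
 note hx = h_restrict[OF x 2(1)]
 have sn: "nt_in (sg a u) (ftor_comp (h1 a u) x) (d1 a u)" if a: "a : ob A" "u : one B" "src B u = b" "trg B u = P0 t a" for a u
 proof (rule nt_inI[OF ftor_in_comp[OF x cat_cone_in(1)[OF h[OF 2(1)] X a]] dn(1)[OF a]], goal_cases)
  case (4 z) then show ?case using sd[OF 4 a] x0[OF 4] a 2(1) by (simp add: sg_def)
 next
  case (5 z) then show ?case using sd[OF 5 a] hx(2)[OF 5 a] by (simp add: sg_def fx0)
 next
  case (6 z) then show ?case using sd[OF 6 a] by (simp add: sg_def)
 next
  case (7 ps)
  let ?z = "Dom Y ps" and ?z' = "Cod Y ps"
  have o: "?z : Ob Y" "?z' : Ob Y" using Y.dom_cod 7 by auto
  have "F_ar (ftor_comp (h1 a u) x) ps = c1 a u |> x1 ps"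
   using 7 x1[OF 7] x0[OF o(1)] a 2(1) fx(2)[OF o(1) 7] by (simp add: fxs h1)
  then show ?case using o sd[OF o(1) a] sd[OF o(2) a] si[OF o(2) a] x1e[OF 7 a] fd(7-9)[OF a 7] by (simp add: sg_def)
 qed (simp_all add: sg_def)
 have "cone_mor A B CAT t (V X) b (%a u. h1 a u *[CAT] x) (%a mu. h2 a mu **[CAT] id2 CAT x) (%f u. h3 f u **[CAT] id2 CAT x) d1 d2 d3 sg"
  unfolding cat_cone_mor_iff[OF hx(1) 2(3) X]
 proof (intro conjI ballI allI impI, goal_cases)
  case (1 a u) then show ?case using sn by simp
 next
  case (2 z)
  have "CM b (%a u. F_ob (h1 a u *[CAT] x) z) (%a mu. T_at (h2 a mu **[CAT] id2 CAT x) z) (%f u. T_at (h3 f u **[CAT] id2 CAT x) z)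
   (%a u. F_ob (d1 a u) z) (%a mu. T_at (d2 a mu) z) (%f u. T_at (d3 f u) z) (s z)"
   by (rule cone_mor_cong[OF s[OF 2] \<open>b : ob B\<close>]) (use 2 in "simp_all add: hx fx0")
  then show ?case using 2 by (simp add: sg_def)
 qed
 moreover have "iso2 CAT (sg a u)" if a: "a : ob A" "u : one B" "src B u = b" "trg B u = P0 t a" for a u
  unfolding iso2_CAT
  by (rule H.nat_iso_homI[OF sn[OF a], of X "P0 D a"]) (use a si in "simp_all add: fxs h1 sg_def")
 moreover have "x : one CAT" "src CAT x = Y" "trg CAT x = P0 K' b" using ftor_inD(1-3)[OF x] 2(1) by (simp_all add: K')
 ultimately show ?case by (intro exI[of _ x] exI[of _ sg] conjI) blast+
qed

end

section \<open>Pointwise universal families of cones are preserved by representables\<close>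

lemma psf_comp_assoc:
 assumes "psf A B t" "psf B H R" "psf H K U"
 shows "psf_comp A K (psf_comp B K U R) t = psf_comp A K U (psf_comp A H R t)"
proof -
 interpret t: psf A B t by fact
 interpret R: psf B H R by fact
 interpret U: psf H K U by fact
 have *: "psf A K (psf_comp A K (psf_comp B K U R) t)" "psf A K (psf_comp A K U (psf_comp A H R t))"
  using assms psf_psf_comp by metis+
 show ?thesis
  by (rule psfun_eqI[OF psf.axioms(3)[OF *(1)] psf.axioms(3)[OF *(2)]]) simp_all
qed

locale kan_trans_cat = kan_cat A B H t D + kan_trans A B H t D R ee
 for A :: "('a, 'p, 'q) two_cat" and B :: "('b, 'f, 't) two_cat" and H :: "('h, 'f, 't) two_cat" (structure) and t D R ee
begin

abbreviation "R' X \<equiv> psf_comp B CAT (rep H X) R"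
abbreviation "ee' X \<equiv> ps_whisker_left A CAT (rep H X) ee"

lemma R'_psf: "X : ob H ==> psf B CAT (R' X)"
 using psf_psf_comp[OF K.psf_axioms' H.psf_rep] by auto

lemma R't: "X : ob H ==> psf_comp A CAT (R' X) t = psf_comp A CAT (rep H X) (psf_comp A H R t)"
 by (rule psf_comp_assoc[OF t.psf_axioms' K.psf_axioms' H.psf_rep])

lemma iso_hom_map2:
 assumes "X : ob H" "iso2 H gm" shows "nat_iso (hom_map2 H (id2 H (id1 H X)) gm)"
proof -
 have "iso2 CAT (hom_map2 H (id2 H (id1 H X)) gm)"
  by (rule two_category.iso2I[OF two_category_CAT, of _ "hom_map2 H (id2 H (id1 H X)) (inv2 H gm)"])
   (use assms in auto)
 then show ?thesis by simp
qed

lemma ee'_simps [simp]: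
 assumes X: "X : ob H"
 shows "N_src (ee' X) = psf_comp A CAT (rep H X) (psf_comp A H R t)" "N_trg (ee' X) = V X"
  "a : ob A ==> N1 (ee' X) a = hom_map H (id1 H X) (N1 ee a)"
  "f : one A ==> N2 (ee' X) f = hom_map2 H (id2 H (id1 H X)) (N2 ee f)"
proof -
 interpret C: two_category "CAT :: (('f, 't) cat, ('f, 't, 'f, 't) ftor, ('f, 't, 'f, 't) ntrans) two_cat"
  by (rule two_category_CAT)
 show "N_src (ee' X) = psf_comp A CAT (rep H X) (psf_comp A H R t)" "N_trg (ee' X) = V X"
  "a : ob A ==> N1 (ee' X) a = hom_map H (id1 H X) (N1 ee a)"
  using X by (simp_all add: ps_whisker_left_def)
 have i: "inv2 CAT (nt_id (hom_map H (id1 H X) k)) = nt_id (hom_map H (id1 H X) k)" if "k : one H" for k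
  using C.inv2_id2[of "hom_map H (id1 H X) k"] that X by simp
 show "f : one A ==> N2 (ee' X) f = hom_map2 H (id2 H (id1 H X)) (N2 ee f)"
  using X by (simp add: ps_whisker_left_def i) (simp add: H.nt_id_hom del: H.hom_map2_id)
qed

lemma ee'_pst:
 assumes X: "X : ob H" shows "pst A CAT (psf_comp A CAT (R' X) t) (V X) (ee' X)"
proof -
 have F: "psf A CAT (psf_comp A CAT (R' X) t)" by (rule psf_psf_comp[OF t.psf_axioms' R'_psf[OF X]])
 note V = V_psf[OF X]
 show ?thesis unfolding R't[OF X]
 proof (rule pstI, goal_cases)
  case 3 show ?case using F unfolding R't[OF X] by (simp add: psf_def)
 next
  case 4 show ?case using V by (simp add: psf_def)
 next
  case (10 f) then show ?case using X by (simp add: iso_hom_map2)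
 next
  case (11 ch)
  have o: "src A (dm A ch) : ob A" "trg A (dm A ch) : ob A" using 11 by auto
  show ?case using 11 o X al.N2_nat[OF 11 refl refl refl refl] by (simp add: H.nt_id_hom del: H.hom_map2_id)
 next
  case (12 f g)
  have o: "src A f : ob A" "trg A g : ob A" "src A g : ob A" using 12 by auto
  show ?case using 12 o X al.N2_cmp[OF 12 refl refl] by (simp add: H.nt_id_hom del: H.hom_map2_id)
 next
  case (13 a)
  then show ?case using X al.N2_unit[OF 13] by (simp add: H.nt_id_hom del: H.hom_map2_id)
 qed (use X in "simp_all add: A.tcat two_category_CAT ps_whisker_left_def")
qed

lemma ee'_kan_trans:
 assumes X: "X : ob H" shows "kan_trans A B CAT t (V X) (R' X) (ee' X)"
 using ee'_pst[OF X] R'_psf[OF X] V_psf[OF X] A.tcat B.tcat two_category_CAT t.psf_axioms'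
 by (simp add: kan_trans_def kan_setup_def)

lemma ee'_psran_data:
 assumes X: "X : ob H" shows "psran_data A B CAT (V X) t (R' X) (ee' X)"
 using ee'_pst[OF X] R'_psf[OF X] A.tcat B.tcat two_category_CAT t.psf_axioms'
 by (simp add: psran_data_def)

lemma pointwise_if_universal:
 assumes u: "universal_bicone A B H t D R (tc1 H R ee) (tc2 H R ee) (tc3 A H t R ee)"
 shows "is_pointwise_psran A B H t D R ee"
proof -
 interpret p: psran_data A B H D t R ee by unfold_locales
 have "preserves_psran A B CAT t D R ee (rep H X)" if X: "X : ob H" for X
 proof -
  interpret k: kan_trans A B CAT t "V X" "R' X" "ee' X" by (rule ee'_kan_trans[OF X])
  interpret q: psran_data A B CAT "V X" t "R' X" "ee' X" by (rule ee'_psran_data[OF X])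
  interpret h: ubicone_hom A B H t D R "tc1 H R ee" "tc2 H R ee" "tc3 A H t R ee" "tw H R ee" X "R' X"
   "tc1 CAT (R' X) (ee' X)" "tc2 CAT (R' X) (ee' X)" "tc3 A CAT t (R' X) (ee' X)"
  proof (intro ubicone_hom.intro ubicone_hom_axioms.intro, goal_cases)
   case 1 show ?case by unfold_locales
  next
   case 2 show ?case using u trans_bicone by (simp add: ubicone_def ubicone_axioms_def)
  next
   case 3 show ?case by (rule X)
  next
   case (4 b) then show ?case using X by simp
  next
   case (5 b) then show ?case using k.trans_cone[OF 5] X by simp
  next
   case (6 a u) then show ?case using X by (simp add: tc1_def)
  next
   case (7 a mu y)
   have "src B (dm B mu) : ob B" using 7 by auto
   then show ?case using X 7 by (simp add: tc2_def H.nt_id_hom del: H.hom_map2_id)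
  next
   case (8 f u y)
   have "src B u : ob B" "trg A f : ob A" "src A f : ob A" using 8 by auto
   then show ?case using X 8 by (simp add: tc3_def H.nt_id_hom del: H.hom_map2_id)
  qed
  show ?thesis unfolding preserves_psran_def by (rule q.psran_if_universal[OF h.hom_universal])
 qed
 then show ?thesis using p.psran_if_universal[OF u] by (simp add: is_pointwise_psran_def)
qed

end

section \<open>Pointwise extensions have universal families of cones\<close>

text \<open>The identity of \<open>B\<close>; with it \<open>B(b,-)\<close> is an instance of the weights
 \<open>B(b,t-)\<close>.\<close>

definition psf_unit where "psf_unit B = strict B B (%x. x) (%f. f) (%al. al)"

lemma psf_unit_simps [simp]:
 "x : ob B ==> P0 (psf_unit B) x = x" "f : one B ==> P1 (psf_unit B) f = f" "al : two B ==> P2 (psf_unit B) al = al"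
 "[|f : one B; g : one B; trg B f = src B g|] ==> Pc (psf_unit B) g f = id2 B (g *[B] f)"
 "x : ob B ==> Pu (psf_unit B) x = id2 B (id1 B x)"
 by (simp_all add: psf_unit_def)

lemma psf_unit: "two_category B ==> psf B B (psf_unit B)"
proof -
 assume "two_category B"
 then interpret B: two_category B .
 show ?thesis unfolding psf_unit_def
  by (rule sfun.axioms(1)[OF sfun_strict[OF B.tcat B.tcat strict_pseudofunctor[OF B.tcat B.tcat]]]) simp_all
qed

lemma psf_comp_unit:
 assumes "psf B H F" shows "psf_comp B H F (psf_unit B) = F"
proof -
 interpret F: psf B H F by fact
 interpret c: psf B H "psf_comp B H F (psf_unit B)" by (rule psf_psf_comp[OF psf_unit[OF F.A.tcat] assms])
 show ?thesis by (rule psfun_eqI[OF c.pseudofunctor_axioms F.pseudofunctor_axioms]) simp_all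
qed

lemma (in kan_cat) mt_eqI:
 assumes m: "mdf A CAT (W b) (V X) nu nu' m" and n: "mdf A CAT (W b) (V X) nu nu' n" and b: "b : ob B" "X : ob H"
  and e: "!!a u. [|a : ob A; u : one B; src B u = b; trg B u = P0 t a|] ==> mt m a u = mt n a u"
 shows "m = n"
proof (rule mdf_eqI[OF m n])
 fix a assume a: "a : ob A"
 interpret m: mdf A CAT "W b" "V X" nu nu' m by (rule m)
 interpret n: mdf A CAT "W b" "V X" nu nu' n by (rule n)
 have ma: "nt_in (M_at m a) (N1 nu a) (N1 nu' a)" using m.M_simps[OF a] by (simp add: nt_in_def)
 have na: "nt_in (M_at n a) (N1 nu a) (N1 nu' a)" using n.M_simps[OF a] by (simp add: nt_in_def)
 show "M_at m a = M_at n a"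
 proof (rule nt_in_eqI[OF ma na])
  fix u assume u: "u : Ob (F_src (N1 nu a))"
  have "F_src (N1 nu a) = hom B b (P0 t a)" by (rule ftor_inD(2)[OF pt_in(1)[OF m.al.pst_axioms b a]])
  then show "T_at (M_at m a) u = T_at (M_at n a) u" using e[of a u] u a by (simp add: mt_def)
 qed
qed

locale kan_yoneda = kan_trans_cat A B H t D R ee + y: kan_cat B B H "psf_unit B" R
 for A :: "('a, 'p, 'q) two_cat" and B :: "('b, 'f, 't) two_cat" and H :: "('h, 'f, 't) two_cat" (structure) and t D R ee +
 fixes b X
 assumes b [simp]: "b : ob B" and X [simp]: "X : ob H"
  and psran: "is_psran A B CAT t (V X) (R' X) (ee' X)"
begin

lemma yW: "y.W b = rep B b"
 by (rule psf_comp_unit[OF B.psf_rep[OF b]])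

lemma yp: "pst B CAT (rep B b) (R' X) sg ==> pst B CAT (y.W b) (y.V X) sg"
 and ym: "mdf B CAT (rep B b) (R' X) sg ta n ==> mdf B CAT (y.W b) (y.V X) sg ta n"
 unfolding yW .

sublocale q: psran_data A B CAT "V X" t "R' X" "ee' X" by (rule ee'_psran_data[OF X])

abbreviation "F \<equiv> post_functor (PS B CAT) (PS A CAT) (precomp A B CAT t) (ee' X) (V X) (R' X) (rep B b)"
abbreviation "es sg \<equiv> ps_comp A CAT (ee' X) (ps_whisker_right A CAT sg t)"

lemma F_equiv: "hom_equiv (PS B CAT) (rep B b) (R' X) (PS A CAT) (W b) (V X) F"
 using psran unfolding q.is_psran_iff using B.psf_rep[OF b] by (simp add: psf_def)

lemmas psB = pst_iff[OF B.tcat two_category_CAT] and mdB = mdf_iff[OF B.tcat two_category_CAT]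

lemma F_ob: "pst B CAT (rep B b) (R' X) sg ==> F_ob F sg = es sg"
 by (simp add: psB)

lemma F_ar: "mdf B CAT (rep B b) (R' X) sg ta n ==> F_ar F n = id2 (PS A CAT) (ee' X) **[PS A CAT] modif_whisker_right A CAT n t"
 by (simp add: mdB)

lemma es_pst: "pst B CAT (rep B b) (R' X) sg ==> pst A CAT (W b) (V X) (es sg)"
 using q.post_at by simp

lemma es_pt:
 assumes s: "pst B CAT (rep B b) (R' X) sg"
 shows "[|a : ob A; u : one B; src B u = b; trg B u = P0 t a|] ==> pt1 (es sg) a u = N1 ee a \<odot> pt1 sg (P0 t a) u"
  "[|a : ob A; mu : two B; src B (dm B mu) = b; trg B (dm B mu) = P0 t a|] ==> pt2 (es sg) a mu = N1 ee a |> pt2 sg (P0 t a) mu"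
  "[|f : one A; u : one B; src B u = b; trg B u = P0 t (src A f)|] ==> pt3 (es sg) f u =
   (N1 ee (trg A f) |> pt3 sg (P1 t f) u) \<cdot> (N2 ee f <| pt1 sg (P0 t (src A f)) u)"
proof -
 note s' = yp[OF s]
 interpret c: cone B B H "psf_unit B" R b X "pt1 sg" "pt2 sg" "pt3 sg" by (rule y.pt_cone[OF s' b X])
 note i = y.pt_in[OF s' b X]
 have fs [simp]: "F_src (N1 sg c) = hom B b c" "F_trg (N1 sg c) = hom H X (P0 R c)" if "c : ob B" for c
  using ftor_inD(2,3)[OF i(1)[OF that]] that by simp_all
 have c1: "F_ob (N1 sg c) u : one H" "src H (F_ob (N1 sg c) u) = X" "trg H (F_ob (N1 sg c) u) = P0 R c"
  if "c : ob B" "u : one B" "src B u = b" "trg B u = c" for c u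
  using c.c1[of c u] that by (simp_all add: pt1_def)
 show "pt1 (es sg) a u = N1 ee a \<odot> pt1 sg (P0 t a) u" if "a : ob A" "u : one B" "src B u = b" "trg B u = P0 t a" for a u
  using that c1[of "P0 t a" u] by (simp add: pt1_def)
 show "pt2 (es sg) a mu = N1 ee a |> pt2 sg (P0 t a) mu" if "a : ob A" "mu : two B" "src B (dm B mu) = b" "trg B (dm B mu) = P0 t a" for a mu
  using that c1[of "P0 t a" "dm B mu"] c.c2[of "P0 t a" mu] by (simp add: pt2_def pt1_def)
 show "pt3 (es sg) f u = (N1 ee (trg A f) |> pt3 sg (P1 t f) u) \<cdot> (N2 ee f <| pt1 sg (P0 t (src A f)) u)"
  if f: "f : one A" "u : one B" "src B u = b" "trg B u = P0 t (src A f)" for f u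
 proof -
  have o: "src A f : ob A" "trg A f : ob A" "P1 t f : one B" using f by auto
  have T: "T_src (N2 sg (P1 t f)) = ftor_comp (hom_map H (id1 H X) (P1 R (P1 t f))) (N1 sg (P0 t (src A f)))"
   "T_trg (N2 sg (P1 t f)) = ftor_comp (N1 sg (P0 t (trg A f))) (hom_map B (id1 B b) (P1 t f))"
   using nt_inD(2,3)[OF i(2)[OF o(3)]] f by simp_all
  have c3: "T_at (N2 sg (P1 t f)) u : two H" "dm H (T_at (N2 sg (P1 t f)) u) = P1 R (P1 t f) \<odot> F_ob (N1 sg (P0 t (src A f))) u"
    "cd H (T_at (N2 sg (P1 t f)) u) = F_ob (N1 sg (P0 t (trg A f))) (P1 t f *[B] u)"
   using c.c3[of "P1 t f" u] c.c3_in[of "P1 t f" u] f by (simp_all add: pt1_def pt3_def)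
  have c2: "F_ar (N1 sg (P0 t (trg A f))) (id2 B (P1 t f *[B] u)) = id2 H (F_ob (N1 sg (P0 t (trg A f))) (P1 t f *[B] u))"
   using c.c2_id[of "P0 t (trg A f)" "P1 t f *[B] u"] f by (simp add: pt2_def pt1_def)
  have c2': "F_ar (N1 sg (P0 t (src A f))) (id2 B u) = id2 H (F_ob (N1 sg (P0 t (src A f))) u)"
   using c.c2_id[of "P0 t (src A f)" u] f by (simp add: pt2_def pt1_def)
  show ?thesis
   using f o T c3 c2 c2' c1[of "P0 t (src A f)" u] c1[of "P0 t (trg A f)" "P1 t f *[B] u"] by (simp add: pt3_def pt1_def)
 qed
qed

lemma es_mt:
 assumes n: "mdf B CAT (rep B b) (R' X) sg ta n" and a: "a : ob A" "u : one B" "src B u = b" "trg B u = P0 t a"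
 shows "mt (id2 (PS A CAT) (ee' X) **[PS A CAT] modif_whisker_right A CAT n t) a u = N1 ee a |> mt n (P0 t a) u"
proof -
 interpret n: mdf B CAT "rep B b" "R' X" sg ta n by (rule n)
 note s' = yp[OF n.al.pst_axioms] and t' = yp[OF n.bt.pst_axioms]
 interpret c: cone B B H "psf_unit B" R b X "pt1 ta" "pt2 ta" "pt3 ta" by (rule y.pt_cone[OF t' b X])
 note m = cone_morD(1-3)[OF y.mt_cone_mor[OF ym[OF n] b X], of "P0 t a" u, unfolded mt_def pt1_def]
 interpret c0: cone B B H "psf_unit B" R b X "pt1 sg" "pt2 sg" "pt3 sg" by (rule y.pt_cone[OF s' b X])
 have "P0 t a : ob B" using a by simp
 then show ?thesis
  using a m c0.c1[of "P0 t a" u, unfolded pt1_def] n.M_simps[of "P0 t a"] ftor_inD(2,3)[OF y.pt_in(1)[OF s' b X, of "P0 t a"]] c.c1[of "P0 t a" u, unfolded pt1_def]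
  by (simp add: mt_def)
qed

lemma y_cone:
 assumes x: "x : one H" "src H x = X" "trg H x = P0 R b"
 shows "y.CN b X (%c u. P1 R u \<odot> x) (%c mu. P2 R mu <| x) (r2 H (Pc R) x)"
proof -
 have "pst B H (psf_comp B H R (psf_unit B)) R (ps_id B H R)"
  using pst_ps_id[OF K.psf_axioms'] by (simp add: psf_comp_unit[OF K.psf_axioms'])
 then interpret k: kan_trans B B H "psf_unit B" R R "ps_id B H R"
  by (simp add: kan_trans_def y.kan_setup_axioms K.psf_axioms')
 show ?thesis
  by (rule y.cone_cong[OF y.cone_restrict[OF k.trans_cone[OF b] x(1,3,2)]])
   (use x in "auto simp: tc1_def tc2_def tc3_def")
qed

definition ys where "ys x = y.pack b X (%c u. P1 R u \<odot> x) (%c mu. P2 R mu <| x) (r2 H (Pc R) x)"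

lemma ys_pst:
 assumes x: "x : one H" "src H x = X" "trg H x = P0 R b"
 shows "pst B CAT (rep B b) (R' X) (ys x)"
 using y.pack_pst[OF y_cone[OF x]] unfolding yW ys_def .

lemma ys_pt [simp]:
 "[|u : one B; src B u = b; trg B u = c; c : ob B|] ==> pt1 (ys x) c u = P1 R u \<odot> x"
 "[|mu : two B; src B (dm B mu) = b; trg B (dm B mu) = c; c : ob B|] ==> pt2 (ys x) c mu = P2 R mu <| x"
 "[|k : one B; u : one B; src B u = b; trg B u = src B k|] ==> pt3 (ys x) k u = Pc R k u <| x"
 using y.pack_pt(1)[of c u b] y.pack_pt(2)[of c mu b] y.pack_pt(3)[of k u b] by (auto simp: ys_def)

lemma es_ys:
 assumes x: "x : one H" "src H x = X" "trg H x = P0 R b"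
 shows "[|a : ob A; u : one B; src B u = b; trg B u = P0 t a|] ==> pt1 (es (ys x)) a u = tc1 H R ee a u \<odot> x"
  "[|a : ob A; mu : two B; src B (dm B mu) = b; trg B (dm B mu) = P0 t a|] ==> pt2 (es (ys x)) a mu = tc2 H R ee a mu <| x"
  "[|f : one A; u : one B; src B u = b; trg B u = P0 t (src A f)|] ==> pt3 (es (ys x)) f u = tc3 A H t R ee f u <| x"
 using x by (simp_all add: es_pt[OF ys_pst[OF x]] tc1_def tc2_def tc3_def)

text \<open>The Yoneda lemma: a modification between the transformations of \<open>x\<close> and \<open>y\<close> is
  whiskering with a 2-cell \<open>x \<Rightarrow> y\<close>.\<close>

lemma ys_full:
 assumes x: "x : one H" "src H x = X" "trg H x = P0 R b" and z: "z : one H" "src H z = X" "trg H z = P0 R b"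
  and k: "mdf B CAT (rep B b) (R' X) (ys x) (ys z) k"
 obtains n where "n : two H" "dm H n = x" "cd H n = z"
  "!!c u. [|c : ob B; u : one B; src B u = b; trg B u = c|] ==> mt k c u = P1 R u |> n"
proof -
 let ?i = "id1 B b"
 note cm = cone_morD[OF y.mt_cone_mor[OF ym[OF k] b X]]
 have m: "mt k c u : two H" "dm H (mt k c u) = P1 R u \<odot> x" "cd H (mt k c u) = P1 R u \<odot> z"
  if "c : ob B" "u : one B" "src B u = b" "trg B u = c" for c u
  using cm(1-3)[of c u] that by simp_all
 let ?m = "mt k b ?i"
 have "EX n. n : two H & dm H n = x & cd H n = z & (Pu R b <| z) \<cdot> n = ?m \<cdot> (Pu R b <| x)"
  by (rule exI[of _ "inv2 H (Pu R b <| z) \<cdot> (?m \<cdot> (Pu R b <| x))"]) (use m[of b ?i] x z in simp)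
 then obtain n where n: "n : two H" "dm H n = x" "cd H n = z"
  and un: "(Pu R b <| z) \<cdot> n = ?m \<cdot> (Pu R b <| x)" by blast
 have "mt k c u = P1 R u |> n" if u: "c : ob B" "u : one B" "src B u = b" "trg B u = c" for c u
 proof -
 have e: "mt k c u \<cdot> (Pc R u ?i <| x) = (Pc R u ?i <| z) \<cdot> (P1 R u |> ?m)"
  using cm(5)[of u ?i c] u by simp
 have px: "(Pc R u ?i <| x) \<cdot> (P1 R u |> (Pu R b <| x)) = id2 H (P1 R u \<odot> x)"
  using arg_cong[OF K.Pu_right[of u], of "%v. v <| x"] u x by simp
 have pz: "(Pc R u ?i <| z) \<cdot> (P1 R u |> (Pu R b <| z)) = id2 H (P1 R u \<odot> z)"
  using arg_cong[OF K.Pu_right[of u], of "%v. v <| z"] u z by simp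
 have r: "(P1 R u |> ?m) \<cdot> (P1 R u |> (Pu R b <| x)) = (P1 R u |> (Pu R b <| z)) \<cdot> (P1 R u |> n)"
  using arg_cong[OF un[symmetric], of "%v. P1 R u |> v"] u x z n m[of b ?i] by simp
 have "mt k c u = mt k c u \<cdot> ((Pc R u ?i <| x) \<cdot> (P1 R u |> (Pu R b <| x)))"
  unfolding px using m[OF u] u x by simp
 also have "\<dots> = (Pc R u ?i <| z) \<cdot> ((P1 R u |> ?m) \<cdot> (P1 R u |> (Pu R b <| x)))"
  using u x z m[OF u] m[of b ?i] by (simp add: H.vreassoc[OF e])
 also have "\<dots> = ((Pc R u ?i <| z) \<cdot> (P1 R u |> (Pu R b <| z))) \<cdot> (P1 R u |> n)"
  unfolding r by (rule H.vcomp_assoc[symmetric]) (use u x z n in simp_all)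
 also have "\<dots> = P1 R u |> n" unfolding pz using n u x z by simp
 finally show ?thesis .
 qed
 then show ?thesis using that[OF n] by blast
qed

lemma ys_mdf:
 assumes x: "x : one H" "src H x = X" "trg H x = P0 R b" and z: "z : one H" "src H z = X" "trg H z = P0 R b"
  and n: "n : two H" "dm H n = x" "cd H n = z"
 shows "mdf B CAT (rep B b) (R' X) (ys x) (ys z) (y.pack_mor b (ys x) (ys z) (%c u. P1 R u |> n))"
proof -
 have "y.CM b (pt1 (ys x)) (pt2 (ys x)) (pt3 (ys x)) (pt1 (ys z)) (pt2 (ys z)) (pt3 (ys z)) (%c u. P1 R u |> n)"
 proof (rule cone_morI, goal_cases)
  case (1 c u) then show ?case using n x z by simp
 next
  case (2 c mu)
  then show ?case using H.exchange[of n "P2 R mu", OF _ _ _ refl refl refl refl] n x z by simp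
 next
  case (3 k u)
  then show ?case using H.exchange[of n "Pc R k u", OF _ _ _ refl refl refl refl] n x z by simp
 qed
 then show ?thesis using y.pack_mor_mdf[OF yp[OF ys_pst[OF x]] yp[OF ys_pst[OF z]] b X] unfolding yW by blast
qed

text \<open>A morphism of cones is a modification between the images of the transformations of \<open>x\<close> and
 \<open>z\<close> under the comparison functor; it lifts to \<open>B(b,-)\<close> and is then induced by a
 2-cell.\<close>

lemma universal_at:
 assumes x: "x : one H" "src H x = X" "trg H x = P0 R b" and z: "z : one H" "src H z = X" "trg H z = P0 R b"
  and m: "CM b (r1 H (tc1 H R ee) x) (r2 H (tc2 H R ee) x) (r2 H (tc3 A H t R ee) x)
    (r1 H (tc1 H R ee) z) (r2 H (tc2 H R ee) z) (r2 H (tc3 A H t R ee) z) m"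
 shows "EX! n. n : two H & dm H n = x & cd H n = z &
   (ALL a:ob A. ALL u. u : one B --> src B u = b --> trg B u = P0 t a --> tc1 H R ee a u |> n = m a u)"
proof -
 note sx = ys_pst[OF x] and sz = ys_pst[OF z]
 have m': "CM b (pt1 (es (ys x))) (pt2 (es (ys x))) (pt3 (es (ys x))) (pt1 (es (ys z))) (pt2 (es (ys z))) (pt3 (es (ys z))) m"
  by (rule cone_mor_cong[OF m b]) (simp_all add: es_ys[OF x] es_ys[OF z])
 let ?p = "pack_mor b (es (ys x)) (es (ys z)) m"
 note p = pack_mor_mdf[OF es_pst[OF sx] es_pst[OF sz] b X m']
 have Fk: "F_ar F k = ?p \<longleftrightarrow> (ALL a:ob A. ALL u. u : one B --> src B u = b --> trg B u = P0 t a --> N1 ee a |> mt k (P0 t a) u = m a u)"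
  if k: "mdf B CAT (rep B b) (R' X) (ys x) (ys z) k" for k
 proof
  assume e: "F_ar F k = ?p"
  show "ALL a:ob A. ALL u. u : one B --> src B u = b --> trg B u = P0 t a --> N1 ee a |> mt k (P0 t a) u = m a u"
   using es_mt[OF k] pack_mor_simps(3) e[unfolded F_ar[OF k]] by metis
 next
  assume e: "ALL a:ob A. ALL u. u : one B --> src B u = b --> trg B u = P0 t a --> N1 ee a |> mt k (P0 t a) u = m a u"
  have "mdf A CAT (W b) (V X) (es (ys x)) (es (ys z)) (id2 (PS A CAT) (ee' X) **[PS A CAT] modif_whisker_right A CAT k t)"
   using mdf_hcomp[OF mdf_whisker_right[OF k t.psf_axioms'] mdf_id2[OF ee'_pst[OF X]]] .
  then show "F_ar F k = ?p" unfolding F_ar[OF k]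
   by (rule mt_eqI[OF _ p b X]) (use es_mt[OF k] e in simp)
 qed
 have "EX! k. k : two (PS B CAT) & dm (PS B CAT) k = ys x & cd (PS B CAT) k = ys z & F_ar F k = ?p"
  by (rule hom_equivD(2)[OF F_equiv]) (use sx sz p in "simp_all add: psB mdfi F_ob")
 then obtain k where k0: "k : two (PS B CAT)" "dm (PS B CAT) k = ys x" "cd (PS B CAT) k = ys z" "F_ar F k = ?p"
  and un0: "!!k'. [|k' : two (PS B CAT); dm (PS B CAT) k' = ys x; cd (PS B CAT) k' = ys z; F_ar F k' = ?p|] ==> k' = k"
  by (elim ex1E) blast
 have k: "mdf B CAT (rep B b) (R' X) (ys x) (ys z) k" "F_ar F k = ?p"
  using k0(1-3) sx by (simp_all add: mdB psB k0(4))
 have un: "k' = k" if "mdf B CAT (rep B b) (R' X) (ys x) (ys z) k'" "F_ar F k' = ?p" for k'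
  by (rule un0[OF _ _ _ that(2)]) (use that(1) in "simp_all add: mdB")
 obtain n where n: "n : two H" "dm H n = x" "cd H n = z"
  and nk: "!!c u. [|c : ob B; u : one B; src B u = b; trg B u = c|] ==> mt k c u = P1 R u |> n"
  using ys_full[OF x z k(1)] by blast
 have w: "tc1 H R ee a u |> l = N1 ee a |> (P1 R u |> l)"
  if "a : ob A" "u : one B" "src B u = b" "trg B u = P0 t a" "l : two H" "dm H l = x" for a u l
  using that x by (simp add: tc1_def)
 show ?thesis
 proof (rule ex1I[of _ n], goal_cases)
  case 1
  show ?case using n w nk Fk[OF k(1)] k(2) by simp
 next
  case (2 n')
  then have n': "n' : two H" "dm H n' = x" "cd H n' = z" by auto
  let ?k = "y.pack_mor b (ys x) (ys z) (%c u. P1 R u |> n')"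
  have kd: "mdf B CAT (rep B b) (R' X) (ys x) (ys z) ?k" by (rule ys_mdf[OF x z n'])
  have "F_ar F ?k = ?p" unfolding Fk[OF kd]
   using 2 w n' y.pack_mor_simps(3) by simp
  then have "?k = k" by (rule un[OF kd])
  then have "mt ?k b (id1 B b) = mt k b (id1 B b)" by simp
  then have e: "P1 R (id1 B b) |> n' = P1 R (id1 B b) |> n"
   using y.pack_mor_simps(3)[of b "id1 B b" b] nk[of b "id1 B b"] by simp
  have x1: "(Pu R b <| z) \<cdot> l = (P1 R (id1 B b) |> l) \<cdot> (Pu R b <| x)"
   if l: "l : two H" "dm H l = x" "cd H l = z" for l
   using H.exchange[of l "Pu R b", OF _ _ _ refl refl refl refl] l x z by simp
  show ?case
   by (rule H.iso2_cancel_left[of "Pu R b <| z"]) (use x1[OF n'] x1[OF n] e n n' x z in simp_all)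
 qed
qed

text \<open>A transformation \<open>sg : B(b,-) \<rightarrow> H(X,R-)\<close> is determined up to isomorphism by the
 1-cell \<open>x\<close> that is its value at the identity of \<open>b\<close>, so a cone that comes from
 \<open>sg\<close> is isomorphic to the restriction along \<open>x\<close>.\<close>

lemma universal_ess_surj:
 assumes d: "CN b X d1 d2 d3"
 shows "EX x s. x : one H & src H x = X & trg H x = P0 R b &
  CM b (r1 H (tc1 H R ee) x) (r2 H (tc2 H R ee) x) (r2 H (tc3 A H t R ee) x) d1 d2 d3 s &
  (ALL a:ob A. ALL u. u : one B --> src B u = b --> trg B u = P0 t a --> iso2 H (s a u))"
proof -
 let ?p = "pack b X d1 d2 d3" and ?i = "id1 B b"
 have p: "pst A CAT (W b) (V X) ?p" by (rule pack_pst[OF d])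
 obtain sg bt where s: "pst B CAT (rep B b) (R' X) sg" and bt: "iso2 (PS A CAT) bt" "dm (PS A CAT) bt = F_ob F sg" "cd (PS A CAT) bt = ?p"
  using hom_equivD(3)[OF F_equiv, of ?p] p by (auto simp: psB psti)
 have bm: "mdf A CAT (W b) (V X) (es sg) ?p bt"
  using M.iso2_in[OF bt(1)] bt(2,3) es_pst[OF s] by (simp add: F_ob[OF s] mdfi psti)
 interpret c: cone B B H "psf_unit B" R b X "pt1 sg" "pt2 sg" "pt3 sg" by (rule y.pt_cone[OF yp[OF s] b X])
 define x where "x = pt1 sg b ?i"
 have x: "x : one H" "src H x = X" "trg H x = P0 R b" using c.c1[of b ?i] by (simp_all add: x_def)
 let ?z = "%a u. N1 ee a |> pt3 sg u ?i"
 have c3: "iso2 H (pt3 sg u ?i)" "pt3 sg u ?i : two H" "dm H (pt3 sg u ?i) = P1 R u \<odot> x" "cd H (pt3 sg u ?i) = pt1 sg (trg B u) u"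
  if "u : one B" "src B u = b" for u using c.c3[of u ?i] c.c3_in[of u ?i] that by (auto simp: x_def)
 note ec = pt_cone[OF es_pst[OF s] b X]
 have zm: "CM b (r1 H (tc1 H R ee) x) (r2 H (tc2 H R ee) x) (r2 H (tc3 A H t R ee) x)
  (pt1 (es sg)) (pt2 (es sg)) (pt3 (es sg)) ?z"
 proof (rule cone_morI, goal_cases)
  case (1 a u) then show ?case using c3[of u] x by (simp add: es_pt[OF s] tc1_def)
 next
  case (2 a mu)
  let ?u = "dm B mu" and ?v = "cd B mu"
  have e: "pt3 sg ?v ?i \<cdot> (P2 R mu <| x) = pt2 sg (P0 t a) mu \<cdot> pt3 sg ?u ?i"
   using c.c3_nat2[of mu ?u ?v ?i b "P0 t a"] 2 B.hcomp_id[of mu] by (simp add: x_def)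
  show ?case using arg_cong[OF e, of "%v. N1 ee a |> v"] 2 x c3[of ?u] c3[of ?v] c.c2[of "P0 t a" mu] c.c1[of "P0 t a" ?u] c.c1[of "P0 t a" ?v]
   by (simp add: es_pt[OF s] tc2_def)
 next
  case (3 f u)
  let ?a = "src A f" and ?a' = "trg A f" and ?tf = "P1 t f"
  have o: "?a : ob A" "?a' : ob A" using 3 by auto
  have e: "pt3 sg (?tf *[B] u) ?i \<cdot> (Pc R ?tf u <| x) = pt3 sg ?tf u \<cdot> (P1 R ?tf |> pt3 sg u ?i)"
   using c.c3_comp[of u ?tf ?i b "P0 t ?a'"] 3 o c.c2_id[of "P0 t ?a'" "?tf *[B] u"] c.c3[of ?tf u] c3[of u] c.c3_in[of ?tf u] by (auto simp: x_def)
  have e': "(N1 ee ?a' |> pt3 sg (?tf *[B] u) ?i) \<cdot> (N1 ee ?a' |> (Pc R ?tf u <| x))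
   = (N1 ee ?a' |> pt3 sg ?tf u) \<cdot> ((N1 ee ?a' \<odot> P1 R ?tf) |> pt3 sg u ?i)"
   using arg_cong[OF e, of "%v. N1 ee ?a' |> v"] 3 o x c3[of u] c3[of "?tf *[B] u"] c.c3[of ?tf u] c.c3_in[of ?tf u] c.c1[of "P0 t ?a" u] c.c1[of "P0 t ?a'" "?tf *[B] u"] by simp
  have h: "((N1 ee ?a' \<odot> P1 R ?tf) |> pt3 sg u ?i) \<cdot> (N2 ee f <| (P1 R u \<odot> x))
   = (N2 ee f <| pt1 sg (P0 t ?a) u) \<cdot> ((P1 D f \<odot> N1 ee ?a) |> pt3 sg u ?i)"
   by (rule H.exchange[symmetric]) (use 3 o x c3[of u] c.c1[of "P0 t ?a" u] in simp_all)
  show ?case using 3 o x c3[of u] c3[of "?tf *[B] u"] c.c3[of ?tf u] c.c3_in[of ?tf u] c.c1[of "P0 t ?a" u] c.c1[of "P0 t ?a'" "?tf *[B] u"]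
   by (simp add: es_pt[OF s] tc3_def H.vreassoc[OF e'] h)
 qed
 have bc: "CM b (pt1 (es sg)) (pt2 (es sg)) (pt3 (es sg)) d1 d2 d3 (mt bt)"
  by (rule cone_mor_cong[OF mt_cone_mor[OF bm b X] b]) simp_all
 note rx = cone_restrict[OF trans_cone[OF b] x(1,3,2)]
 have "iso2 H (mt bt a u \<cdot> ?z a u)" if a: "a : ob A" "u : one B" "src B u = b" "trg B u = P0 t a" for a u
 proof -
  interpret m: mdf A CAT "W b" "V X" "es sg" ?p bt by (rule bm)
  have n: "nat_iso (M_at bt a)" using PS_iso2_at[OF A.tcat two_category_CAT bt(1) a(1)] by simp
  note f = ftor_inD(2,3)[OF pt_in(1)[OF es_pst[OF s] b X a(1)]]
  have dd: "T_src (M_at bt a) = N1 (es sg) a" using m.M_simps(2)[OF a(1)] by simp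
  have "iso2 H (mt bt a u)" unfolding mt_def by (rule H.nat_iso_homD[OF n]) (unfold dd f, use a in simp_all)
  then show ?thesis using cone_morD(1-3)[OF bc a] cone_morD(1-3)[OF zm a] c3[OF a(2,3)] a x by simp
 qed
 then show ?thesis using cone_mor_comp[OF rx ec d zm bc] x by blast
qed

end

lemma (in kan_trans_cat) universal_if_preserved:
 assumes p: "!!X. X : ob H ==> preserves_psran A B CAT t D R ee (rep H X)"
 shows "universal_bicone A B H t D R (tc1 H R ee) (tc2 H R ee) (tc3 A H t R ee)"
proof -
 have "kan_setup B B H (psf_unit B) R"
  by (intro kan_setup.intro B.tcat H.tcat psf_unit K.psf_axioms')
 then have y: "kan_cat B B H (psf_unit B) R" by (rule kan_cat.intro)
 have k: "kan_yoneda A B H t D R ee b X" if "b : ob B" "X : ob H" for b X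
  by (intro kan_yoneda.intro kan_yoneda_axioms.intro kan_trans_cat_axioms y that p[OF that(2), unfolded preserves_psran_def])
 show ?thesis unfolding universal_bicone_def
 proof (intro ballI conjI allI impI, goal_cases)
  case (1 b X x z m) show ?case by (rule kan_yoneda.universal_at[OF k[OF 1(1,2)] 1(3-9)])
 next
  case (2 b X d1 d2 d3) show ?case by (rule kan_yoneda.universal_ess_surj[OF k[OF 2(1,2)] 2(3)])
 qed
qed

section \<open>Universal families represent\<close>

context universal_family
begin

definition "elf b X = \<lparr>F_src = hom H X (l b), F_trg = hom M (P0 S b) (P0 N X),
 F_ob = (\<lambda>k\<in>Ob (hom H X (l b)). P1 N k \<odot> lam b), F_ar = (\<lambda>ph\<in>Ar (hom H X (l b)). P2 N ph <| lam b)\<rparr>"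

lemma elf_simps [simp]:
 "[|k : one H; src H k = X; trg H k = l b|] ==> F_ob (elf b X) k = P1 N k \<odot> lam b"
 "[|ph : two H; src H (dm H ph) = X; trg H (dm H ph) = l b|] ==> F_ar (elf b X) ph = P2 N ph <| lam b"
 "F_src (elf b X) = hom H X (l b)" "F_trg (elf b X) = hom M (P0 S b) (P0 N X)"
 by (simp_all add: elf_def)

lemma elf_in: "[|b : ob B; X : ob H|] ==> ftor_in (elf b X) (hom H X (l b)) (hom M (P0 S b) (P0 N X))"
 by (rule ftor_inI)
  (auto simp: category_hom H.tcat M.tcat, auto simp: elf_def hom_def)

lemma elf_equivalence:
 assumes b: "b : ob B" "X : ob H" shows "equivalence_of_categories (elf b X)"
proof (rule equivalence_if_hom_equiv[OF H.tcat M.tcat])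
 show "hom_equiv H X (l b) M (P0 S b) (P0 N X) (elf b X)"
  unfolding hom_equiv_def
 proof (intro conjI allI impI ballI, goal_cases)
  case 1 show ?case by (rule elf_in[OF b])
 next
  case (2 u v bt)
  then have "EX! n. n : two H & dm H n = u & cd H n = v & P2 N n <| lam b = bt"
   using b by (intro full_faithful) simp_all
  moreover have "n : two H & dm H n = u & cd H n = v & P2 N n <| lam b = bt \<longleftrightarrow>
   n : two H & dm H n = u & cd H n = v & F_ar (elf b X) n = bt" for n
   using 2 by auto
  ultimately show ?case by simp
 next
  case (3 c)
  then obtain f bt where "f : one H" "src H f = X" "trg H f = l b" "iso2 M bt" "dm M bt = P1 N f \<odot> lam b" "cd M bt = c"
   using ess_surj[OF b, of c] by auto
  then show ?case by (intro exI[of _ f] exI[of _ bt]) simp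
 qed
qed

text \<open>The functors \<open>k \<mapsto> N k *[M] lam b\<close> are strictly natural, since \<open>N\<close> is a
 2-functor.\<close>

lemma ex_representation:
 assumes b: "b : ob B"
 shows "EX th. cat_pseudonatural_equivalence (op2 H) (corep H (l b)) (psf_comp (op2 H) CAT (rep M (P0 S b)) N) th"
proof -
 let ?th = "\<lparr>C1 = elf b, C2 = (%h. nt_id (ftor_comp (elf b (src H h)) (hom_map H h (id1 H (l b)))))\<rparr>"
 have O: "two_category (op2 H)" by (rule two_category_op2) unfold_locales
 interpret F: sfun "op2 H" CAT "corep H (l b)" by (rule H.sfun_corep) (simp add: b)
 have Sb: "P0 S b : ob M" using b by simp
 have G: "psf (op2 H) CAT (psf_comp (op2 H) CAT (rep M (P0 S b)) N)"
  by (rule psf_psf_comp[OF N.psf_axioms' M.psf_rep[OF Sb]])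
 note r [simp] = rep_comp_simps[OF N.psf_axioms' Sb]
 have hh: "ftor_in (ftor_comp (elf b (src H h)) (hom_map H h (id1 H (l b)))) (hom H (trg H h) (l b)) (hom M (P0 S b) (P0 N (src H h)))"
  if "h : one H" for h
  by (rule ftor_in_comp[OF H.ftor_in_hom_map elf_in]) (use that b in auto)
 have nat: "ftor_comp (hom_map M (id1 M (P0 S b)) (P1 N h)) (elf b (trg H h)) = ftor_comp (elf b (src H h)) (hom_map H h (id1 H (l b)))"
  if "h : one H" for h
  by (rule ftor_in_eqI[OF ftor_in_comp[OF elf_in M.ftor_in_hom_map] ftor_in_comp[OF H.ftor_in_hom_map elf_in]])
   (use that b in auto)
 interpret cpn "op2 H" "corep H (l b)" "psf_comp (op2 H) CAT (rep M (P0 S b)) N" ?th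
 proof (rule cpnI[OF O F.psf_axioms' G])
  show "ftor_in (C1 ?th x) (P0 (corep H (l b)) x) (P0 (psf_comp (op2 H) CAT (rep M (P0 S b)) N) x)" if "x : ob (op2 H)" for x
   using that elf_in[OF b, of x] by simp
  show "nt_in (C2 ?th f) (ftor_comp (P1 (psf_comp (op2 H) CAT (rep M (P0 S b)) N) f) (C1 ?th (src (op2 H) f)))
    (ftor_comp (C1 ?th (trg (op2 H) f)) (P1 (corep H (l b)) f))" if "f : one (op2 H)" for f
   using that nt_in_id[OF hh[of f]] nat[of f] by simp
 qed
 have "cat_pseudonatural (op2 H) (corep H (l b)) (psf_comp (op2 H) CAT (rep M (P0 S b)) N) ?th"
 proof (rule cat_pseudonaturalI, goal_cases)
  case (1 f)
  then have f: "f : one H" by simp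
  have "nat_iso (nt_id (ftor_comp (elf b (src H f)) (hom_map H f (id1 H (l b)))))"
   by (rule M.nat_iso_homI[OF nt_in_id[OF hh[OF f]]]) (use f b in auto)
  then show ?case by simp
 next
  case (2 ch u)
  then show ?case using b by simp
 next
  case (3 f g u)
  then show ?case using b by (simp add: N.Pc_id)
 next
  case (4 x u)
  then show ?case using b by (simp add: N.Pu_id)
 qed
 then have "cat_pseudonatural_equivalence (op2 H) (corep H (l b)) (psf_comp (op2 H) CAT (rep M (P0 S b)) N) ?th"
  using elf_equivalence[OF b] by (simp add: cat_pseudonatural_equivalence_def)
 then show ?thesis by blast
qed

end

text \<open>The functor \<open>x \<mapsto> N x\<close>, composed with the packed cone, is restriction of the cone
 along \<open>x\<close>.\<close>

lemma (in kan_cat) universal_family_if_universal_bicone: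
 assumes u: "universal_bicone A B H t D K c1 c2 c3" and K: "psf B H K"
  and c: "!!b. b : ob B ==> CN b (P0 K b) c1 c2 c3"
 shows "universal_family H B (PS A CAT) ND NT (P0 K) (%b. pack b (P0 K b) c1 c2 c3)"
proof (intro universal_family.intro universal_family_axioms.intro, goal_cases)
 case 1 show ?case by unfold_locales
next
 case (2 b) show ?case by (rule cone.bX(2)[OF c[OF 2]])
next
 case (3 b) then show ?case using pack_pst[OF c[OF 3]] by (simp add: psti)
next
 case (4 b) then show ?case by simp
next
 case (5 b) then show ?case using cone.bX(2)[OF c[OF 5]] by simp
next
 case (6 b f f' m)
 let ?X = "src H f" and ?l = "pack b (P0 K b) c1 c2 c3"
 have X: "?X : ob H" using 6 by auto
 note l = pack_pst[OF c[OF 6(1)]]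
 note rf = pt_restrict[OF l 6(1,2,4)] and rf' = pt_restrict[OF l 6(1,3,5)]
 have md: "mdf A CAT (W b) (V ?X) (ps_comp A CAT (P1 ND f) ?l) (ps_comp A CAT (P1 ND f') ?l) m"
  using 6(7-9) rf(1) by (simp add: mdfi psti)
 have cm: "CM b (r1 H c1 f) (r2 H c2 f) (r2 H c3 f)
   (r1 H c1 f') (r2 H c2 f') (r2 H c3 f') (mt m)"
  by (rule cone_mor_cong[OF mt_cone_mor[OF md 6(1) X] 6(1)]) (simp_all add: rf rf')
 have "P2 ND n **[PS A CAT] id2 (PS A CAT) ?l = m \<longleftrightarrow>
   (ALL a:ob A. ALL u. u : one B --> src B u = b --> trg B u = P0 t a --> c1 a u |> n = mt m a u)"
  if n: "n : two H" "dm H n = f" "cd H n = f'" for n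
 proof -
  let ?q = "P2 ND n **[PS A CAT] id2 (PS A CAT) ?l"
  have q: "mdf A CAT (W b) (V ?X) (ps_comp A CAT (P1 ND f) ?l) (ps_comp A CAT (P1 ND f') ?l) ?q"
   using mdf_hcomp[OF mdf_id2[OF l], of "V ?X" "P1 ND f" "P1 ND f'" "P2 ND n"] ND_mdf[OF n(1)] n 6 by simp
  have mq: "mt ?q a u = c1 a u |> n" if "a : ob A" "u : one B" "src B u = b" "trg B u = P0 t a" for a u
   using mt_simps(3)[OF that(1,2,4) l 6(1) n(1)] that n 6 by simp
  show ?thesis
  proof
   assume "?q = m"
   then show "ALL a:ob A. ALL u. u : one B --> src B u = b --> trg B u = P0 t a --> c1 a u |> n = mt m a u"
    using mq by metis
  next
   assume r: "ALL a:ob A. ALL u. u : one B --> src B u = b --> trg B u = P0 t a --> c1 a u |> n = mt m a u"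
   show "?q = m" by (rule mt_eqI[OF q md 6(1) X]) (use r mq in simp)
  qed
 qed
 then have e: "n : two H & dm H n = f & cd H n = f' & P2 ND n **[PS A CAT] id2 (PS A CAT) ?l = m \<longleftrightarrow>
   n : two H & dm H n = f & cd H n = f' & (ALL a:ob A. ALL u. u : one B --> src B u = b --> trg B u = P0 t a --> c1 a u |> n = mt m a u)" for n
  by blast
 show ?case unfolding e by (rule universal_biconeD(1)[OF u 6(1) X 6(2) refl 6(4,3,6,5) cm])
next
 case (7 b X d)
 have d: "pst A CAT (W b) (V X) d" using 7 by (simp add: psti)
 note l = pack_pst[OF c[OF 7(1)]]
 let ?l = "pack b (P0 K b) c1 c2 c3"
 obtain x s where x: "x : one H" "src H x = X" "trg H x = P0 K b"
  and s: "CM b (r1 H c1 x) (r2 H c2 x) (r2 H c3 x) (pt1 d) (pt2 d) (pt3 d) s"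
  and i: "ALL a:ob A. ALL u. u : one B --> src B u = b --> trg B u = P0 t a --> iso2 H (s a u)"
  using universal_biconeD(2)[OF u 7(1,2) pt_cone[OF d 7(1,2)]] by blast
 note rx = pt_restrict[OF l 7(1) x(1,3)]
 note px = rx(1)[unfolded x(2)]
 let ?r = "ps_comp A CAT (P1 ND x) ?l"
 have s': "CM b (pt1 ?r) (pt2 ?r) (pt3 ?r) (pt1 d) (pt2 d) (pt3 d) s"
  by (rule cone_mor_cong[OF s 7(1)]) (simp_all add: rx)
 have i': "iso2 H (s a u)" if "a : ob A" "u : one B" "src B u = b" "trg B u = P0 t a" for a u using i that by blast
 note v' = cone_mor_inv[OF pt_cone[OF px 7(1,2)] pt_cone[OF d 7(1,2)] s' i']
 let ?bt = "pack_mor b ?r d s" and ?gm = "pack_mor b d ?r (%a u. inv2 H (s a u))"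
 note bt = pack_mor_mdf[OF px d 7(1,2) s'] and gm = pack_mor_mdf[OF d px 7(1,2) v']
 note ss = cone_morD(1-3)[OF s']
 have e1: "?gm .[PS A CAT] ?bt = id2 (PS A CAT) ?r"
 proof (rule mt_eqI[OF mdf_vcomp[OF bt gm] mdf_id2[OF px] 7(1,2)])
  fix a u assume a: "a : ob A" "u : one B" "src B u = b" "trg B u = P0 t a"
  show "mt (?gm .[PS A CAT] ?bt) a u = mt (id2 (PS A CAT) ?r) a u"
   unfolding mt_simps(1)[OF a(1,2,4) bt 7(1,2) a(3)] mt_simps(2)[OF a(1,2,4) px 7(1,2) a(3)]
   using a ss[OF a] i'[OF a] by simp
 qed
 have e2: "?bt .[PS A CAT] ?gm = id2 (PS A CAT) d"
 proof (rule mt_eqI[OF mdf_vcomp[OF gm bt] mdf_id2[OF d] 7(1,2)])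
  fix a u assume a: "a : ob A" "u : one B" "src B u = b" "trg B u = P0 t a"
  have "mt (?bt .[PS A CAT] ?gm) a u = mt ?bt a u \<cdot> mt ?gm a u"
   by (rule mt_simps(1)[OF a(1,2,4) gm 7(1,2) a(3)])
  also have "\<dots> = s a u \<cdot> inv2 H (s a u)" by (simp only: pack_mor_simps(3)[OF a])
  also have "\<dots> = id2 H (pt1 d a u)" using i'[OF a] ss(3)[OF a] by simp
  also have "\<dots> = mt (id2 (PS A CAT) d) a u" by (rule mt_simps(2)[OF a(1,2,4) d 7(1,2) a(3), symmetric])
  finally show "mt (?bt .[PS A CAT] ?gm) a u = mt (id2 (PS A CAT) d) a u" .
 qed
 have m: "modification A CAT ?bt" "modification A CAT ?gm" using bt gm unfolding mdfi by blast+
 have "iso2 (PS A CAT) ?bt"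
 proof (rule M.iso2I[of _ ?gm])
  show "?gm .[PS A CAT] ?bt = id2 (PS A CAT) (dm (PS A CAT) ?bt)" by (simp only: e1 PS_simps pack_mor_simps)
  show "?bt .[PS A CAT] ?gm = id2 (PS A CAT) (cd (PS A CAT) ?bt)" by (simp only: e2 PS_simps pack_mor_simps)
 qed (simp_all only: PS_simps pack_mor_simps m)
 then show ?case using x by (intro exI[of _ x] exI[of _ ?bt] conjI) (simp_all only: PS_simps pack_mor_simps)
qed

section \<open>Pointwise pseudo-Kan extensions and weighted bilimits\<close>

context kan_cat
begin

lemma fam_eq: "fam = bilimit_family A B H t D"
 by (simp add: fam_def bilimit_family_def)

lemma weight_eq: "hom_weight A B t b = W b"
 by (simp add: hom_weight_def)

lemma pointwise_if_universal_psf: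
 assumes "universal_psf H B (PS A CAT) ND NT l lam L om"
 shows "EX ee. is_pointwise_psran A B H t D L ee"
proof -
 interpret u: kan_universal A B H t D l lam L om
  using assms by (simp add: kan_universal_def kan_cat_axioms)
 interpret c: ubicone A B H t D L u.uc1 u.uc2 u.uc3 u.uw
  using u.universal_bicone_exists u.uc_universal by (simp add: ubicone_def ubicone_axioms_def)
 obtain ee where e: "pst A H (psf_comp A H L t) D ee" "universal_bicone A B H t D L (tc1 H L ee) (tc2 H L ee) (tc3 A H t L ee)"
  using c.ex_universal_trans by blast
 interpret k: kan_trans_cat A B H t D L ee
  using e(1) by (simp add: kan_trans_cat_def kan_trans_def kan_cat_axioms kan_setup_axioms u.L.psf_axioms')
 show ?thesis using k.pointwise_if_universal[OF e(2)] by blast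
qed

lemma pointwise_if_bilimit_pseudofunctor:
 assumes "is_bilimit_pseudofunctor A B H t D L Th"
 shows "EX ee. is_pointwise_psran A B H t D L ee"
proof -
 have L: "psf B H L" using assms by (simp add: is_bilimit_pseudofunctor_def psf_def B.tcat H.tcat)
 interpret j: joint_family H B "PS A CAT" ND NT L Th
  using assms L by (simp add: joint_family_def joint_family_axioms_def param_axioms fam_eq is_bilimit_pseudofunctor_def)
 show ?thesis by (rule pointwise_if_universal_psf[OF j.universal_psf_axioms])
qed

lemma ex_bilimit_pseudofunctor:
 assumes "ALL b:ob B. is_bilimit A H (hom_weight A B t b) D (l b) (th b)"
 shows "EX L Th. is_bilimit_pseudofunctor A B H t D L Th & extends_bilimits B H L Th l th"
proof -
 interpret c: bilimit_choice H B "PS A CAT" ND NT l th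
  using assms by (simp add: bilimit_choice_def bilimit_choice_axioms_def param_axioms is_bilimit_def weight_eq)
 show ?thesis using c.ex_extension by (auto simp: is_bilimit_pseudofunctor_def fam_eq psf_def)
qed

lemma bilimits_if_pointwise:
 assumes "is_pointwise_psran A B H t D R ee" and b: "b : ob B"
 shows "has_bilimit A H (hom_weight A B t b) D"
proof -
 have p: "is_psran A B H t D R ee" "!!X. X : ob H ==> preserves_psran A B CAT t D R ee (rep H X)"
  using assms(1) by (auto simp: is_pointwise_psran_def)
 interpret q: psran_data A B H D t R ee
  by (rule psran_dataI[OF A.tcat B.tcat H.tcat t.pseudofunctor_axioms p(1)])
 interpret k: kan_trans_cat A B H t D R ee
  by (simp add: kan_trans_cat_def kan_cat_axioms q.kan_trans_axioms)
 interpret u: universal_family H B "PS A CAT" ND NT "P0 R" "%b. pack b (P0 R b) (tc1 H R ee) (tc2 H R ee) (tc3 A H t R ee)"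
  by (rule universal_family_if_universal_bicone[OF k.universal_if_preserved[OF p(2)] q.R.psf_axioms' q.trans_cone])
 have r: "P0 R b : ob H" using b by simp
 obtain th where "cat_pseudonatural_equivalence (op2 H) (corep H (P0 R b)) (psf_comp (op2 H) CAT (rep (PS A CAT) (W b)) ND) th"
  using u.ex_representation[OF b] unfolding NT_simps(1)[OF b] by blast
 then have "is_bilimit A H (hom_weight A B t b) D (P0 R b) th"
  unfolding is_bilimit_def weight_eq using r by (intro conjI)
 then show ?thesis unfolding has_bilimit_def by blast
qed

end

theorem corollary3p22:
  fixes A :: "('a, 'p, 'q) two_cat"
    and B :: "('b, 'f, 't) two_cat"
    and H :: "('h, 'f, 't) two_cat"
    and D :: "('a, 'p, 'q, 'h, 'f, 't) psfun"
    and t :: "('a, 'p, 'q, 'b, 'f, 't) psfun"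
  assumes "two_category A" and "two_category B" and "two_category H"
    and "pseudofunctor A H D" and "pseudofunctor A B t"
  shows "((\<exists>R \<epsilon>. is_pointwise_psran A B H t D R \<epsilon>)
        \<longleftrightarrow> (\<forall>b\<in>ob B. has_bilimit A H (hom_weight A B t b) D))
    \<and> ((\<exists>R \<epsilon>. is_pointwise_psran A B H t D R \<epsilon>) \<longrightarrow>
      (\<forall>R \<epsilon>. is_psran A B H t D R \<epsilon> \<longrightarrow>
        (\<forall>l \<theta>. (\<forall>b\<in>ob B. is_bilimit A H (hom_weight A B t b) D (l b) (\<theta> b)) \<longrightarrow>
          (\<exists>L \<Theta>. is_bilimit_pseudofunctor A B H t D L \<Theta> \<and> extends_bilimits B H L \<Theta> l \<theta>))
        \<and> (\<forall>L \<Theta>. is_bilimit_pseudofunctor A B H t D L \<Theta> \<longrightarrow>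
          (\<exists>\<sigma>. pseudonatural_equivalence B H \<sigma> \<and> N_src \<sigma> = R \<and> N_trg \<sigma> = L))))"
proof -
 interpret kan_cat A B H t D
  using assms by (simp add: kan_cat_def kan_setup_def psf_def)
 have 1: "(EX R ee. is_pointwise_psran A B H t D R ee) \<longleftrightarrow> (ALL b:ob B. has_bilimit A H (hom_weight A B t b) D)"
 proof
  assume "EX R ee. is_pointwise_psran A B H t D R ee"
  then show "ALL b:ob B. has_bilimit A H (hom_weight A B t b) D" using bilimits_if_pointwise by blast
 next
  assume "ALL b:ob B. has_bilimit A H (hom_weight A B t b) D"
  then obtain l th where "ALL b:ob B. is_bilimit A H (hom_weight A B t b) D (l b) (th b)"
   unfolding has_bilimit_def by metis
  then show "EX R ee. is_pointwise_psran A B H t D R ee"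
   using ex_bilimit_pseudofunctor pointwise_if_bilimit_pseudofunctor by blast
 qed
 have 2: "EX sg. pseudonatural_equivalence B H sg & N_src sg = R & N_trg sg = L"
  if R: "is_psran A B H t D R ee" and L: "is_bilimit_pseudofunctor A B H t D L Th" for R ee L Th
 proof -
  obtain ee' where "is_psran A B H t D L ee'"
   using pointwise_if_bilimit_pseudofunctor[OF L] by (auto simp: is_pointwise_psran_def)
  then show ?thesis by (rule psran_unique[OF assms(1,2,3,5) R])
 qed
 show ?thesis using 1 2 ex_bilimit_pseudofunctor by blast
qed

end
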